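(* Let $0<\varepsilon<1/6$ and let $R$ be a set of items that admits a feasible packing (rotations by $90$ degrees allowed) in the $N\times N$ knapsack. Then there exist a subset $R'\subseteq R$ with $p(R')\ge(\frac23-c\,\varepsilon)p(R)$, for an absolute constant $c>0$, and a container packing of $R'$ (rotations allowed) in the $N\times N$ knapsack using at most $f(\varepsilon)$ containers, where $f(\varepsilon)$ depends only on $\varepsilon$.
   Context: Items are axis-parallel rectangles with width $w(i)$, height $h(i)$, profit $p(i)\ge0$; $p(S)=\sum_{i\in S}p(i)$. A container is an axis-parallel box placed in the knapsack, labelled horizontal, vertical, or area. A container packing of a set of items is a collection of containers with pairwise disjoint interiors together with a non-overlapping placement of each item (possibly rotated by $90$ degrees) inside some container such that: items in a horizontal container are stacked one on top of the other (their projections on the $y$-axis have pairwise disjoint interiors); items in a vertical container are placed side by side (their projections on the $x$-axis have pairwise disjoint interiors); each item in an area container of size $a\times b$ has width at most $\varepsilon a$ and height at most $\varepsilon b$. *)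

theory Defs
  imports Main "HOL-Library.Product_Plus" Complex_Main
begin

text \<open>Items are indexed by natural numbers; item i has width w i, height h i, profit p i.
  A rotation flag rot i (True = rotated by 90 degrees) swaps width and height.\<close>

definition rot_w :: "(nat \<Rightarrow> real) \<Rightarrow> (nat \<Rightarrow> real) \<Rightarrow> (nat \<Rightarrow> bool) \<Rightarrow> nat \<Rightarrow> real" where
  "rot_w w h rot i = (if rot i then h i else w i)"

definition rot_h :: "(nat \<Rightarrow> real) \<Rightarrow> (nat \<Rightarrow> real) \<Rightarrow> (nat \<Rightarrow> bool) \<Rightarrow> nat \<Rightarrow> real" where
  "rot_h w h rot i = (if rot i then w i else h i)"

definition box_int :: "real \<Rightarrow> real \<Rightarrow> real \<Rightarrow> real \<Rightarrow> (real \<times> real) set" where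
  "box_int x y a b = {x<..<x+a} \<times> {y<..<y+b}"

definition feasible_packing :: "real \<Rightarrow> (nat \<Rightarrow> real) \<Rightarrow> (nat \<Rightarrow> real) \<Rightarrow> nat set \<Rightarrow> bool" where
  "feasible_packing N w h R \<longleftrightarrow>
    (\<exists>(px::nat \<Rightarrow> real) (py::nat \<Rightarrow> real) (rot::nat \<Rightarrow> bool).
      (\<forall>i\<in>R. 0 \<le> px i \<and> px i + rot_w w h rot i \<le> N \<and> 0 \<le> py i \<and> py i + rot_h w h rot i \<le> N) \<and>
      (\<forall>i\<in>R. \<forall>j\<in>R. i \<noteq> j \<longrightarrow>
         box_int (px i) (py i) (rot_w w h rot i) (rot_h w h rot i) \<inter>
         box_int (px j) (py j) (rot_w w h rot j) (rot_h w h rot j) = {}))"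

datatype container_label = Horizontal | Vertical | Area

definition container_packing ::
  "real \<Rightarrow> real \<Rightarrow> (nat \<Rightarrow> real) \<Rightarrow> (nat \<Rightarrow> real) \<Rightarrow> nat set \<Rightarrow> nat \<Rightarrow> bool" where
  "container_packing \<epsilon> N w h R' m \<longleftrightarrow>
    (\<exists>(cx::nat \<Rightarrow> real) (cy::nat \<Rightarrow> real) (ca::nat \<Rightarrow> real) (cb::nat \<Rightarrow> real)
      (lab::nat \<Rightarrow> container_label) (asg::nat \<Rightarrow> nat)
      (px::nat \<Rightarrow> real) (py::nat \<Rightarrow> real) (rot::nat \<Rightarrow> bool).
      \<comment> \<open>containers lie in the knapsack and have pairwise disjoint interiors\<close>
      (\<forall>k<m. 0 \<le> ca k \<and> 0 \<le> cb k \<and> 0 \<le> cx k \<and> cx k + ca k \<le> N \<and> 0 \<le> cy k \<and> cy k + cb k \<le> N) \<and>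
      (\<forall>k<m. \<forall>l<m. k \<noteq> l \<longrightarrow>
         box_int (cx k) (cy k) (ca k) (cb k) \<inter> box_int (cx l) (cy l) (ca l) (cb l) = {}) \<and>
      \<comment> \<open>every item is placed inside its container\<close>
      (\<forall>i\<in>R'. asg i < m \<and>
         cx (asg i) \<le> px i \<and> px i + rot_w w h rot i \<le> cx (asg i) + ca (asg i) \<and>
         cy (asg i) \<le> py i \<and> py i + rot_h w h rot i \<le> cy (asg i) + cb (asg i)) \<and>
      \<comment> \<open>items do not overlap\<close>
      (\<forall>i\<in>R'. \<forall>j\<in>R'. i \<noteq> j \<longrightarrow>
         box_int (px i) (py i) (rot_w w h rot i) (rot_h w h rot i) \<inter>
         box_int (px j) (py j) (rot_w w h rot j) (rot_h w h rot j) = {}) \<and>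
      \<comment> \<open>horizontal containers: items stacked (disjoint y-projection interiors)\<close>
      (\<forall>i\<in>R'. \<forall>j\<in>R'. i \<noteq> j \<and> asg i = asg j \<and> lab (asg i) = Horizontal \<longrightarrow>
         {py i<..<py i + rot_h w h rot i} \<inter> {py j<..<py j + rot_h w h rot j} = {}) \<and>
      \<comment> \<open>vertical containers: items side by side (disjoint x-projection interiors)\<close>
      (\<forall>i\<in>R'. \<forall>j\<in>R'. i \<noteq> j \<and> asg i = asg j \<and> lab (asg i) = Vertical \<longrightarrow>
         {px i<..<px i + rot_w w h rot i} \<inter> {px j<..<px j + rot_w w h rot j} = {}) \<and>
      \<comment> \<open>area containers: items are small relative to the container\<close>
      (\<forall>i\<in>R'. lab (asg i) = Area \<longrightarrow>
         rot_w w h rot i \<le> \<epsilon> * ca (asg i) \<and> rot_h w h rot i \<le> \<epsilon> * cb (asg i)))"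

end

theory Submission
  imports Defs "HOL-Analysis.Analysis"
begin

text \<open>Rearranging items along a line costs a bounded number of dropped items. To make this cheap, the few items
of high profit are fixed in place and only the boundedly many gaps between them are rearranged, where every
dropped item has low profit.

Scaling heights up by 1 + del leaves room to align tall items to boundedly many rows. The short items between
them merge into one block for each row and set of tall items on the left. Tall items and blocks have boundedly
many types, so the x-axis is rearranged according to the boundedly many sets of types met by a vertical line. The contents
of a wide block are packed by linear grouping of widths, those of a narrow one by shelves. Hence, with extra
height, almost all the profit survives in boundedly many containers.

To gain this extra height in the unit square, choose scales d << s << D such that items with a side
or an offset from the boundary between d and D have negligible profit. Consider the vertically spanning items, those that
come within d of both the top and the bottom side.
If some of them have width at least 5d in total and at most a third of the profit, drop these:
the rest of the spanning items form one vertical container and the items near the top and bottom sides are turned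
by 90 degrees into the gap. If the spanning items have width at most 30d in total, either the tall
items near the top (or near the bottom) carry at most a third of the profit, and dropping them frees a strip
for the turned spanning items, or those near the top and near the bottom carry two thirds
together and form a staircase that can be packed alone. The only other case is a single spanning item
with more than a third of the profit. The same holds horizontally, so either two such
items suffice, or one item nearly fills the square. Around that item, two complementary layouts of the
remaining ring together use every other item, so one of them keeps half of the rest.\<close>

section \<open>Intervals on a line\<close>

text \<open>A strip is freed by dropping the cheapest of many thin horizontal bands and lowering
  what lies above it. Only tall items reaching the band resist, and the spanning ones are in the way
  at both sides; turning is the remedy, since spanning items of small total width become a low
  stack. The fraction 2/3 has two sources: spanning items wider than 30d in total, none with more
  than a third of the profit, split into three parts of width at least 5d, one of them cheap; and
  one item with more than a third, plus half of the rest, exceeds two thirds. The width 5d pays for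
  two turned end strips, each doubled to 2d by the augmentation, and for an augmentation by d in the
  middle. The stack of height 30d is lower than s/2, the part of a freed strip of height s that the
  augmentation leaves over. Every bound on the number of containers must be known before the items
  are; hence each scale is picked from a finite sequence fixed in advance, and the bounds for all
  its members are summed.\<close>

definition sep :: "('i \<Rightarrow> real) \<Rightarrow> ('i \<Rightarrow> real) \<Rightarrow> 'i \<Rightarrow> 'i \<Rightarrow> bool" where
  "sep x s i j \<longleftrightarrow> x i + s i \<le> x j \<or> x j + s j \<le> x i"

lemma sep_commute: "sep x s i j \<longleftrightarrow> sep x s j i"
  unfolding sep_def by auto

section \<open>Separated intervals, greedy filling and averaging\<close>

lemma finite_argmin:
  fixes f :: "'i \<Rightarrow> real"
  assumes "finite I" "I \<noteq> {}"
  obtains m where "m \<in> I" "\<And>i. i \<in> I \<Longrightarrow> f m \<le> f i"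
proof -
  have "Min (f ` I) \<in> f ` I" using assms by (intro Min_in) auto
  then obtain m where "m \<in> I" "f m = Min (f ` I)" by (auto elim: imageE)
  then show thesis using assms by (intro that[of m]) auto
qed

text \<open>Induction on the item that starts furthest right: an item separated from it cannot lie
  to its right, so all others end before it starts, and \<open>v\<close> may be lowered to that
  start.\<close>

lemma sum_le_of_sep:
  fixes x s :: "'i \<Rightarrow> real"
  assumes "finite I" "\<And>i. i \<in> I \<Longrightarrow> 0 < s i" "\<And>i. i \<in> I \<Longrightarrow> u \<le> x i \<and> x i + s i \<le> v"
    "\<And>i j. i \<in> I \<Longrightarrow> j \<in> I \<Longrightarrow> i \<noteq> j \<Longrightarrow> sep x s i j" "u \<le> v"
  shows "sum s I \<le> v - u"
  using assms
proof (induction "card I" arbitrary: I v)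
  case 0
  then show ?case by simp
next
  case (Suc n)
  have ne: "I \<noteq> {}" using Suc.hyps(2) by auto
  obtain m where m: "m \<in> I" "\<And>i. i \<in> I \<Longrightarrow> - x m \<le> - x i"
    using finite_argmin[OF Suc.prems(1) ne, of "\<lambda>i. - x i"] by blast
  have le: "x i \<le> x m" if "i \<in> I" for i
    using m(2)[OF that] by simp
  have "sum s (I - {m}) \<le> x m - u"
  proof (rule Suc.hyps(1))
    show "n = card (I - {m})" using Suc.hyps(2) m(1) Suc.prems(1) by simp
    show "finite (I - {m})" using Suc.prems(1) by simp
    fix i assume i: "i \<in> I - {m}"
    then have "sep x s i m" using Suc.prems(4) m(1) by auto
    then show "u \<le> x i \<and> x i + s i \<le> x m"
      using i le[of i] Suc.prems(2)[of m] Suc.prems(3)[of i] m(1) unfolding sep_def by auto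
  next
    show "u \<le> x m" using Suc.prems(3)[OF m(1)] by simp
  qed (use Suc.prems m in auto)
  moreover have "sum s I = s m + sum s (I - {m})"
    using m(1) Suc.prems(1) by (simp add: sum.remove)
  ultimately show ?case using Suc.prems(3)[OF m(1)] by linarith
qed

lemma layout_exists:
  fixes s :: "'i \<Rightarrow> real"
  assumes "finite I" "\<And>i. i \<in> I \<Longrightarrow> 0 \<le> s i"
  shows "\<exists>x. (\<forall>i\<in>I. u \<le> x i \<and> x i + s i \<le> u + sum s I) \<and> (\<forall>i\<in>I. \<forall>j\<in>I. i \<noteq> j \<longrightarrow> sep x s i j)"
  using assms
proof (induction I rule: finite_induct)
  case empty
  then show ?case by simp
next
  case (insert a F)
  then obtain x where x: "\<forall>i\<in>F. u \<le> x i \<and> x i + s i \<le> u + sum s F" "\<forall>i\<in>F. \<forall>j\<in>F. i \<noteq> j \<longrightarrow> sep x s i j"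
    by (metis insertCI)
  have s0: "0 \<le> sum s F" "0 \<le> s a" using insert.prems by (auto intro: sum_nonneg)
  let ?x = "x(a := u + sum s F)"
  have "\<forall>i\<in>insert a F. u \<le> ?x i \<and> ?x i + s i \<le> u + sum s (insert a F)"
    using x(1) s0 insert.hyps by fastforce
  moreover have "\<forall>i\<in>insert a F. \<forall>j\<in>insert a F. i \<noteq> j \<longrightarrow> sep ?x s i j"
    using x insert.hyps unfolding sep_def by auto
  ultimately show ?case by blast
qed

text \<open>Greedy selection by decreasing \<open>f\<close>: \<open>G\<close> is what fits into
  \<open>c\<close>, and \<open>z\<close> is the next item, at which the capacity overflows. Peeling
  off an item of least \<open>f\<close> until the rest no longer exceeds \<open>c\<close> produces
  both. With constant \<open>f\<close> this is plain filling in any order.\<close>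

lemma sorted_prefix:
  fixes s f :: "'i \<Rightarrow> real"
  assumes "finite I" "0 \<le> c" "c < sum s I"
  shows "\<exists>G z. G \<subseteq> I \<and> z \<in> I - G \<and> sum s G \<le> c \<and> c < sum s G + s z \<and>
    (\<forall>i\<in>G. \<forall>j\<in>I - G. f j \<le> f i) \<and> (\<forall>j\<in>I - G. f j \<le> f z)"
  using assms
proof (induction "card I" arbitrary: I)
  case 0
  then show ?case by simp
next
  case (Suc n)
  have ne: "I \<noteq> {}" using Suc.hyps(2) by auto
  obtain m where m: "m \<in> I" and le: "\<And>i. i \<in> I \<Longrightarrow> f m \<le> f i"
    using finite_argmin[OF Suc.prems(1) ne, of f] by blast
  have sm: "sum s I = s m + sum s (I - {m})"
    using m Suc.prems(1) by (simp add: sum.remove)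
  show ?case
  proof (cases "c < sum s (I - {m})")
    case True
    have "n = card (I - {m})" "finite (I - {m})" using Suc.hyps(2) m Suc.prems(1) by simp_all
    from Suc.hyps(1)[OF this Suc.prems(2) True]
    obtain G z where G: "G \<subseteq> I - {m}" "z \<in> I - {m} - G" "sum s G \<le> c" "c < sum s G + s z"
      and G5: "\<forall>i\<in>G. \<forall>j\<in>I - {m} - G. f j \<le> f i" and G6: "\<forall>j\<in>I - {m} - G. f j \<le> f z" by blast
    have 1: "f j \<le> f i" if "i \<in> G" "j \<in> I - G" for i j
      using G5 that le[of i] G(1) by (cases "j = m") auto
    have 2: "f j \<le> f z" if "j \<in> I - G" for j
      using G6 that le[of z] G(2) by (cases "j = m") auto
    have 3: "G \<subseteq> I" "z \<in> I - G" using G by auto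
    show ?thesis
      by (rule exI[of _ G], rule exI[of _ z]) (simp add: 1 2 3 G del: Diff_iff)
  next
    case False
    have 1: "I - (I - {m}) = {m}" using m by auto
    have 2: "m \<in> I - (I - {m})" using m by auto
    show ?thesis
    proof (rule exI[of _ "I - {m}"], rule exI[of _ m], intro conjI)
      show "\<forall>i\<in>I - {m}. \<forall>j\<in>I - (I - {m}). f j \<le> f i" unfolding 1 using le by simp
      show "\<forall>j\<in>I - (I - {m}). f j \<le> f m" unfolding 1 by simp
    qed (use 2 sm False Suc.prems in auto)
  qed
qed

text \<open>Each bin is filled until an item \<open>z\<close> overflows it. That item is dropped;
  since it exceeds the capacity together with the contents of the bin, the remaining items still fit
  into the remaining bins in total. So one lost item per bin suffices.\<close>

lemma fill_bins:
  fixes s :: "'i \<Rightarrow> real" and cap :: "'j \<Rightarrow> real"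
  assumes "finite J" "finite I" "\<And>i. i \<in> I \<Longrightarrow> 0 < s i" "\<And>j. j \<in> J \<Longrightarrow> 0 \<le> cap j"
    "sum s I \<le> sum cap J"
  shows "\<exists>asg D. D \<subseteq> I \<and> card D \<le> card J \<and> (\<forall>i\<in>I - D. asg i \<in> J) \<and>
    (\<forall>j\<in>J. sum s {i \<in> I - D. asg i = j} \<le> cap j)"
  using assms
proof (induction J arbitrary: I rule: finite_induct)
  case empty
  have "I = {}"
  proof (rule ccontr)
    assume "I \<noteq> {}"
    then have "0 < sum s I" using empty.prems by (intro sum_pos) auto
    then show False using empty.prems by simp
  qed
  then show ?case by auto
next
  case (insert b J)
  have capb: "0 \<le> cap b" using insert.prems by auto
  show ?case
  proof (cases "sum s I \<le> cap b")
    case True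
    have "sum s {i \<in> I. b = j} \<le> cap j" if "j \<in> insert b J" for j
      using True insert.prems that by (cases "j = b") auto
    then show ?thesis
      by (intro exI[of _ "\<lambda>_. b"] exI[of _ "{}"]) auto
  next
    case False
    obtain G z where G: "G \<subseteq> I" "z \<in> I - G" "sum s G \<le> cap b" "cap b < sum s G + s z"
      using sorted_prefix[of I "cap b" s "\<lambda>_. 0"] False capb insert.prems(1) by (meson not_le)
    let ?I = "I - insert z G"
    have fin: "finite G" using G insert.prems finite_subset by blast
    have "sum s I = sum s (insert z G) + sum s ?I"
      using G insert.prems by (metis (no_types, lifting) DiffD1 add.commute insert_subset sum.subset_diff)
    moreover have "sum s (insert z G) = s z + sum s G" using G fin by simp
    moreover have "sum cap (insert b J) = cap b + sum cap J" using insert.hyps by simp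
    ultimately have "sum s ?I \<le> sum cap J" using insert.prems G by linarith
    then have "\<exists>asg D. D \<subseteq> ?I \<and> card D \<le> card J \<and> (\<forall>i\<in>?I - D. asg i \<in> J) \<and>
      (\<forall>j\<in>J. sum s {i \<in> ?I - D. asg i = j} \<le> cap j)"
      by (intro insert.IH) (use insert.prems in auto)
    then obtain asg D where D: "D \<subseteq> ?I" "card D \<le> card J" "\<forall>i\<in>?I - D. asg i \<in> J"
      "\<forall>j\<in>J. sum s {i \<in> ?I - D. asg i = j} \<le> cap j" by blast
    have finD: "finite D" using D(1) insert.prems finite_subset by blast
    let ?asg = "\<lambda>i. if i \<in> G then b else asg i"
    have "sum s {i \<in> I - insert z D. ?asg i = j} \<le> cap j" if j: "j \<in> insert b J" for j
    proof (cases "j = b")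
      case True
      have "{i \<in> I - insert z D. ?asg i = j} = G"
        using True D G insert.hyps by auto
      then show ?thesis using G True by simp
    next
      case False
      then have "{i \<in> I - insert z D. ?asg i = j} = {i \<in> ?I - D. asg i = j}"
        using D G by auto
      then show ?thesis using D j False by auto
    qed
    moreover have "\<forall>i\<in>I - insert z D. ?asg i \<in> insert b J" using D by auto
    moreover have "card (insert z D) \<le> card (insert b J)"
      using D(2) insert.hyps finD by (simp add: card_insert_if)
    moreover have "insert z D \<subseteq> I" using D G by auto
    ultimately show ?thesis by (intro exI[of _ ?asg] exI[of _ "insert z D"] conjI) (blast | assumption)+
  qed
qed

text \<open>Double counting: over all \<open>M\<close> sets each profit is counted at most
  \<open>c\<close> times, so the cheapest set costs at most the fraction \<open>c / M\<close>. Every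
  later choice of a scale, a strip or a pair of groups rests on this.\<close>

lemma averaging:
  fixes p :: "'i \<Rightarrow> real" and B :: "nat \<Rightarrow> 'i set"
  assumes "finite R" "\<And>i. i \<in> R \<Longrightarrow> 0 \<le> p i" "0 < M"
    "\<And>i. i \<in> R \<Longrightarrow> card {j. j < M \<and> i \<in> B j} \<le> c"
  shows "\<exists>j<M. sum p (B j \<inter> R) \<le> real c / real M * sum p R"
proof (rule ccontr)
  assume "\<not> ?thesis"
  then have *: "\<And>j. j < M \<Longrightarrow> real c / real M * sum p R < sum p (B j \<inter> R)" by force
  have ne: "{..<M} \<noteq> {}" using assms(3) by (metis lessThan_iff empty_iff)
  have "(\<Sum>j<M. real c / real M * sum p R) < (\<Sum>j<M. sum p (B j \<inter> R))"
    by (rule sum_strict_mono[OF finite_lessThan ne]) (rule *, simp only: lessThan_iff)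
  also have "\<dots> = (\<Sum>j<M. \<Sum>i\<in>R. p i * of_bool (i \<in> B j))"
  proof (rule sum.cong[OF refl])
    fix j
    have "sum p (B j \<inter> R) = (\<Sum>i\<in>B j \<inter> R. p i * of_bool (i \<in> B j))"
      by (rule sum.cong) simp_all
    also have "\<dots> = (\<Sum>i\<in>R. p i * of_bool (i \<in> B j))"
      by (rule sum.mono_neutral_left) (use assms(1) in auto)
    finally show "sum p (B j \<inter> R) = (\<Sum>i\<in>R. p i * of_bool (i \<in> B j))" .
  qed
  also have "\<dots> = (\<Sum>i\<in>R. \<Sum>j<M. p i * of_bool (i \<in> B j))" by (rule sum.swap)
  also have "\<dots> = (\<Sum>i\<in>R. p i * real (card {j. j < M \<and> i \<in> B j}))"
  proof (rule sum.cong[OF refl])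
    fix i
    have "(\<Sum>j<M. p i * of_bool (i \<in> B j)) = (\<Sum>j\<in>{j. j < M \<and> i \<in> B j}. p i * of_bool (i \<in> B j))"
      by (rule sum.mono_neutral_right) auto
    also have "\<dots> = (\<Sum>j\<in>{j. j < M \<and> i \<in> B j}. p i)"
      by (rule sum.cong) simp_all
    finally show "(\<Sum>j<M. p i * of_bool (i \<in> B j)) = p i * real (card {j. j < M \<and> i \<in> B j})"
      by simp
  qed
  also have "\<dots> \<le> (\<Sum>i\<in>R. p i * real c)"
    using assms by (intro sum_mono mult_left_mono) auto
  also have "\<dots> = real c * sum p R" by (simp add: sum_distrib_left mult.commute)
  finally show False using assms(3) by simp
qed

text \<open>Linear grouping by decreasing \<open>a\<close>. \<open>D\<close> holds the items at
  which groups overflow: without them a group has length at most \<open>eta\<close>, with them every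
  group but the last exceeds \<open>eta\<close>. So what is kept of group \<open>k + 1\<close>
  always fits where the full group \<open>k\<close> was.\<close>

lemma grouping:
  fixes s a :: "'i \<Rightarrow> real"
  assumes "finite T" "\<And>i. i \<in> T \<Longrightarrow> 0 < s i" "0 < eta" "sum s T \<le> real m * eta"
  shows "\<exists>grp D. D \<subseteq> T \<and> card D \<le> m \<and> (\<forall>i\<in>T. grp i < m) \<and>
    (\<forall>i\<in>T. \<forall>j\<in>T. grp i < grp j \<longrightarrow> a j \<le> a i) \<and>
    (\<forall>k. sum s {i \<in> T - D. grp i = k} \<le> eta) \<and>
    (\<forall>k. (\<exists>j\<in>T. k < grp j) \<longrightarrow> eta < sum s {i \<in> T. grp i = k})"
  using assms
proof (induction m arbitrary: T)
  case 0
  have "T = {}"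
  proof (rule ccontr)
    assume "T \<noteq> {}"
    then have "0 < sum s T" using 0 by (intro sum_pos) auto
    then show False using 0 by simp
  qed
  then show ?case using 0 by auto
next
  case (Suc m)
  show ?case
  proof (cases "sum s T \<le> eta")
    case True
    have "sum s {i \<in> T. 0 = k} \<le> eta" for k :: nat
      using True Suc.prems by (cases "k = 0") auto
    then show ?thesis
      by (intro exI[of _ "\<lambda>_. 0"] exI[of _ "{}"]) auto
  next
    case False
    obtain G z where G: "G \<subseteq> T" "z \<in> T - G" "sum s G \<le> eta" "eta < sum s G + s z"
      "\<forall>i\<in>G. \<forall>j\<in>T - G. a j \<le> a i" "\<forall>j\<in>T - G. a j \<le> a z"
      using sorted_prefix[of T eta s a] False Suc.prems(1,3) by (metis less_imp_le not_le)
    let ?T = "T - insert z G"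
    have fin: "finite G" using G Suc.prems finite_subset by blast
    have "sum s T = sum s (insert z G) + sum s ?T"
      using G Suc.prems by (metis (no_types, lifting) DiffD1 add.commute insert_subset sum.subset_diff)
    moreover have "sum s (insert z G) = s z + sum s G" using G fin by simp
    ultimately have "sum s ?T \<le> real m * eta" using Suc.prems G by (simp add: algebra_simps)
    then obtain grp D where D: "D \<subseteq> ?T" "card D \<le> m" "\<forall>i\<in>?T. grp i < m"
      "\<forall>i\<in>?T. \<forall>j\<in>?T. grp i < grp j \<longrightarrow> a j \<le> a i"
      "\<forall>k. sum s {i \<in> ?T - D. grp i = k} \<le> eta"
      "\<forall>k. (\<exists>j\<in>?T. k < grp j) \<longrightarrow> eta < sum s {i \<in> ?T. grp i = k}"
      using Suc.IH[of ?T] Suc.prems by auto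
    have finD: "finite D" using D(1) Suc.prems finite_subset by blast
    let ?g = "\<lambda>i. if i \<in> insert z G then 0 else Suc (grp i)"
    have 1: "\<forall>i\<in>T. ?g i < Suc m" using D by auto
    have 2: "\<forall>i\<in>T. \<forall>j\<in>T. ?g i < ?g j \<longrightarrow> a j \<le> a i"
    proof (intro ballI impI)
      fix i j assume ij: "i \<in> T" "j \<in> T" "?g i < ?g j"
      then have j: "j \<in> ?T" by (auto split: if_splits)
      show "a j \<le> a i"
      proof (cases "i \<in> insert z G")
        case True
        then show ?thesis using G j by auto
      next
        case False
        then show ?thesis using D(4) ij j by auto
      qed
    qed
    have 3: "sum s {i \<in> T - insert z D. ?g i = k} \<le> eta" for k
    proof (cases k)
      case 0
      have "{i \<in> T - insert z D. ?g i = k} = G" using 0 G D by (auto split: if_splits)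
      then show ?thesis using G by simp
    next
      case (Suc k')
      then have "{i \<in> T - insert z D. ?g i = k} = {i \<in> ?T - D. grp i = k'}" using G D
        by (auto split: if_splits)
      then show ?thesis using D by simp
    qed
    have 4: "eta < sum s {i \<in> T. ?g i = k}" if ex: "\<exists>j\<in>T. k < ?g j" for k
    proof (cases k)
      case 0
      have "{i \<in> T. ?g i = k} = insert z G" using 0 G by (auto split: if_splits)
      then show ?thesis using G fin by simp
    next
      case (Suc k')
      then have "{i \<in> T. ?g i = k} = {i \<in> ?T. grp i = k'}" using G by (auto split: if_splits)
      moreover have "\<exists>j\<in>?T. k' < grp j" using ex Suc by (auto split: if_splits)
      ultimately show ?thesis using D by simp
    qed
    have 5: "insert z D \<subseteq> T" "card (insert z D) \<le> Suc m"
      using D G finD by (auto simp: card_insert_if)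
    show ?thesis
    proof (rule exI[of _ ?g], rule exI[of _ "insert z D"], intro conjI)
      show "\<forall>k. sum s {i \<in> T - insert z D. ?g i = k} \<le> eta" using 3 by blast
      show "\<forall>k. (\<exists>j\<in>T. k < ?g j) \<longrightarrow> eta < sum s {i \<in> T. ?g i = k}" using 4 by blast
    qed (fact 1 2 5)+
  qed
qed

text \<open>\<open>m Z\<close> is the measure of the set of points covered by exactly the items in
  \<open>Z\<close>. This turns a placement into a finite fractional solution that remembers only
  which sets of items occur on a line and for what total length.\<close>

lemma slices:
  fixes l s :: "'i \<Rightarrow> real"
  assumes "finite S" "\<And>i. i \<in> S \<Longrightarrow> 0 < s i" "\<And>i. i \<in> S \<Longrightarrow> u \<le> l i \<and> l i + s i \<le> v" "u \<le> v"
  shows "\<exists>m :: 'i set \<Rightarrow> real. (\<forall>Z. 0 \<le> m Z) \<and> sum m (Pow S) = v - u \<and>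
    (\<forall>i\<in>S. sum m {Z \<in> Pow S. i \<in> Z} = s i) \<and>
    (\<forall>Z. 0 < m Z \<longrightarrow> (\<exists>x. u < x \<and> x < v \<and> Z = {i \<in> S. l i < x \<and> x < l i + s i}))"
proof -
  define cr where "cr x = {i \<in> S. l i < x \<and> x < l i + s i}" for x
  define E where "E Z = {x \<in> {u<..<v}. cr x = Z}" for Z
  define m where "m Z = measure lborel (E Z)" for Z
  \<comment> \<open>Written as a finite intersection of intervals and complements of intervals,
    \<open>E Z\<close> is visibly a Borel set.\<close>
  have E_eq: "E Z = {u<..<v} \<inter> (\<Inter>i\<in>S. if i \<in> Z then {l i<..<l i + s i} else - {l i<..<l i + s i})"
    (is "_ = ?X") if "Z \<subseteq> S" for Z
  proof
    show "E Z \<subseteq> ?X"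
    proof
      fix t assume t: "t \<in> E Z"
      have "t \<in> (if i \<in> Z then {l i<..<l i + s i} else - {l i<..<l i + s i})" if "i \<in> S" for i
        using t that unfolding E_def cr_def by (cases "i \<in> Z") auto
      then show "t \<in> ?X" using t unfolding E_def by blast
    qed
    show "?X \<subseteq> E Z"
    proof
      fix t assume t: "t \<in> ?X"
      have "i \<in> Z \<longleftrightarrow> l i < t \<and> t < l i + s i" if "i \<in> S" for i
      proof -
        have "t \<in> (if i \<in> Z then {l i<..<l i + s i} else - {l i<..<l i + s i})"
          using t that by (simp only: Int_iff INT_iff)
        then show ?thesis by (cases "i \<in> Z") auto
      qed
      then have "cr t = Z" using \<open>Z \<subseteq> S\<close> unfolding cr_def by blast
      then show "t \<in> E Z" using t unfolding E_def by simp
    qed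
  qed
  have meas: "E Z \<in> sets borel" if "Z \<subseteq> S" for Z
  proof (cases "S = {}")
    case True
    then show ?thesis unfolding E_eq[OF that] by simp
  next
    case False
    define X where "X i = (if i \<in> Z then {l i<..<l i + s i} else - {l i<..<l i + s i})" for i
    have "X i \<in> sets borel" for i unfolding X_def by (simp add: borel_comp)
    then have "(\<Inter>i\<in>S. X i) \<in> sets borel"
      using sets.finite_INT[OF assms(1) False, of X borel] by blast
    then have "{u<..<v} \<inter> (\<Inter>i\<in>S. X i) \<in> sets borel"
      by (intro sets.Int) auto
    then show ?thesis unfolding E_eq[OF that] X_def .
  qed
  have fin: "emeasure lborel (E Z) \<noteq> \<infinity>" for Z
  proof -
    have "emeasure lborel (E Z) \<le> emeasure lborel {u<..<v}"
      by (rule emeasure_mono) (auto simp: E_def)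
    then show ?thesis using assms(4) by (auto simp: top_unique)
  qed
  have disj: "disjoint_family_on E X" for X
    unfolding disjoint_family_on_def E_def by auto
  have sumE: "sum m X = measure lborel (\<Union>Z\<in>X. E Z)" if "X \<subseteq> Pow S" for X
  proof -
    have "finite X" using that assms(1) finite_subset by blast
    then show ?thesis unfolding m_def
      by (intro measure_finite_Union[symmetric]) (use meas that disj fin in \<open>auto simp: subset_iff\<close>)
  qed
  have "(\<Union>Z\<in>Pow S. E Z) = {u<..<v}"
  proof (intro equalityI subsetI)
    fix t assume "t \<in> {u<..<v}"
    then have "t \<in> E (cr t)" unfolding E_def by simp
    moreover have "cr t \<in> Pow S" unfolding cr_def by blast
    ultimately show "t \<in> (\<Union>Z\<in>Pow S. E Z)" by (rule UN_I[rotated])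
  qed (auto simp: E_def)
  then have 1: "sum m (Pow S) = v - u" using sumE[of "Pow S"] assms(4) by simp
  have 2: "sum m {Z \<in> Pow S. i \<in> Z} = s i" if i: "i \<in> S" for i
  proof -
    have "(\<Union>Z\<in>{Z \<in> Pow S. i \<in> Z}. E Z) = {l i<..<l i + s i}"
    proof (intro equalityI subsetI)
      fix t assume "t \<in> (\<Union>Z\<in>{Z \<in> Pow S. i \<in> Z}. E Z)"
      then have "i \<in> cr t" unfolding E_def by blast
      then show "t \<in> {l i<..<l i + s i}" unfolding cr_def by simp
    next
      fix t assume t: "t \<in> {l i<..<l i + s i}"
      then have "t \<in> E (cr t)" using assms(3)[OF i] unfolding E_def by simp
      moreover have "cr t \<in> {Z \<in> Pow S. i \<in> Z}" using t i unfolding cr_def by simp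
      ultimately show "t \<in> (\<Union>Z\<in>{Z \<in> Pow S. i \<in> Z}. E Z)" by (rule UN_I[rotated])
    qed
    then show ?thesis using sumE[of "{Z \<in> Pow S. i \<in> Z}"] assms(2)[OF i] by auto
  qed
  have 3: "\<exists>x. u < x \<and> x < v \<and> Z = {i \<in> S. l i < x \<and> x < l i + s i}" if "0 < m Z" for Z
  proof -
    have "E Z \<noteq> {}" using that unfolding m_def by auto
    then show ?thesis unfolding E_def cr_def by auto
  qed
  have 0: "0 \<le> m Z" for Z unfolding m_def by simp
  show ?thesis
  proof (rule exI[of _ m], intro conjI)
    show "\<forall>Z. 0 < m Z \<longrightarrow> (\<exists>x. u < x \<and> x < v \<and> Z = {i \<in> S. l i < x \<and> x < l i + s i})"
      using 3 by blast
  qed (use 0 1 2 in auto)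
qed

text \<open>The items of a class \<open>cl i\<close> lie in intervals \<open>[cu i, cv i]\<close>, one per container; there are at most \<open>K\<close>
containers in all. Items related by \<open>cmp\<close> sit at different heights, so their containers may overlap
horizontally.\<close>

definition arrangeable :: "('i \<Rightarrow> 'c) \<Rightarrow> ('i \<Rightarrow> 'i \<Rightarrow> bool) \<Rightarrow> ('i \<Rightarrow> real) \<Rightarrow> 'i set \<Rightarrow> real \<Rightarrow> real \<Rightarrow> nat \<Rightarrow> bool" where
  "arrangeable cl cmp s S u v K \<longleftrightarrow> (\<exists>x cu cv :: 'i \<Rightarrow> real.
    card ((\<lambda>i. (cl i, cu i, cv i)) ` S) \<le> K \<and>
    (\<forall>i\<in>S. u \<le> cu i \<and> cu i \<le> x i \<and> x i + s i \<le> cv i \<and> cv i \<le> v) \<and>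
    (\<forall>i\<in>S. \<forall>j\<in>S. i \<noteq> j \<longrightarrow> (if (cl i, cu i, cv i) = (cl j, cu j, cv j) then sep x s i j
       else cv i \<le> cu j \<or> cv j \<le> cu i \<or> cmp i j)))"

section \<open>Constructing and combining arrangements with boundedly many containers\<close>

lemma arrangeable_empty: "arrangeable cl cmp s {} u v K"
  unfolding arrangeable_def by simp

lemma arrangeable_mono: "arrangeable cl cmp s S u v K \<Longrightarrow> K \<le> L \<Longrightarrow> arrangeable cl cmp s S u v L"
  unfolding arrangeable_def by (elim exE conjE, intro exI conjI) (erule order_trans, assumption+)

lemma arrangeable_single: "arrangeable cl cmp s {j} (x j) (x j + s j) 1"
  unfolding arrangeable_def
  by (rule exI[of _ x], rule exI[of _ "\<lambda>_. x j"], rule exI[of _ "\<lambda>_. x j + s j"]) simp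

text \<open>Containers of different parts must stay different as triples, since equal triples would
  demand separation inside one container. Positive sizes make every interval nondegenerate, so
  disjoint intervals differ, and \<open>cmp\<close> forces different classes.\<close>

lemma arrangeable_UN:
  fixes S :: "'k \<Rightarrow> 'i set" and u v U V and s :: "'i \<Rightarrow> real"
  assumes fin: "finite Q" "\<And>k. k \<in> Q \<Longrightarrow> finite (S k)"
    and disj: "\<And>k l. k \<in> Q \<Longrightarrow> l \<in> Q \<Longrightarrow> k \<noteq> l \<Longrightarrow> S k \<inter> S l = {}"
    and a: "\<And>k. k \<in> Q \<Longrightarrow> arrangeable cl cmp s (S k) (u k) (v k) (n k)"
    and hull: "\<And>k. k \<in> Q \<Longrightarrow> U \<le> u k \<and> v k \<le> V"
    and sp: "\<And>k l. k \<in> Q \<Longrightarrow> l \<in> Q \<Longrightarrow> k \<noteq> l \<Longrightarrow>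
      v k \<le> u l \<or> v l \<le> u k \<or> (\<forall>i\<in>S k. \<forall>j\<in>S l. cmp i j)"
    and pos: "\<And>k i. k \<in> Q \<Longrightarrow> i \<in> S k \<Longrightarrow> 0 < s i"
    and cmp: "\<And>i j. cmp i j \<Longrightarrow> cl i \<noteq> cl j"
  shows "arrangeable cl cmp s (\<Union>k\<in>Q. S k) U V (sum n Q)"
proof -
  define P where "P k x cu cv \<longleftrightarrow> card ((\<lambda>i. (cl i, cu i, cv i)) ` S k) \<le> n k \<and>
    (\<forall>i\<in>S k. u k \<le> cu i \<and> cu i \<le> x i \<and> x i + s i \<le> cv i \<and> cv i \<le> v k) \<and>
    (\<forall>i\<in>S k. \<forall>j\<in>S k. i \<noteq> j \<longrightarrow> (if (cl i, cu i, cv i) = (cl j, cu j, cv j) then sep x s i j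
       else cv i \<le> cu j \<or> cv j \<le> cu i \<or> cmp i j))" for k and x cu cv :: "'i \<Rightarrow> real"
  have "\<forall>k\<in>Q. \<exists>t. P k (fst t) (fst (snd t)) (snd (snd t))"
    using a unfolding arrangeable_def P_def by fastforce
  then obtain t where t: "\<forall>k\<in>Q. P k (fst (t k)) (fst (snd (t k))) (snd (snd (t k)))"
    by (meson bchoice)
  define X where "X k = fst (t k)" for k
  define CU where "CU k = fst (snd (t k))" for k
  define CV where "CV k = snd (snd (t k))" for k
  have PP: "P k (X k) (CU k) (CV k)" if "k \<in> Q" for k
    using t that unfolding X_def CU_def CV_def by blast
  define kap where "kap i = (THE k. k \<in> Q \<and> i \<in> S k)" for i
  have kap: "kap i = k" if "k \<in> Q" "i \<in> S k" for i k
    unfolding kap_def using that disj by (intro the_equality) blast+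
  define x where "x i = X (kap i) i" for i
  define cu where "cu i = CU (kap i) i" for i
  define cv where "cv i = CV (kap i) i" for i
  have P1: "card ((\<lambda>i. (cl i, cu i, cv i)) ` S k) \<le> n k" if "k \<in> Q" for k
  proof -
    have "(\<lambda>i. (cl i, cu i, cv i)) ` S k = (\<lambda>i. (cl i, CU k i, CV k i)) ` S k"
      by (intro image_cong refl) (simp add: cu_def cv_def kap[OF that])
    then show ?thesis using PP[OF that] unfolding P_def by simp
  qed
  have P2: "u k \<le> cu i" "cu i \<le> x i" "x i + s i \<le> cv i" "cv i \<le> v k" if "k \<in> Q" "i \<in> S k" for k i
    using PP[OF that(1)] that unfolding P_def x_def cu_def cv_def by (simp_all add: kap[OF that])
  have P3: "if (cl i, cu i, cv i) = (cl j, cu j, cv j) then sep x s i j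
       else cv i \<le> cu j \<or> cv j \<le> cu i \<or> cmp i j" if "k \<in> Q" "i \<in> S k" "j \<in> S k" "i \<noteq> j" for k i j
  proof -
    have "sep x s i j \<longleftrightarrow> sep (X k) s i j" unfolding sep_def x_def using kap that by simp
    then show ?thesis
      using PP[OF that(1)] that unfolding P_def cu_def cv_def by (simp add: kap)
  qed
  have "card ((\<lambda>i. (cl i, cu i, cv i)) ` (\<Union>k\<in>Q. S k)) \<le> (\<Sum>k\<in>Q. card ((\<lambda>i. (cl i, cu i, cv i)) ` S k))"
    unfolding image_UN by (rule card_UN_le[OF fin(1)])
  also have "\<dots> \<le> sum n Q" by (rule sum_mono) (rule P1)
  finally have 1: "card ((\<lambda>i. (cl i, cu i, cv i)) ` (\<Union>k\<in>Q. S k)) \<le> sum n Q" .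
  have 2: "U \<le> cu i \<and> cu i \<le> x i \<and> x i + s i \<le> cv i \<and> cv i \<le> V" if "i \<in> (\<Union>k\<in>Q. S k)" for i
    using that P2 hull by (metis UN_E order_trans)
  have 3: "if (cl i, cu i, cv i) = (cl j, cu j, cv j) then sep x s i j
       else cv i \<le> cu j \<or> cv j \<le> cu i \<or> cmp i j"
    if ij: "i \<in> (\<Union>k\<in>Q. S k)" "j \<in> (\<Union>k\<in>Q. S k)" "i \<noteq> j" for i j
  proof -
    obtain k l where kl: "k \<in> Q" "i \<in> S k" "l \<in> Q" "j \<in> S l" using ij by blast
    show ?thesis
    proof (cases "k = l")
      case True
      then show ?thesis using P3 kl ij by blast
    next
      case False
      then consider "v k \<le> u l" | "v l \<le> u k" | "cmp i j" using sp[OF kl(1,3)] kl by blast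
      then show ?thesis
      proof cases
        case 1
        then have "cv i \<le> cu j" using P2[OF kl(1,2)] P2[OF kl(3,4)] by linarith
        moreover have "cu i < cv i" using P2[OF kl(1,2)] pos[OF kl(1,2)] by linarith
        ultimately show ?thesis by auto
      next
        case 2
        then have "cv j \<le> cu i" using P2[OF kl(1,2)] P2[OF kl(3,4)] by linarith
        moreover have "cu j < cv j" using P2[OF kl(3,4)] pos[OF kl(3,4)] by linarith
        ultimately show ?thesis by auto
      next
        case 3
        then show ?thesis using cmp by auto
      qed
    qed
  qed
  show ?thesis unfolding arrangeable_def
    by (rule exI[of _ x], rule exI[of _ cu], rule exI[of _ cv]) (use 1 2 3 in blast)
qed

text \<open>\<open>D1\<close> has few items, \<open>D2\<close> has little profit. Only \<open>q\<close> is bounded here, not the profit of \<open>D1\<close>: that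
is controlled by applying this to low-profit items.\<close>

definition solvable :: "('i \<Rightarrow> 'c) \<Rightarrow> ('i \<Rightarrow> 'i \<Rightarrow> bool) \<Rightarrow> ('i \<Rightarrow> real) \<Rightarrow> ('i \<Rightarrow> real) \<Rightarrow> ('i \<Rightarrow> real)
    \<Rightarrow> 'i set \<Rightarrow> nat \<Rightarrow> nat \<Rightarrow> real \<Rightarrow> bool" where
  "solvable cl cmp x s p I q K eps \<longleftrightarrow> (\<forall>S u v. S \<subseteq> I \<and> (\<forall>i\<in>S. u \<le> x i \<and> x i + s i \<le> v) \<longrightarrow>
    (\<exists>D1 D2. D1 \<subseteq> S \<and> D2 \<subseteq> S \<and> card D1 \<le> q \<and> sum p D2 \<le> eps * sum p S \<and>
      arrangeable cl cmp s (S - (D1 \<union> D2)) u v K))"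

text \<open>The endpoints of the items with profit above the threshold cut the line into boundedly many slabs.
The threshold is chosen by pigeonhole on a geometric scale, so that few items are expensive compared with
the total number of items dropped, while items near the threshold are negligible.\<close>

lemma high_low_arrangement:
  fixes q K0 N :: nat and eps :: real
  assumes eps: "0 < eps" "eps \<le> 1"
  shows "\<exists>K. \<forall>(I::'i set) x s p (cl :: 'i \<Rightarrow> 'c) cmp U V.
    finite I \<and> (\<forall>i\<in>I. 0 < s i \<and> 0 \<le> p i) \<and> (\<forall>i\<in>I. U \<le> x i \<and> x i + s i \<le> V) \<and>
    (\<forall>i j. cmp i j \<longrightarrow> cl i \<noteq> cl j) \<and> (\<forall>i j. cmp i j \<longrightarrow> cmp j i) \<and> card (cl ` I) \<le> N \<and>
    (\<forall>i\<in>I. \<forall>j\<in>I. i \<noteq> j \<longrightarrow> sep x s i j \<or> cmp i j) \<and> solvable cl cmp x s p I q K0 eps \<longrightarrow>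
    (\<exists>I'\<subseteq>I. sum p (I - I') \<le> 3 * eps * sum p I \<and> arrangeable cl cmp s I' U V K)"
proof -
  \<comment> \<open>Ratio of consecutive profit levels: at most \<open>(2 * N + 3 * q) / tau\<close>
    cheap items will be dropped, each of profit at most \<open>c * tau * P\<close>, and this
    \<open>c\<close> keeps their total within \<open>eps * P\<close>.\<close>
  define c where "c = eps / (2 * N + 3 * q + 2)"
  have c: "0 < c" "c < 1" unfolding c_def using eps by (auto simp: field_simps)
  define M where "M = nat \<lceil>1 / eps\<rceil>"
  have M: "0 < M" "1 / real M \<le> eps"
  proof -
    have "1 / eps \<le> real M" unfolding M_def by linarith
    moreover have "0 < 1 / eps" using eps by simp
    ultimately have "0 < real M" by linarith
    then show "0 < M" by simp
    show "1 / real M \<le> eps" using \<open>1 / eps \<le> real M\<close> eps \<open>0 < real M\<close> by (simp add: field_simps)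
  qed
  \<comment> \<open>The threshold \<open>tau\<close> will be at least \<open>c ^ M\<close>, so
    \<open>h\<close> bounds the number of expensive items before the threshold is known.\<close>
  define h where "h = nat \<lceil>1 / c ^ M\<rceil>"
  show ?thesis
  proof (intro exI[of _ "h + (2 * h + 1) * K0"] allI impI; (elim conjE)?)
    fix I :: "'i set" and x s p and cl :: "'i \<Rightarrow> 'c" and cmp U V
    assume fin: "finite I" and sp: "\<forall>i\<in>I. 0 < s i \<and> 0 \<le> p i"
      and UV: "\<forall>i\<in>I. U \<le> x i \<and> x i + s i \<le> V"
      and cmp: "\<forall>i j. cmp i j \<longrightarrow> cl i \<noteq> cl j" and sym: "\<forall>i j. cmp i j \<longrightarrow> cmp j i"
      and N: "card (cl ` I) \<le> N"
      and valid: "\<forall>i\<in>I. \<forall>j\<in>I. i \<noteq> j \<longrightarrow> sep x s i j \<or> cmp i j"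
      and solv: "solvable cl cmp x s p I q K0 eps"
    define P where "P = sum p I"
    have P0: "0 \<le> P" unfolding P_def using sp by (intro sum_nonneg) auto
    show "\<exists>I'\<subseteq>I. sum p (I - I') \<le> 3 * eps * sum p I \<and> arrangeable cl cmp s I' U V (h + (2 * h + 1) * K0)"
    proof (cases "P = 0")
      case True
      then show ?thesis unfolding P_def using arrangeable_empty by (intro exI[of _ "{}"]) auto
    next
      case False
      then have P: "0 < P" using P0 by simp
      define B where "B j = {i. c ^ Suc j * P < p i \<and> p i \<le> c ^ j * P}" for j
      have Bone: "card {j. j < M \<and> i \<in> B j} \<le> 1" for i
      proof -
        have "j = k" if "i \<in> B j" "i \<in> B k" for j k
        proof (rule ccontr)
          have *: False if "i \<in> B j" "i \<in> B k" "j < k" for j k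
          proof -
            have "c ^ k \<le> c ^ Suc j" using c that by (intro power_decreasing) auto
            then have "c ^ k * P \<le> c ^ Suc j * P" using P by (intro mult_right_mono) auto
            then show False using that unfolding B_def by auto
          qed
          assume "j \<noteq> k"
          then show False using * that by (meson linorder_neqE_nat)
        qed
        then obtain a where "{j. j < M \<and> i \<in> B j} \<subseteq> {a}" by blast
        then show ?thesis using card_mono[of "{a}"] by simp
      qed
      obtain j where j: "j < M" "sum p (B j \<inter> I) \<le> real 1 / real M * sum p I"
        using averaging[of I p M B 1] fin sp M Bone by blast
      have jB: "sum p (B j \<inter> I) \<le> eps * P"
        using j(2) M(2) P unfolding P_def
        by (metis mult_right_mono of_nat_1 order_trans less_imp_le)
      define tau where "tau = c ^ j"
      have tau: "0 < tau" "tau \<le> 1" unfolding tau_def using c by (auto intro: power_le_one)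
      define H where "H = {i \<in> I. tau * P < p i}"
      \<comment> \<open>Between the two thresholds lies the negligible band \<open>B j\<close>.
        Without it, every cheap item has less than the fraction \<open>c\<close> of the profit of
        any expensive one.\<close>
      define L where "L = {i \<in> I. p i \<le> c * tau * P}"
      have HI: "H \<subseteq> I" "finite H" and LI: "L \<subseteq> I" "finite L" unfolding H_def L_def using fin by auto
      have I_split: "I = H \<union> L \<union> (B j \<inter> I)"
        unfolding H_def L_def B_def tau_def by (auto simp: not_less not_le)
      have HL: "H \<inter> L = {}"
      proof -
        have "c * tau * P \<le> tau * P" using c tau P by (intro mult_right_mono) (auto simp: mult_le_cancel_right1)
        then show ?thesis unfolding H_def L_def by auto
      qed
      have cardH: "real (card H) \<le> 1 / tau"
      proof -
        have "real (card H) * (tau * P) = (\<Sum>i\<in>H. tau * P)" by simp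
        also have "\<dots> \<le> sum p H" by (intro sum_mono) (auto simp: H_def)
        also have "\<dots> \<le> P" unfolding P_def using sp HI fin by (intro sum_mono2) auto
        finally have "real (card H) * tau * P \<le> 1 * P" by (simp add: mult.assoc)
        then have "real (card H) * tau \<le> 1" using P by (simp only: mult_le_cancel_right_pos)
        then show ?thesis using tau by (simp add: field_simps)
      qed
      have "c ^ M \<le> tau" unfolding tau_def using j c by (intro power_decreasing) auto
      then have "1 / tau \<le> 1 / c ^ M" using c tau by (intro divide_left_mono) auto
      then have cardH_h: "card H \<le> h" unfolding h_def using cardH by linarith
      define Pt where "Pt = x ` H \<union> (\<lambda>i. x i + s i) ` H"
      have Pt: "finite Pt" "card Pt \<le> 2 * card H"
      proof -
        show "finite Pt" unfolding Pt_def using HI by simp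
        have "card Pt \<le> card (x ` H) + card ((\<lambda>i. x i + s i) ` H)" unfolding Pt_def by (rule card_Un_le)
        also have "\<dots> \<le> card H + card H" using HI by (intro add_mono card_image_le)
        finally show "card Pt \<le> 2 * card H" by simp
      qed
      \<comment> \<open>Cheap items crossing an endpoint \<open>t\<close> of an expensive one. They
        overlap at \<open>t\<close>, hence have different classes, and there are at most
        \<open>N\<close> of them.\<close>
      define Ct where "Ct t = {i \<in> L. x i < t \<and> t < x i + s i}" for t
      define C where "C = (\<Union>t\<in>Pt. Ct t)"
      have cardC: "card C \<le> card Pt * N"
      proof -
        have "card (Ct t) \<le> N" for t
        proof -
          have "inj_on cl (Ct t)"
          proof (rule inj_onI, rule ccontr)
            fix a b assume ab: "a \<in> Ct t" "b \<in> Ct t" "cl a = cl b" "a \<noteq> b"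
            then have "\<not> sep x s a b" unfolding sep_def Ct_def by auto
            moreover have "a \<in> I" "b \<in> I" using ab LI unfolding Ct_def by auto
            ultimately show False using valid cmp ab by blast
          qed
          then have "card (Ct t) = card (cl ` Ct t)" by (simp add: card_image)
          also have "\<dots> \<le> card (cl ` I)"
            using LI fin unfolding Ct_def by (intro card_mono) auto
          finally show ?thesis using N by simp
        qed
        then have "(\<Sum>t\<in>Pt. card (Ct t)) \<le> card Pt * N" by (rule sum_bounded_above[where 'a=nat, simplified])
        then show ?thesis unfolding C_def using card_UN_le[OF Pt(1), of Ct] by linarith
      qed
      \<comment> \<open>A slab is named by the endpoints that are not to the right of its items.
        These sets form a chain, so their cardinalities tell them apart and there are at most
        \<open>card Pt + 1\<close> slabs.\<close>
      define key where "key i = {t \<in> Pt. t \<le> x i}" for i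
      define Ky where "Ky = key ` (L - C)"
      have finKy: "finite Ky" unfolding Ky_def using LI by simp
      have cardKy: "card Ky \<le> card Pt + 1"
      proof -
        have "inj_on card Ky"
        proof (rule inj_onI)
          fix a b assume "a \<in> Ky" "b \<in> Ky" and eq: "card a = card b"
          then obtain i k where ik: "a = key i" "b = key k" unfolding Ky_def by auto
          have "a \<subseteq> b \<or> b \<subseteq> a" unfolding ik key_def by force
          moreover have "finite a" "finite b" unfolding ik key_def using Pt by auto
          ultimately show "a = b" using eq card_subset_eq by metis
        qed
        moreover have "card ` Ky \<subseteq> {0..card Pt}"
          unfolding Ky_def key_def using Pt(1) by (auto intro: card_mono)
        ultimately have "card Ky \<le> card {0..card Pt}" by (metis card_inj_on_le finite_atLeastAtMost)
        then show ?thesis by simp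
      qed
      define Sk where "Sk k = {i \<in> L - C. key i = k}" for k
      \<comment> \<open>The hull of its items serves as the interval of a slab, which also covers
        the two outer slabs.\<close>
      define u where "u k = Min (x ` Sk k)" for k
      define v where "v k = Max ((\<lambda>i. x i + s i) ` Sk k)" for k
      have finSk: "finite (Sk k)" and SkI: "Sk k \<subseteq> I" for k unfolding Sk_def using LI by auto
      have Skne: "Sk k \<noteq> {}" if "k \<in> Ky" for k using that unfolding Sk_def Ky_def by auto
      have uv: "u k \<le> x i" "x i + s i \<le> v k" if "i \<in> Sk k" for i k
        unfolding u_def v_def using that finSk[of k] by auto
      have u_ge: "r \<le> u k" if "k \<in> Ky" "\<And>i. i \<in> Sk k \<Longrightarrow> r \<le> x i" for r k
        unfolding u_def using that finSk[of k] Skne[OF that(1)] by simp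
      have v_le: "v k \<le> r" if "k \<in> Ky" "\<And>i. i \<in> Sk k \<Longrightarrow> x i + s i \<le> r" for r k
        unfolding v_def using that finSk[of k] Skne[OF that(1)] by simp
      have "\<forall>k. \<exists>D. fst D \<subseteq> Sk k \<and> snd D \<subseteq> Sk k \<and> card (fst D) \<le> q \<and>
          sum p (snd D) \<le> eps * sum p (Sk k) \<and> arrangeable cl cmp s (Sk k - (fst D \<union> snd D)) (u k) (v k) K0"
        using solv SkI uv unfolding solvable_def by (metis fst_conv snd_conv)
      then obtain D where D: "\<forall>k. fst (D k) \<subseteq> Sk k \<and> snd (D k) \<subseteq> Sk k \<and> card (fst (D k)) \<le> q \<and>
          sum p (snd (D k)) \<le> eps * sum p (Sk k) \<and>
          arrangeable cl cmp s (Sk k - (fst (D k) \<union> snd (D k))) (u k) (v k) K0"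
        by metis
      define D1 where "D1 k = fst (D k)" for k
      define D2 where "D2 k = snd (D k)" for k
      have D1: "D1 k \<subseteq> Sk k" "card (D1 k) \<le> q" and D2: "D2 k \<subseteq> Sk k" "sum p (D2 k) \<le> eps * sum p (Sk k)"
        and arrk: "arrangeable cl cmp s (Sk k - (D1 k \<union> D2 k)) (u k) (v k) K0" for k
        using D unfolding D1_def D2_def by blast+
      have not_cross: "t \<le> x i \<or> x i + s i \<le> t" if "i \<in> Sk k" "t \<in> Pt" for i k t
        using that unfolding Sk_def C_def Ct_def by force
      have key_iff: "t \<in> k \<longleftrightarrow> t \<le> x i" if "i \<in> Sk k" "t \<in> Pt" for i k t
        using that unfolding Sk_def key_def by auto
      \<comment> \<open>Left summands are the expensive items, kept where they are; right summands
        are the slabs, each rearranged inside its hull.\<close>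
      define S where "S = case_sum (\<lambda>j. {j}) (\<lambda>k. Sk k - (D1 k \<union> D2 k))"
      define uu where "uu = case_sum x u"
      define vv where "vv = case_sum (\<lambda>j. x j + s j) v"
      define n where "n = case_sum (\<lambda>_::'i. 1) (\<lambda>_::real set. K0)"
      define Q where "Q = Inl ` H \<union> Inr ` Ky"
      define I' where "I' = (\<Union>k\<in>Q. S k)"
      have kk: "v k \<le> u l \<or> v l \<le> u k" if kl: "k \<in> Ky" "l \<in> Ky" "k \<noteq> l" for k l
      proof -
        have *: "v l \<le> u k" if kl: "k \<in> Ky" "l \<in> Ky" "t \<in> k" "t \<notin> l" for k l t
        proof -
          have t: "t \<in> Pt" using kl unfolding Ky_def key_def by auto
          have "t \<le> u k" using u_ge[OF kl(1)] key_iff t kl by blast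
          moreover have "v l \<le> t" using v_le[OF kl(2)] not_cross key_iff t kl by blast
          ultimately show ?thesis by linarith
        qed
        show ?thesis using * kl by blast
      qed
      \<comment> \<open>A slab that is not beside the item \<open>j\<close> lies within its
        interval. Then every item of the slab overlaps \<open>j\<close>, and validity leaves only
        \<open>cmp\<close>.\<close>
      have hk: "x j + s j \<le> u k \<or> v k \<le> x j \<or> (\<forall>i\<in>Sk k. cmp i j)" if jk: "j \<in> H" "k \<in> Ky" for j k
      proof -
        have t: "x j \<in> Pt" "x j + s j \<in> Pt" unfolding Pt_def using jk by auto
        consider "x j \<notin> k" | "x j + s j \<in> k" | "x j \<in> k" "x j + s j \<notin> k" by blast
        then show ?thesis
        proof cases
          case 1
          then show ?thesis using v_le[OF jk(2)] not_cross key_iff t by blast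
        next
          case 2
          then show ?thesis using u_ge[OF jk(2)] key_iff t by blast
        next
          case 3
          have "cmp i j" if i: "i \<in> Sk k" for i
          proof -
            have "x j \<le> x i" using key_iff[OF i t(1)] 3 by simp
            moreover have "x i + s i \<le> x j + s j" using key_iff[OF i t(2)] not_cross[OF i t(2)] 3 by simp
            moreover have "0 < s i" "i \<in> I" "j \<in> I" using i sp SkI jk HI by auto
            ultimately have "\<not> sep x s i j" unfolding sep_def by linarith
            moreover have "i \<noteq> j" using i jk HL unfolding Sk_def by auto
            ultimately show ?thesis using valid \<open>i \<in> I\<close> \<open>j \<in> I\<close> by blast
          qed
          then show ?thesis by blast
        qed
      qed
      have arrI: "arrangeable cl cmp s I' U V (sum n Q)"
        unfolding I'_def
      proof (rule arrangeable_UN[where u=uu and v=vv])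
        show "finite Q" unfolding Q_def using HI finKy by simp
        show "finite (S k)" if "k \<in> Q" for k
          using that unfolding Q_def S_def by (auto simp: finSk)
        show "S k \<inter> S l = {}" if "k \<in> Q" "l \<in> Q" "k \<noteq> l" for k l
          using that HL unfolding Q_def S_def Sk_def by auto
        show "arrangeable cl cmp s (S k) (uu k) (vv k) (n k)" if "k \<in> Q" for k
          using that arrk arrangeable_single unfolding Q_def S_def uu_def vv_def n_def by auto
        show "U \<le> uu k \<and> vv k \<le> V" if "k \<in> Q" for k
          using that UV HI SkI unfolding Q_def uu_def vv_def
          by (auto intro!: u_ge v_le simp: subset_iff)
        show "vv k \<le> uu l \<or> vv l \<le> uu k \<or> (\<forall>i\<in>S k. \<forall>j\<in>S l. cmp i j)"
          if kl: "k \<in> Q" "l \<in> Q" "k \<noteq> l" for k l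
        proof (cases k; cases l)
          fix a b assume e: "k = Inl a" "l = Inl b"
          then have "a \<in> I" "b \<in> I" "a \<noteq> b" using kl HI unfolding Q_def by auto
          then show ?thesis using valid e unfolding uu_def vv_def S_def sep_def by auto
        next
          fix a b assume e: "k = Inl a" "l = Inr b"
          then have "a \<in> H" "b \<in> Ky" using kl unfolding Q_def by auto
          from hk[OF this] show ?thesis using sym e unfolding uu_def vv_def S_def by auto
        next
          fix a b assume e: "k = Inr a" "l = Inl b"
          then have "b \<in> H" "a \<in> Ky" using kl unfolding Q_def by auto
          from hk[OF this] show ?thesis using sym e unfolding uu_def vv_def S_def by auto
        next
          fix a b assume e: "k = Inr a" "l = Inr b"
          then have "a \<in> Ky" "b \<in> Ky" "a \<noteq> b" using kl unfolding Q_def by auto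
          from kk[OF this] show ?thesis using e unfolding uu_def vv_def S_def by auto
        qed
        show "0 < s i" if "k \<in> Q" "i \<in> S k" for k i
          using that sp HI unfolding Q_def S_def by (auto dest!: subsetD[OF SkI])
        show "cl i \<noteq> cl j" if "cmp i j" for i j using cmp that by blast
      qed
      have sumn: "sum n Q \<le> h + (2 * h + 1) * K0"
      proof -
        have "sum n Q = sum n (Inl ` H) + sum n (Inr ` Ky)"
          unfolding Q_def using HI finKy by (intro sum.union_disjoint) auto
        also have "\<dots> = card H + card Ky * K0" unfolding n_def by (simp add: sum.reindex)
        also have "\<dots> \<le> h + (2 * h + 1) * K0"
          using cardH_h cardKy Pt by (intro add_mono mult_right_mono) auto
        finally show ?thesis .
      qed
      have arrI': "arrangeable cl cmp s I' U V (h + (2 * h + 1) * K0)"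
        using arrI sumn by (rule arrangeable_mono)
      have I'I: "I' \<subseteq> I" unfolding I'_def Q_def S_def using HI SkI by auto
      have p0: "0 \<le> p i" if "i \<in> I" for i using sp that by blast
      define E where "E = C \<union> (\<Union>k\<in>Ky. D1 k)"
      have sub: "I - I' \<subseteq> (B j \<inter> I) \<union> (E \<union> (\<Union>k\<in>Ky. D2 k))"
      proof
        fix i assume i: "i \<in> I - I'"
        show "i \<in> (B j \<inter> I) \<union> (E \<union> (\<Union>k\<in>Ky. D2 k))"
        proof (rule ccontr)
          assume n: "i \<notin> (B j \<inter> I) \<union> (E \<union> (\<Union>k\<in>Ky. D2 k))"
          then have "i \<in> H \<union> L" using i I_split by blast
          moreover have "i \<notin> H" using i unfolding I'_def Q_def S_def by auto
          ultimately have iL: "i \<in> L - C" using n unfolding E_def by blast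
          then have k: "key i \<in> Ky" "i \<in> Sk (key i)" unfolding Ky_def Sk_def by auto
          then have "i \<in> S (Inr (key i))" "Inr (key i) \<in> Q" using n unfolding S_def E_def Q_def by auto
          then show False using i unfolding I'_def by blast
        qed
      qed
      have EL: "E \<subseteq> L" unfolding E_def C_def Ct_def using D1 unfolding Sk_def by blast
      have D2I: "(\<Union>k\<in>Ky. D2 k) \<subseteq> I" using D2 SkI by blast
      \<comment> \<open>Each of the at most \<open>2 * card H\<close> endpoints loses
        \<open>N\<close> crossing items, and each of the at most \<open>2 * card H + 1\<close> slabs
        loses \<open>q\<close>; \<open>1 \<le> 1 / tau\<close> absorbs the one extra slab.\<close>
      have cardE: "real (card E) \<le> (2 * N + 3 * q) / tau"
      proof -
        have "card E \<le> card C + (\<Sum>k\<in>Ky. card (D1 k))"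
          unfolding E_def using card_Un_le card_UN_le[OF finKy, of D1]
          by (metis (no_types, lifting) add_left_mono order_trans)
        also have "(\<Sum>k\<in>Ky. card (D1 k)) \<le> card Ky * q"
          using sum_mono[of Ky "\<lambda>k. card (D1 k)" "\<lambda>_. q"] D1 by simp
        also have "card C + card Ky * q \<le> 2 * card H * N + (2 * card H + 1) * q"
        proof (intro add_mono)
          show "card C \<le> 2 * card H * N" using cardC Pt(2) by (meson mult_le_mono1 order_trans)
          show "card Ky * q \<le> (2 * card H + 1) * q" using cardKy Pt(2) by (intro mult_le_mono1) linarith
        qed
        finally have "real (card E) \<le> real (2 * card H * N + (2 * card H + 1) * q)" by (simp only: of_nat_le_iff)
        also have "\<dots> = real (card H) * (2 * N + 2 * q) + q" by (simp add: algebra_simps)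
        also have "\<dots> \<le> 1 / tau * (2 * N + 2 * q) + 1 / tau * q"
        proof (intro add_mono mult_right_mono cardH)
          have "1 \<le> 1 / tau" using tau by simp
          then show "real q \<le> 1 / tau * q" using mult_right_mono[of 1 "1 / tau" "real q"] by simp
        qed simp
        also have "\<dots> = (2 * N + 3 * q) / tau" by (simp add: add_divide_distrib)
        finally show ?thesis .
      qed
      have sumE: "sum p E \<le> eps * P"
      proof -
        have "sum p E \<le> real (card E) * (c * tau * P)"
          using sum_bounded_above[of E p "c * tau * P"] EL unfolding L_def by auto
        also have "\<dots> \<le> (2 * N + 3 * q) / tau * (c * tau * P)"
          using cardE c tau P by (intro mult_right_mono) auto
        also have "\<dots> = (2 * N + 3 * q) * c * P" using tau by simp
        also have "\<dots> \<le> eps * P"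
          unfolding c_def using eps P by (intro mult_right_mono) (auto simp: field_simps)
        finally show ?thesis .
      qed
      have sumD2: "sum p (\<Union>k\<in>Ky. D2 k) \<le> eps * P"
      proof -
        have disj: "\<forall>k\<in>Ky. \<forall>l\<in>Ky. k \<noteq> l \<longrightarrow> Sk k \<inter> Sk l = {}" unfolding Sk_def by auto
        have "sum p (\<Union>k\<in>Ky. D2 k) = (\<Sum>k\<in>Ky. sum p (D2 k))"
          using finKy D2(1) finSk disj
          by (intro sum.UNION_disjoint) (blast intro: finite_subset)+
        also have "\<dots> \<le> (\<Sum>k\<in>Ky. eps * sum p (Sk k))" by (intro sum_mono D2)
        also have "\<dots> = eps * sum p (\<Union>k\<in>Ky. Sk k)"
          using finKy finSk disj by (simp add: sum.UNION_disjoint sum_distrib_left)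
        also have "\<dots> \<le> eps * P" unfolding P_def
          using eps fin SkI p0 by (intro mult_left_mono sum_mono2) auto
        finally show ?thesis .
      qed
      have finE: "finite E" "finite (\<Union>k\<in>Ky. D2 k)"
        using EL LI D2I fin by (auto intro: finite_subset)
      have "sum p (I - I') \<le> sum p ((B j \<inter> I) \<union> (E \<union> (\<Union>k\<in>Ky. D2 k)))"
        using sub fin finE EL LI D2I p0 by (intro sum_mono2) blast+
      also have "\<dots> \<le> sum p (B j \<inter> I) + (sum p E + sum p (\<Union>k\<in>Ky. D2 k))"
      proof -
        have un: "sum p (X \<union> Y) \<le> sum p X + sum p Y" if "X \<subseteq> I" "Y \<subseteq> I" for X Y
        proof -
          have "finite X" "finite Y" using that fin finite_subset by blast+
          then have "sum p (X \<union> Y) + sum p (X \<inter> Y) = sum p X + sum p Y" by (rule sum.union_inter)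
          moreover have "0 \<le> sum p (X \<inter> Y)" using that p0 by (intro sum_nonneg) blast
          ultimately show ?thesis by linarith
        qed
        have "sum p (E \<union> (\<Union>k\<in>Ky. D2 k)) \<le> sum p E + sum p (\<Union>k\<in>Ky. D2 k)"
          using EL LI D2I by (intro un) blast+
        moreover have "sum p ((B j \<inter> I) \<union> (E \<union> (\<Union>k\<in>Ky. D2 k))) \<le> sum p (B j \<inter> I) + sum p (E \<union> (\<Union>k\<in>Ky. D2 k))"
          using EL LI D2I by (intro un) blast+
        ultimately show ?thesis by linarith
      qed
      also have "\<dots> \<le> 3 * eps * sum p I" using jB sumE sumD2 unfolding P_def by simp
      finally show ?thesis using arrI' I'I by blast
    qed
  qed
qed

text \<open>A slice of the arrangement is the set of items met by a point; merging slices with the same set of classes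
yields \<open>2 ^ card C\<close> cells, and each class is repacked greedily into its cells.\<close>

lemma class_solvable:
  fixes I :: "'i set" and cl :: "'i \<Rightarrow> 'c" and comp :: "'c \<Rightarrow> 'c \<Rightarrow> bool"
  assumes fin: "finite I" and sp: "\<And>i. i \<in> I \<Longrightarrow> 0 < s i \<and> 0 \<le> p i"
    and C: "finite C" "cl ` I \<subseteq> C" and irr: "\<And>c. \<not> comp c c"
    and valid: "\<And>i j. i \<in> I \<Longrightarrow> j \<in> I \<Longrightarrow> i \<noteq> j \<Longrightarrow> sep x s i j \<or> comp (cl i) (cl j)"
    and eps: "0 \<le> eps"
  shows "solvable cl (\<lambda>i j. comp (cl i) (cl j)) x s p I (card C * 2 ^ card C) (card C * 2 ^ card C) eps"
  unfolding solvable_def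
proof (intro allI impI, elim conjE)
  fix S u v assume SI: "S \<subseteq> I" and uv: "\<forall>i\<in>S. u \<le> x i \<and> x i + s i \<le> v"
  let ?cmp = "\<lambda>i j. comp (cl i) (cl j)"
  let ?N = "card C * 2 ^ card C"
  have finS: "finite S" using SI fin finite_subset by blast
  have s0: "0 < s i" if "i \<in> S" for i using sp SI that by blast
  have clC: "cl i \<in> C" if "i \<in> S" for i using C SI that by blast
  have sumS0: "0 \<le> eps * sum p S" using eps sp SI by (intro mult_nonneg_nonneg sum_nonneg) auto
  show "\<exists>D1 D2. D1 \<subseteq> S \<and> D2 \<subseteq> S \<and> card D1 \<le> ?N \<and> sum p D2 \<le> eps * sum p S \<and>
      arrangeable cl ?cmp s (S - (D1 \<union> D2)) u v ?N"
  proof (cases "S = {}")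
    case True
    then show ?thesis using arrangeable_empty by (intro exI[of _ "{}"]) simp
  next
    case False
    then obtain i0 where "i0 \<in> S" by blast
    then have "u \<le> v" using uv s0[of i0] by force
    then have "\<exists>m. (\<forall>Z. 0 \<le> m Z) \<and> sum m (Pow S) = v - u \<and>
      (\<forall>i\<in>S. sum m {Z \<in> Pow S. i \<in> Z} = s i) \<and>
      (\<forall>Z. 0 < m Z \<longrightarrow> (\<exists>t. u < t \<and> t < v \<and> Z = {i \<in> S. x i < t \<and> t < x i + s i}))"
      using uv by (intro slices[OF finS s0]) auto
    then obtain m where m0: "\<And>Z. 0 \<le> m Z" and mS: "sum m (Pow S) = v - u"
      and mi: "\<And>i. i \<in> S \<Longrightarrow> sum m {Z \<in> Pow S. i \<in> Z} = s i"
      and mx: "\<And>Z. 0 < m Z \<Longrightarrow> \<exists>t. u < t \<and> t < v \<and> Z = {i \<in> S. x i < t \<and> t < x i + s i}"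
      by (elim exE conjE) blast
    have mcomp: "comp (cl i) (cl j)" if "0 < m Z" "i \<in> Z" "j \<in> Z" "i \<noteq> j" for Z i j
    proof -
      from mx[OF that(1)] obtain t where "Z = {i \<in> S. x i < t \<and> t < x i + s i}" by (elim exE conjE)
      then have "i \<in> I" "j \<in> I" "\<not> sep x s i j" using that SI unfolding sep_def by auto
      then show ?thesis using valid that by blast
    qed
    \<comment> \<open>Slices meeting the same set of classes are put next to each other;
      \<open>W c\<close> is the width of the resulting cell.\<close>
    define W where "W c = sum m {Z \<in> Pow S. cl ` Z = c}" for c
    have W0: "0 \<le> W c" for c unfolding W_def using m0 by (intro sum_nonneg)
    have "sum W (Pow C) = sum m (Pow S)"
      unfolding W_def using finS C clC by (intro sum.group) auto
    then have WS: "sum W (Pow C) = v - u" using mS by simp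
    obtain pos where pos: "\<forall>c\<in>Pow C. u \<le> pos c \<and> pos c + W c \<le> u + sum W (Pow C)"
      and possep: "\<forall>c\<in>Pow C. \<forall>d\<in>Pow C. c \<noteq> d \<longrightarrow> sep pos W c d"
      using layout_exists[of "Pow C" W u] W0 C(1) by auto
    define SX where "SX X = {i \<in> S. cl i = X}" for X
    define J where "J X = {c \<in> Pow C. X \<in> c}" for X
    have finJ: "finite (J X)" and cardJ: "card (J X) \<le> 2 ^ card C" for X
    proof -
      show "finite (J X)" unfolding J_def using C by simp
      have "card (J X) \<le> card (Pow C)" unfolding J_def using C by (intro card_mono) auto
      then show "card (J X) \<le> 2 ^ card C" using C by (simp add: card_Pow)
    qed
    \<comment> \<open>By \<open>mcomp\<close> and irreflexivity of \<open>comp\<close>, a slice of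
      positive measure meets at most one item of each class. So a class has exactly the total size
      of the cells that contain it, and greedy filling applies.\<close>
    have cap: "sum s (SX X) = sum W (J X)" if X: "X \<in> C" for X
    proof -
      have "sum s (SX X) = (\<Sum>i\<in>SX X. \<Sum>Z\<in>Pow S. m Z * of_bool (i \<in> Z))"
      proof (rule sum.cong[OF refl])
        fix i assume "i \<in> SX X"
        then have "s i = sum m {Z \<in> Pow S. i \<in> Z}" using mi unfolding SX_def by simp
        also have "\<dots> = (\<Sum>Z\<in>{Z \<in> Pow S. i \<in> Z}. m Z * of_bool (i \<in> Z))" by (rule sum.cong) auto
        also have "\<dots> = (\<Sum>Z\<in>Pow S. m Z * of_bool (i \<in> Z))"
          using finS by (intro sum.mono_neutral_left) auto
        finally show "s i = (\<Sum>Z\<in>Pow S. m Z * of_bool (i \<in> Z))" .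
      qed
      also have "\<dots> = (\<Sum>Z\<in>Pow S. \<Sum>i\<in>SX X. m Z * of_bool (i \<in> Z))" by (rule sum.swap)
      also have "\<dots> = (\<Sum>Z\<in>Pow S. m Z * of_bool (X \<in> cl ` Z))"
      proof (rule sum.cong[OF refl])
        fix Z assume Z: "Z \<in> Pow S"
        have finX: "finite (SX X)" unfolding SX_def using finS by simp
        show "(\<Sum>i\<in>SX X. m Z * of_bool (i \<in> Z)) = m Z * of_bool (X \<in> cl ` Z)"
        proof (cases "0 < m Z \<and> X \<in> cl ` Z")
          case False
          then consider "m Z = 0" | "X \<notin> cl ` Z" using m0[of Z] by (auto simp: less_le)
          then show ?thesis
          proof cases
            case 2
            then have "\<forall>i\<in>SX X. i \<notin> Z" unfolding SX_def by auto
            then show ?thesis using 2 by simp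
          qed simp
        next
          case True
          then obtain i where i: "i \<in> Z" "cl i = X" by blast
          have iS: "i \<in> SX X" using i Z unfolding SX_def by auto
          have "j \<notin> Z" if "j \<in> SX X - {i}" for j
          proof
            assume "j \<in> Z"
            then have "comp (cl i) (cl j)" using mcomp True i that by blast
            then show False using that i irr unfolding SX_def by auto
          qed
          then have "(\<Sum>i\<in>SX X. m Z * of_bool (i \<in> Z)) = (\<Sum>i\<in>{i}. m Z * of_bool (i \<in> Z))"
            using iS finX by (intro sum.mono_neutral_right) auto
          then show ?thesis using i True by simp
        qed
      qed
      also have "\<dots> = sum m {Z \<in> Pow S. X \<in> cl ` Z}"
      proof -
        have "sum m {Z \<in> Pow S. X \<in> cl ` Z} = (\<Sum>Z\<in>{Z \<in> Pow S. X \<in> cl ` Z}. m Z * of_bool (X \<in> cl ` Z))"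
          by (rule sum.cong) auto
        also have "\<dots> = (\<Sum>Z\<in>Pow S. m Z * of_bool (X \<in> cl ` Z))"
          using finS by (intro sum.mono_neutral_left) auto
        finally show ?thesis by simp
      qed
      also have "\<dots> = sum W (J X)"
      proof -
        have "{Z \<in> Pow S. cl ` Z = c} = {Z \<in> {Z \<in> Pow S. X \<in> cl ` Z}. cl ` Z = c}" if "c \<in> J X" for c
          using that unfolding J_def by auto
        then have "sum W (J X) = (\<Sum>c\<in>J X. sum m {Z \<in> {Z \<in> Pow S. X \<in> cl ` Z}. cl ` Z = c})"
          unfolding W_def by (intro sum.cong refl) simp
        also have "\<dots> = sum m {Z \<in> Pow S. X \<in> cl ` Z}"
        proof (rule sum.group)
          show "(\<lambda>Z. cl ` Z) ` {Z \<in> Pow S. X \<in> cl ` Z} \<subseteq> J X"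
            unfolding J_def using clC by blast
        qed (use finS finJ in auto)
        finally show ?thesis by simp
      qed
      finally show ?thesis .
    qed
    define Pr where "Pr X f E \<longleftrightarrow> E \<subseteq> SX X \<and> card E \<le> card (J X) \<and> (\<forall>i\<in>SX X - E. f i \<in> J X) \<and>
      (\<forall>c\<in>J X. sum s {i \<in> SX X - E. f i = c} \<le> W c)" for X and f :: "'i \<Rightarrow> 'c set" and E
    have "\<exists>f E. Pr X f E" if X: "X \<in> C" for X
    proof -
      have "finite (SX X)" "\<And>i. i \<in> SX X \<Longrightarrow> 0 < s i" unfolding SX_def using finS s0 by simp_all
      from fill_bins[OF finJ this W0 eq_refl[OF cap[OF X]]]
      show ?thesis unfolding Pr_def .
    qed
    then obtain ag D where Pr: "\<And>X. X \<in> C \<Longrightarrow> Pr X (ag X) (D X)" by metis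
    define asg where "asg i = ag (cl i) i" for i
    define D1 where "D1 = (\<Union>X\<in>C. D X)"
    have D: "D X \<subseteq> SX X" "card (D X) \<le> 2 ^ card C" if "X \<in> C" for X
      using Pr[OF that] cardJ[of X] unfolding Pr_def by auto
    have D1S: "D1 \<subseteq> S" unfolding D1_def using D(1) unfolding SX_def by blast
    have cardD1: "card D1 \<le> ?N"
    proof -
      have "card D1 \<le> (\<Sum>X\<in>C. card (D X))" unfolding D1_def by (rule card_UN_le[OF C(1)])
      also have "\<dots> \<le> (\<Sum>X\<in>C. 2 ^ card C)" by (intro sum_mono D)
      finally show ?thesis by simp
    qed
    define G where "G X c = {i \<in> SX X - D X. asg i = c}" for X c
    have asgJ: "asg i \<in> J (cl i)" "i \<in> G (cl i) (asg i)" if i: "i \<in> S - D1" for i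
    proof -
      have "i \<in> SX (cl i) - D (cl i)" "cl i \<in> C" using i clC unfolding SX_def D1_def by auto
      then show "asg i \<in> J (cl i)" "i \<in> G (cl i) (asg i)"
        using Pr[of "cl i"] unfolding asg_def Pr_def G_def by auto
    qed
    have sumG: "sum s (G X c) \<le> W c" if "X \<in> C" "c \<in> J X" for X c
    proof -
      have "G X c = {i \<in> SX X - D X. ag X i = c}"
        unfolding G_def asg_def SX_def by auto
      then show ?thesis using Pr[OF that(1)] that(2) unfolding Pr_def by auto
    qed
    have finG: "finite (G X c)" for X c unfolding G_def SX_def using finS by auto
    have "\<forall>X c. \<exists>y. (\<forall>i\<in>G X c. pos c \<le> y i \<and> y i + s i \<le> pos c + sum s (G X c)) \<and>
      (\<forall>i\<in>G X c. \<forall>j\<in>G X c. i \<noteq> j \<longrightarrow> sep y s i j)"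
    proof (intro allI)
      fix X c
      have "0 \<le> s i" if "i \<in> G X c" for i using that s0[of i] unfolding G_def SX_def by auto
      then show "\<exists>y. (\<forall>i\<in>G X c. pos c \<le> y i \<and> y i + s i \<le> pos c + sum s (G X c)) \<and>
        (\<forall>i\<in>G X c. \<forall>j\<in>G X c. i \<noteq> j \<longrightarrow> sep y s i j)"
        using layout_exists[OF finG, of X c s "pos c"] by blast
    qed
    then obtain Y where Y: "\<And>X c i. i \<in> G X c \<Longrightarrow> pos c \<le> Y X c i \<and> Y X c i + s i \<le> pos c + sum s (G X c)"
      and Ysep: "\<And>X c i j. i \<in> G X c \<Longrightarrow> j \<in> G X c \<Longrightarrow> i \<noteq> j \<Longrightarrow> sep (Y X c) s i j"
      by metis
    define y where "y i = Y (cl i) (asg i) i" for i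
    define cu where "cu i = pos (asg i)" for i
    define cv where "cv i = pos (asg i) + W (asg i)" for i
    have asgP: "asg i \<in> Pow C" "cl i \<in> asg i" "cl i \<in> C" if "i \<in> S - D1" for i
      using asgJ[OF that] clC that unfolding J_def by auto
    have 2: "u \<le> cu i \<and> cu i \<le> y i \<and> y i + s i \<le> cv i \<and> cv i \<le> v" if i: "i \<in> S - D1" for i
    proof -
      have "cu i \<le> y i" "y i + s i \<le> cu i + sum s (G (cl i) (asg i))"
        using Y[OF asgJ(2)[OF i]] unfolding y_def cu_def by auto
      moreover have "sum s (G (cl i) (asg i)) \<le> W (asg i)"
        using sumG asgP(3)[OF i] asgJ(1)[OF i] by blast
      moreover have "u \<le> pos (asg i)" "pos (asg i) + W (asg i) \<le> v"
        using pos asgP(1)[OF i] WS by auto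
      ultimately show ?thesis unfolding cu_def cv_def by linarith
    qed
    have 3: "if (cl i, cu i, cv i) = (cl j, cu j, cv j) then sep y s i j
       else cv i \<le> cu j \<or> cv j \<le> cu i \<or> comp (cl i) (cl j)"
      if ij: "i \<in> S - D1" "j \<in> S - D1" "i \<noteq> j" for i j
    proof (cases "asg i = asg j")
      case True
      show ?thesis
      proof (cases "cl i = cl j")
        case c: True
        have "sep (Y (cl i) (asg i)) s i j"
          using Ysep[OF asgJ(2)[OF ij(1)], of j] asgJ(2)[OF ij(2)] True c ij by simp
        then have "sep y s i j" unfolding sep_def y_def using True c by simp
        then show ?thesis using True c unfolding cu_def cv_def by simp
      next
        case False
        \<comment> \<open>A cell holding an item has positive width, hence contains a slice of
          positive measure meeting both classes. Its two items overlapped in the given placement, so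
          the classes are compatible.\<close>
        have "W (asg i) \<noteq> 0" using 2[OF ij(1)] s0[of i] ij unfolding cu_def cv_def by auto
        then obtain Z where Z: "Z \<in> {Z \<in> Pow S. cl ` Z = asg i}" "m Z \<noteq> 0"
          unfolding W_def using sum.neutral by (metis (no_types, lifting))
        then have mZ: "0 < m Z" using m0[of Z] by simp
        have "cl i \<in> cl ` Z" "cl j \<in> cl ` Z" using Z asgP[OF ij(1)] asgP[OF ij(2)] True by auto
        then obtain i' j' where "i' \<in> Z" "cl i' = cl i" "j' \<in> Z" "cl j' = cl j" by force
        then have "comp (cl i) (cl j)" using mcomp[OF mZ, of i' j'] False by metis
        then show ?thesis using False by simp
      qed
    next
      case False
      then have "sep pos W (asg i) (asg j)" using possep asgP(1) ij by blast
      then have *: "cv i \<le> cu j \<or> cv j \<le> cu i" unfolding sep_def cu_def cv_def .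
      moreover have "cu i < cv i" "cu j < cv j" using 2[OF ij(1)] 2[OF ij(2)] s0[of i] s0[of j] ij by auto
      ultimately show ?thesis by auto
    qed
    have 1: "card ((\<lambda>i. (cl i, cu i, cv i)) ` (S - D1)) \<le> ?N"
    proof -
      have "(\<lambda>i. (cl i, cu i, cv i)) ` (S - D1) \<subseteq> (\<lambda>(X, c). (X, pos c, pos c + W c)) ` (C \<times> Pow C)"
      proof
        fix t assume "t \<in> (\<lambda>i. (cl i, cu i, cv i)) ` (S - D1)"
        then obtain i where i: "i \<in> S - D1" "t = (cl i, cu i, cv i)" by blast
        then have "t = (\<lambda>(X, c). (X, pos c, pos c + W c)) (cl i, asg i)" unfolding cu_def cv_def by simp
        then show "t \<in> (\<lambda>(X, c). (X, pos c, pos c + W c)) ` (C \<times> Pow C)"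
          using asgP[OF i(1)] by (intro image_eqI[of _ _ "(cl i, asg i)"]) auto
      qed
      then have "card ((\<lambda>i. (cl i, cu i, cv i)) ` (S - D1)) \<le> card (C \<times> Pow C)"
        using C by (meson card_image_le card_mono finite_Pow_iff finite_SigmaI finite_imageI order_trans)
      then show ?thesis using C by (simp add: card_cartesian_product card_Pow)
    qed
    have "arrangeable cl ?cmp s (S - D1) u v ?N"
      unfolding arrangeable_def
      by (rule exI[of _ y], rule exI[of _ cu], rule exI[of _ cv]) (use 1 2 3 in blast)
    then show ?thesis using D1S cardD1 sumS0
      by (intro exI[of _ D1] exI[of _ "{}"]) simp
  qed
qed

text \<open>Group both classes by decreasing \<open>a\<close> into \<open>m\<close> groups of length \<open>eta\<close>. Groups \<open>k\<close> and \<open>l\<close> of different classes are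
compatible once \<open>k + l \<ge> m\<close>: the items at least as large in both classes are then longer than \<open>v - u\<close>
in total, so two of them overlap.
Laying out one class in order and the other in reverse, and dropping a cheap pair of groups to shift
the rest by one, makes all overlaps compatible.\<close>

lemma staircase_solvable:
  fixes I :: "'i set" and cl :: "'i \<Rightarrow> bool" and a :: "'i \<Rightarrow> real"
  assumes fin: "finite I" and sp: "\<And>i. i \<in> I \<Longrightarrow> 0 < s i \<and> 0 \<le> p i"
    and valid: "\<And>i j. i \<in> I \<Longrightarrow> j \<in> I \<Longrightarrow> i \<noteq> j \<Longrightarrow> sep x s i j \<or> (cl i \<noteq> cl j \<and> a i + a j \<le> H)"
    and m: "2 \<le> m"
  shows "solvable cl (\<lambda>i j. cl i \<noteq> cl j \<and> a i + a j \<le> H) x s p I (2 * m) (2 * m) (1 / real (m - 1))"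
  unfolding solvable_def
proof (intro allI impI, elim conjE)
  fix S u v assume SI: "S \<subseteq> I" and uv: "\<forall>i\<in>S. u \<le> x i \<and> x i + s i \<le> v"
  let ?cmp = "\<lambda>i j. cl i \<noteq> cl j \<and> a i + a j \<le> H"
  have finS: "finite S" using SI fin finite_subset by blast
  have s0: "0 < s i" and p0: "0 \<le> p i" if "i \<in> S" for i using sp SI that by blast+
  show "\<exists>D1 D2. D1 \<subseteq> S \<and> D2 \<subseteq> S \<and> card D1 \<le> 2 * m \<and> sum p D2 \<le> 1 / real (m - 1) * sum p S \<and>
      arrangeable cl ?cmp s (S - (D1 \<union> D2)) u v (2 * m)"
  proof (cases "S = {}")
    case True
    then show ?thesis using arrangeable_empty by (intro exI[of _ "{}"]) simp
  next
    case False
    then obtain i0 where "i0 \<in> S" by blast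
    then have uv': "u < v" using uv s0[of i0] by force
    define eta where "eta = (v - u) / m"
    have eta: "0 < eta" "real m * eta = v - u" unfolding eta_def using uv' m by auto
    define T where "T b = {i \<in> S. cl i = b}" for b
    have finT: "finite (T b)" for b unfolding T_def using finS by simp
    have sumT: "sum s (T b) \<le> real m * eta" for b
      unfolding eta(2)
    proof (rule sum_le_of_sep)
      fix i j assume "i \<in> T b" "j \<in> T b" "i \<noteq> j"
      then show "sep x s i j" using valid SI unfolding T_def by blast
    qed (use finT s0 uv uv' in \<open>auto simp: T_def\<close>)
    define Pr where "Pr b f E \<longleftrightarrow> E \<subseteq> T b \<and> card E \<le> m \<and> (\<forall>i\<in>T b. f i < m) \<and>
      (\<forall>i\<in>T b. \<forall>j\<in>T b. f i < f j \<longrightarrow> a j \<le> a i) \<and>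
      (\<forall>k. sum s {i \<in> T b - E. f i = k} \<le> eta) \<and>
      (\<forall>k. (\<exists>j\<in>T b. k < f j) \<longrightarrow> eta < sum s {i \<in> T b. f i = k})" for b and f :: "'i \<Rightarrow> nat" and E
    have "\<exists>f E. Pr b f E" for b
    proof -
      have "\<And>i. i \<in> T b \<Longrightarrow> 0 < s i" unfolding T_def using s0 by simp
      from grouping[OF finT this eta(1) sumT] show ?thesis unfolding Pr_def .
    qed
    then obtain gr D where Pr: "\<And>b. Pr b (gr b) (D b)" by metis
    define g where "g i = gr (cl i) i" for i
    have gT: "gr b i = g i" if "i \<in> T b" for b i using that unfolding g_def T_def by simp
    have DT: "D b \<subseteq> T b" "card (D b) \<le> m" for b using Pr[of b] unfolding Pr_def by blast+
    have gm: "g i < m" if "i \<in> S" for i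
      using Pr[of "cl i"] that unfolding g_def T_def Pr_def by simp
    have gmono: "a j \<le> a i" if "i \<in> T b" "j \<in> T b" "g i < g j" for i j b
      using Pr[of b] that gT[OF that(1)] gT[OF that(2)] unfolding Pr_def by metis
    have gsum: "sum s {i \<in> T b - D b. g i = k} \<le> eta" for b k
    proof -
      have "{i \<in> T b - D b. g i = k} = {i \<in> T b - D b. gr b i = k}"
        using gT by auto
      then show ?thesis using Pr[of b] unfolding Pr_def by simp
    qed
    have gfull: "eta < sum s {i \<in> T b. g i = k}" if "j \<in> T b" "k < g j" for b j k
    proof -
      have "{i \<in> T b. g i = k} = {i \<in> T b. gr b i = k}" using gT by auto
      then show ?thesis using Pr[of b] that gT[OF that(1)] unfolding Pr_def by metis
    qed
    \<comment> \<open>All groups before that of \<open>i\<close> are full and consist of items at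
      least as large as \<open>i\<close>; the item \<open>i\<close> itself makes the inequality
      strict.\<close>
    have rank: "real (g i) * eta < sum s {t \<in> T b. a i \<le> a t}" if i: "i \<in> T b" for i b
    proof -
      let ?L = "{t \<in> T b. g t < g i}"
      have "sum s ?L = (\<Sum>k<g i. sum s {t \<in> ?L. g t = k})"
        by (rule sum.group[symmetric]) (use finT in auto)
      also have "\<dots> = (\<Sum>k<g i. sum s {t \<in> T b. g t = k})"
        by (intro sum.cong refl arg_cong[where f="sum s"]) auto
      also have "\<dots> \<ge> (\<Sum>k<g i. eta)"
        by (intro sum_mono less_imp_le gfull[OF i]) simp
      finally have "real (g i) * eta \<le> sum s ?L" by simp
      moreover have "sum s (insert i ?L) = s i + sum s ?L" using finT by (intro sum.insert) auto
      moreover have "sum s (insert i ?L) \<le> sum s {t \<in> T b. a i \<le> a t}"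
        using finS i gmono s0 by (intro sum_mono2) (auto simp: T_def less_imp_le)
      moreover have "0 < s i" using i s0 unfolding T_def by simp
      ultimately show ?thesis by linarith
    qed
    \<comment> \<open>Candidate pairs: group \<open>k + 1\<close> of one class and group
      \<open>m - 1 - k\<close> of the other, with indices adding up to \<open>m\<close>. These
      \<open>m - 1\<close> pairs are disjoint, so one of them is cheap.\<close>
    define B where "B k = {i. (cl i \<and> g i = Suc k) \<or> (\<not> cl i \<and> g i = m - 1 - k)}" for k
    have "\<exists>k<m - 1. sum p (B k \<inter> S) \<le> real 1 / real (m - 1) * sum p S"
    proof (rule averaging)
      fix i
      have "{k. k < m - 1 \<and> i \<in> B k} \<subseteq> {if cl i then g i - 1 else m - 1 - g i}"
        unfolding B_def by auto
      then show "card {k. k < m - 1 \<and> i \<in> B k} \<le> 1" using card_mono[of "{if cl i then g i - 1 else m - 1 - g i}"] by simp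
    qed (use finS p0 m in auto)
    then obtain k0 where k0: "k0 < m - 1" "sum p (B k0 \<inter> S) \<le> 1 / real (m - 1) * sum p S" by auto
    define kk where "kk = Suc k0"
    define D1 where "D1 = D True \<union> D False"
    define D2 where "D2 = B k0 \<inter> S"
    have D1S: "D1 \<subseteq> S" unfolding D1_def using DT unfolding T_def by blast
    have cardD1: "card D1 \<le> 2 * m" unfolding D1_def
      using card_Un_le[of "D True" "D False"] DT[of True] DT[of False] by linarith
    \<comment> \<open>One class is laid out by increasing index, the other by decreasing index.
      Unshifted, the two indices at a position would add up to \<open>m - 1\<close>, one too few;
      the shifts made possible by the dropped pair raise the sum to exactly \<open>m\<close>
      wherever both classes are present.\<close>
    define po where "po b k = (if b then (if k < kk then k else k - 1) else (if k > m - kk then m - k else m - 1 - k))"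
      for b k
    define G where "G b k = {i \<in> T b - D b. g i = k}" for b k
    define R where "R = S - (D1 \<union> D2)"
    have RG: "i \<in> G (cl i) (g i)" and Rne: "cl i \<Longrightarrow> g i \<noteq> kk" "\<not> cl i \<Longrightarrow> g i \<noteq> m - kk" and RS: "i \<in> S" if "i \<in> R" for i
    proof -
      show "i \<in> G (cl i) (g i)" using that unfolding R_def G_def D1_def T_def by (cases "cl i") auto
      show "cl i \<Longrightarrow> g i \<noteq> kk" "\<not> cl i \<Longrightarrow> g i \<noteq> m - kk" "i \<in> S"
        using that unfolding R_def D2_def B_def kk_def by auto
    qed
    have finG: "finite (G b k)" for b k unfolding G_def using finT by simp
    have "\<forall>b k. \<exists>y. (\<forall>i\<in>G b k. u + po b k * eta \<le> y i \<and> y i + s i \<le> (u + po b k * eta) + sum s (G b k)) \<and>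
      (\<forall>i\<in>G b k. \<forall>j\<in>G b k. i \<noteq> j \<longrightarrow> sep y s i j)"
    proof (intro allI)
      fix b k
      have "0 \<le> s i" if "i \<in> G b k" for i using that s0[of i] unfolding G_def T_def by auto
      then show "\<exists>y. (\<forall>i\<in>G b k. u + po b k * eta \<le> y i \<and> y i + s i \<le> (u + po b k * eta) + sum s (G b k)) \<and>
        (\<forall>i\<in>G b k. \<forall>j\<in>G b k. i \<noteq> j \<longrightarrow> sep y s i j)"
        using layout_exists[OF finG, of b k s "u + po b k * eta"] by blast
    qed
    then obtain Y where Y: "\<And>b k i. i \<in> G b k \<Longrightarrow> u + po b k * eta \<le> Y b k i \<and> Y b k i + s i \<le> u + po b k * eta + sum s (G b k)"
      and Ysep: "\<And>b k i j. i \<in> G b k \<Longrightarrow> j \<in> G b k \<Longrightarrow> i \<noteq> j \<Longrightarrow> sep (Y b k) s i j"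
      by metis
    define y where "y i = Y (cl i) (g i) i" for i
    define pp where "pp i = po (cl i) (g i)" for i
    define cu where "cu i = u + pp i * eta" for i
    define cv where "cv i = u + (pp i + 1) * eta" for i
    have ppm: "pp i < m" if "i \<in> R" for i
      using gm[OF RS[OF that]] k0 Rne[OF that] unfolding pp_def po_def kk_def by auto
    have 2: "u \<le> cu i \<and> cu i \<le> y i \<and> y i + s i \<le> cv i \<and> cv i \<le> v" if i: "i \<in> R" for i
    proof -
      have "cu i \<le> y i" "y i + s i \<le> cu i + sum s (G (cl i) (g i))"
        using Y[OF RG[OF i]] unfolding y_def cu_def pp_def by auto
      moreover have "sum s (G (cl i) (g i)) \<le> eta" using gsum unfolding G_def by blast
      moreover have "cv i = cu i + eta" unfolding cu_def cv_def by (simp add: algebra_simps)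
      moreover have "0 \<le> pp i * eta" using eta by simp
      moreover have "(pp i + 1) * eta \<le> m * eta" using ppm[OF i] eta by (intro mult_right_mono) auto
      ultimately show ?thesis using eta unfolding cu_def cv_def by linarith
    qed
    have finU: "finite {t \<in> T b. r \<le> a t}" for b r using finT by simp
    have compat: "a i + a j \<le> H" if ij: "i \<in> R" "j \<in> R" "cl i" "\<not> cl j" "pp i = pp j" for i j
    proof (rule ccontr)
      assume n: "\<not> a i + a j \<le> H"
      have gg: "g i + g j = m"
        using ij(5) Rne(1)[OF ij(1,3)] Rne(2)[OF ij(2,4)] gm[OF RS[OF ij(1)]] gm[OF RS[OF ij(2)]] k0(1) ij(3,4)
        unfolding pp_def po_def kk_def by (auto split: if_splits)
      \<comment> \<open>If \<open>i\<close> and \<open>j\<close> were too large together, no item of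
        \<open>?U\<close> would be compatible with one of \<open>?V\<close>, so all of them would be
        separated on the line; but \<open>rank\<close> makes their total length exceed
        \<open>v - u\<close>.\<close>
      let ?U = "{t \<in> T True. a i \<le> a t}" and ?V = "{t \<in> T False. a j \<le> a t}"
      have "sum s (?U \<union> ?V) \<le> v - u"
      proof (rule sum_le_of_sep)
        fix t t' assume t: "t \<in> ?U \<union> ?V" "t' \<in> ?U \<union> ?V" "t \<noteq> t'"
        then have "t \<in> I" "t' \<in> I" using SI unfolding T_def by auto
        moreover have "\<not> (cl t \<noteq> cl t' \<and> a t + a t' \<le> H)" using t n unfolding T_def by auto
        ultimately show "sep x s t t'" using valid t(3) by blast
      next
        show "finite (?U \<union> ?V)" using finU by simp
      qed (use s0 uv uv' in \<open>auto simp: T_def\<close>)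
      moreover have "sum s (?U \<union> ?V) = sum s ?U + sum s ?V"
        using finS by (intro sum.union_disjoint) (auto simp: T_def)
      moreover have "real (g i) * eta < sum s ?U" "real (g j) * eta < sum s ?V"
        using rank[of i True] rank[of j False] ij RS unfolding T_def by auto
      moreover have "real (g i) * eta + real (g j) * eta = v - u"
        using gg eta(2) by (metis distrib_right of_nat_add)
      ultimately show False by linarith
    qed
    have 3: "if (cl i, cu i, cv i) = (cl j, cu j, cv j) then sep y s i j
       else cv i \<le> cu j \<or> cv j \<le> cu i \<or> ?cmp i j"
      if ij: "i \<in> R" "j \<in> R" "i \<noteq> j" for i j
    proof (cases "pp i = pp j")
      case True
      then have e: "cu i = cu j" "cv i = cv j" unfolding cu_def cv_def by simp_all
      show ?thesis
      proof (cases "cl i = cl j")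
        case c: True
        have gg: "g i = g j"
          using True c Rne[OF ij(1)] Rne[OF ij(2)] gm[OF RS[OF ij(1)]] gm[OF RS[OF ij(2)]] k0(1)
          unfolding pp_def po_def kk_def by (auto split: if_splits)
        have "sep (Y (cl i) (g i)) s i j"
          using Ysep[OF RG[OF ij(1)], of j] RG[OF ij(2)] gg c ij by simp
        then have "sep y s i j" unfolding sep_def y_def using gg c by simp
        then show ?thesis using c e by simp
      next
        case False
        have "a i + a j \<le> H"
        proof (cases "cl i")
          case True
          then show ?thesis using compat[OF ij(1,2)] False \<open>pp i = pp j\<close> by simp
        next
          case f: False
          then show ?thesis using compat[OF ij(2,1)] False \<open>pp i = pp j\<close> by simp
        qed
        then show ?thesis using False by simp
      qed
    next
      case False
      have *: "cv i \<le> cu j" if "pp i < pp j" for i j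
        unfolding cu_def cv_def using that eta by (intro add_left_mono mult_right_mono) auto
      have "cu i < cv i" "cu j < cv j" unfolding cu_def cv_def using eta by auto
      then show ?thesis using *[of i j] *[of j i] False by (metis Pair_inject linorder_neqE_nat not_le)
    qed
    have 1: "card ((\<lambda>i. (cl i, cu i, cv i)) ` R) \<le> 2 * m"
    proof -
      have "(\<lambda>i. (cl i, cu i, cv i)) ` R \<subseteq> (\<lambda>(b, k). (b, u + real k * eta, u + (real k + 1) * eta)) ` (UNIV \<times> {..<m})"
      proof
        fix t assume "t \<in> (\<lambda>i. (cl i, cu i, cv i)) ` R"
        then obtain i where i: "i \<in> R" "t = (cl i, cu i, cv i)" by blast
        then have "t = (\<lambda>(b, k). (b, u + real k * eta, u + (real k + 1) * eta)) (cl i, pp i)"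
          unfolding cu_def cv_def by simp
        then show "t \<in> (\<lambda>(b, k). (b, u + real k * eta, u + (real k + 1) * eta)) ` (UNIV \<times> {..<m})"
          using ppm[OF i(1)] by (intro image_eqI[of _ _ "(cl i, pp i)"]) auto
      qed
      then have "card ((\<lambda>i. (cl i, cu i, cv i)) ` R) \<le> card ((UNIV :: bool set) \<times> {..<m})"
        by (meson card_image_le card_mono finite finite_SigmaI finite_imageI finite_lessThan order_trans)
      then show ?thesis by (simp add: card_cartesian_product)
    qed
    have "arrangeable cl ?cmp s R u v (2 * m)"
      unfolding arrangeable_def
      by (rule exI[of _ y], rule exI[of _ cu], rule exI[of _ cv]) (use 1 2 3 in blast)
    then show ?thesis using D1S cardD1 k0(2) unfolding R_def
      by (intro exI[of _ D1] exI[of _ D2]) (simp add: D2_def)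
  qed
qed

section \<open>Container packings without rotation\<close>

text \<open>Positive side lengths make the open box nonempty, so that its inclusion in the knapsack
  can be turned back into inequalities for its sides.\<close>

definition container :: "real \<Rightarrow> (nat \<Rightarrow> real) \<Rightarrow> (nat \<Rightarrow> real) \<Rightarrow> real \<Rightarrow> real \<Rightarrow> real \<Rightarrow> real \<Rightarrow> nat set \<Rightarrow> bool" where
  "container e w h X Y a b S \<longleftrightarrow> 0 < a \<and> 0 < b \<and> (\<exists>lab px py.
    (\<forall>i\<in>S. X \<le> px i \<and> px i + w i \<le> X + a \<and> Y \<le> py i \<and> py i + h i \<le> Y + b) \<and>
    (\<forall>i\<in>S. \<forall>j\<in>S. i \<noteq> j \<longrightarrow> (case lab of Horizontal \<Rightarrow> sep py h i j | Vertical \<Rightarrow> sep px w i j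
       | Area \<Rightarrow> sep px w i j \<or> sep py h i j)) \<and>
    (lab = Area \<longrightarrow> (\<forall>i\<in>S. w i \<le> e * a \<and> h i \<le> e * b)))"

lemma containerI:
  assumes "0 < a" "0 < b"
    "\<forall>i\<in>S. X \<le> px i \<and> px i + w i \<le> X + a \<and> Y \<le> py i \<and> py i + h i \<le> Y + b"
    "\<forall>i\<in>S. \<forall>j\<in>S. i \<noteq> j \<longrightarrow> (case lab of Horizontal \<Rightarrow> sep py h i j | Vertical \<Rightarrow> sep px w i j
       | Area \<Rightarrow> sep px w i j \<or> sep py h i j)"
    "lab = Area \<longrightarrow> (\<forall>i\<in>S. w i \<le> e * a \<and> h i \<le> e * b)"
  shows "container e w h X Y a b S"
  unfolding container_def using assms by blast

text \<open>The open container boxes lie in the region \<open>A\<close>, so packings in disjoint regions can be combined.\<close>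

inductive containable :: "real \<Rightarrow> (nat \<Rightarrow> real) \<Rightarrow> (nat \<Rightarrow> real) \<Rightarrow> (real \<times> real) set \<Rightarrow> nat set \<Rightarrow> nat \<Rightarrow> bool"
  for e w h where
  empty: "containable e w h A {} 0"
| single: "container e w h X Y a b S \<Longrightarrow> box_int X Y a b \<subseteq> A \<Longrightarrow> containable e w h A S 1"
| union: "containable e w h A S m \<Longrightarrow> containable e w h B T n \<Longrightarrow> A \<inter> B = {} \<Longrightarrow> S \<inter> T = {} \<Longrightarrow>
    containable e w h (A \<union> B) (S \<union> T) (m + n)"
| mono: "containable e w h A S m \<Longrightarrow> A \<subseteq> B \<Longrightarrow> m \<le> n \<Longrightarrow> containable e w h B S n"

lemma box_disj:
  "X + a \<le> X' \<or> X' + a' \<le> X \<or> Y + b \<le> Y' \<or> Y' + b' \<le> Y \<Longrightarrow>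
    box_int X Y a b \<inter> box_int X' Y' a' b' = {}"
  unfolding box_int_def by auto

lemma box_sub:
  "X' \<le> X \<Longrightarrow> X + a \<le> X' + a' \<Longrightarrow> Y' \<le> Y \<Longrightarrow> Y + b \<le> Y' + b' \<Longrightarrow> box_int X Y a b \<subseteq> box_int X' Y' a' b'"
  unfolding box_int_def by auto

lemma containable_empty: "containable e w h A {} n"
  by (rule containable.mono[OF containable.empty]) auto

lemma containable_subset: "containable e w h A S n \<Longrightarrow> T \<subseteq> S \<Longrightarrow> containable e w h A T n"
proof (induction arbitrary: T rule: containable.induct)
  case (empty A)
  then show ?case using containable_empty by simp
next
  case (single X Y a b S A)
  obtain lab px py where p: "0 < a" "0 < b"
    "\<forall>i\<in>S. X \<le> px i \<and> px i + w i \<le> X + a \<and> Y \<le> py i \<and> py i + h i \<le> Y + b"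
    "\<forall>i\<in>S. \<forall>j\<in>S. i \<noteq> j \<longrightarrow> (case lab of Horizontal \<Rightarrow> sep py h i j | Vertical \<Rightarrow> sep px w i j
       | Area \<Rightarrow> sep px w i j \<or> sep py h i j)"
    "lab = Area \<longrightarrow> (\<forall>i\<in>S. w i \<le> e * a \<and> h i \<le> e * b)"
    using single.hyps(1) unfolding container_def by (elim exE conjE)
  have "container e w h X Y a b T"
    by (rule containerI[where lab=lab and px=px and py=py, OF p(1,2)])
      (use p(3-5) single.prems in \<open>simp_all only: subset_iff Ball_def, blast+\<close>)
  then show ?case using single.hyps(2) by (rule containable.single)
next
  case (union A S m B U n)
  have "containable e w h (A \<union> B) ((T \<inter> S) \<union> (T \<inter> U)) (m + n)"
    using union.IH union.hyps by (intro containable.union) auto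
  moreover have "(T \<inter> S) \<union> (T \<inter> U) = T" using union.prems by blast
  ultimately show ?case by simp
next
  case (mono A S m B n)
  then show ?case by (meson containable.mono)
qed

text \<open>The item sets may overlap: an item present in both packings is kept in the
  first.\<close>

lemma containable_Un:
  assumes "containable e w h A S m" "containable e w h B T n" "A \<inter> B = {}"
  shows "containable e w h (A \<union> B) (S \<union> T) (m + n)"
proof -
  have "containable e w h (A \<union> B) (S \<union> (T - S)) (m + n)"
    using assms by (intro containable.union) (auto intro: containable_subset)
  then show ?thesis by simp
qed

lemma containable_UN:
  assumes "finite Q" "\<And>k. k \<in> Q \<Longrightarrow> containable e w h (A k) (S k) (n k)"
    "\<And>k l. k \<in> Q \<Longrightarrow> l \<in> Q \<Longrightarrow> k \<noteq> l \<Longrightarrow> A k \<inter> A l = {}"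
  shows "containable e w h (\<Union>k\<in>Q. A k) (\<Union>k\<in>Q. S k) (sum n Q)"
  using assms
proof (induction Q rule: finite_induct)
  case empty
  then show ?case using containable_empty by simp
next
  case (insert q Q)
  have "containable e w h (\<Union>k\<in>Q. A k) (\<Union>k\<in>Q. S k) (sum n Q)" using insert by auto
  moreover have "A q \<inter> (\<Union>k\<in>Q. A k) = {}"
    using insert.prems(2)[of q] insert.hyps by blast
  ultimately have "containable e w h (A q \<union> (\<Union>k\<in>Q. A k)) (S q \<union> (\<Union>k\<in>Q. S k)) (n q + sum n Q)"
    using insert.prems(1)[of q] by (intro containable_Un) auto
  then show ?case using insert.hyps by simp
qed

section \<open>Packing a single rectangle\<close>

lemma containable_vertical:
  assumes "finite S" "\<And>i. i \<in> S \<Longrightarrow> 0 < w i \<and> 0 < h i" "sum w S \<le> a" "\<And>i. i \<in> S \<Longrightarrow> h i \<le> b"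
  shows "containable e w h (box_int X Y a b) S 1"
proof (cases "S = {}")
  case True
  then show ?thesis using containable_empty by simp
next
  case False
  then obtain i where i: "i \<in> S" by blast
  have "0 < sum w S" using False assms by (intro sum_pos) auto
  then have ab: "0 < a" "0 < b" using assms i by (force, force)
  have "\<exists>x. (\<forall>i\<in>S. X \<le> x i \<and> x i + w i \<le> X + sum w S) \<and> (\<forall>i\<in>S. \<forall>j\<in>S. i \<noteq> j \<longrightarrow> sep x w i j)"
    by (rule layout_exists) (use assms in \<open>auto simp: less_imp_le\<close>)
  then obtain x where x: "\<forall>i\<in>S. X \<le> x i \<and> x i + w i \<le> X + sum w S" "\<forall>i\<in>S. \<forall>j\<in>S. i \<noteq> j \<longrightarrow> sep x w i j"
    by (elim exE conjE)
  have "container e w h X Y a b S"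
    unfolding container_def
    by (intro conjI ab exI[of _ Vertical] exI[of _ x] exI[of _ "\<lambda>_. Y"]) (use x assms in \<open>auto intro: order_trans\<close>)
  then show ?thesis by (rule containable.single) simp
qed

lemma containable_horizontal:
  assumes "finite S" "\<And>i. i \<in> S \<Longrightarrow> 0 < w i \<and> 0 < h i" "sum h S \<le> b" "\<And>i. i \<in> S \<Longrightarrow> w i \<le> a"
  shows "containable e w h (box_int X Y a b) S 1"
proof (cases "S = {}")
  case True
  then show ?thesis using containable_empty by simp
next
  case False
  then obtain i where i: "i \<in> S" by blast
  have "0 < sum h S" using False assms by (intro sum_pos) auto
  then have ab: "0 < a" "0 < b" using assms i by (force, force)
  have "\<exists>y. (\<forall>i\<in>S. Y \<le> y i \<and> y i + h i \<le> Y + sum h S) \<and> (\<forall>i\<in>S. \<forall>j\<in>S. i \<noteq> j \<longrightarrow> sep y h i j)"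
    by (rule layout_exists) (use assms in \<open>auto simp: less_imp_le\<close>)
  then obtain y where y: "\<forall>i\<in>S. Y \<le> y i \<and> y i + h i \<le> Y + sum h S" "\<forall>i\<in>S. \<forall>j\<in>S. i \<noteq> j \<longrightarrow> sep y h i j"
    by (elim exE conjE)
  have "container e w h X Y a b S"
    unfolding container_def
    by (intro conjI ab exI[of _ Horizontal] exI[of _ "\<lambda>_. X"] exI[of _ y]) (use y assms in \<open>auto intro: order_trans\<close>)
  then show ?thesis by (rule containable.single) simp
qed

lemma containable_area:
  assumes "\<And>i. i \<in> S \<Longrightarrow> 0 < w i \<and> 0 < h i"
    "\<And>i. i \<in> S \<Longrightarrow> X \<le> x i \<and> x i + w i \<le> X + a \<and> Y \<le> y i \<and> y i + h i \<le> Y + b"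
    "\<And>i j. i \<in> S \<Longrightarrow> j \<in> S \<Longrightarrow> i \<noteq> j \<Longrightarrow> sep x w i j \<or> sep y h i j"
    "\<And>i. i \<in> S \<Longrightarrow> w i \<le> e * a \<and> h i \<le> e * b"
  shows "containable e w h (box_int X Y a b) S 1"
proof (cases "S = {}")
  case True
  then show ?thesis using containable_empty by simp
next
  case False
  then obtain i where i: "i \<in> S" by blast
  have ab: "0 < a" "0 < b" using assms(1,2)[OF i] by linarith+
  have "container e w h X Y a b S"
    unfolding container_def
    by (intro conjI ab exI[of _ Area] exI[of _ x] exI[of _ y]) (use assms in auto)
  then show ?thesis by (rule containable.single) simp
qed

text \<open>Shelves by decreasing height. A shelf takes items until their width exceeds
  \<open>a - om\<close>; they still fit, as no item is wider than \<open>om\<close>. All of them are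
  at least as tall as the next shelf, so the area of a shelf pays for the height of the next one,
  and only the first height \<open>H\<close> is extra.\<close>

lemma shelf_packing:
  fixes w h :: "'i \<Rightarrow> real"
  assumes "finite S" "\<And>i. i \<in> S \<Longrightarrow> 0 < w i \<and> w i \<le> om \<and> 0 < h i \<and> h i \<le> H" "0 \<le> om" "om < a"
  shows "\<exists>x y. (\<forall>i\<in>S. X \<le> x i \<and> x i + w i \<le> X + a \<and> Y \<le> y i \<and>
      y i + h i \<le> Y + H + (\<Sum>i\<in>S. w i * h i) / (a - om)) \<and>
    (\<forall>i\<in>S. \<forall>j\<in>S. i \<noteq> j \<longrightarrow> sep x w i j \<or> sep y h i j)"
  using assms
proof (induction "card S" arbitrary: S H Y rule: less_induct)
  case less
  have area0: "0 \<le> (\<Sum>i\<in>T. w i * h i) / (a - om)" if "T \<subseteq> S" for T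
    using less.prems that by (intro divide_nonneg_nonneg sum_nonneg) (auto simp: subset_iff less_imp_le)
  show ?case
  proof (cases "sum w S \<le> a")
    case True
    have "\<exists>x. (\<forall>i\<in>S. X \<le> x i \<and> x i + w i \<le> X + sum w S) \<and> (\<forall>i\<in>S. \<forall>j\<in>S. i \<noteq> j \<longrightarrow> sep x w i j)"
      by (rule layout_exists) (use less.prems in \<open>auto simp: less_imp_le\<close>)
    then obtain x where x: "\<forall>i\<in>S. X \<le> x i \<and> x i + w i \<le> X + sum w S" "\<forall>i\<in>S. \<forall>j\<in>S. i \<noteq> j \<longrightarrow> sep x w i j"
      by (elim exE conjE)
    have "X \<le> x i \<and> x i + w i \<le> X + a \<and> Y \<le> Y \<and> Y + h i \<le> Y + H + (\<Sum>i\<in>S. w i * h i) / (a - om)" if "i \<in> S" for i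
      
    proof -
      have "X \<le> x i" "x i + w i \<le> X + sum w S" using x(1) that by blast+
      then show ?thesis using True less.prems(2)[OF that] area0[OF order_refl] by linarith
    qed
    then show ?thesis using x by (intro exI[of _ x] exI[of _ "\<lambda>_. Y"]) auto
  next
    case False
    have "0 \<le> a - om" "a - om < sum w S" using less.prems False by auto
    from sorted_prefix[OF less.prems(1) this, of h]
    obtain G z where G: "G \<subseteq> S" "z \<in> S - G" "sum w G \<le> a - om" "a - om < sum w G + w z"
      "\<forall>i\<in>G. \<forall>j\<in>S - G. h j \<le> h i" "\<forall>j\<in>S - G. h j \<le> h z" by (elim exE conjE)
    let ?A = "insert z G" let ?B = "S - insert z G"
    have finG: "finite G" using G less.prems finite_subset by blast
    have sumA: "sum w ?A = sum w G + w z" using G finG by (simp add: add.commute)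
    have leA: "sum w ?A \<le> a" using sumA G less.prems(2)[of z] by auto
    \<comment> \<open>Height of the next shelf; the value 0 when nothing remains keeps the area
      estimate below valid.\<close>
    define H2 where "H2 = (if ?B = {} then 0 else Max (h ` ?B))"
    have H2B: "h i \<le> H2" if "i \<in> ?B" for i
    proof -
      have "?B \<noteq> {}" using that by blast
      then show ?thesis unfolding H2_def using that less.prems(1) by auto
    qed
    have H2A: "H2 \<le> h i" if i: "i \<in> ?A" for i
    proof (cases "?B = {}")
      case True
      then show ?thesis unfolding H2_def using less.prems(2)[of i] i G by auto
    next
      case False
      have "Max (h ` ?B) \<in> h ` ?B" using False less.prems(1) by (intro Max_in) auto
      then obtain j where "j \<in> ?B" "H2 = h j" unfolding H2_def using False by auto
      then show ?thesis using G i by auto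
    qed
    have H20: "0 \<le> H2"
    proof (cases "?B = {}")
      case False
      then obtain j where j: "j \<in> ?B" by blast
      then show ?thesis using H2B[OF j] less.prems(2)[of j] by auto
    qed (simp add: H2_def)
    have "card ?B < card S" using G less.prems(1) by (intro psubset_card_mono) auto
    then have "\<exists>x y. (\<forall>i\<in>?B. X \<le> x i \<and> x i + w i \<le> X + a \<and> Y + H \<le> y i \<and>
      y i + h i \<le> Y + H + H2 + (\<Sum>i\<in>?B. w i * h i) / (a - om)) \<and>
      (\<forall>i\<in>?B. \<forall>j\<in>?B. i \<noteq> j \<longrightarrow> sep x w i j \<or> sep y h i j)"
      by (rule less.hyps) (use less.prems H2B in auto)
    then obtain x y where B: "\<forall>i\<in>?B. X \<le> x i \<and> x i + w i \<le> X + a \<and> Y + H \<le> y i \<and>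
      y i + h i \<le> Y + H + H2 + (\<Sum>i\<in>?B. w i * h i) / (a - om)"
      "\<forall>i\<in>?B. \<forall>j\<in>?B. i \<noteq> j \<longrightarrow> sep x w i j \<or> sep y h i j" by (elim exE conjE)
    have "\<exists>x. (\<forall>i\<in>?A. X \<le> x i \<and> x i + w i \<le> X + sum w ?A) \<and> (\<forall>i\<in>?A. \<forall>j\<in>?A. i \<noteq> j \<longrightarrow> sep x w i j)"
      by (rule layout_exists) (use less.prems(2) finG G in \<open>auto simp: less_imp_le subset_iff\<close>)
    then obtain x' where x': "\<forall>i\<in>?A. X \<le> x' i \<and> x' i + w i \<le> X + sum w ?A" "\<forall>i\<in>?A. \<forall>j\<in>?A. i \<noteq> j \<longrightarrow> sep x' w i j"
      by (elim exE conjE)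
    have "H2 * (a - om) \<le> H2 * sum w ?A" using H20 sumA G by (intro mult_left_mono) auto
    also have "\<dots> = (\<Sum>i\<in>?A. w i * H2)" by (simp add: sum_distrib_left mult.commute)
    also have "\<dots> \<le> (\<Sum>i\<in>?A. w i * h i)"
      using H2A less.prems(2) G by (intro sum_mono mult_left_mono) (auto simp: subset_iff less_imp_le)
    finally have H2area: "H2 \<le> (\<Sum>i\<in>?A. w i * h i) / (a - om)" using less.prems by (simp add: field_simps)
    have "(\<Sum>i\<in>S. w i * h i) = (\<Sum>i\<in>?A. w i * h i) + (\<Sum>i\<in>?B. w i * h i)"
      using G less.prems(1) by (metis (no_types, lifting) DiffD1 add.commute insert_subset sum.subset_diff)
    then have tot: "H2 + (\<Sum>i\<in>?B. w i * h i) / (a - om) \<le> (\<Sum>i\<in>S. w i * h i) / (a - om)"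
      using H2area by (simp add: add_divide_distrib)
    let ?x = "\<lambda>i. if i \<in> ?A then x' i else x i" and ?y = "\<lambda>i. if i \<in> ?A then Y else y i"
    have 1: "X \<le> ?x i \<and> ?x i + w i \<le> X + a \<and> Y \<le> ?y i \<and>
      ?y i + h i \<le> Y + H + (\<Sum>i\<in>S. w i * h i) / (a - om)" if i: "i \<in> S" for i
    proof (cases "i \<in> ?A")
      case True
      then have "X \<le> x' i" "x' i + w i \<le> X + sum w ?A" using x'(1) by blast+
      then have "X \<le> x' i \<and> x' i + w i \<le> X + a \<and> Y \<le> Y \<and> Y + h i \<le> Y + H + (\<Sum>i\<in>S. w i * h i) / (a - om)"
        using leA less.prems(2)[OF i] area0[OF order_refl] by linarith
      then show ?thesis using True by (simp only: if_True)
    next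
      case False
      then have iB: "i \<in> ?B" using i by blast
      have "0 \<le> H" using less.prems(2)[OF i] by linarith
      then have "X \<le> x i \<and> x i + w i \<le> X + a \<and> Y \<le> y i \<and> y i + h i \<le> Y + H + (\<Sum>i\<in>S. w i * h i) / (a - om)"
        using bspec[OF B(1) iB] tot by linarith
      then show ?thesis using False by (simp only: if_False)
    qed
    have 2: "sep ?x w i j \<or> sep ?y h i j" if ij: "i \<in> S" "j \<in> S" "i \<noteq> j" for i j
    proof -
      have AB: "sep ?y h i j" if "i \<in> ?A" "j \<in> ?B" for i j
      proof -
        have "h i \<le> H" using that less.prems(2)[of i] G by blast
        moreover have "Y + H \<le> y j" using B(1) that by blast
        moreover have "j \<notin> ?A" using that by blast
        ultimately show ?thesis using that(1) unfolding sep_def by (simp only: if_True if_False) linarith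
      qed
      consider "i \<in> ?A" "j \<in> ?A" | "i \<in> ?A" "j \<in> ?B" | "i \<in> ?B" "j \<in> ?A" | "i \<in> ?B" "j \<in> ?B" using ij by blast
      then show ?thesis
      proof cases
        case 1
        then have "sep x' w i j" using x' ij by blast
        then have "sep ?x w i j" using 1 unfolding sep_def by simp
        then show ?thesis ..
      next
        case 2
        then show ?thesis using AB by blast
      next
        case 3
        then show ?thesis using AB[of j i] sep_commute by metis
      next
        case 4
        then have "sep x w i j \<or> sep y h i j" using B ij by blast
        then show ?thesis using 4 unfolding sep_def by simp
      qed
    qed
    show ?thesis by (rule exI[of _ ?x], rule exI[of _ ?y]) (use 1 2 in blast)
  qed
qed

text \<open>Shelves waste at most \<open>om\<close> of the width and \<open>mu\<close> of the
  height, which leaves the capacity \<open>(a - om) * (b - mu)\<close>; the bounds by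
  \<open>e\<close> make the box an area container.\<close>

lemma containable_small:
  assumes "finite S" "\<And>i. i \<in> S \<Longrightarrow> 0 < w i \<and> w i \<le> om \<and> 0 < h i \<and> h i \<le> mu"
    "0 \<le> om" "om < a" "om \<le> e * a" "mu \<le> e * b" "(\<Sum>i\<in>S. w i * h i) \<le> (a - om) * (b - mu)"
  shows "containable e w h (box_int X Y a b) S 1"
proof -
  have "\<exists>x y. (\<forall>i\<in>S. X \<le> x i \<and> x i + w i \<le> X + a \<and> Y \<le> y i \<and>
      y i + h i \<le> Y + mu + (\<Sum>i\<in>S. w i * h i) / (a - om)) \<and>
    (\<forall>i\<in>S. \<forall>j\<in>S. i \<noteq> j \<longrightarrow> sep x w i j \<or> sep y h i j)"
    by (rule shelf_packing) (use assms in auto)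
  then obtain x y where xy: "\<forall>i\<in>S. X \<le> x i \<and> x i + w i \<le> X + a \<and> Y \<le> y i \<and>
      y i + h i \<le> Y + mu + (\<Sum>i\<in>S. w i * h i) / (a - om)"
    "\<forall>i\<in>S. \<forall>j\<in>S. i \<noteq> j \<longrightarrow> sep x w i j \<or> sep y h i j" by (elim exE conjE)
  have "(\<Sum>i\<in>S. w i * h i) / (a - om) \<le> b - mu"
    using assms(4,7) by (simp add: divide_le_eq mult.commute)
  then show ?thesis
    using xy assms by (intro containable_area[of S w h X x a Y y b e]) fastforce+
qed

text \<open>Fubini for slices: weighting every item by \<open>f\<close> times its size amounts to
  integrating the sum of \<open>f\<close> over the items met by a line.\<close>

lemma slice_weight:
  fixes f s :: "'i \<Rightarrow> real"
  assumes "finite S" "\<And>i. i \<in> S \<Longrightarrow> sum m {Z \<in> Pow S. i \<in> Z} = s i"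
  shows "(\<Sum>i\<in>S. f i * s i) = (\<Sum>Z\<in>Pow S. m Z * sum f Z)"
proof -
  have "(\<Sum>i\<in>S. f i * s i) = (\<Sum>i\<in>S. \<Sum>Z\<in>Pow S. m Z * (f i * of_bool (i \<in> Z)))"
  proof (rule sum.cong[OF refl])
    fix i assume i: "i \<in> S"
    have "f i * s i = f i * sum m {Z \<in> Pow S. i \<in> Z}" using assms(2)[OF i] by simp
    also have "\<dots> = (\<Sum>Z\<in>{Z \<in> Pow S. i \<in> Z}. m Z * (f i * of_bool (i \<in> Z)))"
      unfolding sum_distrib_left by (rule sum.cong) auto
    also have "\<dots> = (\<Sum>Z\<in>Pow S. m Z * (f i * of_bool (i \<in> Z)))"
      using assms(1) by (intro sum.mono_neutral_left) auto
    finally show "f i * s i = (\<Sum>Z\<in>Pow S. m Z * (f i * of_bool (i \<in> Z)))" .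
  qed
  also have "\<dots> = (\<Sum>Z\<in>Pow S. \<Sum>i\<in>S. m Z * (f i * of_bool (i \<in> Z)))" by (rule sum.swap)
  also have "\<dots> = (\<Sum>Z\<in>Pow S. m Z * sum f Z)"
  proof (rule sum.cong[OF refl])
    fix Z assume Z: "Z \<in> Pow S"
    have "(\<Sum>i\<in>S. f i * of_bool (i \<in> Z)) = (\<Sum>i\<in>Z. f i * of_bool (i \<in> Z))"
      using Z assms(1) by (intro sum.mono_neutral_right) auto
    also have "\<dots> = sum f Z" by (rule sum.cong) auto
    finally show "(\<Sum>i\<in>S. m Z * (f i * of_bool (i \<in> Z))) = m Z * sum f Z"
      by (simp add: sum_distrib_left[symmetric])
  qed
  finally show ?thesis .
qed

definition packed :: "('i \<Rightarrow> real) \<Rightarrow> ('i \<Rightarrow> real) \<Rightarrow> ('i \<Rightarrow> real) \<Rightarrow> ('i \<Rightarrow> real) \<Rightarrow> 'i set \<Rightarrow> real \<Rightarrow> real \<Rightarrow> bool" where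
  "packed w h x y S a b \<longleftrightarrow> finite S \<and> (\<forall>i\<in>S. 0 < w i \<and> 0 < h i \<and>
      0 \<le> x i \<and> x i + w i \<le> a \<and> 0 \<le> y i \<and> y i + h i \<le> b) \<and>
    (\<forall>i\<in>S. \<forall>j\<in>S. i \<noteq> j \<longrightarrow> sep x w i j \<or> sep y h i j)"

lemma packed_subset: "packed w h x y S a b \<Longrightarrow> T \<subseteq> S \<Longrightarrow> packed w h x y T a b"
  unfolding packed_def by (auto intro: finite_subset)

text \<open>The items met by a horizontal line are separated within the width \<open>a\<close>;
  integrating this over the height \<open>b\<close> bounds the area.\<close>

lemma packed_area:
  assumes "packed w h x y S a b" "0 \<le> a" "0 \<le> b"
  shows "(\<Sum>i\<in>S. w i * h i) \<le> a * b"
proof -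
  have fin: "finite S" using assms unfolding packed_def by blast
  have "\<exists>m. (\<forall>Z. 0 \<le> m Z) \<and> sum m (Pow S) = b - 0 \<and> (\<forall>i\<in>S. sum m {Z \<in> Pow S. i \<in> Z} = h i) \<and>
    (\<forall>Z. 0 < m Z \<longrightarrow> (\<exists>t. 0 < t \<and> t < b \<and> Z = {i \<in> S. y i < t \<and> t < y i + h i}))"
    by (rule slices) (use assms fin in \<open>auto simp: packed_def\<close>)
  then obtain m where m: "\<And>Z. 0 \<le> m Z" "sum m (Pow S) = b" "\<And>i. i \<in> S \<Longrightarrow> sum m {Z \<in> Pow S. i \<in> Z} = h i"
    "\<And>Z. 0 < m Z \<Longrightarrow> \<exists>t. 0 < t \<and> t < b \<and> Z = {i \<in> S. y i < t \<and> t < y i + h i}"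
    by (elim exE conjE) (auto simp del: Pow_iff)
  have "m Z * sum w Z \<le> m Z * a" for Z
  proof (cases "0 < m Z")
    case True
    from m(4)[OF this] obtain t where t: "Z = {i \<in> S. y i < t \<and> t < y i + h i}" by (elim exE conjE)
    have "sum w Z \<le> a - 0"
    proof (rule sum_le_of_sep[where x=x])
      fix i j assume ij: "i \<in> Z" "j \<in> Z" "i \<noteq> j"
      then have "\<not> sep y h i j" "i \<in> S" "j \<in> S" unfolding t sep_def by auto
      then show "sep x w i j" using assms(1) ij unfolding packed_def by blast
    qed (use assms fin in \<open>auto simp: t packed_def\<close>)
    then show ?thesis using True by simp
  next
    case False
    then have "m Z = 0" using m(1)[of Z] by simp
    then show ?thesis by simp
  qed
  then have "(\<Sum>Z\<in>Pow S. m Z * sum w Z) \<le> (\<Sum>Z\<in>Pow S. m Z * a)" by (rule sum_mono)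
  also have "\<dots> = a * b" using m(2) by (metis mult.commute sum_distrib_right)
  finally show ?thesis using slice_weight[OF fin, of m h w] m(3) by simp
qed

lemma floor_bound: "0 \<le> z \<Longrightarrow> real n \<le> z \<Longrightarrow> n \<le> nat \<lfloor>z\<rfloor>"
  by (simp add: le_nat_floor)

text \<open>Slice the items of width above \<open>om1\<close> by horizontal lines and round widths by linear grouping: a configuration
counts the items of each group on a line. The groups, shifted by one, fit into the horizontal containers of
the configurations, and the leftover width of every configuration is filled with the narrow items.\<close>

lemma block_packing:
  fixes e om1 xi :: real
  assumes e: "0 < e" "e \<le> 1" and om1: "0 < om1" "om1 \<le> 1" and xi: "0 < xi"
  shows "\<exists>om2>0. om2 < om1 \<and> (\<exists>mu>0. \<exists>K. \<forall>w h x y S u g. packed w h x y S u g \<and>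
    0 \<le> u \<and> u \<le> 1 \<and> 0 \<le> g \<and> g \<le> 1 \<and> (\<forall>i\<in>S. h i \<le> mu \<and> (om1 < w i \<or> w i \<le> om2)) \<longrightarrow>
    (\<exists>S1 S2 S3. S = S1 \<union> S2 \<union> S3 \<and> containable e w h (box_int 0 0 u g) S1 K \<and>
      sum h S2 \<le> xi \<and> (\<Sum>i\<in>S3. w i * h i) \<le> xi \<and> (\<forall>i\<in>S3. w i \<le> om2)))"
proof -
  \<comment> \<open>Budget for \<open>S2\<close>: one quarter of \<open>xi\<close> is the height of
    the widest group, which has no predecessor to move into, and another quarter, through
    \<open>dd\<close>, covers the few items lost at group and slot boundaries.\<close>
  define eta where "eta = xi / 4"
  define m where "m = nat \<lceil>1 / om1 / eta\<rceil>"
  define B where "B = nat \<lfloor>1 / om1\<rfloor>"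
  \<comment> \<open>Number of configurations: wide items exceed \<open>om1\<close>, so each of the
    \<open>m\<close> groups occurs at most \<open>B\<close> times on a line.\<close>
  define Nc where "Nc = Suc B ^ m"
  define Nb where "Nb = Nc * B"
  \<comment> \<open>Small against \<open>e * xi\<close>, so that a leftover rectangle too narrow to
    be an area container wastes little area.\<close>
  define om2 where "om2 = min (om1 / 2) (e * xi / 4)"
  define dd where "dd = real (m + m * Nb + 1)"
  \<comment> \<open>The three terms control, in turn, the height of the lost wide items, the area
    wasted because leftover rectangles are too low, and the area of the narrow items that overflow
    those rectangles.\<close>
  define mu where "mu = min (xi / 4 / dd) (min (e * xi / 4 / Nc) (xi / 4 / (Nc + 1)))"
  define K where "K = Nc * (1 + m * B)"
  have eta: "0 < eta" unfolding eta_def using xi by simp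
  have m_ge: "1 / om1 \<le> real m * eta"
  proof -
    have "1 / om1 / eta \<le> real m" unfolding m_def by linarith
    then show ?thesis by (simp only: pos_divide_le_eq[OF eta])
  qed
  have Nc: "0 < Nc" unfolding Nc_def by simp
  have om2: "0 < om2" "om2 < om1" "om2 \<le> e * xi / 4" "om2 \<le> 1"
    unfolding om2_def using om1 e xi by auto
  have dd: "0 < dd" unfolding dd_def by (simp add: add_pos_nonneg)
  have mu: "0 < mu" "mu \<le> xi / 4 / dd" "mu \<le> e * xi / 4 / Nc" "mu \<le> xi / 4 / (Nc + 1)"
    unfolding mu_def using xi e Nc dd by auto
  have main: "\<exists>S1 S2 S3. S = S1 \<union> S2 \<union> S3 \<and> containable e w h (box_int 0 0 u g) S1 K \<and>
      sum h S2 \<le> xi \<and> (\<Sum>i\<in>S3. w i * h i) \<le> xi \<and> (\<forall>i\<in>S3. w i \<le> om2)"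
    if pkS: "packed w h x y S u g" and u: "0 \<le> u" "u \<le> 1" and g: "0 \<le> g" "g \<le> 1"
      and small: "\<forall>i\<in>S. h i \<le> mu \<and> (om1 < w i \<or> w i \<le> om2)" for w h x y S u g
  proof -
    have fin: "finite S" using pkS unfolding packed_def by blast
    have pos: "0 < w i" "0 < h i" if "i \<in> S" for i using pkS that unfolding packed_def by blast+
    have hmu: "h i \<le> mu" if "i \<in> S" for i using small that by blast
    define Hs where "Hs = {i \<in> S. om1 < w i}"
    define Sm where "Sm = {i \<in> S. w i \<le> om2}"
    have HS: "Hs \<subseteq> S" "Sm \<subseteq> S" "Hs \<inter> Sm = {}" "S = Hs \<union> Sm" "finite Hs" "finite Sm"
      unfolding Hs_def Sm_def using fin small om2 by auto
    have area: "(\<Sum>i\<in>S. w i * h i) \<le> u * g" by (rule packed_area[OF pkS u(1) g(1)])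
    have area_split: "(\<Sum>i\<in>S. w i * h i) = (\<Sum>i\<in>Hs. w i * h i) + (\<Sum>i\<in>Sm. w i * h i)"
      using HS by (metis sum.union_disjoint)
    have areaSm: "0 \<le> (\<Sum>i\<in>Sm. w i * h i)" using pos HS by (intro sum_nonneg) (auto simp: subset_iff less_imp_le)
    have Htot: "sum h Hs \<le> real m * eta"
    proof -
      have "om1 * sum h Hs \<le> (\<Sum>i\<in>Hs. w i * h i)"
        unfolding sum_distrib_left
      proof (rule sum_mono)
        fix i assume "i \<in> Hs"
        then have "om1 \<le> w i" "0 \<le> h i" using pos(2)[of i] unfolding Hs_def by auto
        then show "om1 * h i \<le> w i * h i" by (rule mult_right_mono)
      qed
      also have "\<dots> \<le> 1" using area area_split areaSm u g mult_le_one[of u g] by linarith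
      finally have "sum h Hs \<le> 1 / om1" using om1 by (simp add: field_simps)
      then show ?thesis using m_ge by linarith
    qed
    have "\<exists>mm. (\<forall>Z. 0 \<le> mm Z) \<and> sum mm (Pow Hs) = g - 0 \<and> (\<forall>i\<in>Hs. sum mm {Z \<in> Pow Hs. i \<in> Z} = h i) \<and>
      (\<forall>Z. 0 < mm Z \<longrightarrow> (\<exists>t. 0 < t \<and> t < g \<and> Z = {i \<in> Hs. y i < t \<and> t < y i + h i}))"
      by (rule slices) (use pkS HS g in \<open>auto simp: packed_def\<close>)
    then obtain mm where mm0: "\<forall>Z. 0 \<le> mm Z" and mm2: "sum mm (Pow Hs) = g - 0"
      and mm3: "\<forall>i\<in>Hs. sum mm {Z \<in> Pow Hs. i \<in> Z} = h i"
      and mm4: "\<forall>Z. 0 < mm Z \<longrightarrow> (\<exists>t. 0 < t \<and> t < g \<and> Z = {i \<in> Hs. y i < t \<and> t < y i + h i})"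
      by (elim exE conjE)
    note mm = mm0[rule_format] mm2 mm3 mm4[rule_format]
    have mmi: "sum mm {Z \<in> Pow Hs. i \<in> Z} = h i" if "i \<in> Hs" for i using mm(3) that by blast
    have lineW: "sum w Z \<le> u" and lineH: "Z \<subseteq> Hs" if "0 < mm Z" for Z
    proof -
      from mm(4)[OF that] obtain t where t: "Z = {i \<in> Hs. y i < t \<and> t < y i + h i}" by (elim exE conjE)
      show "Z \<subseteq> Hs" unfolding t by blast
      have "sum w Z \<le> u - 0"
      proof (rule sum_le_of_sep[where x=x])
        fix i j assume ij: "i \<in> Z" "j \<in> Z" "i \<noteq> j"
        then have "\<not> sep y h i j" "i \<in> S" "j \<in> S" using HS unfolding t sep_def by auto
        then show "sep x w i j" using pkS ij unfolding packed_def by blast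
      qed (use pkS HS u in \<open>auto simp: t packed_def\<close>)
      then show "sum w Z \<le> u" by simp
    qed
    have cardZ: "card Z \<le> B" if "0 < mm Z" for Z
    proof -
      have Z: "Z \<subseteq> Hs" "finite Z" using lineH[OF that] HS finite_subset by auto
      have "real (card Z) * om1 = (\<Sum>i\<in>Z. om1)" by simp
      also have "\<dots> \<le> sum w Z" using Z by (intro sum_mono) (auto simp: Hs_def)
      also have "\<dots> \<le> 1" using lineW[OF that] u by linarith
      finally have "real (card Z) \<le> 1 / om1" using om1 by (simp add: field_simps)
      then show ?thesis unfolding B_def using om1 by (intro floor_bound) auto
    qed
    have posHs: "\<And>i. i \<in> Hs \<Longrightarrow> 0 < h i" using pos HS by blast
    have "\<exists>grp D. D \<subseteq> Hs \<and> card D \<le> m \<and> (\<forall>i\<in>Hs. grp i < m) \<and>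
      (\<forall>i\<in>Hs. \<forall>j\<in>Hs. grp i < grp j \<longrightarrow> w j \<le> w i) \<and>
      (\<forall>k. sum h {i \<in> Hs - D. grp i = k} \<le> eta) \<and>
      (\<forall>k. (\<exists>j\<in>Hs. k < grp j) \<longrightarrow> eta < sum h {i \<in> Hs. grp i = k})"
      by (rule grouping[OF HS(5) posHs eta Htot])
    then obtain grp D where D: "D \<subseteq> Hs" "card D \<le> m" and grpm: "\<forall>i\<in>Hs. grp i < m"
      and gmono: "\<forall>i\<in>Hs. \<forall>j\<in>Hs. grp i < grp j \<longrightarrow> w j \<le> w i"
      and gle: "\<forall>k. sum h {i \<in> Hs - D. grp i = k} \<le> eta"
      and gfull: "\<forall>k. (\<exists>j\<in>Hs. k < grp j) \<longrightarrow> eta < sum h {i \<in> Hs. grp i = k}" by (elim exE conjE)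
    define Gr where "Gr k = {i \<in> Hs. grp i = k}" for k
    have finGr: "finite (Gr k)" for k unfolding Gr_def using HS by simp
    define conf where "conf Z = (\<lambda>k\<in>{..<m}. card {i \<in> Z. grp i = k})" for Z
    define Cf where "Cf = PiE {..<m} (\<lambda>_. {..B})"
    have finCf: "finite Cf" unfolding Cf_def by (intro finite_PiE) auto
    have cardCf: "card Cf = Nc" unfolding Cf_def Nc_def by (subst card_PiE) auto
    have confCf: "conf Z \<in> Cf" if "0 < mm Z" for Z
    proof -
      have finZ: "finite Z" using lineH[OF that] HS finite_subset by auto
      have "card {i \<in> Z. grp i = k} \<le> B" for k
        using cardZ[OF that] card_mono[OF finZ, of "{i \<in> Z. grp i = k}"] by auto
      then show ?thesis unfolding conf_def Cf_def by auto
    qed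
    define P where "P = {Z \<in> Pow Hs. 0 < mm Z}"
    have finP: "finite P" unfolding P_def using HS by simp
    have sumP: "(\<Sum>Z\<in>Pow Hs. mm Z * f Z) = (\<Sum>Z\<in>P. mm Z * f Z)" for f :: "nat set \<Rightarrow> real"
    proof (rule sum.mono_neutral_right)
      show "\<forall>Z\<in>Pow Hs - P. mm Z * f Z = 0"
      proof
        fix Z assume "Z \<in> Pow Hs - P"
        then have "mm Z = 0" using mm(1)[of Z] unfolding P_def by auto
        then show "mm Z * f Z = 0" by simp
      qed
    qed (use HS in \<open>auto simp: P_def\<close>)
    \<comment> \<open>Slices with equal configuration are merged into one horizontal layer of height
      \<open>t c\<close>.\<close>
    define t where "t c = sum mm {Z \<in> P. conf Z = c}" for c
    have t0: "0 \<le> t c" for c unfolding t_def using mm(1) by (intro sum_nonneg)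
    have tsum: "(\<Sum>c\<in>Cf. t c * f c) = (\<Sum>Z\<in>P. mm Z * f (conf Z))" for f :: "(nat \<Rightarrow> nat) \<Rightarrow> real"
    proof -
      have "(\<Sum>c\<in>Cf. t c * f c) = (\<Sum>c\<in>Cf. \<Sum>Z\<in>{Z \<in> P. conf Z = c}. mm Z * f (conf Z))"
        unfolding t_def sum_distrib_right by (intro sum.cong refl) auto
      also have "\<dots> = (\<Sum>Z\<in>P. mm Z * f (conf Z))"
        by (rule sum.group) (use finP finCf confCf in \<open>auto simp: P_def\<close>)
      finally show ?thesis .
    qed
    define Cp where "Cp = {c \<in> Cf. 0 < t c}"
    have finCp: "finite Cp" and cardCp: "card Cp \<le> Nc"
    proof -
      show "finite Cp" unfolding Cp_def using finCf by simp
      show "card Cp \<le> Nc" unfolding Cp_def cardCf[symmetric] using finCf by (intro card_mono) auto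
    qed
    have tsum': "(\<Sum>c\<in>Cp. t c * f c) = (\<Sum>Z\<in>P. mm Z * f (conf Z))" for f :: "(nat \<Rightarrow> nat) \<Rightarrow> real"
    proof -
      have "(\<Sum>c\<in>Cp. t c * f c) = (\<Sum>c\<in>Cf. t c * f c)"
        using finCf t0 unfolding Cp_def by (intro sum.mono_neutral_left) (auto simp: less_le)
      then show ?thesis using tsum by simp
    qed
    have CpZ: "\<exists>Z. 0 < mm Z \<and> conf Z = c" if "c \<in> Cp" for c
    proof -
      have "t c \<noteq> 0" using that unfolding Cp_def by simp
      then have "{Z \<in> P. conf Z = c} \<noteq> {}" unfolding t_def by (metis sum.empty)
      then obtain Z where "Z \<in> {Z \<in> P. conf Z = c}" by blast
      then show ?thesis unfolding P_def by blast
    qed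
    have sumt: "sum t Cp = g"
    proof -
      have "sum t Cp = (\<Sum>Z\<in>P. mm Z)" using tsum'[of "\<lambda>_. 1"] by simp
      also have "\<dots> = sum mm (Pow Hs)" using sumP[of "\<lambda>_. 1"] by simp
      finally show ?thesis using mm(2) by simp
    qed
    have cnt: "(\<Sum>c\<in>Cp. t c * real (c k)) = sum h (Gr k)" if "k < m" for k
    proof -
      have "(\<Sum>c\<in>Cp. t c * real (c k)) = (\<Sum>Z\<in>P. mm Z * real (conf Z k))" by (rule tsum')
      also have "\<dots> = (\<Sum>Z\<in>P. mm Z * (\<Sum>i\<in>Z. of_bool (grp i = k)))"
      proof (rule sum.cong[OF refl])
        fix Z assume "Z \<in> P"
        then have finZ: "finite Z" using HS finite_subset unfolding P_def by blast
        have "(\<Sum>i\<in>Z. of_bool (grp i = k)) = (\<Sum>i\<in>{i \<in> Z. grp i = k}. of_bool (grp i = k) :: real)"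
          using finZ by (intro sum.mono_neutral_right) auto
        also have "\<dots> = real (card {i \<in> Z. grp i = k})" by simp
        finally show "mm Z * real (conf Z k) = mm Z * (\<Sum>i\<in>Z. of_bool (grp i = k))"
          unfolding conf_def using that by simp
      qed
      also have "\<dots> = (\<Sum>Z\<in>Pow Hs. mm Z * (\<Sum>i\<in>Z. of_bool (grp i = k)))" by (rule sumP[symmetric])
      also have "\<dots> = (\<Sum>i\<in>Hs. of_bool (grp i = k) * h i)"
        by (rule slice_weight[OF HS(5), of mm h "\<lambda>i. of_bool (grp i = k)", symmetric]) (rule mmi)
      also have "\<dots> = (\<Sum>i\<in>Gr k. of_bool (grp i = k) * h i)"
        unfolding Gr_def using HS by (intro sum.mono_neutral_right) auto
      also have "\<dots> = sum h (Gr k)" unfolding Gr_def by (rule sum.cong) auto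
      finally show ?thesis .
    qed
    \<comment> \<open>Slots of group \<open>k\<close> get the least width of the group: together
      they are no wider than the items on the original line, yet wide enough for every item of group
      \<open>k + 1\<close>.\<close>
    define mk where "mk k = (if Gr k = {} then 0 else Min (w ` Gr k))" for k
    have mk_le: "mk k \<le> w i" if "i \<in> Gr k" for i k
      using that finGr[of k] unfolding mk_def by auto
    have mk0: "0 \<le> mk k" for k
    proof (cases "Gr k = {}")
      case False
      then have "Min (w ` Gr k) \<in> w ` Gr k" using finGr by (intro Min_in) auto
      then show ?thesis using False pos HS unfolding mk_def Gr_def by (auto simp: subset_iff less_imp_le)
    qed (simp add: mk_def)
    have mk_ge: "r \<le> mk k" if "\<And>i. i \<in> Gr k \<Longrightarrow> r \<le> w i" "Gr k \<noteq> {}" for r k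
      using that finGr[of k] unfolding mk_def by auto
    define sg where "sg c = (\<Sum>k<m. real (c k) * mk k)" for c :: "nat \<Rightarrow> nat"
    have sg_le: "sg (conf Z) \<le> sum w Z" if Z: "0 < mm Z" for Z
    proof -
      have finZ: "finite Z" "Z \<subseteq> Hs" using lineH[OF Z] HS finite_subset by auto
      have "sg (conf Z) \<le> (\<Sum>k<m. sum w {i \<in> Z. grp i = k})"
        unfolding sg_def
      proof (rule sum_mono)
        fix k assume k: "k \<in> {..<m}"
        have "real (conf Z k) * mk k = (\<Sum>i\<in>{i \<in> Z. grp i = k}. mk k)" unfolding conf_def using k by simp
        also have "\<dots> \<le> sum w {i \<in> Z. grp i = k}"
          using finZ by (intro sum_mono mk_le) (auto simp: Gr_def)
        finally show "real (conf Z k) * mk k \<le> sum w {i \<in> Z. grp i = k}" .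
      qed
      also have "\<dots> = sum w Z" by (rule sum.group) (use finZ grpm in auto)
      finally show ?thesis .
    qed
    have sg_u: "sg c \<le> u" if "c \<in> Cp" for c
      using CpZ[OF that] sg_le lineW by (meson order_trans)
    have sg0: "0 \<le> sg c" for c unfolding sg_def using mk0 by (intro sum_nonneg) auto
    \<comment> \<open>Slot widths are rounded down, so the layers leave at least as much free area
      as the narrow items occupied.\<close>
    have free: "(\<Sum>i\<in>Sm. w i * h i) \<le> (\<Sum>c\<in>Cp. (u - sg c) * t c)"
    proof -
      have "(\<Sum>c\<in>Cp. t c * sg c) = (\<Sum>Z\<in>P. mm Z * sg (conf Z))" by (rule tsum')
      also have "\<dots> \<le> (\<Sum>Z\<in>P. mm Z * sum w Z)"
        using sg_le mm(1) by (intro sum_mono mult_left_mono) (auto simp: P_def)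
      also have "\<dots> = (\<Sum>i\<in>Hs. w i * h i)"
        unfolding sumP[symmetric] by (rule slice_weight[OF HS(5), of mm h w, symmetric]) (rule mmi)
      finally have "(\<Sum>c\<in>Cp. t c * sg c) \<le> (\<Sum>i\<in>Hs. w i * h i)" .
      moreover have "(\<Sum>c\<in>Cp. (u - sg c) * t c) = u * sum t Cp - (\<Sum>c\<in>Cp. t c * sg c)"
      proof -
        have "(\<Sum>c\<in>Cp. (u - sg c) * t c) = (\<Sum>c\<in>Cp. u * t c - t c * sg c)"
          by (intro sum.cong refl) (simp add: algebra_simps)
        then show ?thesis by (simp only: sum_subtractf sum_distrib_left)
      qed
      ultimately show ?thesis using area area_split sumt by simp
    qed
    have "\<exists>yp. (\<forall>c\<in>Cp. 0 \<le> yp c \<and> yp c + t c \<le> 0 + sum t Cp) \<and>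
      (\<forall>c\<in>Cp. \<forall>d\<in>Cp. c \<noteq> d \<longrightarrow> sep yp t c d)"
      by (rule layout_exists[OF finCp]) (rule t0)
    then obtain yp where yp: "\<forall>c\<in>Cp. 0 \<le> yp c \<and> yp c + t c \<le> 0 + sum t Cp"
      and ypsep: "\<forall>c\<in>Cp. \<forall>d\<in>Cp. c \<noteq> d \<longrightarrow> sep yp t c d"
      by (elim exE conjE)
    define Sl where "Sl c = Sigma {..<m} (\<lambda>k. {..<c k})" for c :: "nat \<Rightarrow> nat"
    define sw where "sw = (\<lambda>(k, r::nat). mk k)"
    have finSl: "finite (Sl c)" for c unfolding Sl_def by simp
    have sumSl: "sum sw (Sl c) = sg c" for c
      unfolding Sl_def sw_def sg_def by (subst sum.Sigma[symmetric]) auto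
    have "\<exists>f. (\<forall>q\<in>Sl c. 0 \<le> f q \<and> f q + sw q \<le> 0 + sum sw (Sl c)) \<and>
      (\<forall>q\<in>Sl c. \<forall>r\<in>Sl c. q \<noteq> r \<longrightarrow> sep f sw q r)" for c
      by (rule layout_exists[OF finSl]) (use mk0 in \<open>auto simp: sw_def\<close>)
    then obtain xp where xp: "\<And>c. (\<forall>q\<in>Sl c. 0 \<le> xp c q \<and> xp c q + sw q \<le> 0 + sum sw (Sl c)) \<and>
      (\<forall>q\<in>Sl c. \<forall>r\<in>Sl c. q \<noteq> r \<longrightarrow> sep (xp c) sw q r)" by metis
    define Bn where "Bn k = Sigma Cp (\<lambda>c. {..<c k})" for k :: nat
    have cB: "c k \<le> B" if "c \<in> Cp" "k < m" for c k
      using that unfolding Cp_def Cf_def by (auto simp: PiE_iff)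
    have finBn: "finite (Bn k)" for k unfolding Bn_def using finCp by simp
    have cardBn: "card (Bn k) \<le> Nb" if "k < m" for k
    proof -
      have "card (Bn k) = (\<Sum>c\<in>Cp. c k)" unfolding Bn_def using finCp by simp
      also have "\<dots> \<le> (\<Sum>c\<in>Cp. B)" by (intro sum_mono) (use cB that in auto)
      also have "\<dots> = card Cp * B" by simp
      also have "\<dots> \<le> Nb" unfolding Nb_def using cardCp by (rule mult_le_mono1)
      finally show ?thesis .
    qed
    \<comment> \<open>Group \<open>k + 1\<close> moves into the slots of group \<open>k\<close>.
      Without \<open>D\<close> its height is at most \<open>eta\<close>, while those slots offer the
      height of the full group \<open>k\<close>, which exceeds \<open>eta\<close>.\<close>
    define It where "It k = {i \<in> Hs - D. grp i = Suc k}" for k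
    define Pr where "Pr k f E \<longleftrightarrow> E \<subseteq> It k \<and> card E \<le> card (Bn k) \<and> (\<forall>i\<in>It k - E. f i \<in> Bn k) \<and>
      (\<forall>b\<in>Bn k. sum h {i \<in> It k - E. f i = b} \<le> t (fst b))"
      for k and f :: "nat \<Rightarrow> (nat \<Rightarrow> nat) \<times> nat" and E
    have "\<exists>f E. Pr k f E" if k: "k < m" for k
    proof -
      have f: "finite (It k)" and p: "\<And>i. i \<in> It k \<Longrightarrow> 0 < h i" unfolding It_def using HS posHs by auto
      have le: "sum h (It k) \<le> (\<Sum>b\<in>Bn k. t (fst b))"
      proof -
        have "(\<Sum>b\<in>Bn k. t (fst b)) = (\<Sum>c\<in>Cp. \<Sum>r<c k. t c)"
          unfolding Bn_def using finCp by (subst sum.Sigma) (auto simp: case_prod_unfold)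
        also have "\<dots> = sum h (Gr k)" using cnt[OF k] by (simp add: mult.commute)
        finally have e: "(\<Sum>b\<in>Bn k. t (fst b)) = sum h (Gr k)" .
        show ?thesis
        proof (cases "It k = {}")
          case True
          then have "sum h (It k) = 0" by simp
          moreover have "0 \<le> sum h (Gr k)" by (intro sum_nonneg) (auto simp: Gr_def less_imp_le posHs)
          ultimately show ?thesis using e by simp
        next
          case False
          then obtain j where "j \<in> Hs" "grp j = Suc k" unfolding It_def by auto
          then have "\<exists>j\<in>Hs. k < grp j" by (intro bexI[of _ j]) simp_all
          then have "eta < sum h (Gr k)" unfolding Gr_def using gfull by simp
          moreover have "sum h (It k) \<le> eta" unfolding It_def using gle by (rule spec)
          ultimately show ?thesis using e by linarith
        qed
      qed
      show ?thesis unfolding Pr_def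
        by (rule fill_bins[where cap="\<lambda>b. t (fst b)", OF finBn f p _ le]) (simp_all add: t0)
    qed
    then obtain ag E where Pr: "\<And>k. k < m \<Longrightarrow> Pr k (ag k) (E k)" by metis
    define rest where "rest c = u - sg c" for c
    \<comment> \<open>Both sides of the leftover rectangle are large enough for the area condition
      on narrow items; \<open>kp\<close> is the area that shelves then guarantee.\<close>
    define good where "good c \<longleftrightarrow> om2 < e * rest c \<and> mu < e * t c" for c
    define kp where "kp c = (if good c then (rest c - om2) * (t c - mu) else 0)" for c
    have rest01: "0 \<le> rest c" "rest c \<le> 1" if "c \<in> Cp" for c
      unfolding rest_def using sg_u[OF that] sg0[of c] u by auto
    have e_le: "e * r \<le> r" if "0 \<le> r" for r using e that by (simp add: mult_left_le_one_le)
    have goodD: "om2 < rest c" "mu < t c" if "good c" "c \<in> Cp" for c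
      using that e_le[OF rest01(1)[OF that(2)]] e_le[OF t0[of c]] unfolding good_def by auto
    have kp0: "0 \<le> kp c" if "c \<in> Cp" for c
      unfolding kp_def using goodD[OF _ that] by (auto intro: mult_nonneg_nonneg)
    have waste: "rest c * t c \<le> kp c + (t c * (om2 / e) + mu / e)" if c: "c \<in> Cp" for c
    proof (cases "good c")
      case True
      have "mu \<le> mu / e" "om2 \<le> om2 / e" using e mu(1) om2(1) by (auto simp: le_divide_eq)
      then have "t c * om2 \<le> t c * (om2 / e)" "rest c * mu \<le> 1 * (mu / e)"
        using t0[of c] rest01[OF c] mu(1) by (intro mult_left_mono mult_mono; simp)+
      moreover have "0 \<le> om2 * mu" using om2 mu by simp
      moreover have "(rest c - om2) * (t c - mu) = rest c * t c - rest c * mu - t c * om2 + om2 * mu"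
        by (simp add: algebra_simps)
      ultimately show ?thesis using True unfolding kp_def by (simp only: if_True)
    next
      case False
      then consider "rest c \<le> om2 / e" | "t c \<le> mu / e"
        unfolding good_def using e by (auto simp: le_divide_eq not_less mult.commute)
      then show ?thesis
      proof cases
        case 1
        then have "rest c * t c \<le> om2 / e * t c" using t0 by (intro mult_right_mono)
        moreover have "0 \<le> mu / e" using mu e by simp
        ultimately show ?thesis using False unfolding kp_def by (simp add: mult.commute)
      next
        case 2
        then have "rest c * t c \<le> 1 * (mu / e)" using t0 rest01[OF c] by (intro mult_mono) auto
        moreover have "0 \<le> t c * (om2 / e)" using t0[of c] om2 e by simp
        ultimately show ?thesis using False unfolding kp_def by simp
      qed
    qed
    have totwaste: "(\<Sum>c\<in>Cp. t c * (om2 / e) + mu / e) \<le> xi / 2"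
    proof -
      have "(\<Sum>c\<in>Cp. t c * (om2 / e) + mu / e) = g * (om2 / e) + card Cp * (mu / e)"
        using sumt by (simp only: sum.distrib sum_distrib_right[symmetric] sum_constant)
      also have "\<dots> \<le> 1 * (xi / 4) + Nc * (xi / 4 / Nc)"
      proof (intro add_mono mult_mono)
        show "om2 / e \<le> xi / 4" using om2(3) e by (simp add: divide_le_eq mult.commute)
        show "mu / e \<le> xi / 4 / Nc" using mu(3) e by (simp add: divide_le_eq mult.commute)
      qed (use g cardCp mu e om2 xi in auto)
      also have "\<dots> = xi / 2" using Nc by simp
      finally show ?thesis .
    qed
    \<comment> \<open>The extra bin \<open>None\<close> absorbs the area wasted in the leftover
      rectangles; its contents become part of \<open>S3\<close>.\<close>
    define Bs where "Bs = insert None (Some ` Cp)"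
    define cap where "cap = case_option (xi / 2) kp"
    have finBs: "finite Bs" unfolding Bs_def using finCp by simp
    have cardBs: "card Bs \<le> Nc + 1"
    proof -
      have "card Bs \<le> card (Some ` Cp) + 1" unfolding Bs_def using finCp by (simp add: card_insert_if)
      also have "card (Some ` Cp) \<le> card Cp" using finCp by (rule card_image_le)
      finally show ?thesis using cardCp by simp
    qed
    have "\<exists>asg E. E \<subseteq> Sm \<and> card E \<le> card Bs \<and> (\<forall>i\<in>Sm - E. asg i \<in> Bs) \<and>
      (\<forall>b\<in>Bs. sum (\<lambda>i. w i * h i) {i \<in> Sm - E. asg i = b} \<le> cap b)"
    proof (rule fill_bins[OF finBs HS(6)])
      show "0 < w i * h i" if "i \<in> Sm" for i using pos HS that by auto
      show "0 \<le> cap b" if "b \<in> Bs" for b using that kp0 xi unfolding Bs_def cap_def by auto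
      have "sum cap Bs = xi / 2 + sum kp Cp"
        unfolding Bs_def cap_def using finCp by (subst sum.insert) (auto simp: sum.reindex)
      moreover have "(\<Sum>c\<in>Cp. rest c * t c) \<le> (\<Sum>c\<in>Cp. kp c + (t c * (om2 / e) + mu / e))"
        by (rule sum_mono) (rule waste)
      moreover have "\<dots> = sum kp Cp + (\<Sum>c\<in>Cp. t c * (om2 / e) + mu / e)" by (rule sum.distrib)
      ultimately show "(\<Sum>i\<in>Sm. w i * h i) \<le> sum cap Bs"
        using free totwaste unfolding rest_def by linarith
    qed
    then obtain as Es where Es: "Es \<subseteq> Sm" "card Es \<le> card Bs" "\<forall>i\<in>Sm - Es. as i \<in> Bs"
      "\<forall>b\<in>Bs. sum (\<lambda>i. w i * h i) {i \<in> Sm - Es. as i = b} \<le> cap b" by (elim exE conjE)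
    define Q where "Q = Sigma Cp (\<lambda>c. insert None (Some ` Sl c))"
    define AA where "AA = (\<lambda>(c, q). case q of None \<Rightarrow> box_int (sg c) (yp c) (rest c) (t c)
      | Some q' \<Rightarrow> box_int (xp c q') (yp c) (sw q') (t c))"
    define SS where "SS = (\<lambda>(c, q). case q of None \<Rightarrow> {i \<in> Sm - Es. as i = Some c}
      | Some q' \<Rightarrow> {i \<in> It (fst q') - E (fst q'). ag (fst q') i = (c, snd q')})"
    define S1 where "S1 = (\<Union>q\<in>Q. SS q)"
    \<comment> \<open>Lost wide items: the first group, the items at group boundaries and those that
      overflow a slot.\<close>
    define S2 where "S2 = {i \<in> Hs - D. grp i = 0} \<union> D \<union> (\<Union>k<m. E k)"
    define S3 where "S3 = Es \<union> {i \<in> Sm - Es. as i = None}"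
    have finQ: "finite Q" unfolding Q_def using finCp finSl by auto
    have SlE: "\<exists>k r. q = (k, r) \<and> k < m \<and> r < c k" if "q \<in> Sl c" for q c using that unfolding Sl_def by auto
    have cQ: "containable e w h (AA q) (SS q) 1" if q: "q \<in> Q" for q
    proof -
      obtain c o' where q': "q = (c, o')" "c \<in> Cp" "o' = None \<or> (\<exists>r. o' = Some r \<and> r \<in> Sl c)"
        using q unfolding Q_def by auto
      show ?thesis
      proof (cases o')
        case None
        let ?T = "{i \<in> Sm - Es. as i = Some c}"
        have T: "(\<Sum>i\<in>?T. w i * h i) \<le> kp c" using Es(4) q'(2) unfolding Bs_def cap_def by auto
        have "containable e w h (box_int (sg c) (yp c) (rest c) (t c)) ?T 1"
        proof (cases "good c")
          case True
          then show ?thesis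
          proof (intro containable_small[where om=om2 and mu=mu])
            show "finite ?T" using HS by simp
            show "0 < w i \<and> w i \<le> om2 \<and> 0 < h i \<and> h i \<le> mu" if "i \<in> ?T" for i
              using that pos hmu unfolding Sm_def by auto
            show "(\<Sum>i\<in>?T. w i * h i) \<le> (rest c - om2) * (t c - mu)"
              using T True unfolding kp_def by simp
          qed (use om2 goodD[OF True q'(2)] True in \<open>auto simp: good_def\<close>)
        next
          case False
          have "?T = {}"
          proof (rule ccontr)
            assume "?T \<noteq> {}"
            then have "0 < (\<Sum>i\<in>?T. w i * h i)" using HS pos by (intro sum_pos) auto
            then show False using T False unfolding kp_def by simp
          qed
          then show ?thesis by (simp only: containable_empty)
        qed
        then show ?thesis unfolding AA_def SS_def q'(1) None by simp
      next
        case (Some r)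
        obtain k l where kl: "r = (k, l)" "k < m" "l < c k" using SlE q'(3) Some by blast
        let ?T = "{i \<in> It k - E k. ag k i = (c, l)}"
        have "(c, l) \<in> Bn k" unfolding Bn_def using q'(2) kl by simp
        then have T: "sum h ?T \<le> t c" using Pr[OF kl(2)] unfolding Pr_def by fastforce
        have "containable e w h (box_int (xp c r) (yp c) (mk k) (t c)) ?T 1"
        proof (rule containable_horizontal[OF _ _ T])
          show "finite ?T" unfolding It_def using HS by simp
          fix i assume i: "i \<in> ?T"
          then have iH: "i \<in> Hs" "grp i = Suc k" unfolding It_def by auto
          then show "0 < w i \<and> 0 < h i" using pos HS by blast
          have ne: "Gr k \<noteq> {}"
          proof
            assume "Gr k = {}"
            then have "sum h {i \<in> Hs. grp i = k} = 0" unfolding Gr_def by (simp only: sum.empty)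
            moreover have "\<exists>j\<in>Hs. k < grp j" using iH by (intro bexI[of _ i]) simp_all
            ultimately show False using gfull eta by (metis less_irrefl less_trans)
          qed
          show "w i \<le> mk k" using mk_ge[OF _ ne, of "w i"] gmono iH unfolding Gr_def by auto
        qed
        then show ?thesis unfolding AA_def SS_def q'(1) Some kl(1) sw_def by simp
      qed
    qed
    have AAdisj: "AA q \<inter> AA q' = {}" if qq: "q \<in> Q" "q' \<in> Q" "q \<noteq> q'" for q q'
    proof -
      obtain c o1 where q1: "q = (c, o1)" "c \<in> Cp" "o1 = None \<or> (\<exists>r. o1 = Some r \<and> r \<in> Sl c)"
        using qq(1) unfolding Q_def by auto
      obtain d o2 where q2: "q' = (d, o2)" "d \<in> Cp" "o2 = None \<or> (\<exists>r. o2 = Some r \<and> r \<in> Sl d)"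
        using qq(2) unfolding Q_def by auto
      show ?thesis
      proof (cases "c = d")
        case False
        then have "sep yp t c d" using ypsep q1 q2 by blast
        then show ?thesis unfolding AA_def q1(1) q2(1) sep_def
          by (auto split: option.splits intro!: box_disj)
      next
        case True
        have slot: "xp c r + sw r \<le> sg c" if "r \<in> Sl c" for r using xp[of c] that sumSl[of c] by auto
        have "sep (xp c) sw r r'" if "r \<in> Sl c" "r' \<in> Sl c" "r \<noteq> r'" for r r' using xp[of c] that by blast
        then have slots: "xp c r + sw r \<le> xp c r' \<or> xp c r' + sw r' \<le> xp c r"
          if "r \<in> Sl c" "r' \<in> Sl c" "r \<noteq> r'" for r r' using that unfolding sep_def by blast
        show ?thesis
        proof (cases o1; cases o2)
          assume "o1 = None" "o2 = None"
          then show ?thesis using qq(3) q1(1) q2(1) True by simp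
        next
          fix r assume o: "o1 = None" "o2 = Some r"
          then have "box_int (sg c) (yp c) (rest c) (t c) \<inter> box_int (xp c r) (yp c) (sw r) (t c) = {}"
            using slot[of r] q2(3) True by (intro box_disj) auto
          then show ?thesis unfolding AA_def q1(1) q2(1) True[symmetric] o by simp
        next
          fix r assume o: "o1 = Some r" "o2 = None"
          then have "box_int (xp c r) (yp c) (sw r) (t c) \<inter> box_int (sg c) (yp c) (rest c) (t c) = {}"
            using slot[of r] q1(3) by (intro box_disj) auto
          then show ?thesis unfolding AA_def q1(1) q2(1) True[symmetric] o by simp
        next
          fix r r' assume o: "o1 = Some r" "o2 = Some r'"
          then have "r \<in> Sl c" "r' \<in> Sl c" "r \<noteq> r'" using q1 q2 qq(3) True by auto
          then have "box_int (xp c r) (yp c) (sw r) (t c) \<inter> box_int (xp c r') (yp c) (sw r') (t c) = {}"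
            using slots[of r r'] by (intro box_disj) blast
          then show ?thesis unfolding AA_def q1(1) q2(1) True[symmetric] o by simp
        qed
      qed
    qed
    have AAsub: "(\<Union>q\<in>Q. AA q) \<subseteq> box_int 0 0 u g"
    proof -
      have "AA q \<subseteq> box_int 0 0 u g" if q: "q \<in> Q" for q
      proof -
        obtain c o1 where q1: "q = (c, o1)" "c \<in> Cp" "o1 = None \<or> (\<exists>r. o1 = Some r \<and> r \<in> Sl c)"
          using q unfolding Q_def by auto
        have "0 \<le> yp c" "yp c + t c \<le> g" using yp q1(2) sumt by auto
        moreover have "0 \<le> xp c r" "xp c r + sw r \<le> u" if "r \<in> Sl c" for r
          using xp[of c] that sumSl[of c] sg_u[OF q1(2)] by auto
        ultimately have "box_int (sg c) (yp c) (rest c) (t c) \<subseteq> box_int 0 0 u g"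
          "\<And>r. r \<in> Sl c \<Longrightarrow> box_int (xp c r) (yp c) (sw r) (t c) \<subseteq> box_int 0 0 u g"
          using sg0[of c] unfolding rest_def by (intro box_sub; simp)+
        then show ?thesis using q1(3) unfolding AA_def q1(1) by (elim disjE exE conjE) simp_all
      qed
      then show ?thesis by blast
    qed
    have cardQ: "sum (\<lambda>_. 1) Q \<le> K"
    proof -
      have "card (insert None (Some ` Sl c)) \<le> 1 + m * B" if c: "c \<in> Cp" for c
      proof -
        have "card (Sl c) = (\<Sum>k<m. c k)" unfolding Sl_def by simp
        also have "\<dots> \<le> (\<Sum>k<m. B)" using cB[OF c] by (intro sum_mono) auto
        finally have "card (Sl c) \<le> m * B" by simp
        moreover have "card (Some ` Sl c) \<le> card (Sl c)" using finSl by (rule card_image_le)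
        ultimately show ?thesis using finSl by (simp add: card_insert_if)
      qed
      then have "(\<Sum>c\<in>Cp. card (insert None (Some ` Sl c))) \<le> card Cp * (1 + m * B)"
        using sum_bounded_above[of Cp "\<lambda>c. card (insert None (Some ` Sl c))" "1 + m * B"] by simp
      also have "\<dots> \<le> K" unfolding K_def using cardCp by (rule mult_le_mono1)
      finally show ?thesis unfolding Q_def using finCp finSl by simp
    qed
    have cpn1: "containable e w h (box_int 0 0 u g) S1 K"
      unfolding S1_def
      by (rule containable.mono[OF containable_UN[OF finQ cQ AAdisj] AAsub cardQ])
    have S_eq: "S = S1 \<union> S2 \<union> S3"
    proof
      show "S1 \<union> S2 \<union> S3 \<subseteq> S"
      proof -
        have "SS q \<subseteq> S" for q unfolding SS_def It_def using HS by (auto split: option.splits prod.splits)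
        moreover have "E k \<subseteq> S" if "k < m" for k using Pr[OF that] HS unfolding Pr_def It_def by blast
        ultimately show ?thesis unfolding S1_def S2_def S3_def using HS D Es by blast
      qed
      show "S \<subseteq> S1 \<union> S2 \<union> S3"
      proof
        fix i assume "i \<in> S"
        then consider "i \<in> Hs" | "i \<in> Sm" using HS by blast
        then show "i \<in> S1 \<union> S2 \<union> S3"
        proof cases
          case 1
          show ?thesis
          proof (cases "i \<in> S2")
            case False
            then have "grp i \<noteq> 0" "i \<notin> D" using 1 unfolding S2_def by auto
            then obtain k where k: "grp i = Suc k" by (cases "grp i") auto
            then have km: "k < m" using grpm 1 by force
            have i: "i \<in> It k - E k" using 1 False km k unfolding It_def S2_def by auto
            then have "ag k i \<in> Bn k" using Pr[OF km] unfolding Pr_def by blast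
            then obtain c r where cr: "ag k i = (c, r)" "c \<in> Cp" "r < c k" unfolding Bn_def by auto
            then have "(c, Some (k, r)) \<in> Q" unfolding Q_def Sl_def using km by auto
            moreover have "i \<in> SS (c, Some (k, r))" unfolding SS_def using i cr by simp
            ultimately show ?thesis unfolding S1_def by blast
          qed simp
        next
          case 2
          show ?thesis
          proof (cases "i \<in> S3")
            case False
            then have i: "i \<in> Sm - Es" "as i \<noteq> None" using 2 unfolding S3_def by auto
            then obtain c where c: "as i = Some c" by blast
            then have "c \<in> Cp" using Es(3) i unfolding Bs_def by force
            then have "(c, None) \<in> Q" unfolding Q_def by auto
            moreover have "i \<in> SS (c, None)" unfolding SS_def using i c by simp
            ultimately show ?thesis unfolding S1_def by blast
          qed simp
        qed
      qed
    qed
    have EIt: "E k \<subseteq> It k" "card (E k) \<le> Nb" if "k < m" for k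
      using Pr[OF that] cardBn[OF that] unfolding Pr_def by auto
    have sumS2: "sum h S2 \<le> xi"
    proof -
      have sub: "X \<subseteq> Hs \<Longrightarrow> sum h X \<le> real (card X) * mu" for X
        using sum_bounded_above[of X h mu] hmu HS by auto
      have nn: "X \<subseteq> Hs \<Longrightarrow> 0 \<le> sum h X" for X using posHs by (intro sum_nonneg) (auto simp: less_imp_le subset_iff)
      have un: "sum h (X \<union> Y) \<le> sum h X + sum h Y" if "X \<subseteq> Hs" "Y \<subseteq> Hs" for X Y
      proof -
        have "finite X" "finite Y" using that HS finite_subset by blast+
        then have "sum h (X \<union> Y) + sum h (X \<inter> Y) = sum h X + sum h Y" by (rule sum.union_inter)
        moreover have "0 \<le> sum h (X \<inter> Y)" using that by (intro nn) blast
        ultimately show ?thesis by linarith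
      qed
      let ?E = "\<Union>k<m. E k" and ?G = "{i \<in> Hs - D. grp i = 0}"
      have E: "?E \<subseteq> Hs" using EIt unfolding It_def by blast
      have cE: "card ?E \<le> m * Nb"
      proof -
        have "card ?E \<le> (\<Sum>k<m. card (E k))" by (rule card_UN_le) simp
        also have "\<dots> \<le> (\<Sum>k<m. Nb)" using EIt by (intro sum_mono) auto
        finally show ?thesis by simp
      qed
      have "sum h S2 \<le> sum h (?G \<union> D) + sum h ?E" unfolding S2_def using D E by (intro un) auto
      also have "sum h (?G \<union> D) \<le> sum h ?G + sum h D" using D by (intro un) auto
      also have "sum h ?G \<le> eta" using gle by blast
      also have "sum h D \<le> real m * mu" using sub[OF D(1)] D(2) mu(1) by (meson mult_right_mono of_nat_le_iff order_trans less_imp_le)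
      also have "sum h ?E \<le> real (m * Nb) * mu"
        using sub[OF E] cE mu(1) by (meson mult_right_mono of_nat_le_iff order_trans less_imp_le)
      finally have "sum h S2 \<le> eta + (real m * mu + real (m * Nb) * mu)" by simp
      also have "real m * mu + real (m * Nb) * mu \<le> mu * dd" unfolding dd_def using mu(1) by (simp add: algebra_simps)
      also have "\<dots> \<le> xi / 4" using mu(2) by (simp only: pos_le_divide_eq[OF dd])
      finally show ?thesis unfolding eta_def using xi by simp
    qed
    have sumS3: "(\<Sum>i\<in>S3. w i * h i) \<le> xi"
    proof -
      let ?N = "{i \<in> Sm - Es. as i = None}"
      have fE: "finite Es" "finite ?N" using Es HS finite_subset by auto
      have "(\<Sum>i\<in>S3. w i * h i) = (\<Sum>i\<in>Es. w i * h i) + (\<Sum>i\<in>?N. w i * h i)"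
        unfolding S3_def using fE by (intro sum.union_disjoint) auto
      moreover have "(\<Sum>i\<in>?N. w i * h i) \<le> xi / 2" using Es(4) unfolding Bs_def cap_def by auto
      moreover have "(\<Sum>i\<in>Es. w i * h i) \<le> real (card Es) * mu"
      proof (rule sum_bounded_above)
        fix i assume "i \<in> Es"
        then have i: "i \<in> S" "w i \<le> om2" using Es unfolding Sm_def by auto
        have "w i * h i \<le> 1 * mu" using i hmu[OF i(1)] pos[OF i(1)] om2 by (intro mult_mono) auto
        then show "w i * h i \<le> mu" by simp
      qed
      moreover have "real (card Es) * mu \<le> xi / 4"
      proof -
        have "real (card Es) * mu \<le> (Nc + 1) * mu" using Es(2) cardBs mu(1) by (intro mult_right_mono) auto
        also have "\<dots> \<le> xi / 4" using mu(4) by (simp add: field_simps)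
        finally show ?thesis .
      qed
      ultimately show ?thesis using xi by linarith
    qed
    have S3om: "\<forall>i\<in>S3. w i \<le> om2" unfolding S3_def using Es unfolding Sm_def by auto
    show ?thesis
      by (rule exI[of _ S1], rule exI[of _ S2], rule exI[of _ S3], intro conjI)
        (fact S_eq cpn1 sumS2 sumS3 S3om)+
  qed
  show ?thesis
  proof (rule exI[of _ om2], intro conjI, rule om2(1), rule om2(2), rule exI[of _ mu], intro conjI,
      rule mu(1), rule exI[of _ K], intro allI impI, elim conjE)
    fix w h x y :: "nat \<Rightarrow> real" and S u g
    assume "packed w h x y S u g" "0 \<le> u" "u \<le> 1" "0 \<le> g" "g \<le> 1" "\<forall>i\<in>S. h i \<le> mu \<and> (om1 < w i \<or> w i \<le> om2)"
    from main[OF this] show "\<exists>S1 S2 S3. S = S1 \<union> S2 \<union> S3 \<and> containable e w h (box_int 0 0 u g) S1 K \<and>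
      sum h S2 \<le> xi \<and> (\<Sum>i\<in>S3. w i * h i) \<le> xi \<and> (\<forall>i\<in>S3. w i \<le> om2)" .
  qed
qed

section \<open>Resource augmentation\<close>

lemma sep_affine:
  assumes "0 < a" "sep x w i j"
  shows "sep (\<lambda>i. a * x i + c) (\<lambda>i. a * w i) i j"
proof -
  have "a * u \<le> a * v" if "u \<le> v" for u v using assms(1) that by simp
  from this[of "x i + w i" "x j"] this[of "x j + w j" "x i"] show ?thesis
    using assms(2) unfolding sep_def by (auto simp: distrib_left)
qed

lemma affine_box:
  assumes "0 < a" "0 < b"
  shows "(\<lambda>p. (a * fst p + c, b * snd p + d)) ` box_int X Y A B = box_int (a * X + c) (b * Y + d) (a * A) (b * B)"
    (is "?f ` _ = ?R")
proof
  show "?f ` box_int X Y A B \<subseteq> ?R"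
  proof
    fix q assume "q \<in> ?f ` box_int X Y A B"
    then obtain r where r: "q = ?f r" "r \<in> box_int X Y A B" by blast
    define s t where "s = fst r" and "t = snd r"
    have st: "q = (a * s + c, b * t + d)" "X < s" "s < X + A" "Y < t" "t < Y + B"
      using r unfolding box_int_def s_def t_def by auto
    have "a * X < a * s" "a * s < a * (X + A)" "b * Y < b * t" "b * t < b * (Y + B)"
      using st assms by simp_all
    then show "q \<in> ?R" unfolding st(1) box_int_def by (simp add: distrib_left)
  qed
  show "?R \<subseteq> ?f ` box_int X Y A B"
  proof
    fix q assume q: "q \<in> ?R"
    obtain s t where st: "q = (s, t)" by (cases q)
    have "((s - c) / a, (t - d) / b) \<in> box_int X Y A B"
      using q assms unfolding st box_int_def by (simp add: field_simps)
    moreover have "q = ?f ((s - c) / a, (t - d) / b)" using assms unfolding st by simp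
    ultimately show "q \<in> ?f ` box_int X Y A B" by blast
  qed
qed

lemma container_affine:
  assumes "0 < a" "0 < b" "container e w h X Y A B S"
  shows "container e (\<lambda>i. a * w i) (\<lambda>i. b * h i) (a * X + c) (b * Y + d) (a * A) (b * B) S"
proof -
  obtain lab px py where p: "0 < A" "0 < B"
    "\<forall>i\<in>S. X \<le> px i \<and> px i + w i \<le> X + A \<and> Y \<le> py i \<and> py i + h i \<le> Y + B"
    "\<forall>i\<in>S. \<forall>j\<in>S. i \<noteq> j \<longrightarrow> (case lab of Horizontal \<Rightarrow> sep py h i j | Vertical \<Rightarrow> sep px w i j
       | Area \<Rightarrow> sep px w i j \<or> sep py h i j)"
    "lab = Area \<longrightarrow> (\<forall>i\<in>S. w i \<le> e * A \<and> h i \<le> e * B)"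
    using assms(3) unfolding container_def by blast
  show ?thesis
  proof (rule containerI[where lab=lab and px="\<lambda>i. a * px i + c" and py="\<lambda>i. b * py i + d"])
    show "\<forall>i\<in>S. a * X + c \<le> a * px i + c \<and> a * px i + c + a * w i \<le> a * X + c + a * A \<and>
      b * Y + d \<le> b * py i + d \<and> b * py i + d + b * h i \<le> b * Y + d + b * B"
    proof
      fix i assume "i \<in> S"
      then have "X \<le> px i" "px i + w i \<le> X + A" "Y \<le> py i" "py i + h i \<le> Y + B" using p(3) by auto
      then have "a * X \<le> a * px i" "a * (px i + w i) \<le> a * (X + A)" "b * Y \<le> b * py i"
        "b * (py i + h i) \<le> b * (Y + B)"
        using assms by simp_all
      then show "a * X + c \<le> a * px i + c \<and> a * px i + c + a * w i \<le> a * X + c + a * A \<and>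
        b * Y + d \<le> b * py i + d \<and> b * py i + d + b * h i \<le> b * Y + d + b * B"
        by (simp add: distrib_left)
    qed
    show "\<forall>i\<in>S. \<forall>j\<in>S. i \<noteq> j \<longrightarrow> (case lab of
        Horizontal \<Rightarrow> sep (\<lambda>i. b * py i + d) (\<lambda>i. b * h i) i j
      | Vertical \<Rightarrow> sep (\<lambda>i. a * px i + c) (\<lambda>i. a * w i) i j
      | Area \<Rightarrow> sep (\<lambda>i. a * px i + c) (\<lambda>i. a * w i) i j \<or> sep (\<lambda>i. b * py i + d) (\<lambda>i. b * h i) i j)"
    proof (intro ballI impI)
      fix i j assume "i \<in> S" "j \<in> S" "i \<noteq> j"
      then have "case lab of Horizontal \<Rightarrow> sep py h i j | Vertical \<Rightarrow> sep px w i j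
       | Area \<Rightarrow> sep px w i j \<or> sep py h i j" using p(4) by blast
      then show "case lab of
          Horizontal \<Rightarrow> sep (\<lambda>i. b * py i + d) (\<lambda>i. b * h i) i j
        | Vertical \<Rightarrow> sep (\<lambda>i. a * px i + c) (\<lambda>i. a * w i) i j
        | Area \<Rightarrow> sep (\<lambda>i. a * px i + c) (\<lambda>i. a * w i) i j \<or> sep (\<lambda>i. b * py i + d) (\<lambda>i. b * h i) i j"
        by (cases lab) (auto intro: sep_affine[OF assms(1)] sep_affine[OF assms(2)])
    qed
    show "lab = Area \<longrightarrow> (\<forall>i\<in>S. a * w i \<le> e * (a * A) \<and> b * h i \<le> e * (b * B))"
      using p(5) assms by (simp add: mult.left_commute)
  qed (use p assms in auto)
qed

lemma containable_affine:
  assumes "0 < a" "0 < b" "containable e w h A S n"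
  shows "containable e (\<lambda>i. a * w i) (\<lambda>i. b * h i) ((\<lambda>p. (a * fst p + c, b * snd p + d)) ` A) S n"
  using assms(3)
proof (induction rule: containable.induct)
  case (empty A)
  then show ?case by (rule containable.empty)
next
  case (single X Y A' B' S A)
  show ?case
    by (rule containable.single[OF container_affine[OF assms(1,2) single.hyps(1), of c d]])
      (use single.hyps(2) in \<open>unfold affine_box[OF assms(1,2), symmetric], blast\<close>)
next
  case (union A S m B T n)
  have "inj (\<lambda>p. (a * fst p + c, b * snd p + d))" using assms by (auto simp: inj_def prod_eq_iff)
  then have "(\<lambda>p. (a * fst p + c, b * snd p + d)) ` A \<inter> (\<lambda>p. (a * fst p + c, b * snd p + d)) ` B = {}"
    using union.hyps by (simp add: image_Int[symmetric])
  then show ?case unfolding image_Un using union by (intro containable.union) auto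
next
  case (mono A S m B n)
  then show ?case by (meson containable.mono image_mono)
qed

lemma containable_translate:
  assumes "containable e w h (box_int 0 0 u g) S n"
  shows "containable e w h (box_int X Y u g) S n"
  using containable_affine[of 1 1, OF _ _ assms, of X Y] affine_box[of 1 1 X Y 0 0 u g] by simp

lemma containable_scale:
  assumes "containable e (\<lambda>i. w i / a) (\<lambda>i. h i / b) (box_int 0 0 A B) S n" "0 < a" "0 < b"
  shows "containable e w h (box_int 0 0 (a * A) (b * B)) S n"
  using containable_affine[OF assms(2,3,1), of 0 0] affine_box[OF assms(2,3), of 0 0 0 0 A B] assms(2,3) by simp

lemma containable_transpose:
  assumes "containable e w h A S n"
  shows "containable e h w (prod.swap ` A) S n"
  using assms
proof (induction rule: containable.induct)
  case (empty A)
  then show ?case by (rule containable.empty)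
next
  case (single X Y a b S A)
  obtain lab px py where p: "0 < a" "0 < b"
    "\<forall>i\<in>S. X \<le> px i \<and> px i + w i \<le> X + a \<and> Y \<le> py i \<and> py i + h i \<le> Y + b"
    "\<forall>i\<in>S. \<forall>j\<in>S. i \<noteq> j \<longrightarrow> (case lab of Horizontal \<Rightarrow> sep py h i j | Vertical \<Rightarrow> sep px w i j
       | Area \<Rightarrow> sep px w i j \<or> sep py h i j)"
    "lab = Area \<longrightarrow> (\<forall>i\<in>S. w i \<le> e * a \<and> h i \<le> e * b)"
    using single.hyps(1) unfolding container_def by blast
  define lab' where "lab' = (case lab of Horizontal \<Rightarrow> Vertical | Vertical \<Rightarrow> Horizontal | Area \<Rightarrow> Area)"
  have "container e h w Y X b a S"
  proof (rule containerI[where lab=lab' and px=py and py=px])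
    show "\<forall>i\<in>S. \<forall>j\<in>S. i \<noteq> j \<longrightarrow> (case lab' of Horizontal \<Rightarrow> sep px w i j | Vertical \<Rightarrow> sep py h i j
       | Area \<Rightarrow> sep py h i j \<or> sep px w i j)"
      using p(4) unfolding lab'_def by (cases lab) auto
    show "lab' = Area \<longrightarrow> (\<forall>i\<in>S. h i \<le> e * b \<and> w i \<le> e * a)"
      using p(5) unfolding lab'_def by (cases lab) auto
  qed (use p in auto)
  moreover have "box_int Y X b a = prod.swap ` box_int X Y a b" unfolding box_int_def by (simp add: product_swap)
  ultimately show ?case using single.hyps(2) by (metis containable.single image_mono)
next
  case (union A S m B T n)
  have "prod.swap ` A \<inter> prod.swap ` B = {}"
    using union.hyps by (auto simp: prod.swap_def)
  then show ?case unfolding image_Un using union by (intro containable.union) auto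
next
  case (mono A S m B n)
  then show ?case by (meson containable.mono image_mono)
qed

lemma containable_cong:
  assumes "containable e w h A S n" "\<And>i. i \<in> S \<Longrightarrow> w' i = w i \<and> h' i = h i"
  shows "containable e w' h' A S n"
  using assms
proof (induction rule: containable.induct)
  case (empty A)
  then show ?case by (simp add: containable.empty)
next
  case (single X Y a b S A)
  have "sep px w' i j = sep px w i j" "sep py h' i j = sep py h i j" if "i \<in> S" "j \<in> S" for px py i j
    using single.prems that unfolding sep_def by simp_all
  then have "container e w' h' X Y a b S"
    using single.hyps(1) single.prems unfolding container_def
    by (elim conjE exE, intro conjI exI) (auto split: container_label.splits)
  then show ?case using single.hyps(2) by (rule containable.single)
next
  case (union A S m B T n)
  then show ?case by (intro containable.union) auto
next
  case (mono A S m B n)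
  then show ?case by (meson containable.mono)
qed

text \<open>The losses per slab and the number of cells from \<open>class_solvable\<close> depend
  only on \<open>card C\<close>, so one \<open>K\<close> serves all sets of items with these
  classes.\<close>

lemma class_arrangement:
  fixes C :: "'c set" and comp :: "'c \<Rightarrow> 'c \<Rightarrow> bool" and eps :: real
  assumes "0 < eps" "eps \<le> 1" "finite C" "\<And>c. \<not> comp c c" "\<And>c d. comp c d \<Longrightarrow> comp d c"
  shows "\<exists>K. \<forall>(I::'i set) x s p cl U V.
    finite I \<and> (\<forall>i\<in>I. 0 < s i \<and> 0 \<le> p i) \<and> (\<forall>i\<in>I. U \<le> x i \<and> x i + s i \<le> V) \<and> cl ` I \<subseteq> C \<and>
    (\<forall>i\<in>I. \<forall>j\<in>I. i \<noteq> j \<longrightarrow> sep x s i j \<or> comp (cl i) (cl j)) \<longrightarrow>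
    (\<exists>I'\<subseteq>I. sum p (I - I') \<le> 3 * eps * sum p I \<and> arrangeable cl (\<lambda>i j. comp (cl i) (cl j)) s I' U V K)"
proof -
  let ?q = "card C * 2 ^ card C"
  from high_low_arrangement[OF assms(1,2), of "card C" ?q ?q]
  obtain K where K: "\<forall>(I::'i set) x s p (cl :: 'i \<Rightarrow> 'c) cmp U V.
    finite I \<and> (\<forall>i\<in>I. 0 < s i \<and> 0 \<le> p i) \<and> (\<forall>i\<in>I. U \<le> x i \<and> x i + s i \<le> V) \<and>
    (\<forall>i j. cmp i j \<longrightarrow> cl i \<noteq> cl j) \<and> (\<forall>i j. cmp i j \<longrightarrow> cmp j i) \<and> card (cl ` I) \<le> card C \<and>
    (\<forall>i\<in>I. \<forall>j\<in>I. i \<noteq> j \<longrightarrow> sep x s i j \<or> cmp i j) \<and> solvable cl cmp x s p I ?q ?q eps \<longrightarrow>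
    (\<exists>I'\<subseteq>I. sum p (I - I') \<le> 3 * eps * sum p I \<and> arrangeable cl cmp s I' U V K)" by (elim exE)
  show ?thesis
  proof (rule exI[of _ K], intro allI impI, elim conjE)
    fix I :: "'i set" and x s p :: "'i \<Rightarrow> real" and cl :: "'i \<Rightarrow> 'c" and U V
    assume a: "finite I" "\<forall>i\<in>I. 0 < s i \<and> 0 \<le> p i" "\<forall>i\<in>I. U \<le> x i \<and> x i + s i \<le> V" "cl ` I \<subseteq> C"
      "\<forall>i\<in>I. \<forall>j\<in>I. i \<noteq> j \<longrightarrow> sep x s i j \<or> comp (cl i) (cl j)"
    have "solvable cl (\<lambda>i j. comp (cl i) (cl j)) x s p I ?q ?q eps"
      by (rule class_solvable) (use a assms in auto)
    moreover have "card (cl ` I) \<le> card C" using a assms(3) by (intro card_mono)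
    moreover have "\<forall>i j. comp (cl i) (cl j) \<longrightarrow> cl i \<noteq> cl j" using assms(4) by metis
    moreover have "\<forall>i j. comp (cl i) (cl j) \<longrightarrow> comp (cl j) (cl i)" using assms(5) by blast
    ultimately show "\<exists>I'\<subseteq>I. sum p (I - I') \<le> 3 * eps * sum p I \<and> arrangeable cl (\<lambda>i j. comp (cl i) (cl j)) s I' U V K"
      using a by (intro K[rule_format] conjI) assumption+
  qed
qed

text \<open>A class \<open>(r, r', t)\<close> occupies the rows \<open>r\<close> to \<open>r' - 1\<close>; \<open>t\<close> is 0 for a tall item, 1 for a wide and 2 for a narrow
block.\<close>

definition disjoint_rows :: "nat \<times> nat \<times> nat \<Rightarrow> nat \<times> nat \<times> nat \<Rightarrow> bool" where
  "disjoint_rows c d \<longleftrightarrow> fst c < fst (snd c) \<and> fst d < fst (snd d) \<and> (fst (snd c) \<le> fst d \<or> fst (snd d) \<le> fst c)"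

section \<open>Rows, blocks and gaps between sizes\<close>

lemma ceil_nat: "0 \<le> z \<Longrightarrow> z \<le> real (nat \<lceil>z\<rceil>) \<and> real (nat \<lceil>z\<rceil>) < z + 1"
  by linarith

lemma floor_nat: "0 \<le> z \<Longrightarrow> real (nat \<lfloor>z\<rfloor>) \<le> z \<and> z < real (nat \<lfloor>z\<rfloor>) + 1"
  by linarith

text \<open>The arrangement of classes and the packing of blocks enter as hypotheses because the
  constants depend on each other: \<open>om\<close> and \<open>xi\<close> on \<open>KC\<close>, and
  \<open>mu\<close> on the packing of blocks. Half of the extra height \<open>del\<close> stretches
  the positions; the other half forms four strips of height \<open>del / 8\<close> for short items
  crossing a row boundary, for narrow containers, and for the two kinds of leftovers of wide
  blocks.\<close>

lemma aligned_packing: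
  fixes e del rho g mu om oma omb xi eps :: real and n KC KB NB :: nat
    and w h p x y :: "nat \<Rightarrow> real"
  assumes e: "0 < e" "e \<le> 1" and del: "0 < del" "del \<le> 1" and rho: "0 < rho"
    and g: "0 < g" "real n * g = 1 + del / 2" "g \<le> del * rho / 4" "g \<le> del / 8"
    and om: "0 < om" "om * (KC + 2) \<le> e" "oma \<le> om" "0 < omb" "omb < oma"
    and NB: "NB = nat \<lfloor>1 / om\<rfloor>" and xi: "0 \<le> xi" "KC * NB * xi \<le> del / 64"
    and mu: "0 < mu" "mu < rho" "n * mu \<le> del / 8" "mu \<le> e * g" "mu \<le> e * del / 8" "mu \<le> del / 16"
    and CLp: "\<forall>(I::nat set set) x s p cl U V.
      finite I \<and> (\<forall>i\<in>I. 0 < s i \<and> 0 \<le> p i) \<and> (\<forall>i\<in>I. U \<le> x i \<and> x i + s i \<le> V) \<and> cl ` I \<subseteq> {..n} \<times> {..n} \<times> {..2} \<and>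
      (\<forall>i\<in>I. \<forall>j\<in>I. i \<noteq> j \<longrightarrow> sep x s i j \<or> disjoint_rows (cl i) (cl j)) \<longrightarrow>
      (\<exists>I'\<subseteq>I. sum p (I - I') \<le> 3 * eps * sum p I \<and> arrangeable cl (\<lambda>i j. disjoint_rows (cl i) (cl j)) s I' U V KC)"
    and BLp: "\<forall>w h x y S u g. packed w h x y S u g \<and>
      0 \<le> u \<and> u \<le> 1 \<and> 0 \<le> g \<and> g \<le> 1 \<and> (\<forall>i\<in>S. h i \<le> mu \<and> (oma < w i \<or> w i \<le> omb)) \<longrightarrow>
      (\<exists>S1 S2 S3. S = S1 \<union> S2 \<union> S3 \<and> containable e w h (box_int 0 0 u g) S1 KB \<and>
        sum h S2 \<le> xi \<and> (\<Sum>i\<in>S3. w i * h i) \<le> xi \<and> (\<forall>i\<in>S3. w i \<le> omb))"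
    and pkR: "packed w h x y R 1 1" and p0: "\<forall>i\<in>R. 0 \<le> p i" and eps: "0 < eps"
    and gap: "\<forall>i\<in>R. h i \<le> mu \<or> rho < h i" "\<forall>i\<in>R. w i \<le> omb \<or> oma < w i"
  shows "\<exists>R'\<subseteq>R. sum p (R - R') \<le> 3 * eps * sum p R \<and>
    containable e w h (box_int 0 0 1 (1 + del)) R' (KC * (1 + NB * KB) + n + 3)"
proof -
  have fin: "finite R" using pkR unfolding packed_def by blast
  have R: "0 < w i" "0 < h i" "0 \<le> x i" "x i + w i \<le> 1" "0 \<le> y i" "y i + h i \<le> 1" if "i \<in> R" for i
    using pkR that unfolding packed_def by blast+
  have Rsep: "sep x w i j \<or> sep y h i j" if "i \<in> R" "j \<in> R" "i \<noteq> j" for i j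
    using pkR that unfolding packed_def by blast
  have gmono: "real a * g \<le> real b * g" if "a \<le> b" for a b :: nat
    using that g(1) by (intro mult_right_mono) auto
  have gless: "a \<le> b" if "real a * g < (real b + 1) * g" for a b :: nat
    using that g(1) by (simp add: mult_less_cancel_right)
  define d1 where "d1 = 1 + del / 2"
  have d1: "1 < d1" "d1 \<le> 3 / 2" unfolding d1_def using del by auto
  \<comment> \<open>Only positions are stretched, not heights, so a tall item gains more than
    \<open>del / 2 * rho\<close> of vertical room, which is at least two rows.\<close>
  define y1 where "y1 i = d1 * y i" for i
  have y1_0: "0 \<le> y1 i" if "i \<in> R" for i unfolding y1_def using R(5)[OF that] d1 by simp
  have ytop: "y1 i + h i \<le> d1 * (y i + h i)" "d1 * (y i + h i) \<le> real n * g" if "i \<in> R" for i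
  proof -
    have "1 * h i \<le> d1 * h i" using R(2)[OF that] d1 by (intro mult_right_mono) auto
    then show "y1 i + h i \<le> d1 * (y i + h i)" unfolding y1_def by (simp add: distrib_left)
    have "d1 * (y i + h i) \<le> d1 * 1" using R(6)[OF that] d1 by (intro mult_left_mono) auto
    then show "d1 * (y i + h i) \<le> real n * g" using g(2) unfolding d1_def by simp
  qed
  have ysep: "d1 * (y i + h i) \<le> y1 j \<or> d1 * (y j + h j) \<le> y1 i"
    if "i \<in> R" "j \<in> R" "i \<noteq> j" "\<not> sep x w i j" for i j
  proof -
    have "sep y h i j" using Rsep that by blast
    then show ?thesis unfolding sep_def y1_def using d1 by auto
  qed
  define Tl where "Tl = {i \<in> R. rho < h i}"
  define Sh where "Sh = {i \<in> R. h i \<le> mu}"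
  have TS: "Tl \<subseteq> R" "Sh \<subseteq> R" "R = Tl \<union> Sh" "Tl \<inter> Sh = {}" unfolding Tl_def Sh_def using gap(1) mu(2) by auto
  \<comment> \<open>A tall item gets the full rows inside its stretched interval. Rounding inwards
    costs less than two rows, so its height still fits, and vertically separated items get disjoint
    rows.\<close>
  define lo where "lo i = nat \<lceil>y1 i / g\<rceil>" for i
  define hi where "hi i = nat \<lfloor>d1 * (y i + h i) / g\<rfloor>" for i
  have lo: "y1 i \<le> real (lo i) * g" "real (lo i) * g < y1 i + g" if "i \<in> R" for i
  proof -
    have "y1 i / g \<le> real (lo i) \<and> real (lo i) < y1 i / g + 1"
      unfolding lo_def using y1_0[OF that] g(1) by (intro ceil_nat) simp
    then show "y1 i \<le> real (lo i) * g" "real (lo i) * g < y1 i + g"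
      using g(1) by (auto simp: field_simps)
  qed
  have hi: "real (hi i) * g \<le> d1 * (y i + h i)" "d1 * (y i + h i) < real (hi i) * g + g" if "i \<in> R" for i
  proof -
    have "0 \<le> d1 * (y i + h i) / g" using R(2,5)[OF that] g(1) d1 by simp
    then have "real (hi i) \<le> d1 * (y i + h i) / g \<and> d1 * (y i + h i) / g < real (hi i) + 1"
      unfolding hi_def by (rule floor_nat)
    then show "real (hi i) * g \<le> d1 * (y i + h i)" "d1 * (y i + h i) < real (hi i) * g + g"
      using g(1) by (auto simp: field_simps)
  qed
  have tall: "h i \<le> (real (hi i) - real (lo i)) * g" "lo i < hi i" "hi i \<le> n" if "i \<in> Tl" for i
  proof -
    have i: "i \<in> R" "rho < h i" using that unfolding Tl_def by auto
    have "del / 2 * rho \<le> del / 2 * h i" using i del by (intro mult_left_mono) auto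
    then have "2 * g \<le> del / 2 * h i" using g(3) by simp
    moreover have "d1 * (y i + h i) = y1 i + h i + del / 2 * h i" unfolding y1_def d1_def by (simp add: algebra_simps)
    ultimately have "h i \<le> real (hi i) * g - real (lo i) * g"
      using lo(2)[OF i(1)] hi(2)[OF i(1)] by linarith
    then show 1: "h i \<le> (real (hi i) - real (lo i)) * g" by (simp add: left_diff_distrib)
    have "0 < (real (hi i) - real (lo i)) * g" using 1 R(2)[OF i(1)] by linarith
    then show "lo i < hi i" using g(1) by (simp add: zero_less_mult_iff)
    have "real (hi i) * g < (real n + 1) * g"
      using hi(1)[OF i(1)] ytop(2)[OF i(1)] g(1) by (simp add: distrib_right)
    then show "hi i \<le> n" by (rule gless)
  qed
  define row where "row i = nat \<lfloor>y1 i / g\<rfloor>" for i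
  have row: "real (row i) * g \<le> y1 i" "y1 i < (real (row i) + 1) * g" "row i < n" if "i \<in> R" for i
  proof -
    have *: "real (row i) \<le> y1 i / g \<and> y1 i / g < real (row i) + 1"
      unfolding row_def using y1_0[OF that] g(1) by (intro floor_nat) simp
    then show 1: "real (row i) * g \<le> y1 i" "y1 i < (real (row i) + 1) * g"
      using g(1) by (auto simp: field_simps)
    have "real (row i) * g < real n * g" using 1 ytop[OF that] R(2)[OF that] by linarith
    then show "row i < n" using g(1) by simp
  qed
  \<comment> \<open>These items leave the rows: those of one row all cross its upper boundary, hence
    stand side by side, and fit into one strip of height \<open>mu\<close>.\<close>
  define Cr where "Cr = {i \<in> Sh. (real (row i) + 1) * g < y1 i + h i}"
  define Ns where "Ns = Sh - Cr"
  have NsR: "Ns \<subseteq> R" "Cr \<subseteq> R" "finite Ns" "finite Cr" "finite Tl"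
    unfolding Ns_def Cr_def using TS fin finite_subset by auto
  have Ns_y: "y1 i + h i \<le> (real (row i) + 1) * g" if "i \<in> Ns" for i
    using that unfolding Ns_def Cr_def by auto
  have Ns_h: "h i \<le> mu" if "i \<in> Ns" for i using that unfolding Ns_def Sh_def by auto
    \<comment> \<open>short items with equal row and \<open>Lf\<close> have no tall item of that row between them\<close>
  define Lf where "Lf i = {t \<in> Tl. lo t \<le> row i \<and> row i < hi t \<and> x t < x i}" for i
  define key where "key i = (row i, Lf i)" for i
  define Bk where "Bk k = {i \<in> Ns. key i = k}" for k
  define Keys where "Keys = key ` Ns"
  \<comment> \<open>The objects to be arranged are sets of items: a tall item as a singleton, a
    block as the set of its short items. Profits of objects are sums, so the loss bound carries
    over.\<close>
  define I where "I = (\<lambda>t. {t}) ` Tl \<union> Bk ` Keys"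
  have finI: "finite I" unfolding I_def Keys_def using NsR by simp
  have IR: "A \<subseteq> R" "finite A" "A \<noteq> {}" if "A \<in> I" for A
  proof -
    show "A \<subseteq> R" using that TS NsR unfolding I_def Bk_def by auto
    then show "finite A" using fin finite_subset by blast
    show "A \<noteq> {}" using that unfolding I_def Keys_def Bk_def by auto
  qed
  define X where "X A = Min (x ` A)" for A
  define Wd where "Wd A = Max ((\<lambda>i. x i + w i) ` A) - X A" for A
  have hull: "X A \<le> x i" "x i + w i \<le> X A + Wd A" if "A \<in> I" "i \<in> A" for A i
    unfolding Wd_def X_def using that IR[OF that(1)] by auto
  have X_ge: "r \<le> X A" if "A \<in> I" "\<And>i. i \<in> A \<Longrightarrow> r \<le> x i" for A r
    unfolding X_def using that IR[OF that(1)] by auto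
  have XW_le: "X A + Wd A \<le> r" if "A \<in> I" "\<And>i. i \<in> A \<Longrightarrow> x i + w i \<le> r" for A r
    unfolding Wd_def using that IR[OF that(1)] by auto
  have X01: "0 \<le> X A" "X A + Wd A \<le> 1" if "A \<in> I" for A
    using X_ge[OF that] XW_le[OF that] IR[OF that] R by blast+
  have Wpos: "0 < Wd A" if A: "A \<in> I" for A
  proof -
    obtain i where "i \<in> A" using IR[OF A] by blast
    then show ?thesis using hull[OF A] R(1) IR[OF A] by fastforce
  qed
  have single: "X {t} = x t" "Wd {t} = w t" for t unfolding X_def Wd_def by auto
  \<comment> \<open>The stretched interval of a tall item covering the row of \<open>i\<close> meets
    that of \<open>i\<close>, so the two items can only be separated horizontally.\<close>
  have sep_block: "(t \<in> Lf i \<longrightarrow> x t + w t \<le> x i) \<and> (t \<notin> Lf i \<longrightarrow> x i + w i \<le> x t)"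
    if t: "t \<in> Tl" "lo t \<le> row i" "row i < hi t" and i: "i \<in> Ns" for t i
  proof -
    have iR: "i \<in> R" "t \<in> R" "i \<noteq> t" using i t NsR TS unfolding Ns_def by auto
    have "sep x w i t"
    proof (rule ccontr)
      assume "\<not> sep x w i t"
      then consider "d1 * (y i + h i) \<le> y1 t" | "d1 * (y t + h t) \<le> y1 i" using ysep iR by blast
      then show False
      proof cases
        case 1
        then have "d1 * (y i + h i) \<le> real (row i) * g" using lo(1)[OF iR(2)] gmono[OF t(2)] lo(2)[OF iR(2)]
          using ytop(1)[OF iR(1)] row(1)[OF iR(1)] tall[OF t(1)] R(2)[OF iR(1)] by linarith
        then show False using ytop(1)[OF iR(1)] row(1)[OF iR(1)] R(2)[OF iR(1)] by linarith
      next
        case 2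
        then have "real (hi t) * g < (real (row i) + 1) * g" using hi(1)[OF iR(2)] row(2)[OF iR(1)] by linarith
        then have "hi t \<le> row i" by (rule gless)
        then show False using t by simp
      qed
    qed
    then show ?thesis using t R(1)[OF iR(1)] R(1)[OF iR(2)] unfolding sep_def Lf_def by auto
  qed
  \<comment> \<open>Any representative will do: a tall object has one item, and the items of a block
    are all short and share their row.\<close>
  define cls where "cls A = (let i = (SOME i. i \<in> A) in if rho < h i then (lo i, hi i, 0)
    else (row i, Suc (row i), if om \<le> Wd A then 1 else 2 :: nat))" for A
  have cls_t: "cls {t} = (lo t, hi t, 0)" if "t \<in> Tl" for t
    using that unfolding cls_def Tl_def by simp
  have cls_b: "cls (Bk k) = (fst k, Suc (fst k), if om \<le> Wd (Bk k) then 1 else 2)" if "k \<in> Keys" for k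
  proof -
    have "Bk k \<noteq> {}" using that unfolding Keys_def Bk_def by auto
    then have "(SOME i. i \<in> Bk k) \<in> Bk k" unfolding some_in_eq .
    moreover have "\<not> rho < h i" "row i = fst k" if "i \<in> Bk k" for i
      using that Ns_h[of i] mu(2) unfolding Bk_def key_def by auto
    ultimately show ?thesis unfolding cls_def Let_def by simp
  qed
  have IC: "(\<exists>t\<in>Tl. A = {t}) \<or> (\<exists>k\<in>Keys. A = Bk k)" if "A \<in> I" for A using that unfolding I_def by auto
  have Keys_n: "fst k < n" if "k \<in> Keys" for k
    using that row(3) NsR unfolding Keys_def key_def by auto
  have clsC: "cls ` I \<subseteq> {..n} \<times> {..n} \<times> {..2}"
  proof
    fix c assume "c \<in> cls ` I"
    then obtain A where A: "A \<in> I" "c = cls A" by blast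
    from IC[OF A(1)] show "c \<in> {..n} \<times> {..n} \<times> {..2}"
    proof (elim disjE bexE)
      fix t assume "t \<in> Tl" "A = {t}"
      then show ?thesis using A cls_t tall[of t] by auto
    next
      fix k assume "k \<in> Keys" "A = Bk k"
      then show ?thesis using A cls_b Keys_n[of k] by auto
    qed
  qed
  have tb: "sep X Wd {t} (Bk k) \<or> disjoint_rows (cls {t}) (cls (Bk k))" if t: "t \<in> Tl" and k: "k \<in> Keys" for t k
  proof (cases "lo t \<le> fst k \<and> fst k < hi t")
    case True
    have BI: "Bk k \<in> I" using k unfolding I_def by blast
    have b: "i \<in> Ns" "row i = fst k" "Lf i = snd k" if "i \<in> Bk k" for i using that unfolding Bk_def key_def by auto
    show ?thesis
    proof (cases "t \<in> snd k")
      case T: True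
      have "x t + w t \<le> X (Bk k)"
        by (rule X_ge[OF BI]) (use sep_block t True T b in auto)
      then show ?thesis unfolding sep_def single by simp
    next
      case F: False
      have "X (Bk k) + Wd (Bk k) \<le> x t"
        by (rule XW_le[OF BI]) (use sep_block t True F b in auto)
      then show ?thesis unfolding sep_def single by simp
    qed
  next
    case False
    then show ?thesis unfolding cls_t[OF t] cls_b[OF k] disjoint_rows_def using tall(2)[OF t] by auto
  qed
  \<comment> \<open>Two blocks of one row with different keys are divided by a tall item that lies
    to the left of one of them and not of the other.\<close>
  have bb: "sep X Wd (Bk k) (Bk l) \<or> disjoint_rows (cls (Bk k)) (cls (Bk l))" if k: "k \<in> Keys" "l \<in> Keys" "k \<noteq> l" for k l
  proof (cases "fst k = fst l")
    case True
    have BI: "Bk k \<in> I" "Bk l \<in> I" using k unfolding I_def by blast+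
    have b: "i \<in> Ns" "row i = fst m" "Lf i = snd m" if "i \<in> Bk m" for i m using that unfolding Bk_def key_def by auto
    have *: "X (Bk l) + Wd (Bk l) \<le> X (Bk k)"
      if k: "k \<in> Keys" "l \<in> Keys" "fst k = fst l" "t \<in> snd k" "t \<notin> snd l" for k l t
    proof -
      have BI: "Bk k \<in> I" "Bk l \<in> I" using k unfolding I_def by blast+
      have t: "t \<in> Tl" "lo t \<le> fst k" "fst k < hi t" using k unfolding Keys_def key_def Lf_def by auto
      have "x t + w t \<le> X (Bk k)"
        by (rule X_ge[OF BI(1)]) (use sep_block t k b in metis)
      moreover have "X (Bk l) + Wd (Bk l) \<le> x t"
        by (rule XW_le[OF BI(2)]) (use sep_block t k b in metis)
      moreover have "0 < w t" using t TS R by blast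
      ultimately show ?thesis by linarith
    qed
    have "snd k \<noteq> snd l" using True k by (metis prod.collapse)
    then obtain t where "t \<in> snd k \<and> t \<notin> snd l \<or> t \<in> snd l \<and> t \<notin> snd k" by blast
    then show ?thesis using *[of k l t] *[of l k t] k True unfolding sep_def by auto
  next
    case False
    then show ?thesis unfolding cls_b[OF k(1)] cls_b[OF k(2)] disjoint_rows_def by auto
  qed
  have tt: "sep X Wd {s} {t} \<or> disjoint_rows (cls {s}) (cls {t})" if st: "s \<in> Tl" "t \<in> Tl" "s \<noteq> t" for s t
  proof (cases "sep x w s t")
    case True
    then show ?thesis unfolding sep_def single by simp
  next
    case False
    have stR: "s \<in> R" "t \<in> R" using st TS by auto
    have *: "hi s \<le> lo t" if "s \<in> R" "t \<in> R" "d1 * (y s + h s) \<le> y1 t" for s t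
      using hi(1)[OF that(1)] lo(1)[OF that(2)] that(3) g(1)
      by (intro gless) (simp add: distrib_right)
    from ysep[OF stR st(3) False] have "hi s \<le> lo t \<or> hi t \<le> lo s" using * stR by blast
    then show ?thesis unfolding cls_t[OF st(1)] cls_t[OF st(2)] disjoint_rows_def using tall(2)[OF st(1)] tall(2)[OF st(2)] by auto
  qed
  have rsym: "disjoint_rows c d \<Longrightarrow> disjoint_rows d c" for c d unfolding disjoint_rows_def by auto
  have valid: "sep X Wd A B \<or> disjoint_rows (cls A) (cls B)" if AB: "A \<in> I" "B \<in> I" "A \<noteq> B" for A B
  proof -
    from IC[OF AB(1)] IC[OF AB(2)] show ?thesis
    proof (elim disjE bexE)
      fix s t assume "s \<in> Tl" "A = {s}" "t \<in> Tl" "B = {t}"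
      then show ?thesis using tt AB by blast
    next
      fix s k assume "s \<in> Tl" "A = {s}" "k \<in> Keys" "B = Bk k"
      then show ?thesis using tb by blast
    next
      fix s k assume "s \<in> Tl" "B = {s}" "k \<in> Keys" "A = Bk k"
      then show ?thesis using tb[of s k] rsym sep_commute by metis
    next
      fix k l assume "k \<in> Keys" "A = Bk k" "l \<in> Keys" "B = Bk l"
      then show ?thesis using bb AB by blast
    qed
  qed
  have "\<exists>I'\<subseteq>I. sum (sum p) (I - I') \<le> 3 * eps * sum (sum p) I \<and>
    arrangeable cls (\<lambda>i j. disjoint_rows (cls i) (cls j)) Wd I' 0 1 KC"
  proof (rule CLp[rule_format], intro conjI)
    show "\<forall>A\<in>I. 0 < Wd A \<and> 0 \<le> sum p A" using Wpos IR p0 by (auto intro!: sum_nonneg simp: subset_iff)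
    show "\<forall>A\<in>I. 0 \<le> X A \<and> X A + Wd A \<le> 1" using X01 by blast
    show "\<forall>A\<in>I. \<forall>B\<in>I. A \<noteq> B \<longrightarrow> sep X Wd A B \<or> disjoint_rows (cls A) (cls B)" using valid by blast
  qed (fact finI clsC)+
  then obtain I' where I': "I' \<subseteq> I" "sum (sum p) (I - I') \<le> 3 * eps * sum (sum p) I"
    and ar: "arrangeable cls (\<lambda>i j. disjoint_rows (cls i) (cls j)) Wd I' 0 1 KC" by blast
  from ar obtain xx cu cv where card_th: "card ((\<lambda>A. (cls A, cu A, cv A)) ` I') \<le> KC"
    and th1: "\<forall>A\<in>I'. 0 \<le> cu A \<and> cu A \<le> xx A \<and> xx A + Wd A \<le> cv A \<and> cv A \<le> 1"
    and th2: "\<forall>A\<in>I'. \<forall>B\<in>I'. A \<noteq> B \<longrightarrow> (if (cls A, cu A, cv A) = (cls B, cu B, cv B) then sep xx Wd A B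
       else cv A \<le> cu B \<or> cv B \<le> cu A \<or> disjoint_rows (cls A) (cls B))"
    unfolding arrangeable_def by (elim exE conjE)
  define R' where "R' = Cr \<union> \<Union>I'"
  have disjI: "A \<inter> B = {}" if AB: "A \<in> I" "B \<in> I" "A \<noteq> B" for A B
  proof -
    have "Tl \<inter> Ns = {}" using TS unfolding Ns_def by blast
    then show ?thesis using AB unfolding I_def Bk_def by auto
  qed
  have UI: "\<Union>I = Tl \<union> Ns" unfolding I_def Keys_def Bk_def by auto
  have sumU: "sum p (\<Union>J) = sum (sum p) J" if "J \<subseteq> I" for J
    using that IR disjI by (intro sum.Union_disjoint[THEN trans]) (auto simp: subset_iff)
  have R'R: "R' \<subseteq> R" unfolding R'_def using I'(1) IR NsR by blast
  have loss: "sum p (R - R') \<le> 3 * eps * sum p R"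
  proof -
    have "R - R' \<subseteq> \<Union>(I - I')"
    proof
      fix i assume i: "i \<in> R - R'"
      then have "i \<in> \<Union>I" unfolding UI R'_def Ns_def using TS by blast
      then show "i \<in> \<Union>(I - I')" using i unfolding R'_def by blast
    qed
    moreover have "\<Union>(I - I') \<subseteq> R" using IR by blast
    ultimately have "sum p (R - R') \<le> sum p (\<Union>(I - I'))"
      using fin p0 by (intro sum_mono2) (auto intro: finite_subset)
    also have "\<dots> = sum (sum p) (I - I')" by (rule sumU) blast
    also have "\<dots> \<le> 3 * eps * sum (sum p) I" by (rule I'(2))
    also have "sum (sum p) I = sum p (\<Union>I)" by (rule sumU[symmetric]) simp
    also have "3 * eps * sum p (\<Union>I) \<le> 3 * eps * sum p R"
      using eps fin p0 TS NsR unfolding UI by (intro mult_left_mono sum_mono2) auto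
    finally show ?thesis .
  qed
  have I'I: "A \<in> I" if "A \<in> I'" for A using that I'(1) by blast
  define wide where "wide A \<longleftrightarrow> snd (snd (cls A)) = 1" for A
  define nar where "nar A \<longleftrightarrow> snd (snd (cls A)) = 2" for A
  have lab: "snd (snd (cls A)) = 0 \<Longrightarrow> \<exists>t\<in>Tl. A = {t}" "wide A \<Longrightarrow> om \<le> Wd A" "nar A \<Longrightarrow> Wd A < om"
    "wide A \<or> nar A \<Longrightarrow> \<exists>k\<in>Keys. A = Bk k \<and> fst (cls A) = fst k \<and> fst (snd (cls A)) = Suc (fst k)"
    "snd (snd (cls A)) = 0 \<or> wide A \<or> nar A"
    if A: "A \<in> I" for A
    unfolding wide_def nar_def using IC[OF A] cls_t cls_b by (auto split: if_splits)
  have blk: "i \<in> Ns" "row i = fst (cls A)" if AA: "A \<in> I" "wide A \<or> nar A" "i \<in> A" for A i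
  proof -
    obtain k where "k \<in> Keys" "A = Bk k" "fst (cls A) = fst k" using lab(4)[OF AA(1)] AA(2) by blast
    then show "i \<in> Ns" "row i = fst (cls A)" using AA(3) unfolding Bk_def key_def by auto
  qed
  have om_e: "om \<le> e" "om \<le> 1 / 2" "KC * om \<le> e"
  proof -
    have "om * 2 \<le> om * (KC + 2)" "KC * om \<le> om * (KC + 2)" using om(1) by (auto simp: algebra_simps)
    then show "om \<le> e" "om \<le> 1 / 2" "KC * om \<le> e" using om(1,2) e by linarith+
  qed
  have g1: "g \<le> 1" using g(4) del by linarith
  define QB where "QB A S1 S2 S3 \<longleftrightarrow> A = S1 \<union> S2 \<union> S3 \<and> containable e w h (box_int 0 0 (Wd A) g) S1 KB \<and>
        sum h S2 \<le> xi \<and> (\<Sum>i\<in>S3. w i * h i) \<le> xi \<and> (\<forall>i\<in>S3. w i \<le> omb)" for A S1 S2 S3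
  have "\<exists>S1 S2 S3. QB A S1 S2 S3" if A: "A \<in> I" "wide A" for A
  proof -
    have "packed w h (\<lambda>i. x i - X A) (\<lambda>i. y1 i - real (fst (cls A)) * g) A (Wd A) g"
      unfolding packed_def
    proof (intro conjI ballI impI)
      show "finite A" using IR[OF A(1)] by blast
      fix i assume i: "i \<in> A"
      have iR: "i \<in> R" using IR[OF A(1)] i by blast
      have b: "i \<in> Ns" "row i = fst (cls A)" using blk[OF A(1) _ i] A(2) by blast+
      show "0 < w i" "0 < h i" using R iR by blast+
      show "0 \<le> x i - X A" "x i - X A + w i \<le> Wd A" using hull[OF A(1) i] by linarith+
      show "0 \<le> y1 i - real (fst (cls A)) * g" using row(1)[OF iR] b by simp
      show "y1 i - real (fst (cls A)) * g + h i \<le> g" using Ns_y[OF b(1)] b by (simp add: distrib_right)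
      fix j assume j: "j \<in> A" "i \<noteq> j"
      have jR: "j \<in> R" using IR[OF A(1)] j by blast
      show "sep (\<lambda>i. x i - X A) w i j \<or> sep (\<lambda>i. y1 i - real (fst (cls A)) * g) h i j"
      proof (cases "sep x w i j")
        case True
        then show ?thesis unfolding sep_def by auto
      next
        case False
        then show ?thesis using ysep[OF iR jR j(2) False] ytop(1)[OF iR] ytop(1)[OF jR] unfolding sep_def by auto
      qed
    qed
    moreover have "\<forall>i\<in>A. h i \<le> mu \<and> (oma < w i \<or> w i \<le> omb)"
      using blk[OF A(1)] A(2) Ns_h gap(2) IR[OF A(1)] by blast
    moreover have "0 \<le> Wd A" "Wd A \<le> 1" using Wpos[OF A(1)] X01[OF A(1)] by linarith+
    ultimately show ?thesis unfolding QB_def using g(1) g1 by (intro BLp[rule_format]) simp_all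
  qed
  then obtain S1 S2 S3 where QB: "\<And>A. A \<in> I \<Longrightarrow> wide A \<Longrightarrow> QB A (S1 A) (S2 A) (S3 A)" by metis
  define tup where "tup A = (cls A, cu A, cv A)" for A
  define Th where "Th = tup ` I'"
  have finI': "finite I'" using I'(1) finI finite_subset by blast
  have finTh: "finite Th" and cardTh: "card Th \<le> KC"
    using finI' card_th unfolding Th_def tup_def by auto
  define Fb where "Fb \<theta> = {A \<in> I'. tup A = \<theta>}" for \<theta>
  have FbD: "A \<in> I'" "A \<in> I" "cls A = fst \<theta>" "cu A = fst (snd \<theta>)" "cv A = snd (snd \<theta>)" if "A \<in> Fb \<theta>" for A \<theta>
    using that I'I unfolding Fb_def tup_def by auto
  have finFb: "finite (Fb \<theta>)" for \<theta> unfolding Fb_def using finI' by simp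
  have Fbsep: "sep xx Wd A B" if "A \<in> Fb \<theta>" "B \<in> Fb \<theta>" "A \<noteq> B" for A B \<theta>
  proof -
    have "(cls A, cu A, cv A) = (cls B, cu B, cv B)" using FbD[OF that(1)] FbD[OF that(2)] by simp
    then show ?thesis using th2 FbD(1) that by (metis (no_types, lifting))
  qed
  define ra where "ra \<theta> = fst (fst \<theta>)" for \<theta> :: "(nat \<times> nat \<times> nat) \<times> real \<times> real"
  define rb where "rb \<theta> = fst (snd (fst \<theta>))" for \<theta> :: "(nat \<times> nat \<times> nat) \<times> real \<times> real"
  define lb where "lb \<theta> = snd (snd (fst \<theta>))" for \<theta> :: "(nat \<times> nat \<times> nat) \<times> real \<times> real"
  define ul where "ul \<theta> = fst (snd \<theta>)" for \<theta> :: "(nat \<times> nat \<times> nat) \<times> real \<times> real"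
  define ur where "ur \<theta> = snd (snd \<theta>)" for \<theta> :: "(nat \<times> nat \<times> nat) \<times> real \<times> real"
  have FbE: "fst (cls A) = ra \<theta>" "fst (snd (cls A)) = rb \<theta>" "snd (snd (cls A)) = lb \<theta>" "cu A = ul \<theta>" "cv A = ur \<theta>"
    "ul \<theta> \<le> xx A" "xx A + Wd A \<le> ur \<theta>" "0 \<le> ul \<theta>" "ur \<theta> \<le> 1"
    if "A \<in> Fb \<theta>" for A \<theta>
    using FbD[OF that] th1 unfolding ra_def rb_def lb_def ul_def ur_def by auto
  have Th_ne: "\<exists>A. A \<in> Fb \<theta>" if "\<theta> \<in> Th" for \<theta> using that unfolding Th_def Fb_def by auto
  have Th_uv: "0 \<le> ul \<theta>" "ur \<theta> \<le> 1" "ul \<theta> < ur \<theta>" "rb \<theta> \<le> n" "lb \<theta> \<le> 2" if \<theta>: "\<theta> \<in> Th" for \<theta>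
  proof -
    obtain A where A: "A \<in> Fb \<theta>" using Th_ne[OF \<theta>] by blast
    show "0 \<le> ul \<theta>" "ur \<theta> \<le> 1" using FbE[OF A] by auto
    show "ul \<theta> < ur \<theta>" using FbE[OF A] Wpos[OF FbD(2)[OF A]] by linarith
    have "cls A \<in> {..n} \<times> {..n} \<times> {..2}" using clsC FbD(2)[OF A] by blast
    then show "rb \<theta> \<le> n" "lb \<theta> \<le> 2" using FbE(2,3)[OF A] by (cases "cls A"; auto)+
  qed
  \<comment> \<open>The horizontal interval of a container times its rows. Two regions are disjoint
    because the arrangement separates the intervals or \<open>disjoint_rows\<close> separates the
    rows.\<close>
  define Rg where "Rg \<theta> = box_int (ul \<theta>) (real (ra \<theta>) * g) (ur \<theta> - ul \<theta>) ((real (rb \<theta>) - real (ra \<theta>)) * g)" for \<theta>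
  have Rgdisj: "Rg \<theta> \<inter> Rg \<eta> = {}" if "\<theta> \<in> Th" "\<eta> \<in> Th" "\<theta> \<noteq> \<eta>" for \<theta> \<eta>
  proof -
    from Th_ne[OF that(1)] Th_ne[OF that(2)] obtain A B where AB: "A \<in> Fb \<theta>" "B \<in> Fb \<eta>" by (elim exE)
    then have ne: "tup A \<noteq> tup B" "A \<noteq> B" using that unfolding Fb_def by auto
    then have "cv A \<le> cu B \<or> cv B \<le> cu A \<or> disjoint_rows (cls A) (cls B)"
      using th2 FbD(1)[OF AB(1)] FbD(1)[OF AB(2)] unfolding tup_def by (metis (no_types, lifting))
    then have "ur \<theta> \<le> ul \<eta> \<or> ur \<eta> \<le> ul \<theta> \<or> rb \<theta> \<le> ra \<eta> \<or> rb \<eta> \<le> ra \<theta>"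
      using FbE[OF AB(1)] FbE[OF AB(2)] unfolding disjoint_rows_def by auto
    then have "ur \<theta> \<le> ul \<eta> \<or> ur \<eta> \<le> ul \<theta> \<or> real (rb \<theta>) * g \<le> real (ra \<eta>) * g \<or> real (rb \<eta>) * g \<le> real (ra \<theta>) * g"
      using gmono by blast
    then show ?thesis unfolding Rg_def by (intro box_disj) (simp add: left_diff_distrib)
  qed
  have Rgsub: "(\<Union>\<theta>\<in>Th. Rg \<theta>) \<subseteq> box_int 0 0 1 d1"
  proof -
    have "Rg \<theta> \<subseteq> box_int 0 0 1 d1" if "\<theta> \<in> Th" for \<theta>
    proof -
      have "real (rb \<theta>) * g \<le> d1" using gmono[OF Th_uv(4)[OF that]] g(2) unfolding d1_def by simp
      then show ?thesis using Th_uv[OF that] g(1) unfolding Rg_def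
        by (intro box_sub) (auto simp: left_diff_distrib)
    qed
    then show ?thesis by blast
  qed
  \<comment> \<open>What stays within the rows: tall items, the parts \<open>S1\<close> of wide
    blocks, and narrow blocks whose container is wide enough to satisfy the area condition for items
    of width up to \<open>om\<close>.\<close>
  define Ct where "Ct \<theta> = (if lb \<theta> = 0 then \<Union>(Fb \<theta>) else if lb \<theta> = 1 then (\<Union>A\<in>Fb \<theta>. S1 A)
    else if om \<le> e * (ur \<theta> - ul \<theta>) then \<Union>(Fb \<theta>) else {})" for \<theta>
  \<comment> \<open>A narrow item moves rigidly with its block. The offsets \<open>b\<close> and
    \<open>c\<close> let one argument serve both the placement within the rows and the one in the
    extra strip.\<close>
  have px_sep: "sep (\<lambda>i. b \<theta> + (x i - X (Bk (key i)) + xx (Bk (key i)) - ul \<theta>)) w i j \<or>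
      sep (\<lambda>i. c + (y1 i - real (ra \<theta>) * g)) h i j"
    if A: "A \<in> Fb \<theta>" "i \<in> A" "B \<in> Fb \<theta>" "j \<in> B" "i \<noteq> j" "lb \<theta> = 2" for A B i j \<theta> c and b :: "_ \<Rightarrow> real"
  proof -
    have AI: "A \<in> I" "B \<in> I" using FbD A by blast+
    have nr: "nar A" "nar B" unfolding nar_def using FbE(3) A by auto
    have Ai: "Bk (key i) = A" and Bj: "Bk (key j) = B"
      using lab(4)[OF AI(1)] lab(4)[OF AI(2)] nr A unfolding Bk_def by auto
    have ijR: "i \<in> R" "j \<in> R" using IR AI A by blast+
    show ?thesis
    proof (cases "A = B")
      case True
      show ?thesis
      proof (cases "sep x w i j")
        case s: True
        then show ?thesis unfolding sep_def Ai Bj True by auto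
      next
        case False
        then show ?thesis using ysep[OF ijR A(5) False] ytop(1)[OF ijR(1)] ytop(1)[OF ijR(2)] unfolding sep_def by auto
      qed
    next
      case False
      then have "sep xx Wd A B" using Fbsep A by blast
      then have "sep (\<lambda>i. b \<theta> + (x i - X (Bk (key i)) + xx (Bk (key i)) - ul \<theta>)) w i j"
        using hull[OF AI(1) A(2)] hull[OF AI(2) A(4)] unfolding sep_def Ai Bj by auto
      then show ?thesis ..
    qed
  qed
  have px_in: "ul \<theta> \<le> x i - X (Bk (key i)) + xx (Bk (key i))" "x i - X (Bk (key i)) + xx (Bk (key i)) + w i \<le> ur \<theta>"
      "real (ra \<theta>) * g \<le> y1 i" "y1 i + h i \<le> real (ra \<theta>) * g + g" "w i \<le> om" "h i \<le> mu" "0 < w i" "0 < h i"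
      "rb \<theta> = Suc (ra \<theta>)"
    if A: "A \<in> Fb \<theta>" "i \<in> A" "lb \<theta> = 2" for A i \<theta>
  proof -
    have AI: "A \<in> I" using FbD A by blast
    have nr: "nar A" unfolding nar_def using FbE(3) A by auto
    have Ai: "Bk (key i) = A" using lab(4)[OF AI(1)] nr A unfolding Bk_def by auto
    have iR: "i \<in> R" using IR AI A by blast
    have b: "i \<in> Ns" "row i = ra \<theta>" using blk[OF AI _ A(2)] nr FbE(1)[OF A(1)] by auto
    show "ul \<theta> \<le> x i - X (Bk (key i)) + xx (Bk (key i))" "x i - X (Bk (key i)) + xx (Bk (key i)) + w i \<le> ur \<theta>"
      using FbE[OF A(1)] hull[OF AI A(2)] unfolding Ai by linarith+
    show "real (ra \<theta>) * g \<le> y1 i" using row(1)[OF iR] b by simp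
    show "y1 i + h i \<le> real (ra \<theta>) * g + g" using Ns_y[OF b(1)] b by (simp add: distrib_right)
    show "w i \<le> om" using lab(3)[OF AI nr] hull[OF AI A(2)] by linarith
    show "h i \<le> mu" using Ns_h b by blast
    show "0 < w i" "0 < h i" using R iR by blast+
    show "rb \<theta> = Suc (ra \<theta>)" using lab(4)[OF AI] nr FbE(1,2)[OF A(1)] by auto
  qed
  have cardW: "card (Fb \<theta>) \<le> NB" if "lb \<theta> = 1" for \<theta>
  proof (cases "Fb \<theta> = {}")
    case False
    have wd: "wide A" if "A \<in> Fb \<theta>" for A unfolding wide_def using FbE(3)[OF that] \<open>lb \<theta> = 1\<close> by simp
    have "real (card (Fb \<theta>)) * om = (\<Sum>A\<in>Fb \<theta>. om)" by simp
    also have "\<dots> \<le> sum Wd (Fb \<theta>)" using lab(2) wd FbD(2) by (intro sum_mono) blast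
    also have "\<dots> \<le> 1 - 0"
    proof (rule sum_le_of_sep[where x=xx])
      show "0 < Wd A" if "A \<in> Fb \<theta>" for A using Wpos FbD(2) that by blast
      show "0 \<le> xx A \<and> xx A + Wd A \<le> 1" if "A \<in> Fb \<theta>" for A using FbE[OF that] by linarith
    qed (use finFb Fbsep in auto)
    finally have "real (card (Fb \<theta>)) \<le> 1 / om" using om(1) by (simp add: field_simps)
    then show ?thesis unfolding NB using om(1) by (intro floor_bound) auto
  qed simp
  have cC: "containable e w h (Rg \<theta>) (Ct \<theta>) (1 + NB * KB)" if \<theta>: "\<theta> \<in> Th" for \<theta>
  proof -
    consider "lb \<theta> = 0" | "lb \<theta> = 1" | "lb \<theta> = 2" using Th_uv(5)[OF \<theta>] by linarith
    then show ?thesis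
    proof cases
      case 1
      have T: "\<exists>t\<in>Tl. A = {t}" if "A \<in> Fb \<theta>" for A using lab(1)[OF FbD(2)[OF that]] FbE(3)[OF that] 1 by simp
      define T where "T = {t. {t} \<in> Fb \<theta>}"
      have TT: "t \<in> Tl" if "t \<in> T" for t 
      proof -
        have "{t} \<in> Fb \<theta>" using that unfolding T_def by simp
        from T[OF this] show ?thesis by (elim bexE) simp
      qed
      have finT: "finite T" by (rule finite_subset[OF _ NsR(5)]) (use TT in blast)
      have U: "\<Union>(Fb \<theta>) = T"
      proof (intro equalityI subsetI)
        fix i assume "i \<in> \<Union>(Fb \<theta>)"
        then obtain A where A: "A \<in> Fb \<theta>" "i \<in> A" by (elim UnionE)
        from T[OF A(1)] A(2) have "A = {i}" by (elim bexE) simp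
        then show "i \<in> T" using A(1) unfolding T_def by simp
      next
        fix i assume "i \<in> T"
        then have "{i} \<in> Fb \<theta>" unfolding T_def by simp
        then show "i \<in> \<Union>(Fb \<theta>)" by (rule UnionI) simp
      qed
      have "containable e w h (Rg \<theta>) T 1"
        unfolding Rg_def
      proof (rule containable_vertical[OF finT])
        show "0 < w t \<and> 0 < h t" if "t \<in> T" for t using TT[OF that] TS R by blast
        show "sum w T \<le> ur \<theta> - ul \<theta>"
        proof (rule sum_le_of_sep[where x="\<lambda>t. xx {t}", OF finT])
          show "0 < w t" if "t \<in> T" for t using TT[OF that] TS R by blast
          show "ul \<theta> \<le> xx {t} \<and> xx {t} + w t \<le> ur \<theta>" if "t \<in> T" for t
            using FbE[of "{t}" \<theta>] that single unfolding T_def by auto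
          show "sep (\<lambda>t. xx {t}) w s t" if "s \<in> T" "t \<in> T" "s \<noteq> t" for s t
            using Fbsep[of "{s}" \<theta> "{t}"] that single unfolding T_def sep_def by auto
        qed (use Th_uv[OF \<theta>] in auto)
        show "h t \<le> (real (rb \<theta>) - real (ra \<theta>)) * g" if "t \<in> T" for t
          using tall(1)[OF TT[OF that]] FbE(1,2)[of "{t}" \<theta>] that cls_t[OF TT[OF that]] unfolding T_def by auto
      qed
      then show ?thesis unfolding Ct_def using 1 U by (auto intro: containable.mono)
    next
      case 2
      have wd: "wide A" if "A \<in> Fb \<theta>" for A unfolding wide_def using FbE(3)[OF that] 2 by simp
      have rr: "rb \<theta> = Suc (ra \<theta>)" if "A \<in> Fb \<theta>" for A
        using lab(4)[OF FbD(2)[OF that]] wd[OF that] FbE(1,2)[OF that] by auto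
      define ar where "ar A = box_int (xx A) (real (ra \<theta>) * g) (Wd A) g" for A
      have "containable e w h (\<Union>A\<in>Fb \<theta>. ar A) (\<Union>A\<in>Fb \<theta>. S1 A) (\<Sum>A\<in>Fb \<theta>. KB)"
      proof (rule containable_UN[OF finFb])
        show "containable e w h (ar A) (S1 A) KB" if "A \<in> Fb \<theta>" for A
          
        proof -
          have "containable e w h (box_int 0 0 (Wd A) g) (S1 A) KB"
            using QB[OF FbD(2)[OF that] wd[OF that]] unfolding QB_def by (elim conjE)
          then show ?thesis unfolding ar_def by (rule containable_translate)
        qed
        show "ar A \<inter> ar B = {}" if "A \<in> Fb \<theta>" "B \<in> Fb \<theta>" "A \<noteq> B" for A B
          using Fbsep[OF that] unfolding ar_def sep_def by (intro box_disj) blast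
      qed
      moreover have "(\<Union>A\<in>Fb \<theta>. ar A) \<subseteq> Rg \<theta>"
      proof -
        have "ar A \<subseteq> Rg \<theta>" if "A \<in> Fb \<theta>" for A
          using FbE[OF that] rr[OF that] unfolding ar_def Rg_def by (intro box_sub) (auto simp: algebra_simps)
        then show ?thesis by blast
      qed
      moreover have "(\<Sum>A\<in>Fb \<theta>. KB) \<le> 1 + NB * KB" using mult_le_mono1[OF cardW[OF 2], of KB] by (simp only: sum_constant of_nat_id)
      ultimately show ?thesis unfolding Ct_def using 2 by (auto intro: containable.mono)
    next
      case 3
      show ?thesis
      proof (cases "om \<le> e * (ur \<theta> - ul \<theta>)")
        case True
        let ?b = "\<lambda>_. ul \<theta>"
        have "containable e w h (Rg \<theta>) (\<Union>(Fb \<theta>)) 1"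
          unfolding Rg_def
        proof (rule containable_area[where x="\<lambda>i. ?b \<theta> + (x i - X (Bk (key i)) + xx (Bk (key i)) - ul \<theta>)"
              and y="\<lambda>i. real (ra \<theta>) * g + (y1 i - real (ra \<theta>) * g)"])
          fix i assume "i \<in> \<Union>(Fb \<theta>)"
          then obtain A where A: "A \<in> Fb \<theta>" "i \<in> A" by blast
          note q = px_in[OF A 3]
          have rg: "(real (rb \<theta>) - real (ra \<theta>)) * g = g" using q(9) by simp
          show "0 < w i \<and> 0 < h i" using q by blast
          show "ul \<theta> \<le> ul \<theta> + (x i - X (Bk (key i)) + xx (Bk (key i)) - ul \<theta>) \<and>
            ul \<theta> + (x i - X (Bk (key i)) + xx (Bk (key i)) - ul \<theta>) + w i \<le> ul \<theta> + (ur \<theta> - ul \<theta>) \<and>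
            real (ra \<theta>) * g \<le> real (ra \<theta>) * g + (y1 i - real (ra \<theta>) * g) \<and>
            real (ra \<theta>) * g + (y1 i - real (ra \<theta>) * g) + h i \<le> real (ra \<theta>) * g + (real (rb \<theta>) - real (ra \<theta>)) * g"
            unfolding rg using q by linarith
          show "w i \<le> e * (ur \<theta> - ul \<theta>) \<and> h i \<le> e * ((real (rb \<theta>) - real (ra \<theta>)) * g)"
            unfolding rg using q True mu(4) by linarith
        next
          fix i j assume "i \<in> \<Union>(Fb \<theta>)" "j \<in> \<Union>(Fb \<theta>)" "i \<noteq> j"
          then show "sep (\<lambda>i. ?b \<theta> + (x i - X (Bk (key i)) + xx (Bk (key i)) - ul \<theta>)) w i j \<or>
            sep (\<lambda>i. real (ra \<theta>) * g + (y1 i - real (ra \<theta>) * g)) h i j"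
            using px_sep[of _ \<theta> i _ j ?b "real (ra \<theta>) * g"] 3 by blast
        qed
        then show ?thesis unfolding Ct_def using 3 True by (auto intro: containable.mono)
      next
        case False
        then show ?thesis unfolding Ct_def using 3 containable_empty by auto
      qed
    qed
  qed
  have M0: "containable e w h (box_int 0 0 1 d1) (\<Union>\<theta>\<in>Th. Ct \<theta>) (KC * (1 + NB * KB))"
  proof (rule containable.mono[OF containable_UN[OF finTh cC Rgdisj] Rgsub])
    show "(\<Sum>\<theta>\<in>Th. 1 + NB * KB) \<le> KC * (1 + NB * KB)"
      using mult_le_mono1[OF cardTh, of "1 + NB * KB"] by simp
  qed
  \<comment> \<open>Height of each of the four strips above the rows; the one for narrow containers
    uses only \<open>g \<le> q\<close> of it.\<close>
  define q where "q = del / 8"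
  have q: "0 < q" "d1 + 4 * q = 1 + del" unfolding q_def d1_def using del by auto
  have M1: "containable e w h (box_int 0 d1 1 q) Cr n"
  proof -
    define ar where "ar r = box_int 0 (d1 + real r * mu) 1 mu" for r :: nat
    define Sr where "Sr r = {i \<in> Cr. row i = r}" for r
    have "containable e w h (\<Union>r\<in>{..<n}. ar r) (\<Union>r\<in>{..<n}. Sr r) (\<Sum>r<n. 1)"
    proof (rule containable_UN)
      fix r
      show "containable e w h (ar r) (Sr r) 1" unfolding ar_def
      proof (rule containable_vertical)
        show f: "finite (Sr r)" unfolding Sr_def using NsR by simp
        show "0 < w i \<and> 0 < h i" if "i \<in> Sr r" for i using that R NsR unfolding Sr_def by blast
        show "h i \<le> mu" if "i \<in> Sr r" for i using that unfolding Sr_def Cr_def Sh_def by blast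
        have "sum w (Sr r) \<le> 1 - 0"
        proof (rule sum_le_of_sep[OF f, where x=x])
          show "0 < w i" if "i \<in> Sr r" for i using that R NsR unfolding Sr_def by blast
          show "0 \<le> x i \<and> x i + w i \<le> 1" if "i \<in> Sr r" for i using that R NsR unfolding Sr_def by blast
          fix i j assume ij: "i \<in> Sr r" "j \<in> Sr r" "i \<noteq> j"
          have ijR: "i \<in> R" "j \<in> R" using ij NsR unfolding Sr_def by auto
          have c: "(real r + 1) * g < y1 i + h i" "(real r + 1) * g < y1 j + h j" using ij unfolding Sr_def Cr_def by auto
          have d: "y1 i < (real r + 1) * g" "y1 j < (real r + 1) * g"
            using row(2)[OF ijR(1)] row(2)[OF ijR(2)] ij unfolding Sr_def by auto
          show "sep x w i j"
            using ysep[OF ijR ij(3)] ytop(1)[OF ijR(1)] ytop(1)[OF ijR(2)] c d by fastforce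
        qed simp
        then show "sum w (Sr r) \<le> 1" by simp
      qed
    next
      fix r s assume "r \<noteq> (s::nat)"
      have *: "d1 + real r * mu + mu \<le> d1 + real s * mu" if "r < s" for r s :: nat
      proof -
        have "(real r + 1) * mu \<le> real s * mu" using that mu(1) by (intro mult_right_mono) auto
        then show ?thesis by (simp add: distrib_right)
      qed
      show "ar r \<inter> ar s = {}" unfolding ar_def
        using *[of r s] *[of s r] \<open>r \<noteq> s\<close> by (intro box_disj) (metis linorder_neqE_nat)
    qed simp
    moreover have "(\<Union>r\<in>{..<n}. ar r) \<subseteq> box_int 0 d1 1 q"
    proof -
      have "ar r \<subseteq> box_int 0 d1 1 q" if "r < n" for r
      proof -
        have "(real r + 1) * mu \<le> real n * mu" using that mu(1) by (intro mult_right_mono) auto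
        then have "real r * mu + mu \<le> q" using mu(3) unfolding q_def by (simp add: distrib_right)
        then show ?thesis unfolding ar_def using mu(1) by (intro box_sub) auto
      qed
      then show ?thesis by blast
    qed
    moreover have "(\<Union>r\<in>{..<n}. Sr r) = Cr" unfolding Sr_def using row(3) NsR by auto
    ultimately show ?thesis using containable.mono by fastforce
  qed
  \<comment> \<open>Containers narrower than \<open>om / e\<close>. There are at most
    \<open>KC\<close> of them and \<open>KC * om \<le> e\<close>, so they fit side by side into one
    strip of width 1, which is wide enough to be an area container for their items.\<close>
  define Nr where "Nr = {\<theta> \<in> Th. lb \<theta> = 2 \<and> \<not> om \<le> e * (ur \<theta> - ul \<theta>)}"
  have M2: "containable e w h (box_int 0 (d1 + q) 1 g) (\<Union>\<theta>\<in>Nr. \<Union>(Fb \<theta>)) 1"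
  proof -
    have finN: "finite Nr" "Nr \<subseteq> Th" unfolding Nr_def using finTh by auto
    define sz where "sz \<theta> = ur \<theta> - ul \<theta>" for \<theta> :: "(nat \<times> nat \<times> nat) \<times> real \<times> real"
    have "\<exists>b. (\<forall>\<theta>\<in>Nr. 0 \<le> b \<theta> \<and> b \<theta> + sz \<theta> \<le> 0 + sum sz Nr) \<and> (\<forall>\<theta>\<in>Nr. \<forall>\<eta>\<in>Nr. \<theta> \<noteq> \<eta> \<longrightarrow> sep b sz \<theta> \<eta>)"
      by (rule layout_exists[OF finN(1)]) (use Th_uv(3) finN(2) in \<open>auto simp: sz_def less_imp_le subset_iff\<close>)
    then obtain b where b: "\<forall>\<theta>\<in>Nr. 0 \<le> b \<theta> \<and> b \<theta> + sz \<theta> \<le> 0 + sum sz Nr"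
      "\<forall>\<theta>\<in>Nr. \<forall>\<eta>\<in>Nr. \<theta> \<noteq> \<eta> \<longrightarrow> sep b sz \<theta> \<eta>" by (elim exE conjE)
    have "sum sz Nr \<le> 1"
    proof -
      have "e * sum sz Nr \<le> (\<Sum>\<theta>\<in>Nr. om)" unfolding sum_distrib_left
        by (rule sum_mono) (auto simp: Nr_def sz_def)
      also have "\<dots> = card Nr * om" by simp
      also have "\<dots> \<le> KC * om"
        using card_mono[OF finTh finN(2)] cardTh om(1) by (intro mult_right_mono) auto
      also have "\<dots> \<le> e * 1" using om_e by simp
      finally show ?thesis using e by simp
    qed
    then have b1: "0 \<le> b \<theta>" "b \<theta> + (ur \<theta> - ul \<theta>) \<le> 1" if "\<theta> \<in> Nr" for \<theta> using b(1) that unfolding sz_def by auto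
    define th where "th i = tup (Bk (key i))" for i
    have thi: "th i = \<theta>" if "\<theta> \<in> Nr" "A \<in> Fb \<theta>" "i \<in> A" for i \<theta> A
    proof -
      have AI: "A \<in> I" using FbD that by blast
      have "nar A" unfolding nar_def using FbE(3)[OF that(2)] that(1) unfolding Nr_def by auto
      then have "Bk (key i) = A" using lab(4)[OF AI] that(3) unfolding Bk_def by auto
      then show ?thesis unfolding th_def using that(2) unfolding Fb_def by simp
    qed
    let ?px = "\<lambda>i. b (th i) + (x i - X (Bk (key i)) + xx (Bk (key i)) - ul (th i))"
    let ?py = "\<lambda>i. (d1 + q) + (y1 i - real (ra (th i)) * g)"
    show ?thesis
    proof (rule containable_area[where x="?px" and y="?py"])
      fix i assume "i \<in> (\<Union>\<theta>\<in>Nr. \<Union>(Fb \<theta>))"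
      then obtain \<theta> A where A: "\<theta> \<in> Nr" "A \<in> Fb \<theta>" "i \<in> A" by blast
      have "lb \<theta> = 2" using A unfolding Nr_def by simp
      note q' = px_in[OF A(2,3) this]
      show "0 < w i \<and> 0 < h i" using q' by blast
      show "0 \<le> ?px i \<and> ?px i + w i \<le> 0 + 1 \<and> d1 + q \<le> ?py i \<and> ?py i + h i \<le> d1 + q + g"
        unfolding thi[OF A] using q' b1[OF A(1)] by linarith
      show "w i \<le> e * 1 \<and> h i \<le> e * g" using q' om_e mu(4) by linarith
    next
      fix i j assume "i \<in> (\<Union>\<theta>\<in>Nr. \<Union>(Fb \<theta>))" "j \<in> (\<Union>\<theta>\<in>Nr. \<Union>(Fb \<theta>))" and ij: "i \<noteq> j"
      then obtain \<theta> A \<eta> B where A: "\<theta> \<in> Nr" "A \<in> Fb \<theta>" "i \<in> A" and B: "\<eta> \<in> Nr" "B \<in> Fb \<eta>" "j \<in> B" by blast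
      have l: "lb \<theta> = 2" "lb \<eta> = 2" using A B unfolding Nr_def by auto
      show "sep ?px w i j \<or> sep ?py h i j"
      proof (cases "\<theta> = \<eta>")
        case True
        show ?thesis using px_sep[OF A(2,3) B(2)[folded True] B(3) ij l(1), of b "d1 + q"]
          unfolding sep_def thi[OF A] thi[OF B] True .
      next
        case False
        then have "sep b sz \<theta> \<eta>" using b(2) A B by blast
        then have "sep ?px w i j"
          using px_in(1,2)[OF A(2,3) l(1)] px_in(1,2)[OF B(2,3) l(2)]
          unfolding sep_def thi[OF A] thi[OF B] sz_def by linarith
        then show ?thesis ..
      qed
    qed
  qed
  define Wi where "Wi = {A \<in> I'. wide A}"
  have finWi: "finite Wi" unfolding Wi_def using finI' by simp
  have cardWi: "card Wi \<le> KC * NB"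
  proof -
    have "Wi \<subseteq> (\<Union>\<theta>\<in>{\<theta> \<in> Th. lb \<theta> = 1}. Fb \<theta>)"
    proof
      fix A assume A: "A \<in> Wi"
      then have "A \<in> Fb (tup A)" "tup A \<in> Th" unfolding Wi_def Fb_def Th_def by auto
      moreover have "lb (tup A) = 1" using A unfolding Wi_def wide_def lb_def tup_def by simp
      ultimately show "A \<in> (\<Union>\<theta>\<in>{\<theta> \<in> Th. lb \<theta> = 1}. Fb \<theta>)" by blast
    qed
    then have "card Wi \<le> card (\<Union>\<theta>\<in>{\<theta> \<in> Th. lb \<theta> = 1}. Fb \<theta>)" using finTh finFb by (intro card_mono) auto
    also have "\<dots> \<le> (\<Sum>\<theta>\<in>{\<theta> \<in> Th. lb \<theta> = 1}. card (Fb \<theta>))" using finTh by (intro card_UN_le) auto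
    also have "\<dots> \<le> (\<Sum>\<theta>\<in>{\<theta> \<in> Th. lb \<theta> = 1}. NB)" using cardW by (intro sum_mono) auto
    also have "\<dots> = card {\<theta> \<in> Th. lb \<theta> = 1} * NB" by simp
    also have "\<dots> \<le> KC * NB"
      using card_mono[OF finTh, of "{\<theta> \<in> Th. lb \<theta> = 1}"] cardTh by (intro mult_le_mono1) auto
    finally show ?thesis .
  qed
  have QW: "S1 A \<subseteq> A" "S2 A \<subseteq> A" "S3 A \<subseteq> A" "sum h (S2 A) \<le> xi" "(\<Sum>i\<in>S3 A. w i * h i) \<le> xi" "\<forall>i\<in>S3 A. w i \<le> omb"
    "A = S1 A \<union> S2 A \<union> S3 A" "A \<in> I" "wide A" if "A \<in> Wi" for A
    using QB[of A] that I'I unfolding Wi_def QB_def by blast+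
  \<comment> \<open>There are at most \<open>KC * NB\<close> wide blocks, so the leftovers of all of
    them together stay within \<open>del / 64\<close>.\<close>
  have sumle: "sum f (\<Union>A\<in>Wi. S A) \<le> del / 64"
    if "\<And>A. A \<in> Wi \<Longrightarrow> S A \<subseteq> A" "\<And>A. A \<in> Wi \<Longrightarrow> sum f (S A) \<le> xi" for f :: "nat \<Rightarrow> real" and S
  proof -
    have "sum f (\<Union>A\<in>Wi. S A) = (\<Sum>A\<in>Wi. sum f (S A))"
    proof (rule sum.UNION_disjoint[OF finWi])
      show "\<forall>A\<in>Wi. finite (S A)" using that(1) IR(2) QW(8) finite_subset by metis
      show "\<forall>A\<in>Wi. \<forall>B\<in>Wi. A \<noteq> B \<longrightarrow> S A \<inter> S B = {}" using that(1) disjI QW(8) by blast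
    qed
    also have "\<dots> \<le> card Wi * xi" using sum_bounded_above[of Wi "\<lambda>A. sum f (S A)" xi] that(2) by simp
    also have "\<dots> \<le> real (KC * NB) * xi" using cardWi xi(1) by (intro mult_right_mono) (auto simp del: of_nat_mult)
    also have "\<dots> \<le> del / 64" using xi(2) by simp
    finally show ?thesis .
  qed
  have WiR: "i \<in> R" "h i \<le> mu" if "A \<in> Wi" "i \<in> A" for A i
    using IR(1)[OF QW(8)[OF that(1)]] blk(1)[OF QW(8)[OF that(1)] _ that(2)] QW(9)[OF that(1)] that Ns_h by blast+
  have M3: "containable e w h (box_int 0 (d1 + 2 * q) 1 q) (\<Union>A\<in>Wi. S2 A) 1"
  proof (rule containable_horizontal)
    have sub: "(\<Union>A\<in>Wi. S2 A) \<subseteq> R" using WiR(1) QW(2) by blast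
    then show "finite (\<Union>A\<in>Wi. S2 A)" using fin finite_subset by blast
    show "0 < w i \<and> 0 < h i" if "i \<in> (\<Union>A\<in>Wi. S2 A)" for i using sub R that by blast
    show "w i \<le> 1" if "i \<in> (\<Union>A\<in>Wi. S2 A)" for i using sub R(3,4) that by fastforce
    have "sum h (\<Union>A\<in>Wi. S2 A) \<le> del / 64" by (rule sumle) (use QW in blast)+
    then show "sum h (\<Union>A\<in>Wi. S2 A) \<le> q" unfolding q_def using del by linarith
  qed
  have M4: "containable e w h (box_int 0 (d1 + 3 * q) 1 q) (\<Union>A\<in>Wi. S3 A) 1"
  proof (rule containable_small[where om=omb and mu=mu])
    have sub: "(\<Union>A\<in>Wi. S3 A) \<subseteq> R" using WiR(1) QW(3) by blast
    then show "finite (\<Union>A\<in>Wi. S3 A)" using fin finite_subset by blast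
    show "0 < w i \<and> w i \<le> omb \<and> 0 < h i \<and> h i \<le> mu" if iU: "i \<in> (\<Union>A\<in>Wi. S3 A)" for i
    proof -
      obtain A where A: "A \<in> Wi" "i \<in> S3 A" using iU by (elim UN_E)
      have "i \<in> A" using QW(3)[OF A(1)] A(2) by (rule subsetD)
      moreover have "w i \<le> omb" using QW(6)[OF A(1)] A(2) by (rule bspec)
      ultimately show ?thesis using R(1,2) WiR[OF A(1)] by simp
    qed
    have "(\<Sum>i\<in>(\<Union>A\<in>Wi. S3 A). w i * h i) \<le> del / 64" by (rule sumle) (use QW in blast)+
    also have "\<dots> \<le> 1 / 2 * (del / 16)" using del by simp
    also have "\<dots> \<le> (1 - omb) * (q - mu)"
      using om om_e mu(6) del unfolding q_def by (intro mult_mono) auto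
    finally show "(\<Sum>i\<in>(\<Union>A\<in>Wi. S3 A). w i * h i) \<le> (1 - omb) * (q - mu)" .
    show "mu \<le> e * q" unfolding q_def using mu(5) by simp
  qed (use om om_e in auto)
  have "containable e w h (box_int 0 0 1 d1 \<union> box_int 0 d1 1 q \<union> box_int 0 (d1 + q) 1 g \<union>
      box_int 0 (d1 + 2 * q) 1 q \<union> box_int 0 (d1 + 3 * q) 1 q)
    ((\<Union>\<theta>\<in>Th. Ct \<theta>) \<union> Cr \<union> (\<Union>\<theta>\<in>Nr. \<Union>(Fb \<theta>)) \<union> (\<Union>A\<in>Wi. S2 A) \<union> (\<Union>A\<in>Wi. S3 A))
    (KC * (1 + NB * KB) + n + 1 + 1 + 1)"
    using g(4) q(1) by (intro containable_Un M0 M1 M2 M3 M4; auto simp: Int_Un_distrib2 q_def box_int_def)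
  then have final: "containable e w h (box_int 0 0 1 (1 + del))
    ((\<Union>\<theta>\<in>Th. Ct \<theta>) \<union> Cr \<union> (\<Union>\<theta>\<in>Nr. \<Union>(Fb \<theta>)) \<union> (\<Union>A\<in>Wi. S2 A) \<union> (\<Union>A\<in>Wi. S3 A))
    (KC * (1 + NB * KB) + n + 3)"
  proof (rule containable.mono)
    show "box_int 0 0 1 d1 \<union> box_int 0 d1 1 q \<union> box_int 0 (d1 + q) 1 g \<union>
      box_int 0 (d1 + 2 * q) 1 q \<union> box_int 0 (d1 + 3 * q) 1 q \<subseteq> box_int 0 0 1 (1 + del)"
      using g(4) q d1 by (intro Un_least box_sub) (auto simp: q_def)
  qed simp
  have "R' \<subseteq> (\<Union>\<theta>\<in>Th. Ct \<theta>) \<union> Cr \<union> (\<Union>\<theta>\<in>Nr. \<Union>(Fb \<theta>)) \<union> (\<Union>A\<in>Wi. S2 A) \<union> (\<Union>A\<in>Wi. S3 A)" (is "_ \<subseteq> ?U")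
  proof
    fix i assume "i \<in> R'"
    then consider "i \<in> Cr" | A where "A \<in> I'" "i \<in> A" unfolding R'_def by blast
    then show "i \<in> ?U"
    proof cases
      case (2 A)
      define \<theta> where "\<theta> = tup A"
      have A: "A \<in> Fb \<theta>" "\<theta> \<in> Th" unfolding \<theta>_def Fb_def Th_def using 2 by auto
      show ?thesis
      proof (cases "wide A")
        case True
        then have W: "A \<in> Wi" using 2 unfolding Wi_def by blast
        have "lb \<theta> = 1" using FbE(3)[OF A(1)] True unfolding wide_def by simp
        then have "S1 A \<subseteq> Ct \<theta>" unfolding Ct_def using A by auto
        moreover have "i \<in> S1 A \<or> i \<in> S2 A \<or> i \<in> S3 A" using QW(7)[OF W] 2(2) by (metis UnE)
        ultimately show ?thesis using W A(2) by (elim disjE) (simp_all only: Un_iff UN_iff, metis subsetD, metis, metis)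
      next
        case False
        then have l: "lb \<theta> = 0 \<or> lb \<theta> = 2"
          using lab(5)[OF FbD(2)[OF A(1)]] FbE(3)[OF A(1)] unfolding nar_def wide_def by auto
        show ?thesis
        proof (cases "\<theta> \<in> Nr")
          case True
          then have "i \<in> (\<Union>\<theta>\<in>Nr. \<Union>(Fb \<theta>))" using A(1) 2(2) by (intro UN_I UnionI)
          then show ?thesis by simp
        next
          case False
          then have "Ct \<theta> = \<Union>(Fb \<theta>)" using l A unfolding Nr_def Ct_def by auto
          then have "i \<in> (\<Union>\<theta>\<in>Th. Ct \<theta>)" using A 2(2) by (intro UN_I[of \<theta>]) auto
          then show ?thesis by simp
        qed
      qed
    qed blast
  qed
  then have "containable e w h (box_int 0 0 1 (1 + del)) R' (KC * (1 + NB * KB) + n + 3)"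
    using final containable_subset by blast
  then show ?thesis using R'R loss by blast
qed

text \<open>The half-open intervals between consecutive terms are disjoint, so each of the
  \<open>C\<close> values of an item hits at most one index; an item is hit at most \<open>C\<close>
  times, and averaging yields a cheap index.\<close>

lemma sequence_pigeonhole:
  fixes o' :: "nat \<Rightarrow> real" and v :: "nat \<Rightarrow> 'i \<Rightarrow> real" and p :: "'i \<Rightarrow> real"
  assumes "\<And>j. o' (Suc j) < o' j" "finite R" "\<And>i. i \<in> R \<Longrightarrow> 0 \<le> p i" "0 < J"
  shows "\<exists>j<J. sum p {i \<in> R. \<exists>c<C. o' (Suc j) < v c i \<and> v c i \<le> o' j} \<le> real C / real J * sum p R"
proof -
  define B where "B j = {i. \<exists>c<C. o' (Suc j) < v c i \<and> v c i \<le> o' j}" for j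
  have anti: "o' b \<le> o' a" if "a \<le> b" for a b
    using that by (induction rule: dec_induct) (auto intro: order_trans less_imp_le assms(1))
  have uniq: "j = k" if "o' (Suc j) < z" "z \<le> o' j" "o' (Suc k) < z" "z \<le> o' k" for j k z
  proof (rule ccontr)
    assume "j \<noteq> k"
    then consider "Suc j \<le> k" | "Suc k \<le> j" by linarith
    then show False using anti[of "Suc j" k] anti[of "Suc k" j] that by cases auto
  qed
  have one: "card {j. j < J \<and> i \<in> B j} \<le> C" for i
  proof -
    have "{j. j < J \<and> i \<in> B j} \<subseteq> (\<lambda>c. THE j. o' (Suc j) < v c i \<and> v c i \<le> o' j) ` {..<C}"
    proof
      fix j assume "j \<in> {j. j < J \<and> i \<in> B j}"
      then obtain c where c: "c < C" "o' (Suc j) < v c i" "v c i \<le> o' j" unfolding B_def by blast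
      then have "(THE j. o' (Suc j) < v c i \<and> v c i \<le> o' j) = j"
        using uniq by (intro the_equality) auto
      then show "j \<in> (\<lambda>c. THE j. o' (Suc j) < v c i \<and> v c i \<le> o' j) ` {..<C}" using c by force
    qed
    then have "card {j. j < J \<and> i \<in> B j} \<le> card ((\<lambda>c. THE j. o' (Suc j) < v c i \<and> v c i \<le> o' j) ` {..<C})"
      by (intro card_mono) auto
    also have "\<dots> \<le> C" using card_image_le[of "{..<C}"] by simp
    finally show ?thesis .
  qed
  obtain j where j: "j < J" "sum p (B j \<inter> R) \<le> real C / real J * sum p R"
    using averaging[of R p J B C] assms one by blast
  moreover have "B j \<inter> R = {i \<in> R. \<exists>c<C. o' (Suc j) < v c i \<and> v c i \<le> o' j}" unfolding B_def by blast
  ultimately show ?thesis by auto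
qed

lemma sequence_pigeonhole_single:
  fixes o' :: "nat \<Rightarrow> real" and v :: "'i \<Rightarrow> real" and p :: "'i \<Rightarrow> real"
  assumes "\<And>j. o' (Suc j) < o' j" "finite R" "\<And>i. i \<in> R \<Longrightarrow> 0 \<le> p i" "0 < J"
  shows "\<exists>j<J. sum p {i \<in> R. o' (Suc j) < v i \<and> v i \<le> o' j} \<le> 1 / real J * sum p R"
  using sequence_pigeonhole[where o'=o' and R=R and p=p and J=J and C=1 and v="\<lambda>_. v"] assms by simp

lemma nat_ceil_inverse:
  assumes "0 < eps"
  shows "0 < nat \<lceil>c / eps\<rceil> \<longleftrightarrow> 0 < c" "0 < c \<Longrightarrow> c / real (nat \<lceil>c / eps\<rceil>) \<le> eps"
proof -
  show "0 < nat \<lceil>c / eps\<rceil> \<longleftrightarrow> 0 < c" using assms by (simp add: zero_less_divide_iff)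
  assume c: "0 < c"
  have "c / eps \<le> real (nat \<lceil>c / eps\<rceil>)" by linarith
  moreover have "0 < c / eps" using assms c by simp
  ultimately have r: "0 < real (nat \<lceil>c / eps\<rceil>)" by linarith
  have "c \<le> real (nat \<lceil>c / eps\<rceil>) * eps"
    using \<open>c / eps \<le> real (nat \<lceil>c / eps\<rceil>)\<close> by (simp only: pos_divide_le_eq[OF assms])
  then show "c / real (nat \<lceil>c / eps\<rceil>) \<le> eps"
    by (simp only: pos_divide_le_eq[OF r] mult.commute)
qed

lemma sum_Un_le:
  fixes p :: "'i \<Rightarrow> real"
  assumes "finite R" "\<And>i. i \<in> R \<Longrightarrow> 0 \<le> p i" "A \<subseteq> R" "B \<subseteq> R"
  shows "sum p (A \<union> B) \<le> sum p A + sum p B"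
proof -
  have "finite A" "finite B" using assms finite_subset by blast+
  then have "sum p (A \<union> B) + sum p (A \<inter> B) = sum p A + sum p B" by (rule sum.union_inter)
  moreover have "0 \<le> sum p (A \<inter> B)" using assms by (intro sum_nonneg) blast
  ultimately show ?thesis by linarith
qed

lemma sum_Diff_le:
  fixes p :: "'i \<Rightarrow> real"
  assumes "finite R" "\<And>i. i \<in> R \<Longrightarrow> 0 \<le> p i" "R - S \<subseteq> A \<union> B" "A \<subseteq> R" "B \<subseteq> R"
  shows "sum p (R - S) \<le> sum p A + sum p B"
proof -
  have "finite (A \<union> B)" using assms by (auto intro: finite_subset)
  then have "sum p (R - S) \<le> sum p (A \<union> B)" using assms by (intro sum_mono2) blast+
  also have "\<dots> \<le> sum p A + sum p B" by (rule sum_Un_le[OF assms(1,2,4,5)])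
  finally show ?thesis .
qed

text \<open>Order of choice: the rows from \<open>del\<close> and \<open>rho\<close>, then the bound
  \<open>KC\<close>, then \<open>om\<close> and \<open>xi\<close>, then a sequence of width scales
  from \<open>om\<close> downwards generated by the packing of blocks. Which scale has a negligible
  gap depends on the items, so \<open>mu\<close> and \<open>K\<close> must serve the whole
  sequence.\<close>

lemma height_gap_packing:
  fixes e eps del rho :: real
  assumes e: "0 < e" "e \<le> 1" and eps: "0 < eps" "eps \<le> 1" and del: "0 < del" "del \<le> 1"
    and rho: "0 < rho" "rho \<le> 1 / 2"
  shows "\<exists>mu>0. mu < rho \<and> (\<exists>K. \<forall>w h p x y R. packed w h x y R 1 1 \<and> (\<forall>i\<in>R. 0 \<le> p i) \<and>
    (\<forall>i\<in>R. h i \<le> mu \<or> rho < h i) \<longrightarrow>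
    (\<exists>R'\<subseteq>R. sum p (R - R') \<le> 4 * eps * sum p R \<and> containable e w h (box_int 0 0 1 (1 + del)) R' K))"
proof -
  define n where "n = nat \<lceil>(1 + del / 2) * 4 / (del * rho)\<rceil>"
  define g where "g = (1 + del / 2) / n"
  have pos: "0 < (1 + del / 2) * 4 / (del * rho)" using del rho by (intro divide_pos_pos mult_pos_pos) auto
  have n: "(1 + del / 2) * 4 / (del * rho) \<le> real n" unfolding n_def by linarith
  then have n0: "0 < real n" using pos by linarith
  have g: "0 < g" "real n * g = 1 + del / 2" unfolding g_def using n0 del by auto
  have g3: "g \<le> del * rho / 4"
    using n n0 del rho unfolding g_def by (simp add: field_simps)
  have "del * rho \<le> del * (1 / 2)" using del rho by (intro mult_left_mono) auto
  then have g4: "g \<le> del / 8" using g3 by simp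
  have "\<exists>K. \<forall>(I::nat set set) x s p cl U V.
    finite I \<and> (\<forall>i\<in>I. 0 < s i \<and> 0 \<le> p i) \<and> (\<forall>i\<in>I. U \<le> x i \<and> x i + s i \<le> V) \<and> cl ` I \<subseteq> {..n} \<times> {..n} \<times> {..2} \<and>
    (\<forall>i\<in>I. \<forall>j\<in>I. i \<noteq> j \<longrightarrow> sep x s i j \<or> disjoint_rows (cl i) (cl j)) \<longrightarrow>
    (\<exists>I'\<subseteq>I. sum p (I - I') \<le> 3 * eps * sum p I \<and> arrangeable cl (\<lambda>i j. disjoint_rows (cl i) (cl j)) s I' U V K)"
    by (rule class_arrangement[OF eps]) (auto simp: disjoint_rows_def)
  then obtain KC where KC: "\<forall>(I::nat set set) x s p cl U V.
    finite I \<and> (\<forall>i\<in>I. 0 < s i \<and> 0 \<le> p i) \<and> (\<forall>i\<in>I. U \<le> x i \<and> x i + s i \<le> V) \<and> cl ` I \<subseteq> {..n} \<times> {..n} \<times> {..2} \<and>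
    (\<forall>i\<in>I. \<forall>j\<in>I. i \<noteq> j \<longrightarrow> sep x s i j \<or> disjoint_rows (cl i) (cl j)) \<longrightarrow>
    (\<exists>I'\<subseteq>I. sum p (I - I') \<le> 3 * eps * sum p I \<and> arrangeable cl (\<lambda>i j. disjoint_rows (cl i) (cl j)) s I' U V KC)"
    by (elim exE)
  define om where "om = e / (KC + 2)"
  define NB where "NB = nat \<lfloor>1 / om\<rfloor>"
  define dd where "dd = real (KC * NB) + 1"
  define xi where "xi = del / 64 / dd"
  have om: "0 < om" "om * (KC + 2) \<le> e" "om \<le> 1" unfolding om_def using e by (auto simp: divide_le_eq)
  have dd: "0 < dd" unfolding dd_def by (simp add: add_nonneg_pos)
  have xi: "0 < xi" unfolding xi_def using del dd by simp
  have xi2: "KC * NB * xi \<le> del / 64"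
  proof -
    have "real (KC * NB) * xi \<le> dd * xi" unfolding dd_def using xi by (intro mult_right_mono) auto
    also have "\<dots> = del / 64" unfolding xi_def using dd by simp
    finally show ?thesis by simp
  qed
  define Q where "Q om1 om2 mu K \<longleftrightarrow> (\<forall>w h x y S u g. packed w h x y S u g \<and>
    0 \<le> u \<and> u \<le> 1 \<and> 0 \<le> g \<and> g \<le> 1 \<and> (\<forall>i\<in>S. h i \<le> mu \<and> (om1 < w i \<or> w i \<le> om2)) \<longrightarrow>
    (\<exists>S1 S2 S3. S = S1 \<union> S2 \<union> S3 \<and> containable e w h (box_int 0 0 u g) S1 K \<and>
      sum h S2 \<le> xi \<and> (\<Sum>i\<in>S3. w i * h i) \<le> xi \<and> (\<forall>i\<in>S3. w i \<le> om2)))" for om1 om2 mu :: real and K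
  have "\<exists>om2 mu K. 0 < om2 \<and> om2 < om1 \<and> 0 < mu \<and> Q om1 om2 mu K" if "0 < om1" "om1 \<le> 1" for om1
  proof -
    from block_packing[OF e that xi] obtain om2 mu K where "0 < om2" "om2 < om1" "0 < mu"
      and "\<forall>w h x y S u g. packed w h x y S u g \<and>
      0 \<le> u \<and> u \<le> 1 \<and> 0 \<le> g \<and> g \<le> 1 \<and> (\<forall>i\<in>S. h i \<le> mu \<and> (om1 < w i \<or> w i \<le> om2)) \<longrightarrow>
      (\<exists>S1 S2 S3. S = S1 \<union> S2 \<union> S3 \<and> containable e w h (box_int 0 0 u g) S1 K \<and>
        sum h S2 \<le> xi \<and> (\<Sum>i\<in>S3. w i * h i) \<le> xi \<and> (\<forall>i\<in>S3. w i \<le> om2))"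
      by (elim exE conjE)
    then show ?thesis unfolding Q_def by (intro exI[of _ om2] exI[of _ mu] exI[of _ K] conjI)
  qed
  then obtain f2 fm fK where f: "\<And>om1. 0 < om1 \<Longrightarrow> om1 \<le> 1 \<Longrightarrow>
    0 < f2 om1 \<and> f2 om1 < om1 \<and> 0 < fm om1 \<and> Q om1 (f2 om1) (fm om1) (fK om1)" by metis
  define f2' where "f2' z = (if 0 < z \<and> z \<le> 1 then f2 z else z - 1)" for z
  define os where "os j = (f2' ^^ j) om" for j
  have os: "0 < os j" "os j \<le> om" for j
  proof (induction j)
    case (Suc j)
    then have "os (Suc j) = f2 (os j)" unfolding os_def f2'_def using om(3) by auto
    then show "0 < os (Suc j)" "os (Suc j) \<le> om" using f[of "os j"] Suc om(3) by auto
  qed (use om in \<open>auto simp: os_def\<close>)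
  have os1: "os j \<le> 1" for j using os(2)[of j] om(3) by linarith
  have osS: "os (Suc j) = f2 (os j)" for j
    using os(1)[of j] os1[of j] unfolding os_def f2'_def by simp
  have osdec: "os (Suc j) < os j" for j using f[OF os(1) os1] osS by simp
  define J where "J = nat \<lceil>1 / eps\<rceil>"
  have J: "0 < J" "1 / real J \<le> eps" unfolding J_def using nat_ceil_inverse[OF eps(1), of 1] by auto
  \<comment> \<open>The first five terms are what the rows and the strips require of
    \<open>mu\<close>; the others make it small enough for the packing of blocks at every
    scale.\<close>
  define M where "M = {rho / 2, del / 8 / n, e * g, e * del / 8, del / 16} \<union> (\<lambda>j. fm (os j)) ` {..<J}"
  define mu where "mu = Min M"
  have finM: "finite M" "M \<noteq> {}" unfolding M_def by auto
  have Mpos: "0 < z" if "z \<in> M" for z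
  proof -
    have A: "0 < rho / 2" "0 < del / 8 / n" "0 < e * g" "0 < e * del / 8" "0 < del / 16"
      using n0 rho del e g by simp_all
    have "0 < fm (os j)" for j using f[OF os(1) os1] by blast
    moreover have "z = rho / 2 \<or> z = del / 8 / n \<or> z = e * g \<or> z = e * del / 8 \<or> z = del / 16 \<or> (\<exists>j. z = fm (os j))"
      using that unfolding M_def by (simp only: Un_iff insert_iff image_iff empty_iff) blast
    ultimately show ?thesis using A by (elim disjE exE) (simp_all only:)
  qed
  have mu0: "0 < mu" unfolding mu_def using finM Mpos by simp
  have mu_le: "mu \<le> z" if "z \<in> M" for z unfolding mu_def using finM that by simp
  have mus: "mu < rho" "mu \<le> del / 8 / n" "mu \<le> e * g" "mu \<le> e * del / 8" "mu \<le> del / 16"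
    using mu_le[of "rho / 2"] mu_le[of "del / 8 / n"] mu_le[of "e * g"] mu_le[of "e * del / 8"]
      mu_le[of "del / 16"] rho unfolding M_def by auto
  have mu_n: "real n * mu \<le> del / 8" using mus(2) n0 by (simp add: field_simps)
  \<comment> \<open>The sum dominates the bound for whichever \<open>j\<close> is selected once the
    items are given.\<close>
  define K where "K = (\<Sum>j<J. KC * (1 + NB * fK (os j)) + n + 3)"
  have main: "\<exists>R'\<subseteq>R. sum p (R - R') \<le> 4 * eps * sum p R \<and> containable e w h (box_int 0 0 1 (1 + del)) R' K"
    if a: "packed w h x y R 1 1" "\<forall>i\<in>R. 0 \<le> p i" "\<forall>i\<in>R. h i \<le> mu \<or> rho < h i" for w h p x y :: "nat \<Rightarrow> real" and R
  proof -
    have fin: "finite R" using a(1) unfolding packed_def by blast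
    obtain j where j: "j < J" "sum p {i \<in> R. os (Suc j) < w i \<and> w i \<le> os j} \<le> 1 / real J * sum p R"
      using sequence_pigeonhole_single[of os R p J w] osdec fin a(2) J(1) by blast
    define B where "B = {i \<in> R. os (Suc j) < w i \<and> w i \<le> os j}"
    have sp: "0 \<le> sum p R" using a(2) by (intro sum_nonneg) auto
    have "sum p B \<le> 1 / real J * sum p R" using j(2) unfolding B_def by simp
    also have "\<dots> \<le> eps * sum p R" using J(2) sp by (rule mult_right_mono)
    finally have B: "sum p B \<le> eps * sum p R" .
    have BLj: "\<forall>w h x y S u g. packed w h x y S u g \<and>
        0 \<le> u \<and> u \<le> 1 \<and> 0 \<le> g \<and> g \<le> 1 \<and> (\<forall>i\<in>S. h i \<le> mu \<and> (os j < w i \<or> w i \<le> os (Suc j))) \<longrightarrow>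
        (\<exists>S1 S2 S3. S = S1 \<union> S2 \<union> S3 \<and> containable e w h (box_int 0 0 u g) S1 (fK (os j)) \<and>
          sum h S2 \<le> xi \<and> (\<Sum>i\<in>S3. w i * h i) \<le> xi \<and> (\<forall>i\<in>S3. w i \<le> os (Suc j)))"
    proof (intro allI impI, elim conjE)
      fix w h x y :: "nat \<Rightarrow> real" and S u g
      assume b: "packed w h x y S u g" "0 \<le> u" "u \<le> 1" "0 \<le> g" "g \<le> 1"
        and b6: "\<forall>i\<in>S. h i \<le> mu \<and> (os j < w i \<or> w i \<le> os (Suc j))"
      have "mu \<le> fm (os j)" using j(1) by (intro mu_le) (auto simp: M_def)
      then have b': "\<forall>i\<in>S. h i \<le> fm (os j) \<and> (os j < w i \<or> w i \<le> f2 (os j))"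
        using b6 unfolding osS by (meson order_trans)
      have "Q (os j) (f2 (os j)) (fm (os j)) (fK (os j))" using f[OF os(1) os1] by blast
      then show "\<exists>S1 S2 S3. S = S1 \<union> S2 \<union> S3 \<and> containable e w h (box_int 0 0 u g) S1 (fK (os j)) \<and>
        sum h S2 \<le> xi \<and> (\<Sum>i\<in>S3. w i * h i) \<le> xi \<and> (\<forall>i\<in>S3. w i \<le> os (Suc j))"
        unfolding osS Q_def by (elim allE impE) (intro conjI, (fact b b')+)
    qed
    have PK: "packed w h x y (R - B) 1 1" using a(1) by (rule packed_subset) blast
    have P0: "\<forall>i\<in>R - B. 0 \<le> p i" and G1: "\<forall>i\<in>R - B. h i \<le> mu \<or> rho < h i" using a(2,3) by blast+
    have G2: "\<forall>i\<in>R - B. w i \<le> os (Suc j) \<or> os j < w i" unfolding B_def by auto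
    have "\<exists>R'\<subseteq>R - B. sum p (R - B - R') \<le> 3 * eps * sum p (R - B) \<and>
      containable e w h (box_int 0 0 1 (1 + del)) R' (KC * (1 + NB * fK (os j)) + n + 3)"
      by (rule aligned_packing[OF e del rho(1) g g3 g4 om(1,2) os(2) os(1) osdec NB_def less_imp_le[OF xi] xi2
            mu0 mus(1) mu_n mus(3,4,5) KC BLj PK P0 eps(1) G1 G2])
    then obtain R' where R': "R' \<subseteq> R - B" "sum p (R - B - R') \<le> 3 * eps * sum p (R - B)"
      "containable e w h (box_int 0 0 1 (1 + del)) R' (KC * (1 + NB * fK (os j)) + n + 3)" by blast
    have "sum p (R - R') \<le> sum p B + sum p (R - B - R')"
      using fin a(2) by (intro sum_Diff_le) (auto simp: B_def)
    moreover have "sum p (R - B) \<le> sum p R" using fin a(2) by (intro sum_mono2) auto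
    then have "3 * eps * sum p (R - B) \<le> 3 * eps * sum p R" using eps by (intro mult_left_mono) auto
    ultimately have 1: "sum p (R - R') \<le> 4 * eps * sum p R" using B R'(2) by linarith
    have "KC * (1 + NB * fK (os j)) + n + 3 \<le> K"
      unfolding K_def using j(1) by (intro member_le_sum) auto
    then have "containable e w h (box_int 0 0 1 (1 + del)) R' K" using R'(3) by (intro containable.mono[OF R'(3)]) auto
    then show ?thesis using R'(1) 1 by blast
  qed
  show ?thesis
  proof (rule exI[of _ mu], intro conjI, rule mu0, rule mus(1), rule exI[of _ K], intro allI impI, elim conjE)
    fix w h p x y :: "nat \<Rightarrow> real" and R
    assume "packed w h x y R 1 1" "\<forall>i\<in>R. 0 \<le> p i" "\<forall>i\<in>R. h i \<le> mu \<or> rho < h i"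
    then show "\<exists>R'\<subseteq>R. sum p (R - R') \<le> 4 * eps * sum p R \<and> containable e w h (box_int 0 0 1 (1 + del)) R' K"
      by (rule main)
  qed
qed

text \<open>The lower end \<open>fm rho\<close> of the gap between short and tall depends on the
  upper end \<open>rho\<close>. Iterating \<open>fm\<close> produces consecutive gaps, and among
  enough of them one contains only negligible profit.\<close>

lemma resource_augmentation_unit:
  fixes e eps del :: real
  assumes e: "0 < e" "e \<le> 1" and eps: "0 < eps" "eps \<le> 1" and del: "0 < del" "del \<le> 1"
  shows "\<exists>K. \<forall>w h p x y R. packed w h x y R 1 1 \<and> (\<forall>i\<in>R. 0 \<le> p i) \<longrightarrow>
    (\<exists>R'\<subseteq>R. sum p (R - R') \<le> 5 * eps * sum p R \<and> containable e w h (box_int 0 0 1 (1 + del)) R' K)"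
proof -
  define Q where "Q rho mu K \<longleftrightarrow> (\<forall>w h p x y R. packed w h x y R 1 1 \<and> (\<forall>i\<in>R. 0 \<le> p i) \<and>
    (\<forall>i\<in>R. h i \<le> mu \<or> rho < h i) \<longrightarrow>
    (\<exists>R'\<subseteq>R. sum p (R - R') \<le> 4 * eps * sum p R \<and> containable e w h (box_int 0 0 1 (1 + del)) R' K))"
    for rho mu :: real and K
  have "\<exists>mu K. 0 < mu \<and> mu < rho \<and> Q rho mu K" if "0 < rho" "rho \<le> 1 / 2" for rho
    using height_gap_packing[OF e eps del that] unfolding Q_def by blast
  then obtain fm fK where f: "\<And>rho. 0 < rho \<Longrightarrow> rho \<le> 1 / 2 \<Longrightarrow> 0 < fm rho \<and> fm rho < rho \<and> Q rho (fm rho) (fK rho)"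
    by metis
  define os where "os j = (fm ^^ j) (1 / 2)" for j
  have os: "0 < os j \<and> os j \<le> 1 / 2" for j
  proof (induction j)
    case (Suc j)
    then have "0 < fm (os j) \<and> fm (os j) < os j" using f[of "os j"] by blast
    moreover have "os (Suc j) = fm (os j)" unfolding os_def by simp
    ultimately show ?case using Suc by linarith
  qed (simp add: os_def)
  have osS: "os (Suc j) = fm (os j)" for j unfolding os_def by simp
  have osdec: "os (Suc j) < os j" for j using f[of "os j"] os[of j] unfolding osS by blast
  define J where "J = nat \<lceil>1 / eps\<rceil>"
  have J: "0 < J" "1 / real J \<le> eps" unfolding J_def using nat_ceil_inverse[OF eps(1), of 1] by auto
  define K where "K = (\<Sum>j<J. fK (os j))"
  show ?thesis
  proof (rule exI[of _ K], intro allI impI, elim conjE)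
    fix w h p x y :: "nat \<Rightarrow> real" and R
    assume a: "packed w h x y R 1 1" "\<forall>i\<in>R. 0 \<le> p i"
    have fin: "finite R" using a(1) unfolding packed_def by blast
    obtain j where j: "j < J" "sum p {i \<in> R. os (Suc j) < h i \<and> h i \<le> os j} \<le> 1 / real J * sum p R"
      using sequence_pigeonhole_single[of os R p J h] osdec fin a(2) J(1) by blast
    define B where "B = {i \<in> R. os (Suc j) < h i \<and> h i \<le> os j}"
    have sp: "0 \<le> sum p R" using a(2) by (intro sum_nonneg) auto
    have "sum p B \<le> 1 / real J * sum p R" using j(2) unfolding B_def by simp
    also have "\<dots> \<le> eps * sum p R" using J(2) sp by (rule mult_right_mono)
    finally have B: "sum p B \<le> eps * sum p R" .
    have Qj: "Q (os j) (fm (os j)) (fK (os j))" using f[of "os j"] os[of j] by blast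
    have PK: "packed w h x y (R - B) 1 1" using a(1) by (rule packed_subset) blast
    have P0: "\<forall>i\<in>R - B. 0 \<le> p i" using a(2) by blast
    have G1: "\<forall>i\<in>R - B. h i \<le> fm (os j) \<or> os j < h i" unfolding B_def osS by auto
    have "\<exists>R'\<subseteq>R - B. sum p (R - B - R') \<le> 4 * eps * sum p (R - B) \<and>
      containable e w h (box_int 0 0 1 (1 + del)) R' (fK (os j))"
      by (rule Qj[unfolded Q_def, rule_format]) (intro conjI, (fact PK P0 G1)+)
    then obtain R' where R': "R' \<subseteq> R - B" "sum p (R - B - R') \<le> 4 * eps * sum p (R - B)"
      "containable e w h (box_int 0 0 1 (1 + del)) R' (fK (os j))" by blast
    have "sum p (R - R') \<le> sum p B + sum p (R - B - R')"
      using fin a(2) by (intro sum_Diff_le) (auto simp: B_def)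
    moreover have "sum p (R - B) \<le> sum p R" using fin a(2) by (intro sum_mono2) auto
    then have "4 * eps * sum p (R - B) \<le> 4 * eps * sum p R" using eps by (intro mult_left_mono) auto
    ultimately have 1: "sum p (R - R') \<le> 5 * eps * sum p R" using B R'(2) by linarith
    have "fK (os j) \<le> K" unfolding K_def using j(1) by (intro member_le_sum) auto
    then have "containable e w h (box_int 0 0 1 (1 + del)) R' K" by (intro containable.mono[OF R'(3)]) auto
    then show "\<exists>R'\<subseteq>R. sum p (R - R') \<le> 5 * eps * sum p R \<and> containable e w h (box_int 0 0 1 (1 + del)) R' K"
      using R'(1) 1 by blast
  qed
qed

lemma packed_scale:
  assumes "packed w h x y R (a::real) b" "0 < a" "0 < b"
  shows "packed (\<lambda>i. w i / a) (\<lambda>i. h i / b) (\<lambda>i. x i / a) (\<lambda>i. y i / b) R 1 1"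
proof -
  have s: "sep (\<lambda>i. x i / c) (\<lambda>i. w i / c) i j \<longleftrightarrow> sep x w i j" if "0 < c" for c i j and x w :: "'a \<Rightarrow> real"
    unfolding sep_def using that by (simp add: add_divide_distrib[symmetric] divide_le_cancel)
  have "x i / c + w i / c \<le> 1 \<longleftrightarrow> x i + w i \<le> c" if "0 < c" for c i and x w :: "'a \<Rightarrow> real"
    using that by (simp add: add_divide_distrib[symmetric])
  then show ?thesis using assms unfolding packed_def by (auto simp: s[OF assms(2)] s[OF assms(3)])
qed

lemma packed_transpose: "packed w h x y R a b \<Longrightarrow> packed h w y x R b a"
  unfolding packed_def by blast

text \<open>The loss consists of \<open>3 * eps\<close> for the arrangement and \<open>eps\<close>
  each for the width gap and the height gap. Scaling to the unit square is harmless since the area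
  condition is relative to the container.\<close>

theorem resource_augmentation:
  fixes e eps del :: real
  assumes e: "0 < e" "e \<le> 1" and eps: "0 < eps" "eps \<le> 1" and del: "0 < del" "del \<le> 1"
  shows "\<exists>K. \<forall>w h p x y R a b. packed w h x y R a b \<and> (\<forall>i\<in>R. 0 \<le> p i) \<longrightarrow>
    (\<exists>R'\<subseteq>R. sum p (R - R') \<le> 5 * eps * sum p R \<and> containable e w h (box_int 0 0 a ((1 + del) * b)) R' K)"
proof -
  obtain K where K: "\<forall>w h p x y R. packed w h x y R 1 1 \<and> (\<forall>i\<in>R. 0 \<le> p i) \<longrightarrow>
    (\<exists>R'\<subseteq>R. sum p (R - R') \<le> 5 * eps * sum p R \<and> containable e w h (box_int 0 0 1 (1 + del)) R' K)"
    using resource_augmentation_unit[OF assms] by (elim exE)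
  show ?thesis
  proof (rule exI[of _ K], intro allI impI, elim conjE)
    fix w h p x y :: "nat \<Rightarrow> real" and R a b
    assume packed: "packed w h x y R a b" and p: "\<forall>i\<in>R. 0 \<le> p i"
    show "\<exists>R'\<subseteq>R. sum p (R - R') \<le> 5 * eps * sum p R \<and> containable e w h (box_int 0 0 a ((1 + del) * b)) R' K"
    proof (cases "R = {}")
      case True
      then show ?thesis using containable_empty by auto
    next
      case False
      then obtain i where "i \<in> R" by blast
      then have "0 < w i" "0 < h i" "0 \<le> x i" "x i + w i \<le> a" "0 \<le> y i" "y i + h i \<le> b"
        using packed unfolding packed_def by blast+
      then have ab: "0 < a" "0 < b" by linarith+
      have "\<exists>R'\<subseteq>R. sum p (R - R') \<le> 5 * eps * sum p R \<and>
        containable e (\<lambda>i. w i / a) (\<lambda>i. h i / b) (box_int 0 0 1 (1 + del)) R' K"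
        by (rule K[rule_format]) (intro conjI, (fact packed_scale[OF packed ab] p)+)
      then obtain R' where R': "R' \<subseteq> R" "sum p (R - R') \<le> 5 * eps * sum p R"
        "containable e (\<lambda>i. w i / a) (\<lambda>i. h i / b) (box_int 0 0 1 (1 + del)) R' K" by blast
      have "containable e w h (box_int 0 0 (a * 1) (b * (1 + del))) R' K" by (rule containable_scale[OF R'(3) ab])
      then show ?thesis using R'(1,2) by (auto simp: mult.commute)
    qed
  qed
qed

lemma swap_box: "prod.swap ` box_int X Y a b = box_int Y X b a"
  unfolding box_int_def by (simp add: product_swap)

section \<open>The unit square\<close>

definition spanning :: "('i \<Rightarrow> real) \<Rightarrow> ('i \<Rightarrow> real) \<Rightarrow> real \<Rightarrow> 'i set \<Rightarrow> 'i set" where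
  "spanning h y d V = {i \<in> V. y i \<le> d \<and> 1 - d \<le> y i + h i}"

definition ends :: "('i \<Rightarrow> real) \<Rightarrow> ('i \<Rightarrow> real) \<Rightarrow> real \<Rightarrow> 'i set \<Rightarrow> 'i set" where
  "ends h y d V = {i \<in> V - spanning h y d V. y i + h i \<le> d \<or> 1 - d \<le> y i}"

text \<open>When no height lies between \<open>d\<close> and \<open>D\<close>, every other
  nonspanning item that reaches above \<open>1 - D\<close> is short, and thin strips handle short
  items. So dropping these items makes the zone cheap to clear.\<close>

definition upper :: "('i \<Rightarrow> real) \<Rightarrow> ('i \<Rightarrow> real) \<Rightarrow> real \<Rightarrow> real \<Rightarrow> 'i set \<Rightarrow> 'i set" where
  "upper h y D d V = {i \<in> V - spanning h y d V. D < h i \<and> 1 - D < y i + h i}"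

definition lower :: "('i \<Rightarrow> real) \<Rightarrow> ('i \<Rightarrow> real) \<Rightarrow> real \<Rightarrow> real \<Rightarrow> 'i set \<Rightarrow> 'i set" where
  "lower h y D d V = {i \<in> V - spanning h y d V. D < h i \<and> y i < D}"

lemma nat_close_card:
  assumes "\<And>i j. i \<in> A \<Longrightarrow> j \<in> A \<Longrightarrow> i \<le> Suc j"
  shows "card (A :: nat set) \<le> 2"
proof (cases "A = {}")
  case False
  define a where "a = (LEAST a. a \<in> A)"
  have a: "a \<in> A" "\<And>j. j \<in> A \<Longrightarrow> a \<le> j"
    unfolding a_def using False by (auto intro: LeastI Least_le)
  have "A \<subseteq> {a, Suc a}"
  proof
    fix i assume "i \<in> A"
    then have "a \<le> i" "i \<le> Suc a" using a assms by auto
    then show "i \<in> {a, Suc a}" by auto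
  qed
  then have "card A \<le> card {a, Suc a}" by (intro card_mono) auto
  then show ?thesis by simp
qed simp

text \<open>Cut the zone above \<open>1 - D\<close> into \<open>M\<close> strips of height \<open>s\<close>, drop the items meeting the cheapest one, and lower
what lies above it.\<close>

lemma zone_shift:
  fixes p :: "'i \<Rightarrow> real"
  assumes packed: "packed w h x y V a 1" and D: "0 < D" "D \<le> 1" and M: "0 < M" and s: "s = D / real M" and d: "d \<le> s"
    and p: "\<And>i. i \<in> V \<Longrightarrow> 0 \<le> p i" and V: "\<And>i. i \<in> V \<Longrightarrow> y i + h i \<le> 1 - D \<or> h i \<le> d"
  shows "\<exists>V'\<subseteq>V. sum p (V - V') \<le> 2 / real M * sum p V \<and> (\<exists>y'. packed w h x y' V' a (1 - s))"
proof -
  have fin: "finite V" using packed unfolding packed_def by blast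
  have s0: "0 < s" and Ms: "real M * s = D" unfolding s using D M by auto
  define lo where "lo j = 1 - D + real j * s" for j
  have loS: "lo (Suc j) = lo j + s" for j unfolding lo_def by (simp add: algebra_simps)
  have lom: "lo i + s \<le> lo j" if "i < j" for i j
  proof -
    have "(real i + 1) * s \<le> real j * s" using that s0 by (intro mult_right_mono) auto
    then show ?thesis unfolding lo_def by (simp add: algebra_simps)
  qed
  define B where "B j = {i. h i \<le> d \<and> y i < lo j + s \<and> lo j < y i + h i}" for j
  \<comment> \<open>An item no taller than a strip meets at most two strips, which are adjacent;
    hence the factor 2.\<close>
  have "\<exists>j<M. sum p (B j \<inter> V) \<le> real 2 / real M * sum p V"
  proof (rule averaging[OF fin p M])
    fix i
    show "card {j. j < M \<and> i \<in> B j} \<le> 2"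
    proof (rule nat_close_card)
      fix j k assume jk: "j \<in> {j. j < M \<and> i \<in> B j}" "k \<in> {j. j < M \<and> i \<in> B j}"
      show "j \<le> Suc k"
      proof (rule ccontr)
        assume "\<not> j \<le> Suc k"
        then have "lo (Suc k) + s \<le> lo j" by (intro lom) simp
        moreover have "lo j < y i + h i" "y i < lo k + s" "h i \<le> d" using jk unfolding B_def by auto
        ultimately show False using d unfolding loS by linarith
      qed
    qed
  qed
  then obtain j where j: "j < M" "sum p (B j \<inter> V) \<le> 2 / real M * sum p V" by auto
  define V' where "V' = V - B j"
  have loD: "1 - D \<le> lo j" "lo j + s \<le> 1"
  proof -
    show "1 - D \<le> lo j" unfolding lo_def using s0 by simp
    have "(real j + 1) * s \<le> real M * s" using j(1) s0 by (intro mult_right_mono) auto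
    then show "lo j + s \<le> 1" using Ms unfolding lo_def by (simp add: distrib_right)
  qed
  have V': "y i + h i \<le> lo j \<or> lo j + s \<le> y i" if "i \<in> V'" for i
    using that V[of i] loD(1) unfolding V'_def B_def by force
  define y' where "y' i = (if y i + h i \<le> lo j then y i else y i - s)" for i
  have pos: "0 < w i" "0 < h i" "0 \<le> x i" "x i + w i \<le> a" "0 \<le> y i" "y i + h i \<le> 1" if "i \<in> V'" for i
    using packed that unfolding packed_def V'_def by blast+
  have "packed w h x y' V' a (1 - s)"
    unfolding packed_def
  proof (intro conjI ballI impI)
    show "finite V'" unfolding V'_def using fin by simp
    fix i assume i: "i \<in> V'"
    show "0 < w i" "0 < h i" "0 \<le> x i" "x i + w i \<le> a" using pos[OF i] by blast+
    show "0 \<le> y' i" using V'[OF i] pos[OF i] loD(1) D(2) unfolding y'_def by auto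
    show "y' i + h i \<le> 1 - s" using V'[OF i] pos[OF i] loD unfolding y'_def by auto
    fix k assume k: "k \<in> V'" "i \<noteq> k"
    show "sep x w i k \<or> sep y' h i k"
    proof (cases "sep x w i k")
      case False
      then have "sep y h i k" using packed i k unfolding packed_def V'_def by blast
      then have "sep y' h i k"
        using V'[OF i] V'[OF k(1)] pos(2)[OF i] pos(2)[OF k(1)] s0 unfolding sep_def y'_def by auto
      then show ?thesis ..
    qed simp
  qed
  moreover have "sum p (V - V') \<le> 2 / real M * sum p V"
  proof -
    have "V - V' = B j \<inter> V" unfolding V'_def by blast
    then show ?thesis using j(2) by simp
  qed
  ultimately show ?thesis unfolding V'_def by blast
qed

lemma packed_flip:
  assumes "packed w h x y V a b"
  shows "packed w h x (\<lambda>i. b - y i - h i) V a b"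
proof -
  have "sep (\<lambda>i. b - y i - h i) h i j \<longleftrightarrow> sep y h i j" for i j unfolding sep_def by auto
  then show ?thesis using assms unfolding packed_def by auto
qed

text \<open>Without the tall items of one side, only items of height at most \<open>d\<close> reach
  the zone at that side, so a strip can be cleared there; the lower zone reduces to the upper one by
  reflection.\<close>

lemma free_zone:
  fixes p :: "'i \<Rightarrow> real"
  assumes packed: "packed w h x y V a 1" and D: "0 < D" "D \<le> 1" and M: "0 < M" and s: "s = D / real M" and d: "d \<le> s"
    and p: "\<And>i. i \<in> V \<Longrightarrow> 0 \<le> p i" and gap: "\<And>i. i \<in> V \<Longrightarrow> h i \<le> d \<or> D < h i"
    and U: "U \<subseteq> V - spanning h y d V" "U \<inter> upper h y D d V = {} \<or> U \<inter> lower h y D d V = {}"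
  shows "\<exists>U'\<subseteq>U. sum p (U - U') \<le> 2 / real M * sum p U \<and> (\<exists>y'. packed w h x y' U' a (1 - s))"
proof -
  have pkU: "packed w h x y U a 1" using U by (intro packed_subset[OF packed]) blast
  have p': "\<And>i. i \<in> U \<Longrightarrow> 0 \<le> p i" using p U by blast
  from U(2) show ?thesis
  proof
    assume u: "U \<inter> upper h y D d V = {}"
    show ?thesis
      by (rule zone_shift[OF pkU D M s d p']) (use u U(1) gap in \<open>force simp: upper_def\<close>)+
  next
    assume u: "U \<inter> lower h y D d V = {}"
    show ?thesis
      by (rule zone_shift[OF packed_flip[OF pkU] D M s d p']) (use u U(1) gap in \<open>force simp: lower_def\<close>)+
  qed
qed

text \<open>A spanning item covers all heights between \<open>d\<close> and \<open>1 - d\<close>. An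
  item outside \<open>ends\<close> meets this range, so the two overlap vertically and can only be
  separated horizontally.\<close>

lemma spanning_sep:
  assumes packed: "packed w h x y V a 1" and d: "d < 1 / 2" and f: "f \<in> spanning h y d V" and i: "i \<in> V" "i \<noteq> f"
    "i \<notin> ends h y d V"
  shows "sep x w i f"
proof -
  have *: "sep x w i f \<or> sep y h i f" using packed i f unfolding packed_def spanning_def by blast
  show ?thesis
  proof (cases "i \<in> spanning h y d V")
    case True
    then show ?thesis using * f d unfolding spanning_def sep_def by auto
  next
    case False
    then have "d < y i + h i" "y i < 1 - d" using i unfolding ends_def by auto
    then show ?thesis using * f unfolding spanning_def sep_def by auto
  qed
qed

lemma spanning_not_ends: "f \<in> spanning h y d V \<Longrightarrow> f \<notin> ends h y d V"
  unfolding ends_def by auto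

lemma spanning_width:
  assumes packed: "packed w h x y V a 1" and d: "d < 1 / 2" and a: "0 \<le> a"
  shows "sum w (spanning h y d V) \<le> a"
proof -
  have "sum w (spanning h y d V) \<le> a - 0"
  proof (rule sum_le_of_sep[where x=x])
    fix i j assume ij: "i \<in> spanning h y d V" "j \<in> spanning h y d V" "i \<noteq> j"
    then show "sep x w i j"
      by (intro spanning_sep[OF packed d]) (auto simp: spanning_not_ends, auto simp: spanning_def)
  qed (use packed a in \<open>auto simp: packed_def spanning_def\<close>)
  then show ?thesis by simp
qed

text \<open>The columns of \<open>F\<close> are cut out: an item moves left by the total width of
  the members of \<open>F\<close> to its left. Horizontally separated items stay so because the
  members of \<open>F\<close> between them fit into the gap between them.\<close>

lemma compaction:
  fixes w x :: "'i \<Rightarrow> real"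
  assumes packed: "packed w h x y N a b" and F: "finite F" "\<And>f. f \<in> F \<Longrightarrow> 0 < w f \<and> 0 \<le> x f \<and> x f + w f \<le> a"
    and FF: "\<And>f g. f \<in> F \<Longrightarrow> g \<in> F \<Longrightarrow> f \<noteq> g \<Longrightarrow> sep x w f g"
    and NF: "\<And>i f. i \<in> N \<Longrightarrow> f \<in> F \<Longrightarrow> sep x w i f"
  shows "\<exists>x'. packed w h x' y N (a - sum w F) b"
proof -
  define L where "L i = {f \<in> F. x f < x i}" for i
  define x' where "x' i = x i - sum w (L i)" for i
  have posF: "0 < w f" "0 \<le> x f" "x f + w f \<le> a" if "f \<in> F" for f using F(2)[OF that] by auto
  have N: "0 < w i" "0 < h i" "0 \<le> x i" "x i + w i \<le> a" "0 \<le> y i" "y i + h i \<le> b" if "i \<in> N" for i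
    using packed that unfolding packed_def by blast+
  have finL: "finite (L i)" for i unfolding L_def using F(1) by simp
  have Lend: "x f + w f \<le> x i" if "i \<in> N" "f \<in> L i" for i f
    using NF[OF that(1), of f] that N(1)[OF that(1)] unfolding L_def sep_def by auto
  have Rend: "x i + w i \<le> x f" if "i \<in> N" "f \<in> F - L i" for i f
    using NF[OF that(1), of f] that posF(1)[of f] unfolding L_def sep_def by auto
  have sumle: "sum w G \<le> v - u" if "G \<subseteq> F" "\<And>f. f \<in> G \<Longrightarrow> u \<le> x f \<and> x f + w f \<le> v" "u \<le> v" for G u v
  proof (rule sum_le_of_sep[where x=x])
    show "finite G" using that(1) F(1) finite_subset by blast
  qed (use that posF FF in blast)+
  have mono: "x' i + w i \<le> x' j" if ij: "i \<in> N" "j \<in> N" "x i + w i \<le> x j" for i j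
  proof -
    have sub: "L i \<subseteq> L j" using ij N(1)[OF ij(1)] unfolding L_def by auto
    have "sum w (L j - L i) \<le> x j - (x i + w i)"
    proof (rule sumle)
      fix f assume f: "f \<in> L j - L i"
      then have "f \<in> F - L i" unfolding L_def by auto
      then show "x i + w i \<le> x f \<and> x f + w f \<le> x j" using Rend[OF ij(1)] Lend[OF ij(2)] f by blast
    qed (use ij in \<open>auto simp: L_def\<close>)
    moreover have "sum w (L j) = sum w (L i) + sum w (L j - L i)"
      using sub finL by (metis add.commute sum.subset_diff)
    ultimately show ?thesis unfolding x'_def by linarith
  qed
  have "packed w h x' y N (a - sum w F) b"
    unfolding packed_def
  proof (intro conjI ballI impI)
    show "finite N" using packed unfolding packed_def by blast
    fix i assume i: "i \<in> N"
    show "0 < w i" "0 < h i" "0 \<le> y i" "y i + h i \<le> b" using N[OF i] by blast+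
    have "sum w (L i) \<le> x i - 0"
      by (rule sumle) (use Lend[OF i] posF N(3)[OF i] in \<open>auto simp: L_def\<close>)
    then show "0 \<le> x' i" unfolding x'_def by simp
    have "sum w (F - L i) \<le> a - (x i + w i)"
      by (rule sumle) (use Rend[OF i] posF N(4)[OF i] in auto)
    moreover have "sum w F = sum w (L i) + sum w (F - L i)"
      using F(1) by (metis (no_types, lifting) L_def add.commute mem_Collect_eq subsetI sum.subset_diff)
    ultimately show "x' i + w i \<le> a - sum w F" unfolding x'_def by linarith
    fix j assume j: "j \<in> N" "i \<noteq> j"
    have "sep x w i j \<or> sep y h i j" using packed i j unfolding packed_def by blast
    then show "sep x' w i j \<or> sep y h i j" using mono i j unfolding sep_def by blast
  qed
  then show ?thesis by (intro exI[of _ x'])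
qed

text \<open>The conclusion of resource augmentation for a fixed bound \<open>K\<close>, so that one
  bound can be shared by several values of \<open>del\<close>.\<close>

definition augments :: "real \<Rightarrow> real \<Rightarrow> nat \<Rightarrow> real \<Rightarrow> bool" where
  "augments e eps K del \<longleftrightarrow> (\<forall>w h p x y R a b. packed w h x y R a b \<and> (\<forall>i\<in>R. 0 \<le> p i) \<longrightarrow>
    (\<exists>R'\<subseteq>R. sum p (R - R') \<le> 5 * eps * sum p R \<and> containable e w h (box_int 0 0 a ((1 + del) * b)) R' K))"

lemma augmentsD:
  assumes "augments e eps K del" "packed w h x y R a b" "\<And>i. i \<in> R \<Longrightarrow> 0 \<le> p i"
  shows "\<exists>R'\<subseteq>R. sum p (R - R') \<le> 5 * eps * sum p R \<and> containable e w h (box_int 0 0 a ((1 + del) * b)) R' K"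
  by (rule assms(1)[unfolded augments_def, rule_format]) (use assms(2,3) in blast)

lemma augments_in:
  assumes "augments e eps K del" "packed w h x y R a b" "\<And>i. i \<in> R \<Longrightarrow> 0 \<le> p i" "(1 + del) * b \<le> b'"
  shows "\<exists>R'\<subseteq>R. sum p (R - R') \<le> 5 * eps * sum p R \<and> containable e w h (box_int 0 0 a b') R' K"
proof -
  have "\<exists>R'\<subseteq>R. sum p (R - R') \<le> 5 * eps * sum p R \<and> containable e w h (box_int 0 0 a ((1 + del) * b)) R' K"
    by (rule augmentsD[OF assms(1,2)]) (rule assms(3))
  then obtain R' where R': "R' \<subseteq> R" "sum p (R - R') \<le> 5 * eps * sum p R"
    "containable e w h (box_int 0 0 a ((1 + del) * b)) R' K" by (elim exE conjE)
  have "box_int 0 0 a ((1 + del) * b) \<subseteq> box_int 0 0 a b'" using assms(4) by (intro box_sub) simp_all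
  then have "containable e w h (box_int 0 0 a b') R' K" by (rule containable.mono[OF R'(3)]) simp
  then show ?thesis using R' by blast
qed

lemma sum_trans_loss:
  fixes p :: "'i \<Rightarrow> real"
  assumes "finite U" "\<And>i. i \<in> U \<Longrightarrow> 0 \<le> p i" "U' \<subseteq> U" "U'' \<subseteq> U'"
    "sum p (U - U') \<le> c * sum p U" "sum p (U' - U'') \<le> c' * sum p U'" "0 \<le> c'"
  shows "sum p (U - U'') \<le> (c + c') * sum p U"
proof -
  have "sum p (U - U'') \<le> sum p (U - U') + sum p (U' - U'')"
    by (rule sum_Diff_le) (use assms in auto)
  moreover have "c' * sum p U' \<le> c' * sum p U"
    using assms by (intro mult_left_mono sum_mono2) auto
  ultimately show ?thesis using assms(5,6) by (simp add: distrib_right)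
qed

section \<open>Clearing a strip, with and without the spanning items\<close>

lemma keep_nonspanning:
  fixes p :: "nat \<Rightarrow> real"
  assumes packed: "packed w h x y V a 1" and D: "0 < D" "D \<le> 1" and M: "0 < M" "2 / real M \<le> eps"
    and s: "s = D / real M" and d: "d \<le> s"
    and p: "\<And>i. i \<in> V \<Longrightarrow> 0 \<le> p i" and gap: "\<And>i. i \<in> V \<Longrightarrow> h i \<le> d \<or> D < h i"
    and U: "U \<subseteq> V - spanning h y d V" "U \<inter> upper h y D d V = {} \<or> U \<inter> lower h y D d V = {}"
    and aug: "augments e eps K (s / 2)" and eps: "0 < eps"
  shows "\<exists>U'\<subseteq>U. sum p (U - U') \<le> 6 * eps * sum p U \<and> containable e w h (box_int 0 0 a (1 - s / 2)) U' K"
proof -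
  have finU: "finite U" and pU: "\<And>i. i \<in> U \<Longrightarrow> 0 \<le> p i" using packed U p unfolding packed_def by (auto intro: finite_subset)
  have "\<exists>U'\<subseteq>U. sum p (U - U') \<le> 2 / real M * sum p U \<and> (\<exists>y'. packed w h x y' U' a (1 - s))"
    by (rule free_zone[OF packed D M(1) s _ _ _ _ U(2)]) (use d p gap U(1) in auto)
  then obtain U1 y' where U1: "U1 \<subseteq> U" "sum p (U - U1) \<le> 2 / real M * sum p U" "packed w h x y' U1 a (1 - s)"
    by (elim exE conjE)
  have s0: "0 < s" unfolding s using D M by simp
  have pU1: "\<And>i. i \<in> U1 \<Longrightarrow> 0 \<le> p i" using U1 pU by blast
  \<comment> \<open>Of the cleared height \<open>s\<close>, augmentation uses at most half; the
    other half remains empty for the caller.\<close>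
  have "(1 + s / 2) * (1 - s) \<le> 1 - s / 2" using s0 by (simp add: algebra_simps)
  then have "\<exists>U2\<subseteq>U1. sum p (U1 - U2) \<le> 5 * eps * sum p U1 \<and> containable e w h (box_int 0 0 a (1 - s / 2)) U2 K"
    by (intro augments_in[OF aug U1(3)] pU1)
  then obtain U2 where U2: "U2 \<subseteq> U1" "sum p (U1 - U2) \<le> 5 * eps * sum p U1"
    "containable e w h (box_int 0 0 a (1 - s / 2)) U2 K" by (elim exE conjE)
  have "sum p (U - U1) \<le> eps * sum p U"
  proof -
    have "2 / real M * sum p U \<le> eps * sum p U" using M(2) pU by (intro mult_right_mono sum_nonneg)
    then show ?thesis using U1(2) by linarith
  qed
  then have "sum p (U - U2) \<le> (eps + 5 * eps) * sum p U"
    using finU pU U1 U2 eps by (intro sum_trans_loss[where U'=U1]) auto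
  then have "sum p (U - U2) \<le> 6 * eps * sum p U" by (simp add: distrib_right)
  moreover have "U2 \<subseteq> U" using U1(1) U2(1) by blast
  ultimately show ?thesis using U2(3) by (intro exI[of _ U2] conjI)
qed

text \<open>The spanning items are cut out and collected in one vertical container at the left.
  Items at the ends are excluded because they may lie above or below a spanning item and then block
  the cutting. The cleared strip is spent entirely on augmentation.\<close>

lemma keep_spanning:
  fixes p :: "nat \<Rightarrow> real"
  assumes packed: "packed w h x y V a 1" and D: "0 < D" "D \<le> 1" and M: "0 < M" "2 / real M \<le> eps"
    and s: "s = D / real M" and d: "d \<le> s" "d < 1 / 2"
    and p: "\<And>i. i \<in> V \<Longrightarrow> 0 \<le> p i" and gap: "\<And>i. i \<in> V \<Longrightarrow> h i \<le> d \<or> D < h i"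
    and U: "U \<subseteq> V - spanning h y d V - ends h y d V" "U \<inter> upper h y D d V = {} \<or> U \<inter> lower h y D d V = {}"
    and aug: "augments e eps K s" and eps: "0 < eps" and a: "0 \<le> a"
  shows "\<exists>U'\<subseteq>U. sum p (U - U') \<le> 6 * eps * sum p U \<and>
    containable e w h (box_int 0 0 a 1) (spanning h y d V \<union> U') (K + 1)"
proof -
  let ?F = "spanning h y d V"
  have finU: "finite U" and pU: "\<And>i. i \<in> U \<Longrightarrow> 0 \<le> p i" using packed U p unfolding packed_def by (auto intro: finite_subset)
  have "U \<subseteq> V - ?F" using U(1) by blast
  have "\<exists>U'\<subseteq>U. sum p (U - U') \<le> 2 / real M * sum p U \<and> (\<exists>y'. packed w h x y' U' a (1 - s))"
    by (rule free_zone[OF packed D M(1) s _ _ _ _ U(2)]) (use d p gap U(1) in auto)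
  then obtain U1 y' where U1: "U1 \<subseteq> U" "sum p (U - U1) \<le> 2 / real M * sum p U" "packed w h x y' U1 a (1 - s)"
    by (elim exE conjE)
  have FV: "?F \<subseteq> V" unfolding spanning_def by blast
  then have finF: "finite ?F" using packed unfolding packed_def by (auto intro: finite_subset)
  have F: "0 < w f" "0 < h f" "0 \<le> x f" "x f + w f \<le> a" "h f \<le> 1" if "f \<in> ?F" for f
  proof -
    have "0 < w f \<and> 0 < h f \<and> 0 \<le> x f \<and> x f + w f \<le> a \<and> 0 \<le> y f \<and> y f + h f \<le> 1"
      using packed FV that unfolding packed_def by blast
    then show "0 < w f" "0 < h f" "0 \<le> x f" "x f + w f \<le> a" "h f \<le> 1" by linarith+
  qed
  have "\<exists>x'. packed w h x' y' U1 (a - sum w ?F) (1 - s)"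
  proof (rule compaction[OF U1(3) finF])
    show "sep x w f g" if "f \<in> ?F" "g \<in> ?F" "f \<noteq> g" for f g
      using that FV by (intro spanning_sep[OF packed d(2)]) (auto simp: spanning_not_ends)
    show "sep x w i f" if "i \<in> U1" "f \<in> ?F" for i f
      using that U(1) U1(1) by (intro spanning_sep[OF packed d(2)]) auto
  qed (use F in auto)
  then obtain x' where x': "packed w h x' y' U1 (a - sum w ?F) (1 - s)" ..
  have s0: "0 < s" unfolding s using D M by simp
  have pU1: "\<And>i. i \<in> U1 \<Longrightarrow> 0 \<le> p i" using U1 pU by blast
  have "(1 + s) * (1 - s) \<le> 1" by (simp add: algebra_simps)
  then have "\<exists>U2\<subseteq>U1. sum p (U1 - U2) \<le> 5 * eps * sum p U1 \<and> containable e w h (box_int 0 0 (a - sum w ?F) 1) U2 K"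
    by (intro augments_in[OF aug x'] pU1)
  then obtain U2 where U2: "U2 \<subseteq> U1" "sum p (U1 - U2) \<le> 5 * eps * sum p U1"
    "containable e w h (box_int 0 0 (a - sum w ?F) 1) U2 K" by (elim exE conjE)
  have "sum p (U - U1) \<le> eps * sum p U"
  proof -
    have "2 / real M * sum p U \<le> eps * sum p U" using M(2) pU by (intro mult_right_mono sum_nonneg)
    then show ?thesis using U1(2) by linarith
  qed
  then have "sum p (U - U2) \<le> (eps + 5 * eps) * sum p U"
    using finU pU U1 U2 eps by (intro sum_trans_loss[where U'=U1]) auto
  then have 1: "sum p (U - U2) \<le> 6 * eps * sum p U" by (simp add: distrib_right)
  have W: "0 \<le> sum w ?F" "sum w ?F \<le> a"
    using F(1) spanning_width[OF packed d(2) a] by (auto intro: sum_nonneg less_imp_le)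
  have "containable e w h (box_int (sum w ?F) 0 (a - sum w ?F) 1) U2 K" by (rule containable_translate[OF U2(3)])
  moreover have "containable e w h (box_int 0 0 (sum w ?F) 1) ?F 1"
    using F by (intro containable_vertical[OF finF]) auto
  moreover have "box_int 0 0 (sum w ?F) 1 \<inter> box_int (sum w ?F) 0 (a - sum w ?F) 1 = {}"
    by (intro box_disj) simp
  ultimately have "containable e w h (box_int 0 0 (sum w ?F) 1 \<union> box_int (sum w ?F) 0 (a - sum w ?F) 1) (?F \<union> U2) (1 + K)"
    by (intro containable_Un)
  moreover have "box_int 0 0 (sum w ?F) 1 \<union> box_int (sum w ?F) 0 (a - sum w ?F) 1 \<subseteq> box_int 0 0 a 1"
    using W by (intro Un_least box_sub) simp_all
  ultimately have "containable e w h (box_int 0 0 a 1) (?F \<union> U2) (K + 1)"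
    by (rule containable.mono) simp
  moreover have "U2 \<subseteq> U" using U1(1) U2(1) by blast
  ultimately show ?thesis using 1 by (intro exI[of _ U2] conjI)
qed

text \<open>Upper and lower items that overlap horizontally have heights adding up to at most 1, and
  two items of the same kind never overlap horizontally. Once upper items hang from the top and
  lower ones stand on the bottom, these conditions also suffice, so the problem becomes one of
  arranging two classes on a line.\<close>

lemma staircase_packing:
  fixes eps :: real
  assumes eps: "0 < eps" "eps \<le> 1"
  shows "\<exists>K. \<forall>e w h p x y R D d. packed w h x y R 1 1 \<and> (\<forall>i\<in>R. 0 \<le> p i) \<and> 0 < D \<and> D \<le> 1 / 2 \<and>
    upper h y D d R \<inter> lower h y D d R = {} \<longrightarrow>
    (\<exists>R'\<subseteq>upper h y D d R \<union> lower h y D d R.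
      sum p ((upper h y D d R \<union> lower h y D d R) - R') \<le> 3 * eps * sum p (upper h y D d R \<union> lower h y D d R) \<and>
      containable e w h (box_int 0 0 1 1) R' K)"
proof -
  \<comment> \<open>The cheap pair of groups is chosen among \<open>m - 1\<close> candidates, hence
    the additional 1.\<close>
  define m where "m = nat \<lceil>1 / eps\<rceil> + 1"
  have c: "0 < nat \<lceil>1 / eps\<rceil>" "1 / real (nat \<lceil>1 / eps\<rceil>) \<le> eps"
    using nat_ceil_inverse[OF eps(1), of 1] zero_less_one by (metis, metis)
  have "m - 1 = nat \<lceil>1 / eps\<rceil>" unfolding m_def by simp
  then have m: "2 \<le> m" "1 / real (m - 1) \<le> eps" using c by (linarith, simp only:)
  from high_low_arrangement[OF eps, of 2 "2 * m" "2 * m"]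
  obtain K where K: "\<forall>(I::nat set) x s p (cl :: nat \<Rightarrow> bool) cmp U V.
    finite I \<and> (\<forall>i\<in>I. 0 < s i \<and> 0 \<le> p i) \<and> (\<forall>i\<in>I. U \<le> x i \<and> x i + s i \<le> V) \<and>
    (\<forall>i j. cmp i j \<longrightarrow> cl i \<noteq> cl j) \<and> (\<forall>i j. cmp i j \<longrightarrow> cmp j i) \<and> card (cl ` I) \<le> 2 \<and>
    (\<forall>i\<in>I. \<forall>j\<in>I. i \<noteq> j \<longrightarrow> sep x s i j \<or> cmp i j) \<and> solvable cl cmp x s p I (2 * m) (2 * m) eps \<longrightarrow>
    (\<exists>I'\<subseteq>I. sum p (I - I') \<le> 3 * eps * sum p I \<and> arrangeable cl cmp s I' U V K)" by (elim exE)
  show ?thesis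
  proof (rule exI[of _ K], intro allI impI, elim conjE)
    fix e and w h p x y :: "nat \<Rightarrow> real" and R D d
    assume packed: "packed w h x y R 1 1" and p: "\<forall>i\<in>R. 0 \<le> p i" and D: "0 < D" "D \<le> 1 / 2"
      and disj: "upper h y D d R \<inter> lower h y D d R = {}"
    define T where "T = upper h y D d R"
    define B where "B = lower h y D d R"
    define I where "I = T \<union> B"
    have IR: "I \<subseteq> R" "T \<subseteq> I" "B \<subseteq> I" "T \<inter> B = {}" using disj unfolding I_def T_def B_def upper_def lower_def by auto
    have R: "0 < w i" "0 < h i" "0 \<le> x i" "x i + w i \<le> 1" "0 \<le> y i" "y i + h i \<le> 1" if "i \<in> R" for i
      using packed that unfolding packed_def by blast+
    have finI: "finite I" using IR packed unfolding packed_def by (auto intro: finite_subset)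
    define cl where "cl i \<longleftrightarrow> i \<in> T" for i
    define cmp where "cmp i j \<longleftrightarrow> cl i \<noteq> cl j \<and> h i + h j \<le> 1" for i j
    have TB: "D < h i" "1 - D < y i + h i" "y i < 1 - D" if "i \<in> T" for i
      using that R(6)[of i] IR unfolding T_def upper_def by auto
    have BB: "D < h i" "y i < D" "D < y i + h i" if "i \<in> B" for i
      using that R(5)[of i] IR unfolding B_def lower_def by auto
    have comp: "h i + h j \<le> 1" if "i \<in> T" "j \<in> B" "sep y h i j" for i j
    proof -
      have "i \<in> R" "j \<in> R" using that IR by blast+
      then show ?thesis using that(3) TB[OF that(1)] BB[OF that(2)] R(5,6)[of i] R(5,6)[of j] D unfolding sep_def by auto
    qed
    have valid: "sep x w i j \<or> (cl i \<noteq> cl j \<and> h i + h j \<le> 1)" if ij: "i \<in> I" "j \<in> I" "i \<noteq> j" for i j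
    proof -
      have yx: "sep x w i j \<or> sep y h i j" using packed ij IR unfolding packed_def by blast
      consider "i \<in> T" "j \<in> T" | "i \<in> T" "j \<in> B" | "i \<in> B" "j \<in> T" | "i \<in> B" "j \<in> B" using ij unfolding I_def by blast
      then show ?thesis
      proof cases
        case 1
        then show ?thesis using yx TB[OF 1(1)] TB[OF 1(2)] unfolding sep_def by auto
      next
        case 2
        then show ?thesis using yx comp[OF 2] IR unfolding cl_def by auto
      next
        case 3
        then have "sep x w i j \<or> h j + h i \<le> 1" using yx comp[OF 3(2,1)] sep_commute by metis
        then show ?thesis using 3 IR unfolding cl_def by auto
      next
        case 4
        then show ?thesis using yx BB[OF 4(1)] BB[OF 4(2)] unfolding sep_def by auto
      qed
    qed
    have sp: "0 < w i \<and> 0 \<le> p i" if "i \<in> I" for i using that IR R p by blast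
    have solv: "solvable cl cmp x w p I (2 * m) (2 * m) eps"
    proof -
      have "solvable cl cmp x w p I (2 * m) (2 * m) (1 / real (m - 1))"
        unfolding cmp_def by (rule staircase_solvable[OF finI sp valid m(1)])
      moreover have "1 / real (m - 1) * sum p S \<le> eps * sum p S" if "S \<subseteq> I" for S
        using m(2) sp that by (intro mult_right_mono sum_nonneg) auto
      ultimately show ?thesis unfolding solvable_def by (meson order_trans)
    qed
    have c2: "card (cl ` I) \<le> 2"
    proof -
      have "card (cl ` I) \<le> card (UNIV :: bool set)" by (rule card_mono) auto
      then show ?thesis by simp
    qed
    have "\<exists>I'\<subseteq>I. sum p (I - I') \<le> 3 * eps * sum p I \<and> arrangeable cl cmp w I' 0 1 K"
      by (rule K[rule_format, where x=x]) (use finI sp IR R valid solv c2 in \<open>auto simp: cmp_def\<close>)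
    then obtain I' where I': "I' \<subseteq> I" "sum p (I - I') \<le> 3 * eps * sum p I" "arrangeable cl cmp w I' 0 1 K" by blast
    from I'(3) obtain xx cu cv where card_th: "card ((\<lambda>i. (cl i, cu i, cv i)) ` I') \<le> K"
      and th1: "\<forall>i\<in>I'. 0 \<le> cu i \<and> cu i \<le> xx i \<and> xx i + w i \<le> cv i \<and> cv i \<le> 1"
      and th2: "\<forall>i\<in>I'. \<forall>j\<in>I'. i \<noteq> j \<longrightarrow> (if (cl i, cu i, cv i) = (cl j, cu j, cv j) then sep xx w i j
         else cv i \<le> cu j \<or> cv j \<le> cu i \<or> cmp i j)"
      unfolding arrangeable_def by (elim exE conjE)
    define tup where "tup i = (cl i, cu i, cv i)" for i
    define Th where "Th = tup ` I'"
    have finI': "finite I'" using I'(1) finI finite_subset by blast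
    have Th: "finite Th" "card Th \<le> K" using finI' card_th unfolding Th_def tup_def by auto
    define Fb where "Fb t = {i \<in> I'. tup i = t}" for t
    have finFb: "finite (Fb t)" for t unfolding Fb_def using finI' by simp
    \<comment> \<open>A container is as tall as its tallest item. For two horizontally overlapping
      containers it suffices that these tallest items are compatible, which the arrangement
      provides.\<close>
    define Hm where "Hm t = Max (h ` Fb t)" for t
    have Hm_ge: "h i \<le> Hm t" if "i \<in> Fb t" for i t unfolding Hm_def using that finFb by simp
    have Hm_ex: "\<exists>i\<in>Fb t. Hm t = h i" if "t \<in> Th" for t
    proof -
      have "Fb t \<noteq> {}" using that unfolding Th_def Fb_def by auto
      then have "Max (h ` Fb t) \<in> h ` Fb t" using finFb by (intro Max_in) auto
      then show ?thesis unfolding Hm_def by blast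
    qed
    define ul where "ul t = fst (snd t)" for t :: "bool \<times> real \<times> real"
    define ur where "ur t = snd (snd t)" for t :: "bool \<times> real \<times> real"
    have FbE: "cl i = fst t" "cu i = ul t" "cv i = ur t" "i \<in> I'" "i \<in> R" if "i \<in> Fb t" for i t
      using that I'(1) IR unfolding Fb_def tup_def ul_def ur_def by auto
    define A where "A t = box_int (ul t) (if fst t then 1 - Hm t else 0) (ur t - ul t) (Hm t)" for t
    have "containable e w h (\<Union>t\<in>Th. A t) (\<Union>t\<in>Th. Fb t) (\<Sum>t\<in>Th. 1)"
    proof (rule containable_UN[OF Th(1)])
      fix t assume t: "t \<in> Th"
      show "containable e w h (A t) (Fb t) 1" unfolding A_def
      proof (rule containable_vertical[OF finFb])
        show "0 < w i \<and> 0 < h i" if "i \<in> Fb t" for i using R FbE(5)[OF that] by blast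
        show "h i \<le> Hm t" if "i \<in> Fb t" for i by (rule Hm_ge[OF that])
        show "sum w (Fb t) \<le> ur t - ul t"
        proof (rule sum_le_of_sep[where x=xx, OF finFb])
          show "0 < w i" if "i \<in> Fb t" for i using R FbE(5)[OF that] by blast
          show "ul t \<le> xx i \<and> xx i + w i \<le> ur t" if "i \<in> Fb t" for i using th1 FbE[OF that] by auto
          show "sep xx w i j" if "i \<in> Fb t" "j \<in> Fb t" "i \<noteq> j" for i j
          proof -
            have "(cl i, cu i, cv i) = (cl j, cu j, cv j)" using FbE[OF that(1)] FbE[OF that(2)] by simp
            then show ?thesis using th2 FbE(4)[OF that(1)] FbE(4)[OF that(2)] that(3) by (metis (no_types, lifting))
          qed
          obtain i where "i \<in> Fb t" using Hm_ex[OF t] by blast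
          then show "ul t \<le> ur t" using th1 FbE[of i t] R(1)[of i] by fastforce
        qed
      qed
    next
      fix t u assume tu: "t \<in> Th" "u \<in> Th" "t \<noteq> u"
      obtain i where i: "i \<in> Fb t" "Hm t = h i" using Hm_ex[OF tu(1)] by blast
      obtain j where j: "j \<in> Fb u" "Hm u = h j" using Hm_ex[OF tu(2)] by blast
      have ne: "tup i \<noteq> tup j" "i \<noteq> j" using i j tu(3) unfolding Fb_def by auto
      have "cv i \<le> cu j \<or> cv j \<le> cu i \<or> cmp i j"
        using th2 FbE(4)[OF i(1)] FbE(4)[OF j(1)] ne unfolding tup_def by (metis (no_types, lifting))
      then show "A t \<inter> A u = {}"
        using FbE[OF i(1)] FbE[OF j(1)] i(2) j(2) unfolding A_def cmp_def by (intro box_disj) auto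
    qed
    then have "containable e w h (box_int 0 0 1 1) (\<Union>t\<in>Th. Fb t) K"
    proof (rule containable.mono)
      show "(\<Sum>t\<in>Th. 1) \<le> K" using Th(2) by simp
      have "A t \<subseteq> box_int 0 0 1 1" if tT: "t \<in> Th" for t
      proof -
        obtain i where i: "i \<in> Fb t" "Hm t = h i" using Hm_ex[OF tT] by blast
        have "0 \<le> ul t" "ur t \<le> 1" using th1 FbE[OF i(1)] by auto
        moreover have "0 \<le> Hm t" "Hm t \<le> 1" using R[OF FbE(5)[OF i(1)]] i(2) by linarith+
        ultimately show ?thesis unfolding A_def by (intro box_sub) auto
      qed
      then show "(\<Union>t\<in>Th. A t) \<subseteq> box_int 0 0 1 1" by blast
    qed
    moreover have "(\<Union>t\<in>Th. Fb t) = I'" unfolding Th_def Fb_def by auto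
    ultimately have "containable e w h (box_int 0 0 1 1) I' K" by simp
    then show "\<exists>R'\<subseteq>upper h y D d R \<union> lower h y D d R.
      sum p ((upper h y D d R \<union> lower h y D d R) - R') \<le> 3 * eps * sum p (upper h y D d R \<union> lower h y D d R) \<and>
      containable e w h (box_int 0 0 1 1) R' K"
      using I'(1,2) unfolding I_def T_def B_def by blast
  qed
qed

section \<open>Layouts that turn items\<close>

definition rot_containable :: "real \<Rightarrow> (nat \<Rightarrow> real) \<Rightarrow> (nat \<Rightarrow> real) \<Rightarrow> (real \<times> real) set \<Rightarrow> nat set \<Rightarrow> nat \<Rightarrow> bool" where
  "rot_containable e w h A S n \<longleftrightarrow> (\<exists>rot. containable e (rot_w w h rot) (rot_h w h rot) A S n)"

lemma rot_containable_of_cpn: "containable e w h A S n \<Longrightarrow> rot_containable e w h A S n"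
  unfolding rot_containable_def by (rule exI[of _ "\<lambda>_. False"]) (simp add: rot_w_def[abs_def] rot_h_def[abs_def])

lemma rot_containable_of_cpn_rotated: "containable e h w A S n \<Longrightarrow> rot_containable e w h A S n"
  unfolding rot_containable_def by (rule exI[of _ "\<lambda>_. True"]) (simp add: rot_w_def[abs_def] rot_h_def[abs_def])

lemma rot_containable_swap: "rot_containable e h w A S n \<Longrightarrow> rot_containable e w h A S n"
proof -
  assume "rot_containable e h w A S n"
  then obtain rot where rot: "containable e (rot_w h w rot) (rot_h h w rot) A S n" unfolding rot_containable_def by blast
  have "rot_w h w rot = rot_w w h (\<lambda>i. \<not> rot i)" "rot_h h w rot = rot_h w h (\<lambda>i. \<not> rot i)"
    unfolding rot_w_def rot_h_def by (auto simp: fun_eq_iff)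
  then show ?thesis using rot unfolding rot_containable_def by metis
qed

lemma rot_containable_mono: "rot_containable e w h A S m \<Longrightarrow> A \<subseteq> B \<Longrightarrow> m \<le> n \<Longrightarrow> rot_containable e w h B S n"
  unfolding rot_containable_def by (blast intro: containable.mono)

text \<open>Each item takes its rotation from the packing that places it, the first one if both
  do.\<close>

lemma rot_containable_Un:
  assumes "rot_containable e w h A S m" "rot_containable e w h B T n" "A \<inter> B = {}"
  shows "rot_containable e w h (A \<union> B) (S \<union> T) (m + n)"
proof -
  obtain r1 where r1: "containable e (rot_w w h r1) (rot_h w h r1) A S m" using assms(1) unfolding rot_containable_def by blast
  obtain r2 where r2: "containable e (rot_w w h r2) (rot_h w h r2) B T n" using assms(2) unfolding rot_containable_def by blast
  define r where "r i = (if i \<in> S then r1 i else r2 i)" for i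
  have "containable e (rot_w w h r) (rot_h w h r) A S m"
    by (rule containable_cong[OF r1]) (simp add: r_def rot_w_def rot_h_def)
  moreover have "containable e (rot_w w h r) (rot_h w h r) B (T - S) n"
    by (rule containable_cong[OF containable_subset[OF r2]]) (auto simp: r_def rot_w_def rot_h_def)
  ultimately have "containable e (rot_w w h r) (rot_h w h r) (A \<union> B) (S \<union> (T - S)) (m + n)"
    using assms(3) by (rule containable_Un)
  then show ?thesis unfolding rot_containable_def by auto
qed

lemma transpose_box: "containable e w h (box_int 0 0 a b) S n \<Longrightarrow> containable e h w (box_int 0 0 b a) S n"
  using containable_transpose[of e w h "box_int 0 0 a b" S n] by (simp only: swap_box)

text \<open>Width budget: the column of the kept spanning items, the compacted middle enlarged by
  \<open>d\<close> and two turned end strips of width \<open>2 * d\<close> add up to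
  \<open>1 + 5 * d - sum w G\<close>, which is at most 1.\<close>

lemma collapse_packing:
  fixes p :: "nat \<Rightarrow> real"
  assumes packed: "packed w h x y V 1 1" and d: "0 < d" "d < 1 / 2"
    and p: "\<And>i. i \<in> V \<Longrightarrow> 0 \<le> p i" and G: "G \<subseteq> spanning h y d V" "5 * d \<le> sum w G"
    and aug: "augments e eps K 1" "augments e eps K d" and eps: "0 < eps"
  shows "\<exists>S\<subseteq>V. sum p (V - S) \<le> sum p G + 15 * eps * sum p V \<and> rot_containable e w h (box_int 0 0 1 1) S (3 * K + 1)"
proof -
  have fin: "finite V" using packed unfolding packed_def by blast
  have V: "0 < w i" "0 < h i" "0 \<le> x i" "x i + w i \<le> 1" "0 \<le> y i" "y i + h i \<le> 1" if "i \<in> V" for i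
    using packed that unfolding packed_def by blast+
  define F where "F = spanning h y d V"
  define Eb where "Eb = {i \<in> V - F. y i + h i \<le> d}"
  define Et where "Et = {i \<in> V - F - Eb. 1 - d \<le> y i}"
  define N where "N = V - F - Eb - Et"
  have FV: "F \<subseteq> V" "finite F" "G \<subseteq> F" "finite G"
    using fin G(1) unfolding F_def spanning_def by (auto intro: finite_subset)
  have EV: "Eb \<subseteq> V" "Et \<subseteq> V" "N \<subseteq> V" unfolding Eb_def Et_def N_def by auto
  have W: "sum w F \<le> 1" unfolding F_def by (rule spanning_width[OF packed d(2)]) simp
  have WG: "sum w (F - G) = sum w F - sum w G" using FV by (simp add: sum_diff)
  have WG0: "0 \<le> sum w (F - G)" using FV V by (intro sum_nonneg) (auto simp: less_imp_le subset_iff)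
  have Fends: "f \<in> F \<Longrightarrow> i \<in> N \<Longrightarrow> sep x w i f" for f i
    unfolding F_def N_def by (intro spanning_sep[OF packed d(2)]) (auto simp: ends_def Eb_def Et_def F_def)
  have FF: "f \<in> F \<Longrightarrow> g \<in> F \<Longrightarrow> f \<noteq> g \<Longrightarrow> sep x w f g" for f g
    using FV(1) unfolding F_def by (intro spanning_sep[OF packed d(2)]) (auto simp: spanning_not_ends)
  have bnd: "5 * eps * sum p T \<le> 5 * eps * sum p V" if "T \<subseteq> V" for T
    using that fin p eps by (intro mult_left_mono sum_mono2) auto
  \<comment> \<open>Augmentation by 1 doubles the height, so a strip of height \<open>d\<close> will
    need \<open>2 * d\<close>.\<close>
  have "packed w h x y Eb 1 d" using packed EV(1) unfolding packed_def Eb_def by (auto intro: finite_subset)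
  then have "\<exists>R'\<subseteq>Eb. sum p (Eb - R') \<le> 5 * eps * sum p Eb \<and> containable e w h (box_int 0 0 1 (2 * d)) R' K"
    by (rule augments_in[OF aug(1)]) (use p EV in auto)
  then obtain S1 where S1: "S1 \<subseteq> Eb" "sum p (Eb - S1) \<le> 5 * eps * sum p Eb" "containable e w h (box_int 0 0 1 (2 * d)) S1 K"
    by (elim exE conjE)
  have "packed w h x (\<lambda>i. y i - (1 - d)) Et 1 d"
  proof -
    have "sep (\<lambda>i. y i - (1 - d)) h i j \<longleftrightarrow> sep y h i j" for i j unfolding sep_def by auto
    then show ?thesis using packed EV(2) unfolding packed_def Et_def by (auto intro: finite_subset)
  qed
  then have "\<exists>R'\<subseteq>Et. sum p (Et - R') \<le> 5 * eps * sum p Et \<and> containable e w h (box_int 0 0 1 (2 * d)) R' K"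
    by (rule augments_in[OF aug(1)]) (use p EV in auto)
  then obtain S2 where S2: "S2 \<subseteq> Et" "sum p (Et - S2) \<le> 5 * eps * sum p Et" "containable e w h (box_int 0 0 1 (2 * d)) S2 K"
    by (elim exE conjE)
  have "\<exists>x'. packed w h x' y N (1 - sum w F) 1"
    by (rule compaction[OF packed_subset[OF packed EV(3)] FV(2)]) (use FF Fends FV V in auto)
  then obtain x' where x': "packed w h x' y N (1 - sum w F) 1" by (elim exE)
  have "0 \<le> sum w F" using FV V by (intro sum_nonneg) (auto simp: less_imp_le subset_iff)
  then have "(1 + d) * (1 - sum w F) \<le> 1 - sum w F + d" using d by (simp add: algebra_simps)
  \<comment> \<open>Augmentation extends the second coordinate. The middle part is transposed for
    it, since its spare room is in the width while its height stays 1.\<close>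
  then have "\<exists>R'\<subseteq>N. sum p (N - R') \<le> 5 * eps * sum p N \<and> containable e h w (box_int 0 0 1 (1 - sum w F + d)) R' K"
    by (intro augments_in[OF aug(2) packed_transpose[OF x']]) (use p EV in auto)
  then obtain S3 where S3: "S3 \<subseteq> N" "sum p (N - S3) \<le> 5 * eps * sum p N"
    "containable e h w (box_int 0 0 1 (1 - sum w F + d)) S3 K" by (elim exE conjE)
  define X1 where "X1 = sum w (F - G)"
  define X2 where "X2 = X1 + (1 - sum w F + d)"
  have X: "0 \<le> X1" "X1 \<le> X2" "X2 + 2 * d + 2 * d \<le> 1"
    unfolding X2_def X1_def using WG0 W d G(2) WG by linarith+
  have C0: "rot_containable e w h (box_int 0 0 X1 1) (F - G) 1"
  proof (rule rot_containable_of_cpn, rule containable_vertical)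
    show "h i \<le> 1" if "i \<in> F - G" for i using that FV V(5,6)[of i] by auto
  qed (use FV V in \<open>auto simp: X1_def\<close>)
  have C3: "rot_containable e w h (box_int X1 0 (1 - sum w F + d) 1) S3 K"
    by (rule rot_containable_of_cpn, rule containable_translate, rule transpose_box, rule S3(3))
  have C1: "rot_containable e w h (box_int X2 0 (2 * d) 1) S1 K"
    by (rule rot_containable_of_cpn_rotated, rule containable_translate, rule transpose_box, rule S1(3))
  have C2: "rot_containable e w h (box_int (X2 + 2 * d) 0 (2 * d) 1) S2 K"
    by (rule rot_containable_of_cpn_rotated, rule containable_translate, rule transpose_box, rule S2(3))
  define S where "S = (F - G) \<union> S3 \<union> S1 \<union> S2"
  have "rot_containable e w h (box_int 0 0 X1 1 \<union> box_int X1 0 (1 - sum w F + d) 1 \<union> box_int X2 0 (2 * d) 1 \<union>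
      box_int (X2 + 2 * d) 0 (2 * d) 1) S (1 + K + K + K)"
    unfolding S_def
  proof (intro rot_containable_Un C0 C1 C2 C3)
    show "box_int 0 0 X1 1 \<inter> box_int X1 0 (1 - sum w F + d) 1 = {}" by (intro box_disj) simp
    show "(box_int 0 0 X1 1 \<union> box_int X1 0 (1 - sum w F + d) 1) \<inter> box_int X2 0 (2 * d) 1 = {}"
      unfolding Int_Un_distrib2 using X by (auto intro!: box_disj simp: X2_def Un_empty)
    show "(box_int 0 0 X1 1 \<union> box_int X1 0 (1 - sum w F + d) 1 \<union> box_int X2 0 (2 * d) 1) \<inter>
      box_int (X2 + 2 * d) 0 (2 * d) 1 = {}"
      unfolding Int_Un_distrib2 Un_empty
    proof (intro conjI)
      show "box_int 0 0 X1 1 \<inter> box_int (X2 + 2 * d) 0 (2 * d) 1 = {}" using X d by (intro box_disj) simp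
      show "box_int X1 0 (1 - sum w F + d) 1 \<inter> box_int (X2 + 2 * d) 0 (2 * d) 1 = {}"
        using d by (intro box_disj) (simp add: X2_def)
      show "box_int X2 0 (2 * d) 1 \<inter> box_int (X2 + 2 * d) 0 (2 * d) 1 = {}" by (intro box_disj) simp
    qed
  qed
  moreover have "box_int 0 0 X1 1 \<union> box_int X1 0 (1 - sum w F + d) 1 \<union> box_int X2 0 (2 * d) 1 \<union>
      box_int (X2 + 2 * d) 0 (2 * d) 1 \<subseteq> box_int 0 0 1 1"
    using X d X2_def by (intro Un_least box_sub) linarith+
  ultimately have cpS: "rot_containable e w h (box_int 0 0 1 1) S (3 * K + 1)" by (rule rot_containable_mono) simp
  have SV: "S \<subseteq> V" unfolding S_def using FV EV S1 S2 S3 by blast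
  have "sum p (V - S) \<le> sum p G + sum p ((Eb - S1) \<union> ((Et - S2) \<union> (N - S3)))"
  proof (rule sum_Diff_le[OF fin p])
    show "V - S \<subseteq> G \<union> ((Eb - S1) \<union> ((Et - S2) \<union> (N - S3)))" unfolding S_def N_def by blast
  qed (use FV EV in blast)+
  also have "sum p ((Eb - S1) \<union> ((Et - S2) \<union> (N - S3))) \<le> sum p (Eb - S1) + sum p ((Et - S2) \<union> (N - S3))"
    by (rule sum_Un_le[OF fin p]) (use EV in auto)
  also have "sum p ((Et - S2) \<union> (N - S3)) \<le> sum p (Et - S2) + sum p (N - S3)"
    by (rule sum_Un_le[OF fin p]) (use EV in auto)
  finally have "sum p (V - S) \<le> sum p G + 15 * eps * sum p V"
    using S1(2) S2(2) S3(2) bnd[OF EV(1)] bnd[OF EV(2)] bnd[OF EV(3)] by linarith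
  then show ?thesis using SV cpS by blast
qed

text \<open>Turned by 90 degrees, spanning items of total width at most \<open>30 * d\<close> form a
  stack no higher than \<open>s / 2\<close>, which is the strip that the other items leave
  free.\<close>

lemma thin_spanning_packing:
  fixes p :: "nat \<Rightarrow> real"
  assumes packed: "packed w h x y V 1 1" and D: "0 < D" "D \<le> 1" and M: "0 < M" "2 / real M \<le> eps"
    and s: "s = D / real M" and d: "0 < d" "60 * d \<le> s"
    and p: "\<And>i. i \<in> V \<Longrightarrow> 0 \<le> p i" and gap: "\<And>i. i \<in> V \<Longrightarrow> h i \<le> d \<or> D < h i"
    and W: "sum w (spanning h y d V) \<le> 30 * d" and Z: "Z = upper h y D d V \<or> Z = lower h y D d V"
    and aug: "augments e eps K (s / 2)" and eps: "0 < eps"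
  shows "\<exists>S\<subseteq>V. sum p (V - S) \<le> sum p Z + 6 * eps * sum p V \<and> rot_containable e w h (box_int 0 0 1 1) S (K + 1)"
proof -
  let ?F = "spanning h y d V"
  define U where "U = V - ?F - Z"
  have fin: "finite V" using packed unfolding packed_def by blast
  have V: "0 < w i" "0 < h i" "0 \<le> y i" "y i + h i \<le> 1" if "i \<in> V" for i using packed that unfolding packed_def by blast+
  have FV: "?F \<subseteq> V" "Z \<subseteq> V" using Z unfolding spanning_def upper_def lower_def by auto
  have "\<exists>U'\<subseteq>U. sum p (U - U') \<le> 6 * eps * sum p U \<and> containable e w h (box_int 0 0 1 (1 - s / 2)) U' K"
    by (rule keep_nonspanning[where d=d, OF packed D M s _ _ _ _ _ aug eps]) (use d p gap Z in \<open>auto simp: U_def\<close>)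
  then obtain U' where U': "U' \<subseteq> U" "sum p (U - U') \<le> 6 * eps * sum p U"
    "containable e w h (box_int 0 0 1 (1 - s / 2)) U' K" by (elim exE conjE)
  have "containable e h w (box_int 0 (1 - s / 2) 1 (s / 2)) ?F 1"
  proof (rule containable_horizontal)
    show "finite ?F" using FV fin finite_subset by blast
    show "0 < h i \<and> 0 < w i" if "i \<in> ?F" for i using that FV V by blast
    show "h i \<le> 1" if "i \<in> ?F" for i using that FV V(3,4)[of i] by auto
    show "sum w ?F \<le> s / 2" using W d by linarith
  qed
  then have "rot_containable e w h (box_int 0 0 1 (1 - s / 2) \<union> box_int 0 (1 - s / 2) 1 (s / 2)) (U' \<union> ?F) (K + 1)"
    using U'(3) by (intro rot_containable_Un rot_containable_of_cpn rot_containable_of_cpn_rotated box_disj) auto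
  moreover have "box_int 0 0 1 (1 - s / 2) \<union> box_int 0 (1 - s / 2) 1 (s / 2) \<subseteq> box_int 0 0 1 1"
  proof -
    have "D * 1 \<le> D * real M" using D M by (intro mult_left_mono) auto
    then have "s \<le> D" unfolding s using M by (simp add: divide_le_eq)
    then have "s \<le> 1" using D by linarith
    then show ?thesis using d by (intro Un_least box_sub) linarith+
  qed
  ultimately have "rot_containable e w h (box_int 0 0 1 1) (U' \<union> ?F) (K + 1)" by (rule rot_containable_mono) simp
  moreover have "sum p (V - (U' \<union> ?F)) \<le> sum p Z + 6 * eps * sum p V"
  proof -
    have "sum p (V - (U' \<union> ?F)) \<le> sum p Z + sum p (U - U')"
      by (rule sum_Diff_le[OF fin p]) (use FV in \<open>auto simp: U_def\<close>)
    moreover have "6 * eps * sum p U \<le> 6 * eps * sum p V"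
      using fin p eps by (intro mult_left_mono sum_mono2) (auto simp: U_def)
    ultimately show ?thesis using U'(2) by linarith
  qed
  moreover have "U' \<union> ?F \<subseteq> V" using U'(1) FV unfolding U_def by blast
  ultimately show ?thesis by blast
qed

text \<open>By the gap between \<open>d\<close> and \<open>D\<close>, an item that comes within
  \<open>D\<close> of both sides comes within \<open>d\<close> of both and is therefore
  spanning.\<close>

lemma upper_lower_disjoint:
  assumes "\<And>i. i \<in> V \<Longrightarrow> (y i \<le> d \<and> 1 - d \<le> y i + h i) \<or> D < y i \<or> y i + h i < 1 - D"
  shows "upper h y D d V \<inter> lower h y D d V = {}"
  using assms unfolding upper_def lower_def spanning_def by fastforce

text \<open>\<open>A\<close> omits the spanning items, \<open>B\<close> those at the ends, and both omit the cheaper of the upper and lower items.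
What they share pays for this double omission.\<close>

lemma two_layouts:
  fixes p :: "nat \<Rightarrow> real"
  assumes packed: "packed w h x y V a 1" and D: "0 < D" "D \<le> 1" and M: "0 < M" "2 / real M \<le> eps"
    and s: "s = D / real M" and d: "d \<le> s" "d < 1 / 2" "d \<le> D"
    and p: "\<And>i. i \<in> V \<Longrightarrow> 0 \<le> p i" and gap: "\<And>i. i \<in> V \<Longrightarrow> h i \<le> d \<or> D < h i"
    and gap2: "\<And>i. i \<in> V \<Longrightarrow> (y i \<le> d \<and> 1 - d \<le> y i + h i) \<or> D < y i \<or> y i + h i < 1 - D"
    and aug: "augments e eps K s" "augments e eps K (s / 2)" and eps: "0 < eps" and a: "0 \<le> a"
  shows "\<exists>A B. A \<subseteq> V \<and> B \<subseteq> V \<and> containable e w h (box_int 0 0 a (1 - s / 2)) A K \<and>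
    containable e w h (box_int 0 0 a 1) B (K + 1) \<and> (1 - 12 * eps) * sum p V \<le> sum p A + sum p B"
proof -
  let ?F = "spanning h y d V" and ?E = "ends h y d V" and ?P = "upper h y D d V" and ?L = "lower h y D d V"
  have fin: "finite V" using packed unfolding packed_def by blast
  have V: "0 < h i" "0 \<le> y i" "y i + h i \<le> 1" if "i \<in> V" for i using packed that unfolding packed_def by blast+
  have sub: "?F \<subseteq> V" "?E \<subseteq> V" "?P \<subseteq> V" "?L \<subseteq> V" unfolding spanning_def ends_def upper_def lower_def by auto
  have f: "finite ?F" "finite ?E" "finite ?P" "finite ?L" using sub fin finite_subset by blast+
  have FE: "?F \<inter> ?E = {}" unfolding ends_def by auto
  \<comment> \<open>An item taller than \<open>D\<close> cannot lie in an end strip of height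
    \<open>d \<le> D\<close>.\<close>
  have PE: "(?P \<union> ?L) \<inter> (?F \<union> ?E) = {}"
  proof -
    have False if "i \<in> ?P \<union> ?L" "i \<in> ?F \<union> ?E" for i
    proof -
      have i: "i \<in> V" "D < h i" "i \<notin> ?F" using that(1) unfolding upper_def lower_def by auto
      then have "y i + h i \<le> d \<or> 1 - d \<le> y i" using that(2) unfolding ends_def by auto
      then show False using i V[OF i(1)] d(3) by linarith
    qed
    then show ?thesis by blast
  qed
  have PL: "?P \<inter> ?L = {}" by (rule upper_lower_disjoint[OF gap2])
  define Z where "Z = (if sum p ?P \<le> sum p ?L then ?P else ?L)"
  have Z: "Z = ?P \<or> Z = ?L" "sum p Z \<le> (sum p ?P + sum p ?L) / 2" unfolding Z_def by auto
  have ZV: "Z \<subseteq> V - ?F - ?E" "finite Z" using Z(1) sub PE f by auto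
  define UA where "UA = V - ?F - Z"
  define UB where "UB = V - ?F - ?E - Z"
  have "\<exists>U'\<subseteq>UA. sum p (UA - U') \<le> 6 * eps * sum p UA \<and> containable e w h (box_int 0 0 a (1 - s / 2)) U' K"
    by (rule keep_nonspanning[OF packed D M s d(1) _ _ _ _ aug(2) eps]) (use p gap Z in \<open>auto simp: UA_def\<close>)
  then obtain A where A: "A \<subseteq> UA" "sum p (UA - A) \<le> 6 * eps * sum p UA" "containable e w h (box_int 0 0 a (1 - s / 2)) A K"
    by (elim exE conjE)
  have "\<exists>U'\<subseteq>UB. sum p (UB - U') \<le> 6 * eps * sum p UB \<and> containable e w h (box_int 0 0 a 1) (?F \<union> U') (K + 1)"
    by (rule keep_spanning[OF packed D M s d(1,2) _ _ _ _ aug(1) eps a]) (use p gap Z in \<open>auto simp: UB_def\<close>)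
  then obtain B where B: "B \<subseteq> UB" "sum p (UB - B) \<le> 6 * eps * sum p UB" "containable e w h (box_int 0 0 a 1) (?F \<union> B) (K + 1)"
    by (elim exE conjE)
  have finU: "finite UA" "finite UB" "UA \<subseteq> V" "UB \<subseteq> V" unfolding UA_def UB_def using fin by auto
  have sA: "sum p UA = sum p V - sum p ?F - sum p Z"
    unfolding UA_def using fin f sub ZV by (subst sum_diff; (subst sum_diff)?) auto
  have sB: "sum p UB = sum p V - sum p ?F - sum p ?E - sum p Z"
  proof -
    have "sum p UB = sum p (V - ?F - ?E) - sum p Z" unfolding UB_def using fin ZV by (intro sum_diff) auto
    also have "sum p (V - ?F - ?E) = sum p (V - ?F) - sum p ?E" using fin sub FE by (intro sum_diff) auto
    also have "sum p (V - ?F) = sum p V - sum p ?F" using fin sub by (intro sum_diff) auto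
    finally show ?thesis by simp
  qed
  have PLle: "sum p ?P + sum p ?L \<le> sum p V - sum p ?F - sum p ?E"
  proof -
    have "sum p ?P + sum p ?L = sum p (?P \<union> ?L)" using f PL by (intro sum.union_disjoint[symmetric]) auto
    also have "\<dots> \<le> sum p (V - ?F - ?E)" using fin sub PE p by (intro sum_mono2) auto
    also have "sum p (V - ?F - ?E) = sum p (V - ?F) - sum p ?E" using fin sub FE by (intro sum_diff) auto
    also have "sum p (V - ?F) = sum p V - sum p ?F" using fin sub by (intro sum_diff) auto
    finally show ?thesis by simp
  qed
  have bnd: "6 * eps * sum p T \<le> 6 * eps * sum p V" if "T \<subseteq> V" for T
    using that fin p eps by (intro mult_left_mono sum_mono2) auto
  define q where "q = 6 * eps * sum p V"
  have "sum p (UA - A) = sum p UA - sum p A" "sum p (UB - B) = sum p UB - sum p B"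
    using finU A(1) B(1) by (auto intro!: sum_diff)
  moreover have "sum p (UA - A) \<le> q" "sum p (UB - B) \<le> q"
    using A(2) B(2) bnd[OF finU(3)] bnd[OF finU(4)] unfolding q_def by linarith+
  ultimately have *: "sum p UA - q \<le> sum p A" "sum p UB - q \<le> sum p B" by linarith+
  have "sum p (?F \<union> B) = sum p ?F + sum p B"
    using f finU B(1) by (intro sum.union_disjoint) (auto simp: UB_def intro: finite_subset)
  moreover have "2 * sum p Z \<le> sum p V - sum p ?F - sum p ?E"
    by (rule order_trans[OF _ PLle]) (use Z(2) in simp)
  \<comment> \<open>Up to the losses, the two sets cover \<open>V\<close> twice except for the
    spanning items, the ends, and \<open>Z\<close> twice. As \<open>2 * sum p Z\<close> is at most
    the profit outside the spanning items and the ends, all of \<open>V\<close> remains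
    once.\<close>
  ultimately have "sum p V - 2 * q \<le> sum p A + sum p (?F \<union> B)"
    using * sA sB by linarith
  then have "(1 - 12 * eps) * sum p V \<le> sum p A + sum p (?F \<union> B)" unfolding q_def by (simp add: left_diff_distrib)
  moreover have "A \<subseteq> V" "?F \<union> B \<subseteq> V" using A B finU sub by blast+
  ultimately show ?thesis using A(3) B(3) by (intro exI[of _ A] exI[of _ "?F \<union> B"] conjI)
qed

text \<open>\<open>m\<close> sits in the lower left corner, \<open>A\<close> in the column to its
  right, and \<open>B\<close>, transposed, in the band above across the full width. That band is at
  most \<open>s / 2\<close> high, so the shortened height of \<open>A\<close> keeps clear of
  it.\<close>

lemma massive_layout:
  assumes "containable e w h (box_int 0 0 (1 - w m) (1 - s / 2)) A K" "containable e h w (box_int 0 0 (1 - h m) 1) B L"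
    "0 < w m" "0 < h m" "w m \<le> 1" "h m \<le> 1" "1 - h m \<le> s / 2"
  shows "rot_containable e w h (box_int 0 0 1 1) ({m} \<union> A \<union> B) (1 + K + L)"
proof -
  have "containable e w h (box_int 0 0 (w m) (h m)) {m} 1" using assms(3,4) by (intro containable_vertical) auto
  moreover have "containable e w h (box_int (w m) 0 (1 - w m) (1 - s / 2)) A K" by (rule containable_translate[OF assms(1)])
  moreover have "containable e w h (box_int 0 (h m) 1 (1 - h m)) B L" by (rule containable_translate[OF transpose_box[OF assms(2)]])
  ultimately have "containable e w h (box_int 0 0 (w m) (h m) \<union> box_int (w m) 0 (1 - w m) (1 - s / 2) \<union>
    box_int 0 (h m) 1 (1 - h m)) ({m} \<union> A \<union> B) (1 + K + L)"
  proof (intro containable_Un)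
    show "box_int 0 0 (w m) (h m) \<inter> box_int (w m) 0 (1 - w m) (1 - s / 2) = {}" by (intro box_disj) simp
    show "(box_int 0 0 (w m) (h m) \<union> box_int (w m) 0 (1 - w m) (1 - s / 2)) \<inter> box_int 0 (h m) 1 (1 - h m) = {}"
      unfolding Int_Un_distrib2 Un_empty using assms(7) by (intro conjI box_disj) auto
  qed
  moreover have "box_int 0 0 (w m) (h m) \<union> box_int (w m) 0 (1 - w m) (1 - s / 2) \<union>
    box_int 0 (h m) 1 (1 - h m) \<subseteq> box_int 0 0 1 1"
    using assms(3-7) by (intro Un_least box_sub) linarith+
  ultimately show ?thesis by (intro rot_containable_of_cpn) (rule containable.mono, auto)
qed

text \<open>Items to the right of \<open>m\<close> slide left by \<open>w m\<close>, which closes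
  the column of \<open>m\<close> and makes one strip out of the two beside it.\<close>

lemma side_packing:
  fixes w h x y :: "nat \<Rightarrow> real"
  assumes packed: "packed w h x y R 1 1" and m: "m \<in> R" and V: "V \<subseteq> R - {m}" "\<And>i. i \<in> V \<Longrightarrow> sep x w i m"
  shows "packed w h (\<lambda>i. if x i + w i \<le> x m then x i else x i - w m) y V (1 - w m) 1"
proof -
  let ?x = "\<lambda>i. if x i + w i \<le> x m then x i else x i - w m"
  have R: "0 < w i" "0 < h i" "0 \<le> x i" "x i + w i \<le> 1" "0 \<le> y i" "y i + h i \<le> 1" if "i \<in> R" for i
    using packed that unfolding packed_def by blast+
  have side: "x i + w i \<le> x m \<or> x m + w m \<le> x i" if "i \<in> V" for i using V(2)[OF that] unfolding sep_def .
  show ?thesis unfolding packed_def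
  proof (intro conjI ballI impI)
    show "finite V" using packed V(1) unfolding packed_def by (auto intro: finite_subset)
    fix i assume i: "i \<in> V"
    then have iR: "i \<in> R" using V by blast
    show "0 < w i" "0 < h i" "0 \<le> y i" "y i + h i \<le> 1" using R iR by blast+
    show "0 \<le> ?x i" "?x i + w i \<le> 1 - w m"
      using side[OF i] R[OF iR] R[OF m] by auto
    fix j assume j: "j \<in> V" "i \<noteq> j"
    then have jR: "j \<in> R" using V by blast
    have "sep x w i j \<or> sep y h i j" using packed iR jR j unfolding packed_def by blast
    then show "sep ?x w i j \<or> sep y h i j"
      using side[OF i] side[OF j(1)] R(1)[OF iR] R(1)[OF jR] R(1)[OF m] unfolding sep_def by auto
  qed
qed

text \<open>The ring splits into items beside \<open>m\<close> and items above or below it. In a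
  layout one part has a full strip including the corner, and the other a shortened one; combining
  the complementary outcomes of \<open>two_layouts\<close> crosswise gives two layouts, and the
  better one keeps half of both parts.\<close>

lemma massive_packing:
  fixes p :: "nat \<Rightarrow> real"
  assumes packed: "packed w h x y R 1 1" and D: "0 < D" "D \<le> 1" and M: "0 < M" "2 / real M \<le> eps"
    and s: "s = D / real M" and d: "0 < d" "4 * d \<le> s" "d < 1 / 2" "d \<le> D"
    and p: "\<And>i. i \<in> R \<Longrightarrow> 0 \<le> p i"
    and gap: "\<And>i. i \<in> R \<Longrightarrow> h i \<le> d \<or> D < h i" "\<And>i. i \<in> R \<Longrightarrow> w i \<le> d \<or> D < w i"
    and gap2: "\<And>i. i \<in> R \<Longrightarrow> (y i \<le> d \<and> 1 - d \<le> y i + h i) \<or> D < y i \<or> y i + h i < 1 - D"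
      "\<And>i. i \<in> R \<Longrightarrow> (x i \<le> d \<and> 1 - d \<le> x i + w i) \<or> D < x i \<or> x i + w i < 1 - D"
    and m: "m \<in> spanning h y d R" "m \<in> spanning w x d R"
    and aug: "augments e eps K s" "augments e eps K (s / 2)" and eps: "0 < eps"
  shows "\<exists>S\<subseteq>R. p m + (sum p R - p m) / 2 - 6 * eps * sum p R \<le> sum p S \<and>
    rot_containable e w h (box_int 0 0 1 1) S (2 * K + 2)"
proof -
  have fin: "finite R" using packed unfolding packed_def by blast
  have mR: "m \<in> R" using m unfolding spanning_def by blast
  have mm: "0 < w m" "0 < h m" "0 \<le> x m" "x m + w m \<le> 1" "0 \<le> y m" "y m + h m \<le> 1"
    using packed mR unfolding packed_def by blast+
  have al: "1 - w m \<le> s / 2" "1 - h m \<le> s / 2" "w m \<le> 1" "h m \<le> 1"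
    using m mm d unfolding spanning_def by auto
  define V where "V = {i \<in> R - {m}. sep x w i m}"
  define H where "H = R - {m} - V"
  have VH: "V \<subseteq> R - {m}" "H \<subseteq> R - {m}" "R = {m} \<union> (V \<union> H)" "V \<inter> H = {}" "finite V" "finite H" "m \<notin> V \<union> H"
    unfolding V_def H_def using mR fin by auto
  have Hs: "sep y h i m" if "i \<in> H" for i
    using packed mR that unfolding packed_def H_def V_def by blast
  have pkV: "packed w h (\<lambda>i. if x i + w i \<le> x m then x i else x i - w m) y V (1 - w m) 1"
    by (rule side_packing[OF packed mR VH(1)]) (simp add: V_def)
  have pkH: "packed h w (\<lambda>i. if y i + h i \<le> y m then y i else y i - h m) x H (1 - h m) 1"
    by (rule side_packing[OF packed_transpose[OF packed] mR VH(2) Hs])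
  have dd: "d \<le> s" using d by linarith
  have "\<exists>A B. A \<subseteq> V \<and> B \<subseteq> V \<and> containable e w h (box_int 0 0 (1 - w m) (1 - s / 2)) A K \<and>
    containable e w h (box_int 0 0 (1 - w m) 1) B (K + 1) \<and> (1 - 12 * eps) * sum p V \<le> sum p A + sum p B"
    by (rule two_layouts[OF pkV D M s dd d(3,4) _ _ _ aug eps]) (use p gap(1) gap2(1) VH(1) al in auto)
  then obtain A B where AB: "A \<subseteq> V" "B \<subseteq> V" "containable e w h (box_int 0 0 (1 - w m) (1 - s / 2)) A K"
    "containable e w h (box_int 0 0 (1 - w m) 1) B (K + 1)" "(1 - 12 * eps) * sum p V \<le> sum p A + sum p B"
    by (elim exE conjE)
  have "\<exists>A B. A \<subseteq> H \<and> B \<subseteq> H \<and> containable e h w (box_int 0 0 (1 - h m) (1 - s / 2)) A K \<and>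
    containable e h w (box_int 0 0 (1 - h m) 1) B (K + 1) \<and> (1 - 12 * eps) * sum p H \<le> sum p A + sum p B"
    by (rule two_layouts[OF pkH D M s dd d(3,4) _ _ _ aug eps]) (use p gap(2) gap2(2) VH(2) al in auto)
  then obtain A' B' where AB': "A' \<subseteq> H" "B' \<subseteq> H" "containable e h w (box_int 0 0 (1 - h m) (1 - s / 2)) A' K"
    "containable e h w (box_int 0 0 (1 - h m) 1) B' (K + 1)" "(1 - 12 * eps) * sum p H \<le> sum p A' + sum p B'"
    by (elim exE conjE)
  have opt1: "rot_containable e w h (box_int 0 0 1 1) ({m} \<union> A \<union> B') (1 + K + (K + 1))"
    by (rule massive_layout[OF AB(3) AB'(4) mm(1,2) al(3,4,2)])
  have opt2: "rot_containable e w h (box_int 0 0 1 1) ({m} \<union> A' \<union> B) (1 + K + (K + 1))"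
    by (rule rot_containable_swap[OF massive_layout[OF AB'(3) AB(4) mm(2,1) al(4,3,1)]])
  have fAB: "finite A" "finite B" "finite A'" "finite B'"
    using AB AB' VH finite_subset by blast+
  have s1: "sum p ({m} \<union> A \<union> B') = p m + sum p A + sum p B'"
  proof -
    have "sum p ({m} \<union> (A \<union> B')) = p m + sum p (A \<union> B')" using fAB AB AB' VH(7) by (subst sum.union_disjoint) auto
    also have "sum p (A \<union> B') = sum p A + sum p B'" using fAB AB AB' VH(4) by (intro sum.union_disjoint) auto
    finally show ?thesis by (simp add: Un_assoc add.assoc)
  qed
  have s2: "sum p ({m} \<union> A' \<union> B) = p m + sum p A' + sum p B"
  proof -
    have "sum p ({m} \<union> (A' \<union> B)) = p m + sum p (A' \<union> B)" using fAB AB AB' VH(7) by (subst sum.union_disjoint) auto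
    also have "sum p (A' \<union> B) = sum p A' + sum p B" using fAB AB AB' VH(4) by (intro sum.union_disjoint) auto
    finally show ?thesis by (simp add: Un_assoc add.assoc)
  qed
  have sVH: "sum p R = p m + (sum p V + sum p H)"
  proof -
    have "sum p ({m} \<union> (V \<union> H)) = p m + sum p (V \<union> H)" using VH by (subst sum.union_disjoint) auto
    also have "sum p (V \<union> H) = sum p V + sum p H" using VH by (intro sum.union_disjoint) auto
    finally show ?thesis using VH(3) by simp
  qed
  have "12 * eps * (sum p V + sum p H) \<le> 12 * eps * sum p R" using eps p[OF mR] sVH by (intro mult_left_mono) auto
  then have tot: "(sum p V + sum p H) - 12 * eps * sum p R \<le> (sum p A + sum p B') + (sum p A' + sum p B)"
    using AB(5) AB'(5) by (simp add: algebra_simps)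
  have sub: "{m} \<union> A \<union> B' \<subseteq> R" "{m} \<union> A' \<union> B \<subseteq> R" using AB AB' VH mR by blast+
  show ?thesis
  proof (cases "sum p A' + sum p B \<le> sum p A + sum p B'")
    case True
    then have "p m + (sum p R - p m) / 2 - 6 * eps * sum p R \<le> sum p ({m} \<union> A \<union> B')" using s1 sVH tot by argo
    then show ?thesis using sub opt1 by (intro exI[of _ "{m} \<union> A \<union> B'"] conjI) (auto intro: rot_containable_mono)
  next
    case False
    then have "p m + (sum p R - p m) / 2 - 6 * eps * sum p R \<le> sum p ({m} \<union> A' \<union> B)" using s2 sVH tot by argo
    then show ?thesis using sub opt2 by (intro exI[of _ "{m} \<union> A' \<union> B"] conjI) (auto intro: rot_containable_mono)
  qed
qed

text \<open>If no item carries more than a third, each is narrower than \<open>5 * d\<close>, or it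
  would itself be a suitable \<open>G\<close>. Greedy pieces then have width between
  \<open>5 * d\<close> and \<open>10 * d\<close>; two of them leave more than \<open>10 * d\<close>,
  so there are three disjoint wide pieces and one carries at most a third.\<close>

lemma heavy_light_or_thin:
  fixes w p :: "'i \<Rightarrow> real"
  assumes fin: "finite F" and wp: "\<And>i. i \<in> F \<Longrightarrow> 0 < w i \<and> 0 \<le> p i" and d: "0 < d" and P: "sum p F \<le> P"
  shows "(\<exists>G\<subseteq>F. 5 * d \<le> sum w G \<and> sum p G \<le> P / 3) \<or> sum w F \<le> 30 * d \<or> (\<exists>f\<in>F. P / 3 < p f)"
proof (rule ccontr)
  assume "\<not> ?thesis"
  then have noG: "\<And>G. G \<subseteq> F \<Longrightarrow> 5 * d \<le> sum w G \<Longrightarrow> P / 3 < sum p G" and W: "30 * d < sum w F"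
    and nof: "\<And>f. f \<in> F \<Longrightarrow> p f \<le> P / 3" by force+
  have small: "w f < 5 * d" if "f \<in> F" for f
  proof (rule ccontr)
    assume "\<not> w f < 5 * d"
    then show False using noG[of "{f}"] nof[OF that] that by auto
  qed
  have piece: "\<exists>G\<subseteq>T. 5 * d \<le> sum w G \<and> sum w G \<le> 10 * d" if T: "T \<subseteq> F" "5 * d < sum w T" for T
  proof -
    have finT: "finite T" using T fin finite_subset by blast
    have "0 \<le> 5 * d" using d by simp
    from sorted_prefix[OF finT this T(2), of "\<lambda>_. 0"]
    obtain G z where G: "G \<subseteq> T" "z \<in> T - G" "sum w G \<le> 5 * d" "5 * d < sum w G + w z" by (elim exE conjE)
    have "finite G" using G finT finite_subset by blast
    then have "sum w (insert z G) = w z + sum w G" using G by simp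
    then show ?thesis using G small[of z] T by (intro exI[of _ "insert z G"]) auto
  qed
  have 1: "5 * d < sum w F" using W d by linarith
  obtain G1 where G1: "G1 \<subseteq> F" "5 * d \<le> sum w G1" "sum w G1 \<le> 10 * d" using piece[OF order_refl 1] by blast
  have s1: "sum f (F - G1) = sum f F - sum f G1" for f :: "'i \<Rightarrow> real" using fin G1 by (intro sum_diff) auto
  have 2: "5 * d < sum w (F - G1)" using s1[of w] G1 W d by linarith
  obtain G2 where G2: "G2 \<subseteq> F - G1" "5 * d \<le> sum w G2" "sum w G2 \<le> 10 * d" using piece[OF Diff_subset 2] by blast
  have s2: "sum f (F - G1 - G2) = sum f (F - G1) - sum f G2" for f :: "'i \<Rightarrow> real" using fin G2 by (intro sum_diff) auto
  have 3: "5 * d \<le> sum w (F - G1 - G2)" using s1[of w] s2[of w] G1 G2 W d by linarith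
  have "P / 3 < sum p G1" "P / 3 < sum p G2" "P / 3 < sum p (F - G1 - G2)"
    using noG[of G1] noG[of G2] noG[of "F - G1 - G2"] G1 G2 3 by auto
  then show False using s1[of p] s2[of p] P by argo
qed

section \<open>Case distinction and choice of the scales\<close>

lemma augments_mono:
  assumes "augments e eps K del" "K \<le> L"
  shows "augments e eps L del"
  unfolding augments_def
proof (intro allI impI, elim conjE)
  fix w h p x y :: "nat \<Rightarrow> real" and R a b
  assume packed: "packed w h x y R a b" "\<forall>i\<in>R. 0 \<le> p i"
  have "\<exists>R'\<subseteq>R. sum p (R - R') \<le> 5 * eps * sum p R \<and> containable e w h (box_int 0 0 a ((1 + del) * b)) R' K"
    by (rule augmentsD[OF assms(1) packed(1)]) (use packed(2) in simp)
  then obtain R' where R': "R' \<subseteq> R" "sum p (R - R') \<le> 5 * eps * sum p R"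
    "containable e w h (box_int 0 0 a ((1 + del) * b)) R' K" by (elim exE conjE)
  show "\<exists>R'\<subseteq>R. sum p (R - R') \<le> 5 * eps * sum p R \<and> containable e w h (box_int 0 0 a ((1 + del) * b)) R' L"
    by (intro exI[of _ R'] conjI R'(1,2) containable.mono[OF R'(3) subset_refl assms(2)])
qed

text \<open>Stated for the vertical direction only: transposing the data exchanges the directions,
  and a conclusion that allows rotation transfers back.\<close>

lemma thin_direction:
  fixes p :: "nat \<Rightarrow> real"
  assumes packed: "packed w h x y R 1 1" and D: "0 < D" "D \<le> 1 / 4" and M: "0 < M" "2 / real M \<le> eps"
    and s: "s = D / real M" and d: "d = s / 100" and eps: "0 < eps" "eps \<le> 1"
    and p: "\<And>i. i \<in> R \<Longrightarrow> 0 \<le> p i" and gap: "\<And>i. i \<in> R \<Longrightarrow> h i \<le> d \<or> D < h i"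
    and gap2: "\<And>i. i \<in> R \<Longrightarrow> (y i \<le> d \<and> 1 - d \<le> y i + h i) \<or> D < y i \<or> y i + h i < 1 - D"
    and aug: "augments e eps K 1" "augments e eps K d" "augments e eps K s" "augments e eps K (s / 2)"
    and KS: "\<forall>e w h p x y R D d. packed w h x y R 1 1 \<and> (\<forall>i\<in>R. 0 \<le> p i) \<and> 0 < D \<and> D \<le> 1 / 2 \<and>
      upper h y D d R \<inter> lower h y D d R = {} \<longrightarrow>
      (\<exists>R'\<subseteq>upper h y D d R \<union> lower h y D d R.
        sum p ((upper h y D d R \<union> lower h y D d R) - R') \<le> 3 * eps * sum p (upper h y D d R \<union> lower h y D d R) \<and>
        containable e w h (box_int 0 0 1 1) R' KS)"
    and nof: "\<forall>f\<in>spanning h y d R. p f \<le> sum p R / 3"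
  shows "\<exists>S\<subseteq>R. (2 / 3 - 15 * eps) * sum p R \<le> sum p S \<and> rot_containable e w h (box_int 0 0 1 1) S (3 * K + KS + 1)"
proof -
  let ?F = "spanning h y d R" and ?T = "upper h y D d R" and ?L = "lower h y D d R" and ?P = "sum p R"
  have fin: "finite R" using packed unfolding packed_def by blast
  have D1: "D \<le> 1" "D \<le> 1 / 2" using D by auto
  have s0: "0 < s" unfolding s using D M by simp
  have sD: "s \<le> D"
  proof -
    have "D * 1 \<le> D * real M" using D M by (intro mult_left_mono) auto
    then show ?thesis unfolding s using M by (simp add: divide_le_eq)
  qed
  have d0: "0 < d" "d < 1 / 2" "60 * d \<le> s" "d \<le> s" unfolding d using s0 sD D by auto
  have P0: "0 \<le> ?P" using p by (intro sum_nonneg)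
  have sub: "?F \<subseteq> R" "?T \<subseteq> R" "?L \<subseteq> R" unfolding spanning_def upper_def lower_def by auto
  have fF: "finite ?F" using sub fin finite_subset by blast
  have wp: "0 < w i \<and> 0 \<le> p i" if "i \<in> ?F" for i using that sub packed p unfolding packed_def by blast
  have PF: "sum p ?F \<le> ?P" using fin sub p by (intro sum_mono2) auto
  have fromloss: "(2 / 3 - 15 * eps) * ?P \<le> sum p S" if "S \<subseteq> R" "sum p (R - S) \<le> ?P / 3 + 15 * eps * ?P" for S
  proof -
    have "sum p (R - S) = ?P - sum p S" using fin that(1) by (intro sum_diff) auto
    moreover have "(2 / 3 - 15 * eps) * ?P = ?P - (?P / 3 + 15 * eps * ?P)" by (simp add: algebra_simps)
    ultimately show ?thesis using that(2) by linarith
  qed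
  have e615: "6 * eps * ?P \<le> 15 * eps * ?P" using eps P0 by (intro mult_right_mono) auto
  from heavy_light_or_thin[OF fF wp d0(1) PF] nof
  consider G where "G \<subseteq> ?F" "5 * d \<le> sum w G" "sum p G \<le> ?P / 3" | "sum w ?F \<le> 30 * d" by force
  then show ?thesis
  proof cases
    case (1 G)
    have "\<exists>S\<subseteq>R. sum p (R - S) \<le> sum p G + 15 * eps * ?P \<and> rot_containable e w h (box_int 0 0 1 1) S (3 * K + 1)"
      by (rule collapse_packing[OF packed d0(1,2) p 1(1,2) aug(1,2) eps(1)])
    then obtain S where S: "S \<subseteq> R" "sum p (R - S) \<le> sum p G + 15 * eps * ?P" "rot_containable e w h (box_int 0 0 1 1) S (3 * K + 1)"
      by (elim exE conjE)
    have "(2 / 3 - 15 * eps) * ?P \<le> sum p S" using S 1(3) by (intro fromloss) auto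
    moreover have "rot_containable e w h (box_int 0 0 1 1) S (3 * K + KS + 1)" by (rule rot_containable_mono[OF S(3)]) auto
    ultimately show ?thesis using S(1) by blast
  next
    case 2
    have disj: "?T \<inter> ?L = {}" by (rule upper_lower_disjoint[OF gap2])
    show ?thesis
    proof (cases "sum p ?T \<le> ?P / 3 \<or> sum p ?L \<le> ?P / 3")
      case True
      then obtain Z where Z: "Z = ?T \<or> Z = ?L" "sum p Z \<le> ?P / 3" by blast
      have "\<exists>S\<subseteq>R. sum p (R - S) \<le> sum p Z + 6 * eps * ?P \<and> rot_containable e w h (box_int 0 0 1 1) S (K + 1)"
        by (rule thin_spanning_packing[OF packed D(1) D1(1) M s d0(1,3) p gap 2 Z(1) aug(4) eps(1)])
      then obtain S where S: "S \<subseteq> R" "sum p (R - S) \<le> sum p Z + 6 * eps * ?P" "rot_containable e w h (box_int 0 0 1 1) S (K + 1)"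
        by (elim exE conjE)
      have "(2 / 3 - 15 * eps) * ?P \<le> sum p S" using S Z(2) e615 by (intro fromloss) auto
      moreover have "rot_containable e w h (box_int 0 0 1 1) S (3 * K + KS + 1)" by (rule rot_containable_mono[OF S(3)]) auto
      ultimately show ?thesis using S(1) by blast
    next
      case False
      have "\<exists>R'\<subseteq>?T \<union> ?L. sum p ((?T \<union> ?L) - R') \<le> 3 * eps * sum p (?T \<union> ?L) \<and> containable e w h (box_int 0 0 1 1) R' KS"
        by (rule KS[rule_format]) (use packed p D(1) D1(2) disj in blast)
      then obtain S where S: "S \<subseteq> ?T \<union> ?L" "sum p ((?T \<union> ?L) - S) \<le> 3 * eps * sum p (?T \<union> ?L)"
        "containable e w h (box_int 0 0 1 1) S KS" by (elim exE conjE)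
      have fT: "finite ?T" "finite ?L" using sub fin finite_subset by blast+
      have sTL: "sum p (?T \<union> ?L) = sum p ?T + sum p ?L" using fT disj by (rule sum.union_disjoint)
      have "sum p (?T \<union> ?L) \<le> ?P" using fin sub p by (intro sum_mono2) auto
      then have "3 * eps * sum p (?T \<union> ?L) \<le> 3 * eps * ?P" using eps by (intro mult_left_mono) auto
      moreover have "sum p ((?T \<union> ?L) - S) = sum p (?T \<union> ?L) - sum p S" using fT S(1) by (intro sum_diff) auto
      ultimately have "2 / 3 * ?P - 3 * eps * ?P \<le> sum p S" using S(2) sTL False by argo
      moreover have "3 * eps * ?P \<le> 15 * eps * ?P" using eps P0 by (intro mult_right_mono) auto
      ultimately have "(2 / 3 - 15 * eps) * ?P \<le> sum p S" unfolding left_diff_distrib by linarith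
      moreover have "rot_containable e w h (box_int 0 0 1 1) S (3 * K + KS + 1)"
        by (rule rot_containable_mono[OF rot_containable_of_cpn[OF S(3)]]) auto
      moreover have "S \<subseteq> R" using S(1) sub by blast
      ultimately show ?thesis by blast
    qed
  qed
qed

lemma pair_packing:
  assumes packed: "packed w h x y R 1 1" and fg: "f \<in> R" "g \<in> R" "f \<noteq> g"
  shows "rot_containable e w h (box_int 0 0 1 1) {f, g} 2"
proof -
  have R: "0 < w i" "0 < h i" "0 \<le> x i" "x i + w i \<le> 1" "0 \<le> y i" "y i + h i \<le> 1" if "i \<in> R" for i
    using packed that unfolding packed_def by blast+
  have "sep x w f g \<or> sep y h f g" using packed fg unfolding packed_def by blast
  then have "box_int (x f) (y f) (w f) (h f) \<inter> box_int (x g) (y g) (w g) (h g) = {}"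
    unfolding sep_def by (intro box_disj) blast
  moreover have "containable e w h (box_int (x i) (y i) (w i) (h i)) {i} 1" if "i \<in> R" for i
    using R[OF that] by (intro containable_vertical) auto
  ultimately have "containable e w h (box_int (x f) (y f) (w f) (h f) \<union> box_int (x g) (y g) (w g) (h g)) ({f} \<union> {g}) (1 + 1)"
    using fg by (intro containable_Un) auto
  moreover have "box_int (x i) (y i) (w i) (h i) \<subseteq> box_int 0 0 1 1" if "i \<in> R" for i
    using R[OF that] by (intro box_sub) auto
  ultimately have "containable e w h (box_int 0 0 1 1) ({f} \<union> {g}) 2"
    using fg by (elim containable.mono) auto
  then show ?thesis by (intro rot_containable_of_cpn) (simp add: insert_commute)
qed

lemma fixed_scale_packing:
  fixes p :: "nat \<Rightarrow> real"
  assumes packed: "packed w h x y R 1 1" and D: "0 < D" "D \<le> 1 / 4" and M: "0 < M" "2 / real M \<le> eps"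
    and s: "s = D / real M" and d: "d = s / 100" and eps: "0 < eps" "eps \<le> 1"
    and p: "\<And>i. i \<in> R \<Longrightarrow> 0 \<le> p i"
    and gap: "\<And>i. i \<in> R \<Longrightarrow> h i \<le> d \<or> D < h i" "\<And>i. i \<in> R \<Longrightarrow> w i \<le> d \<or> D < w i"
    and gap2: "\<And>i. i \<in> R \<Longrightarrow> (y i \<le> d \<and> 1 - d \<le> y i + h i) \<or> D < y i \<or> y i + h i < 1 - D"
      "\<And>i. i \<in> R \<Longrightarrow> (x i \<le> d \<and> 1 - d \<le> x i + w i) \<or> D < x i \<or> x i + w i < 1 - D"
    and aug: "augments e eps K 1" "augments e eps K d" "augments e eps K s" "augments e eps K (s / 2)"
    and KS: "\<forall>e w h p x y R D d. packed w h x y R 1 1 \<and> (\<forall>i\<in>R. 0 \<le> p i) \<and> 0 < D \<and> D \<le> 1 / 2 \<and>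
      upper h y D d R \<inter> lower h y D d R = {} \<longrightarrow>
      (\<exists>R'\<subseteq>upper h y D d R \<union> lower h y D d R.
        sum p ((upper h y D d R \<union> lower h y D d R) - R') \<le> 3 * eps * sum p (upper h y D d R \<union> lower h y D d R) \<and>
        containable e w h (box_int 0 0 1 1) R' KS)"
  shows "\<exists>S\<subseteq>R. (2 / 3 - 15 * eps) * sum p R \<le> sum p S \<and> rot_containable e w h (box_int 0 0 1 1) S (3 * K + KS + 2)"
proof -
  let ?P = "sum p R"
  have fin: "finite R" using packed unfolding packed_def by blast
  have P0: "0 \<le> ?P" using p by (intro sum_nonneg)
  have drop15: "(2 / 3 - 15 * eps) * ?P \<le> 2 / 3 * ?P - c * eps * ?P" if "c \<le> 15" for c
  proof -
    have "c * eps * ?P \<le> 15 * eps * ?P" using that eps P0 by (intro mult_right_mono) auto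
    then show ?thesis by (simp add: left_diff_distrib)
  qed
  consider "\<forall>f\<in>spanning h y d R. p f \<le> ?P / 3" | "\<forall>f\<in>spanning w x d R. p f \<le> ?P / 3"
    | f g where "f \<in> spanning h y d R" "g \<in> spanning w x d R" "?P / 3 < p f" "?P / 3 < p g" by force
  then show ?thesis
  proof cases
    case 1
    have "\<exists>S\<subseteq>R. (2 / 3 - 15 * eps) * ?P \<le> sum p S \<and> rot_containable e w h (box_int 0 0 1 1) S (3 * K + KS + 1)"
      by (rule thin_direction[OF packed D M s d eps p gap(1) gap2(1) aug KS 1])
    then obtain S where "S \<subseteq> R" "(2 / 3 - 15 * eps) * ?P \<le> sum p S" "rot_containable e w h (box_int 0 0 1 1) S (3 * K + KS + 1)"
      by (elim exE conjE)
    then show ?thesis by (intro exI[of _ S] conjI) (auto intro: rot_containable_mono)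
  next
    case 2
    have "\<exists>S\<subseteq>R. (2 / 3 - 15 * eps) * ?P \<le> sum p S \<and> rot_containable e h w (box_int 0 0 1 1) S (3 * K + KS + 1)"
      by (rule thin_direction[OF packed_transpose[OF packed] D M s d eps p gap(2) gap2(2) aug KS 2])
    then obtain S where "S \<subseteq> R" "(2 / 3 - 15 * eps) * ?P \<le> sum p S" "rot_containable e h w (box_int 0 0 1 1) S (3 * K + KS + 1)"
      by (elim exE conjE)
    then show ?thesis by (intro exI[of _ S] conjI) (auto intro: rot_containable_mono rot_containable_swap)
  next
    case (3 f g)
    have fR: "f \<in> R" "g \<in> R" using 3 unfolding spanning_def by auto
    show ?thesis
    proof (cases "f = g")
      case False
      have "(2 / 3 - 15 * eps) * ?P \<le> 2 / 3 * ?P" using drop15[of 0] by simp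
      also have "\<dots> \<le> p f + p g" using 3(3,4) by linarith
      also have "\<dots> = sum p {f, g}" using False by simp
      finally show ?thesis using fR pair_packing[OF packed fR False, of e]
        by (intro exI[of _ "{f, g}"] conjI) (auto intro: rot_containable_mono)
    next
      case True
      have s0: "0 < s" unfolding s using D M by simp
      have sD: "s \<le> D"
      proof -
        have "D * 1 \<le> D * real M" using D M by (intro mult_left_mono) auto
        then show ?thesis unfolding s using M by (simp add: divide_le_eq)
      qed
      have d0: "0 < d" "4 * d \<le> s" "d < 1 / 2" "d \<le> D" "D \<le> 1" unfolding d using s0 sD D by auto
      \<comment> \<open>One item is heavy and spanning in both directions; since \<open>p f\<close>
        exceeds a third of \<open>?P\<close>, the value \<open>p f + (?P - p f) / 2\<close> exceeds
        two thirds of it.\<close>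
      have "\<exists>S\<subseteq>R. p f + (?P - p f) / 2 - 6 * eps * ?P \<le> sum p S \<and> rot_containable e w h (box_int 0 0 1 1) S (2 * K + 2)"
        by (rule massive_packing[OF packed D(1) d0(5) M s d0(1-4) p gap gap2 3(1) 3(2)[folded True] aug(3,4) eps(1)])
      then obtain S where S: "S \<subseteq> R" "p f + (?P - p f) / 2 - 6 * eps * ?P \<le> sum p S"
        "rot_containable e w h (box_int 0 0 1 1) S (2 * K + 2)" by (elim exE conjE)
      have "(2 / 3 - 15 * eps) * ?P \<le> 2 / 3 * ?P - 6 * eps * ?P" by (rule drop15) simp
      also have "\<dots> \<le> sum p S" using S(2) 3(3) by argo
      finally show ?thesis using S by (intro exI[of _ S] conjI) (auto intro: rot_containable_mono)
    qed
  qed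
qed

theorem unit_square_packing:
  fixes eps :: real
  assumes eps: "0 < eps" "eps \<le> 1"
  shows "\<exists>K. \<forall>w h p x y R. packed w h x y R 1 1 \<and> (\<forall>i\<in>R. 0 \<le> p i) \<longrightarrow>
    (\<exists>S\<subseteq>R. (2 / 3 - 16 * eps) * sum p R \<le> sum p S \<and> rot_containable eps w h (box_int 0 0 1 1) S K)"
proof -
  define M where "M = nat \<lceil>2 / eps\<rceil>"
  have M: "0 < M" "2 / real M \<le> eps" unfolding M_def using nat_ceil_inverse[OF eps(1), of 2] by simp_all
  define J where "J = nat \<lceil>4 / eps\<rceil>"
  have J: "0 < J" "4 / real J \<le> eps" unfolding J_def using nat_ceil_inverse[OF eps(1), of 4] by simp_all
  \<comment> \<open>Ratio of consecutive scales: \<open>D\<close> is \<open>Ds k\<close>, a strip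
    has height \<open>s = D / M\<close>, and \<open>d = s / 100\<close> is the next scale.\<close>
  define c where "c = 1 / (100 * real M)"
  have c: "0 < c" "c < 1" unfolding c_def using M by (auto simp: divide_less_eq)
  define Ds where "Ds k = c ^ k / 4" for k
  have Ds: "0 < Ds k" "Ds k \<le> 1 / 4" "Ds (Suc k) < Ds k" "Ds (Suc k) = Ds k / real M / 100" for k
  proof -
    show "0 < Ds k" unfolding Ds_def using c by simp
    show "Ds k \<le> 1 / 4" unfolding Ds_def using c power_le_one[of c k] by simp
    show "Ds (Suc k) < Ds k" unfolding Ds_def using c by simp
    show "Ds (Suc k) = Ds k / real M / 100" unfolding Ds_def c_def by simp
  qed
  have "\<exists>K. augments eps eps K del" if "0 < del" "del \<le> 1" for del
    using resource_augmentation[OF eps(1,2) eps that] unfolding augments_def .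
  then obtain f where f: "\<And>del. 0 < del \<Longrightarrow> del \<le> 1 \<Longrightarrow> augments eps eps (f del) del" by metis
  define Kk where "Kk k = f 1 + f (Ds (Suc k)) + f (Ds k / real M) + f (Ds k / real M / 2)" for k
  obtain KS where KS: "\<forall>e w h p x y R D d. packed w h x y R 1 1 \<and> (\<forall>i\<in>R. 0 \<le> p i) \<and> 0 < D \<and> D \<le> 1 / 2 \<and>
      upper h y D d R \<inter> lower h y D d R = {} \<longrightarrow>
      (\<exists>R'\<subseteq>upper h y D d R \<union> lower h y D d R.
        sum p ((upper h y D d R \<union> lower h y D d R) - R') \<le> 3 * eps * sum p (upper h y D d R \<union> lower h y D d R) \<and>
        containable e w h (box_int 0 0 1 1) R' KS)"
    using staircase_packing[OF eps] by (elim exE)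
  define K where "K = (\<Sum>k<J. 3 * Kk k + KS + 2)"
  show ?thesis
  proof (rule exI[of _ K], intro allI impI, elim conjE)
    fix w h p x y :: "nat \<Rightarrow> real" and R
    assume packed: "packed w h x y R 1 1" and p: "\<forall>i\<in>R. 0 \<le> p i"
    have fin: "finite R" using packed unfolding packed_def by blast
    \<comment> \<open>The quantities that must avoid the gap: both side lengths and, for each
      direction, the larger of the two distances to the boundary, which is at most \<open>d\<close>
      exactly for spanning items.\<close>
    define v where "v = (\<lambda>n i. [h i, w i, max (y i) (1 - (y i + h i)), max (x i) (1 - (x i + w i))] ! n)"
    have "\<exists>k<J. sum p {i \<in> R. \<exists>n<4. Ds (Suc k) < v n i \<and> v n i \<le> Ds k} \<le> real 4 / real J * sum p R"
      by (rule sequence_pigeonhole) (use Ds fin p J in auto)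
    then obtain k where k: "k < J" "sum p {i \<in> R. \<exists>n<4. Ds (Suc k) < v n i \<and> v n i \<le> Ds k} \<le> real 4 / real J * sum p R"
      by (elim exE conjE)
    define Q where "Q = {i \<in> R. \<exists>n<4. Ds (Suc k) < v n i \<and> v n i \<le> Ds k}"
    have P0: "0 \<le> sum p R" using p by (intro sum_nonneg) auto
    have "real 4 / real J * sum p R \<le> eps * sum p R" using J P0 by (intro mult_right_mono) auto
    then have Q: "sum p Q \<le> eps * sum p R" using k(2) unfolding Q_def by linarith
    have gapn: "v n i \<le> Ds (Suc k) \<or> Ds k < v n i" if "i \<in> R - Q" "n < 4" for i n
      using that unfolding Q_def by force
    define s where "s = Ds k / real M"
    have s: "0 < s" "s \<le> 1" "Ds (Suc k) = s / 100"
    proof -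
      show "0 < s" unfolding s_def using Ds(1)[of k] M by simp
      have "1 \<le> real M" using M by simp
      then show "s \<le> 1" unfolding s_def using Ds(2)[of k] M by (simp add: divide_le_eq)
      show "Ds (Suc k) = s / 100" unfolding s_def by (rule Ds(4))
    qed
    have aug: "augments eps eps (Kk k) 1" "augments eps eps (Kk k) (Ds (Suc k))" "augments eps eps (Kk k) s"
      "augments eps eps (Kk k) (s / 2)"
      by (rule augments_mono[OF f]; use s Ds(1,2)[of "Suc k"] in \<open>auto simp: Kk_def s_def\<close>)+
    have pkQ: "packed w h x y (R - Q) 1 1" by (rule packed_subset[OF packed]) blast
    have "\<exists>S\<subseteq>R - Q. (2 / 3 - 15 * eps) * sum p (R - Q) \<le> sum p S \<and>
      rot_containable eps w h (box_int 0 0 1 1) S (3 * Kk k + KS + 2)"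
    proof (rule fixed_scale_packing[OF pkQ Ds(1) Ds(2) M s_def s(3) eps _ _ _ _ _ aug KS])
      fix i assume i: "i \<in> R - Q"
      show "0 \<le> p i" using p i by blast
      show "h i \<le> Ds (Suc k) \<or> Ds k < h i" using gapn[OF i, of 0] unfolding v_def by simp
      show "w i \<le> Ds (Suc k) \<or> Ds k < w i" using gapn[OF i, of 1] unfolding v_def by simp
      show "(y i \<le> Ds (Suc k) \<and> 1 - Ds (Suc k) \<le> y i + h i) \<or> Ds k < y i \<or> y i + h i < 1 - Ds k"
        using gapn[OF i, of 2] unfolding v_def by auto
      show "(x i \<le> Ds (Suc k) \<and> 1 - Ds (Suc k) \<le> x i + w i) \<or> Ds k < x i \<or> x i + w i < 1 - Ds k"
        using gapn[OF i, of 3] unfolding v_def by (auto simp: numeral_3_eq_3)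
    qed
    then obtain S where S: "S \<subseteq> R - Q" "(2 / 3 - 15 * eps) * sum p (R - Q) \<le> sum p S"
      "rot_containable eps w h (box_int 0 0 1 1) S (3 * Kk k + KS + 2)" by (elim exE conjE)
    have "3 * Kk k + KS + 2 \<le> K" unfolding K_def using k(1) by (intro member_le_sum) auto
    then have cpS: "rot_containable eps w h (box_int 0 0 1 1) S K" by (intro rot_containable_mono[OF S(3)]) auto
    have "(2 / 3 - 16 * eps) * sum p R \<le> sum p S"
    proof (cases "0 \<le> 2 / 3 - 15 * eps")
      case True
      have "sum p (R - Q) = sum p R - sum p Q" using fin by (intro sum_diff) (auto simp: Q_def)
      then have "(1 - eps) * sum p R \<le> sum p (R - Q)" using Q by (simp add: left_diff_distrib)
      then have "(2 / 3 - 15 * eps) * ((1 - eps) * sum p R) \<le> (2 / 3 - 15 * eps) * sum p (R - Q)"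
        using True by (rule mult_left_mono)
      moreover have "(2 / 3 - 16 * eps) * sum p R \<le> (2 / 3 - 15 * eps) * (1 - eps) * sum p R"
      proof (intro mult_right_mono[OF _ P0])
        have eq: "(2 / 3 - 15 * eps) * (1 - eps) = (2 / 3 - 16 * eps) + (eps / 3 + 15 * (eps * eps))"
          by (simp add: field_simps)
        have "0 \<le> eps / 3 + 15 * (eps * eps)" using eps(1) by simp
        then show "2 / 3 - 16 * eps \<le> (2 / 3 - 15 * eps) * (1 - eps)" unfolding eq by (rule add_increasing2) simp
      qed
      ultimately show ?thesis using S(2) by (simp add: mult.assoc)
    next
      case False
      \<comment> \<open>For such large \<open>eps\<close> the required profit is not
        positive.\<close>
      then have "(2 / 3 - 16 * eps) * sum p R \<le> 0" using eps P0 by (intro mult_nonpos_nonneg) auto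
      also have "0 \<le> sum p S" using p S(1) by (intro sum_nonneg) auto
      finally show ?thesis .
    qed
    then show "\<exists>S\<subseteq>R. (2 / 3 - 16 * eps) * sum p R \<le> sum p S \<and> rot_containable eps w h (box_int 0 0 1 1) S K"
      using S(1) cpS by blast
  qed
qed

section \<open>From the inductive notion to explicit containers in the knapsack\<close>

definition explicit_packing :: "real \<Rightarrow> (nat \<Rightarrow> real) \<Rightarrow> (nat \<Rightarrow> real) \<Rightarrow> (real \<times> real) set \<Rightarrow> nat set \<Rightarrow> nat \<Rightarrow> bool" where
  "explicit_packing e w h A S m \<longleftrightarrow> (\<exists>cx cy ca cb lab asg px py.
    (\<forall>k<m. 0 < ca k \<and> 0 < cb k \<and> box_int (cx k) (cy k) (ca k) (cb k) \<subseteq> A) \<and>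
    (\<forall>k<m. \<forall>l<m. k \<noteq> l \<longrightarrow> box_int (cx k) (cy k) (ca k) (cb k) \<inter> box_int (cx l) (cy l) (ca l) (cb l) = {}) \<and>
    (\<forall>i\<in>S. asg i < m \<and> cx (asg i) \<le> px i \<and> px i + w i \<le> cx (asg i) + ca (asg i) \<and>
      cy (asg i) \<le> py i \<and> py i + h i \<le> cy (asg i) + cb (asg i)) \<and>
    (\<forall>i\<in>S. \<forall>j\<in>S. i \<noteq> j \<and> asg i = asg j \<longrightarrow> (case lab (asg i) of Horizontal \<Rightarrow> sep py h i j
       | Vertical \<Rightarrow> sep px w i j | Area \<Rightarrow> sep px w i j \<or> sep py h i j)) \<and>
    (\<forall>i\<in>S. lab (asg i) = Area \<longrightarrow> w i \<le> e * ca (asg i) \<and> h i \<le> e * cb (asg i)))"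

lemma explicit_packingI:
  assumes "\<forall>k<m. 0 < ca k \<and> 0 < cb k \<and> box_int (cx k) (cy k) (ca k) (cb k) \<subseteq> A"
    "\<forall>k<m. \<forall>l<m. k \<noteq> l \<longrightarrow> box_int (cx k) (cy k) (ca k) (cb k) \<inter> box_int (cx l) (cy l) (ca l) (cb l) = {}"
    "\<forall>i\<in>S. asg i < m \<and> cx (asg i) \<le> px i \<and> px i + w i \<le> cx (asg i) + ca (asg i) \<and>
      cy (asg i) \<le> py i \<and> py i + h i \<le> cy (asg i) + cb (asg i)"
    "\<forall>i\<in>S. \<forall>j\<in>S. i \<noteq> j \<and> asg i = asg j \<longrightarrow> (case lab (asg i) of Horizontal \<Rightarrow> sep py h i j
       | Vertical \<Rightarrow> sep px w i j | Area \<Rightarrow> sep px w i j \<or> sep py h i j)"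
    "\<forall>i\<in>S. lab (asg i) = Area \<longrightarrow> w i \<le> e * ca (asg i) \<and> h i \<le> e * cb (asg i)"
  shows "explicit_packing e w h A S m"
  unfolding explicit_packing_def
  by (rule exI[of _ cx], rule exI[of _ cy], rule exI[of _ ca], rule exI[of _ cb], rule exI[of _ lab],
      rule exI[of _ asg], rule exI[of _ px], rule exI[of _ py]) (intro conjI assms)

text \<open>Unrolls the induction into functions on container indices. Only items sharing a
  container carry a separation condition; disjoint boxes settle the rest. The number
  \<open>m\<close> may stay below \<open>n\<close> because relaxing the bound adds no
  container.\<close>

lemma explicit_packing_of_cpn:
  assumes "containable e w h A S n"
  shows "\<exists>m\<le>n. explicit_packing e w h A S m"
  using assms
proof (induction rule: containable.induct)
  case (empty A)
  have "explicit_packing e w h A {} 0" by (rule explicit_packingI) auto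
  then show ?case by blast
next
  case (single X Y a b S A)
  obtain lab px py where c: "0 < a" "0 < b"
    "\<forall>i\<in>S. X \<le> px i \<and> px i + w i \<le> X + a \<and> Y \<le> py i \<and> py i + h i \<le> Y + b"
    "\<forall>i\<in>S. \<forall>j\<in>S. i \<noteq> j \<longrightarrow> (case lab of Horizontal \<Rightarrow> sep py h i j | Vertical \<Rightarrow> sep px w i j
       | Area \<Rightarrow> sep px w i j \<or> sep py h i j)"
    "lab = Area \<longrightarrow> (\<forall>i\<in>S. w i \<le> e * a \<and> h i \<le> e * b)"
    using single.hyps(1) unfolding container_def by (elim exE conjE)
  have "explicit_packing e w h A S 1"
    by (rule explicit_packingI[where cx="\<lambda>_. X" and cy="\<lambda>_. Y" and ca="\<lambda>_. a" and cb="\<lambda>_. b"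
          and lab="\<lambda>_. lab" and asg="\<lambda>_. 0" and px=px and py=py]) (use c single.hyps(2) in auto)
  then show ?case by blast
next
  case (union A S m B T n)
  from union.IH obtain m' n' where le: "m' \<le> m" "n' \<le> n"
    and E: "explicit_packing e w h A S m'" "explicit_packing e w h B T n'" by (elim exE conjE)
  from E(1) obtain cx cy ca cb lab asg px py where a:
    "\<forall>k<m'. 0 < ca k \<and> 0 < cb k \<and> box_int (cx k) (cy k) (ca k) (cb k) \<subseteq> A"
    "\<forall>k<m'. \<forall>l<m'. k \<noteq> l \<longrightarrow> box_int (cx k) (cy k) (ca k) (cb k) \<inter> box_int (cx l) (cy l) (ca l) (cb l) = {}"
    "\<forall>i\<in>S. asg i < m' \<and> cx (asg i) \<le> px i \<and> px i + w i \<le> cx (asg i) + ca (asg i) \<and>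
      cy (asg i) \<le> py i \<and> py i + h i \<le> cy (asg i) + cb (asg i)"
    "\<forall>i\<in>S. \<forall>j\<in>S. i \<noteq> j \<and> asg i = asg j \<longrightarrow> (case lab (asg i) of Horizontal \<Rightarrow> sep py h i j
       | Vertical \<Rightarrow> sep px w i j | Area \<Rightarrow> sep px w i j \<or> sep py h i j)"
    "\<forall>i\<in>S. lab (asg i) = Area \<longrightarrow> w i \<le> e * ca (asg i) \<and> h i \<le> e * cb (asg i)"
    unfolding explicit_packing_def by (elim exE conjE)
  from E(2) obtain cx' cy' ca' cb' lab' asg' px' py' where b:
    "\<forall>k<n'. 0 < ca' k \<and> 0 < cb' k \<and> box_int (cx' k) (cy' k) (ca' k) (cb' k) \<subseteq> B"
    "\<forall>k<n'. \<forall>l<n'. k \<noteq> l \<longrightarrow> box_int (cx' k) (cy' k) (ca' k) (cb' k) \<inter> box_int (cx' l) (cy' l) (ca' l) (cb' l) = {}"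
    "\<forall>i\<in>T. asg' i < n' \<and> cx' (asg' i) \<le> px' i \<and> px' i + w i \<le> cx' (asg' i) + ca' (asg' i) \<and>
      cy' (asg' i) \<le> py' i \<and> py' i + h i \<le> cy' (asg' i) + cb' (asg' i)"
    "\<forall>i\<in>T. \<forall>j\<in>T. i \<noteq> j \<and> asg' i = asg' j \<longrightarrow> (case lab' (asg' i) of Horizontal \<Rightarrow> sep py' h i j
       | Vertical \<Rightarrow> sep px' w i j | Area \<Rightarrow> sep px' w i j \<or> sep py' h i j)"
    "\<forall>i\<in>T. lab' (asg' i) = Area \<longrightarrow> w i \<le> e * ca' (asg' i) \<and> h i \<le> e * cb' (asg' i)"
    unfolding explicit_packing_def by (elim exE conjE)
  \<comment> \<open>Containers of the second packing are renumbered from \<open>m'\<close>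
    on.\<close>
  define jn where "jn f g k = (if k < m' then f k else g (k - m'))" for f g :: "nat \<Rightarrow> real" and k
  define jl where "jl k = (if k < m' then lab k else lab' (k - m'))" for k
  define ja where "ja i = (if i \<in> S then asg i else m' + asg' i)" for i
  define jp where "jp f g i = (if i \<in> S then f i else g i)" for f g :: "nat \<Rightarrow> real" and i
  have TS: "i \<notin> S" if "i \<in> T" for i using union.hyps(4) that by blast
  have jS: "ja i = asg i" "ja i < m'" "jn f g (ja i) = f (asg i)" "jl (ja i) = lab (asg i)" "jp f g i = f i"
    if "i \<in> S" for i f g
    using that a(3) unfolding ja_def jn_def jl_def jp_def by auto
  have jT: "ja i = m' + asg' i" "jn f g (ja i) = g (asg' i)" "jl (ja i) = lab' (asg' i)" "jp f g i = g i"
    if "i \<in> T" for i f g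
    using TS[OF that] unfolding ja_def jn_def jl_def jp_def by auto
  have "explicit_packing e w h (A \<union> B) (S \<union> T) (m' + n')"
  proof (rule explicit_packingI[where cx="jn cx cx'" and cy="jn cy cy'" and ca="jn ca ca'" and cb="jn cb cb'"
        and lab=jl and asg=ja and px="jp px px'" and py="jp py py'"])
    have sub: "0 < jn ca ca' k \<and> 0 < jn cb cb' k \<and>
      box_int (jn cx cx' k) (jn cy cy' k) (jn ca ca' k) (jn cb cb' k) \<subseteq> (if k < m' then A else B)"
      if "k < m' + n'" for k
      using that a(1) b(1) unfolding jn_def by auto
    then show "\<forall>k<m' + n'. 0 < jn ca ca' k \<and> 0 < jn cb cb' k \<and>
      box_int (jn cx cx' k) (jn cy cy' k) (jn ca ca' k) (jn cb cb' k) \<subseteq> A \<union> B"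
      by (fastforce split: if_splits)
    show "\<forall>k<m' + n'. \<forall>l<m' + n'. k \<noteq> l \<longrightarrow> box_int (jn cx cx' k) (jn cy cy' k) (jn ca ca' k) (jn cb cb' k) \<inter>
      box_int (jn cx cx' l) (jn cy cy' l) (jn ca ca' l) (jn cb cb' l) = {}"
    proof (intro allI impI)
      fix k l assume kl: "k < m' + n'" "l < m' + n'" "k \<noteq> l"
      consider "k < m'" "l < m'" | "\<not> k < m'" "\<not> l < m'" | "(k < m') \<noteq> (l < m')" by blast
      then show "box_int (jn cx cx' k) (jn cy cy' k) (jn ca ca' k) (jn cb cb' k) \<inter>
        box_int (jn cx cx' l) (jn cy cy' l) (jn ca ca' l) (jn cb cb' l) = {}"
      proof cases
        case 1
        then show ?thesis using a(2) kl unfolding jn_def by simp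
      next
        case 2
        then have "k - m' < n'" "l - m' < n'" "k - m' \<noteq> l - m'" using kl by auto
        then show ?thesis using b(2) 2 unfolding jn_def by simp
      next
        case 3
        then show ?thesis using sub[OF kl(1)] sub[OF kl(2)] union.hyps(3) by (auto split: if_splits)
      qed
    qed
    show "\<forall>i\<in>S \<union> T. ja i < m' + n' \<and> jn cx cx' (ja i) \<le> jp px px' i \<and>
      jp px px' i + w i \<le> jn cx cx' (ja i) + jn ca ca' (ja i) \<and> jn cy cy' (ja i) \<le> jp py py' i \<and>
      jp py py' i + h i \<le> jn cy cy' (ja i) + jn cb cb' (ja i)"
    proof
      fix i assume "i \<in> S \<union> T"
      then show "ja i < m' + n' \<and> jn cx cx' (ja i) \<le> jp px px' i \<and>
        jp px px' i + w i \<le> jn cx cx' (ja i) + jn ca ca' (ja i) \<and> jn cy cy' (ja i) \<le> jp py py' i \<and>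
        jp py py' i + h i \<le> jn cy cy' (ja i) + jn cb cb' (ja i)"
      proof
        assume i: "i \<in> S"
        then show ?thesis using bspec[OF a(3) i] unfolding jS(3,5)[OF i] by (simp add: jS(1)[OF i])
      next
        assume i: "i \<in> T"
        then show ?thesis using bspec[OF b(3) i] unfolding jT(2,4)[OF i] by (simp add: jT(1)[OF i])
      qed
    qed
    have sepS: "sep (jp f g) u i j \<longleftrightarrow> sep f u i j" if "i \<in> S" "j \<in> S" for f g u i j
      unfolding sep_def jS(5)[OF that(1)] jS(5)[OF that(2)] ..
    have sepT: "sep (jp f g) u i j \<longleftrightarrow> sep g u i j" if "i \<in> T" "j \<in> T" for f g u i j
      unfolding sep_def jT(4)[OF that(1)] jT(4)[OF that(2)] ..
    show "\<forall>i\<in>S \<union> T. \<forall>j\<in>S \<union> T. i \<noteq> j \<and> ja i = ja j \<longrightarrow> (case jl (ja i) of Horizontal \<Rightarrow> sep (jp py py') h i j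
       | Vertical \<Rightarrow> sep (jp px px') w i j | Area \<Rightarrow> sep (jp px px') w i j \<or> sep (jp py py') h i j)"
    proof (intro ballI impI)
      fix i j assume ij: "i \<in> S \<union> T" "j \<in> S \<union> T" "i \<noteq> j \<and> ja i = ja j"
      consider "i \<in> S" "j \<in> S" | "i \<in> T" "j \<in> T" | "i \<in> S" "j \<in> T" | "i \<in> T" "j \<in> S" using ij by blast
      then show "case jl (ja i) of Horizontal \<Rightarrow> sep (jp py py') h i j
       | Vertical \<Rightarrow> sep (jp px px') w i j | Area \<Rightarrow> sep (jp px px') w i j \<or> sep (jp py py') h i j"
      proof cases
        case 1
        then show ?thesis using a(4) ij(3) jS(1)[OF 1(1)] jS(1)[OF 1(2)]
          unfolding jS(4)[OF 1(1)] sepS[OF 1] by auto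
      next
        case 2
        then show ?thesis using b(4) ij(3) jT(1)[OF 2(1)] jT(1)[OF 2(2)]
          unfolding jT(3)[OF 2(1)] sepT[OF 2] by auto
      next
        case 3
        then show ?thesis using ij(3) jS(2)[OF 3(1)] jT(1)[OF 3(2)] by simp
      next
        case 4
        then show ?thesis using ij(3) jS(2)[OF 4(2)] jT(1)[OF 4(1)] by simp
      qed
    qed
    show "\<forall>i\<in>S \<union> T. jl (ja i) = Area \<longrightarrow> w i \<le> e * jn ca ca' (ja i) \<and> h i \<le> e * jn cb cb' (ja i)"
    proof
      fix i assume "i \<in> S \<union> T"
      then show "jl (ja i) = Area \<longrightarrow> w i \<le> e * jn ca ca' (ja i) \<and> h i \<le> e * jn cb cb' (ja i)"
      proof
        assume i: "i \<in> S"
        show ?thesis unfolding jS(3,4)[OF i] by (rule bspec[OF a(5) i])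
      next
        assume i: "i \<in> T"
        show ?thesis unfolding jT(2,3)[OF i] by (rule bspec[OF b(5) i])
      qed
    qed
  qed
  then show ?case using le by (intro exI[of _ "m' + n'"]) auto
next
  case (mono A S m B n)
  then obtain m' where m': "m' \<le> m" "explicit_packing e w h A S m'" by blast
  from m'(2) obtain cx cy ca cb lab asg px py where a:
    "\<forall>k<m'. 0 < ca k \<and> 0 < cb k \<and> box_int (cx k) (cy k) (ca k) (cb k) \<subseteq> A"
    "\<forall>k<m'. \<forall>l<m'. k \<noteq> l \<longrightarrow> box_int (cx k) (cy k) (ca k) (cb k) \<inter> box_int (cx l) (cy l) (ca l) (cb l) = {}"
    "\<forall>i\<in>S. asg i < m' \<and> cx (asg i) \<le> px i \<and> px i + w i \<le> cx (asg i) + ca (asg i) \<and>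
      cy (asg i) \<le> py i \<and> py i + h i \<le> cy (asg i) + cb (asg i)"
    "\<forall>i\<in>S. \<forall>j\<in>S. i \<noteq> j \<and> asg i = asg j \<longrightarrow> (case lab (asg i) of Horizontal \<Rightarrow> sep py h i j
       | Vertical \<Rightarrow> sep px w i j | Area \<Rightarrow> sep px w i j \<or> sep py h i j)"
    "\<forall>i\<in>S. lab (asg i) = Area \<longrightarrow> w i \<le> e * ca (asg i) \<and> h i \<le> e * cb (asg i)"
    unfolding explicit_packing_def by (elim exE conjE)
  have "explicit_packing e w h B S m'"
    by (rule explicit_packingI[OF _ a(2-5)]) (use a(1) mono.hyps(2) in blast)
  then show ?case using m'(1) mono.hyps(3) by (meson order_trans)
qed

text \<open>The open box is nonempty, so letting one of its points tend to each side in turn gives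
  the weak inequalities for the sides.\<close>

lemma box_subD:
  assumes "box_int X Y a b \<subseteq> box_int 0 0 N N" "0 < a" "0 < b"
  shows "0 \<le> X \<and> X + a \<le> N \<and> 0 \<le> Y \<and> Y + b \<le> N"
proof -
  have in_box: "0 < u \<and> u < N \<and> 0 < v \<and> v < N" if "X < u" "u < X + a" "Y < v" "v < Y + b" for u v
    using assms(1) that unfolding box_int_def by (auto simp: subset_iff)
  have Ym: "Y < Y + b / 2" "Y + b / 2 < Y + b" and Xm: "X < X + a / 2" "X + a / 2 < X + a" using assms by auto
  have "0 \<le> X"
    by (rule dense_ge_bounded[of X "X + a"]) (use in_box[OF _ _ Ym] assms in \<open>auto simp: less_imp_le\<close>)
  moreover have "X + a \<le> N"
    by (rule dense_le_bounded[of X "X + a"]) (use in_box[OF _ _ Ym] assms in \<open>auto simp: less_imp_le\<close>)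
  moreover have "0 \<le> Y"
    by (rule dense_ge_bounded[of Y "Y + b"]) (use in_box[OF Xm] assms in \<open>auto simp: less_imp_le\<close>)
  moreover have "Y + b \<le> N"
    by (rule dense_le_bounded[of Y "Y + b"]) (use in_box[OF Xm] assms in \<open>auto simp: less_imp_le\<close>)
  ultimately show ?thesis by blast
qed

lemma container_packing_of_cpn:
  assumes "containable e (rot_w w h rot) (rot_h w h rot) (box_int 0 0 N N) S n"
  shows "\<exists>m\<le>n. container_packing e N w h S m"
proof -
  let ?w = "rot_w w h rot" and ?h = "rot_h w h rot"
  from explicit_packing_of_cpn[OF assms] obtain m where m: "m \<le> n" "explicit_packing e ?w ?h (box_int 0 0 N N) S m"
    by (elim exE conjE)
  from m(2) obtain cx cy ca cb lab asg px py where a: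
    "\<forall>k<m. 0 < ca k \<and> 0 < cb k \<and> box_int (cx k) (cy k) (ca k) (cb k) \<subseteq> box_int 0 0 N N"
    "\<forall>k<m. \<forall>l<m. k \<noteq> l \<longrightarrow> box_int (cx k) (cy k) (ca k) (cb k) \<inter> box_int (cx l) (cy l) (ca l) (cb l) = {}"
    "\<forall>i\<in>S. asg i < m \<and> cx (asg i) \<le> px i \<and> px i + ?w i \<le> cx (asg i) + ca (asg i) \<and>
      cy (asg i) \<le> py i \<and> py i + ?h i \<le> cy (asg i) + cb (asg i)"
    "\<forall>i\<in>S. \<forall>j\<in>S. i \<noteq> j \<and> asg i = asg j \<longrightarrow> (case lab (asg i) of Horizontal \<Rightarrow> sep py ?h i j
       | Vertical \<Rightarrow> sep px ?w i j | Area \<Rightarrow> sep px ?w i j \<or> sep py ?h i j)"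
    "\<forall>i\<in>S. lab (asg i) = Area \<longrightarrow> ?w i \<le> e * ca (asg i) \<and> ?h i \<le> e * cb (asg i)"
    unfolding explicit_packing_def by (elim exE conjE)
  have 1: "\<forall>k<m. 0 \<le> ca k \<and> 0 \<le> cb k \<and> 0 \<le> cx k \<and> cx k + ca k \<le> N \<and> 0 \<le> cy k \<and> cy k + cb k \<le> N"
    using a(1) box_subD by (meson less_imp_le)
  have 2: "\<forall>i\<in>S. \<forall>j\<in>S. i \<noteq> j \<longrightarrow> box_int (px i) (py i) (?w i) (?h i) \<inter> box_int (px j) (py j) (?w j) (?h j) = {}"
  proof (intro ballI impI)
    fix i j assume ij: "i \<in> S" "j \<in> S" "i \<noteq> j"
    show "box_int (px i) (py i) (?w i) (?h i) \<inter> box_int (px j) (py j) (?w j) (?h j) = {}"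
    proof (cases "asg i = asg j")
      case True
      then have "case lab (asg i) of Horizontal \<Rightarrow> sep py ?h i j
       | Vertical \<Rightarrow> sep px ?w i j | Area \<Rightarrow> sep px ?w i j \<or> sep py ?h i j" using a(4) ij by blast
      then have "sep px ?w i j \<or> sep py ?h i j" by (cases "lab (asg i)") auto
      then show ?thesis unfolding sep_def by (intro box_disj) blast
    next
      case False
      have sub: "box_int (px i) (py i) (?w i) (?h i) \<subseteq> box_int (cx (asg i)) (cy (asg i)) (ca (asg i)) (cb (asg i))"
        if "i \<in> S" for i using a(3) that by (intro box_sub) auto
      show ?thesis using sub[OF ij(1)] sub[OF ij(2)] a(2,3) ij False by blast
    qed
  qed
  have 3: "\<forall>i\<in>S. \<forall>j\<in>S. i \<noteq> j \<and> asg i = asg j \<and> lab (asg i) = Horizontal \<longrightarrow>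
    {py i<..<py i + ?h i} \<inter> {py j<..<py j + ?h j} = {}"
    using a(4) unfolding sep_def by fastforce
  have 4: "\<forall>i\<in>S. \<forall>j\<in>S. i \<noteq> j \<and> asg i = asg j \<and> lab (asg i) = Vertical \<longrightarrow>
    {px i<..<px i + ?w i} \<inter> {px j<..<px j + ?w j} = {}"
    using a(4) unfolding sep_def by fastforce
  have "container_packing e N w h S m"
    unfolding container_packing_def
    by (rule exI[of _ cx], rule exI[of _ cy], rule exI[of _ ca], rule exI[of _ cb], rule exI[of _ lab],
        rule exI[of _ asg], rule exI[of _ px], rule exI[of _ py], rule exI[of _ rot])
      (intro conjI 1 2 3 4 a(2,3,5))
  then show ?thesis using m(1) by blast
qed

text \<open>If the intervals overlapped in both coordinates, positive side lengths would give the
  two open boxes a common point.\<close>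

lemma sep_of_disjoint_boxes:
  assumes "box_int (x i) (y i) (w i) (h i) \<inter> box_int (x j) (y j) (w j) (h j) = {}"
    "0 < w i" "0 < h i" "0 < w j" "0 < h j"
  shows "sep x w i j \<or> sep y h i j"
proof (rule ccontr)
  assume n: "\<not> (sep x w i j \<or> sep y h i j)"
  have "max (x i) (x j) < min (x i + w i) (x j + w j)" using n assms unfolding sep_def by auto
  then obtain u where u: "max (x i) (x j) < u" "u < min (x i + w i) (x j + w j)" using dense by blast
  have "max (y i) (y j) < min (y i + h i) (y j + h j)" using n assms unfolding sep_def by auto
  then obtain v where v: "max (y i) (y j) < v" "v < min (y i + h i) (y j + h j)" using dense by blast
  have "(u, v) \<in> box_int (x i) (y i) (w i) (h i) \<inter> box_int (x j) (y j) (w j) (h j)"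
    using u v unfolding box_int_def by auto
  then show False using assms(1) by blast
qed

lemma knapsack_container_packing:
  fixes eps :: real
  assumes eps: "0 < eps" "eps \<le> 1"
  shows "\<exists>K. \<forall>N w h p R. finite R \<and> (\<forall>i\<in>R. 0 < w i \<and> 0 < h i \<and> 0 \<le> p i) \<and> feasible_packing N w h R \<longrightarrow>
    (\<exists>S\<subseteq>R. (2 / 3 - 16 * eps) * sum p R \<le> sum p S \<and> (\<exists>m. m \<le> K \<and> container_packing eps N w h S m))"
proof -
  obtain K where K: "\<forall>w h p x y R. packed w h x y R 1 1 \<and> (\<forall>i\<in>R. 0 \<le> p i) \<longrightarrow>
    (\<exists>S\<subseteq>R. (2 / 3 - 16 * eps) * sum p R \<le> sum p S \<and> rot_containable eps w h (box_int 0 0 1 1) S K)"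
    using unit_square_packing[OF eps] by (elim exE)
  show ?thesis
  proof (rule exI[of _ K], intro allI impI, elim conjE)
    fix N :: real and w h p :: "nat \<Rightarrow> real" and R
    assume fin: "finite R" and R: "\<forall>i\<in>R. 0 < w i \<and> 0 < h i \<and> 0 \<le> p i" and fp: "feasible_packing N w h R"
    show "\<exists>S\<subseteq>R. (2 / 3 - 16 * eps) * sum p R \<le> sum p S \<and> (\<exists>m. m \<le> K \<and> container_packing eps N w h S m)"
    proof (cases "R = {}")
      case True
      have "container_packing eps N w h {} 0" unfolding container_packing_def by simp
      then show ?thesis using True by (intro exI[of _ "{}"]) auto
    next
      case False
      from fp obtain px py rot where f:
        "\<forall>i\<in>R. 0 \<le> px i \<and> px i + rot_w w h rot i \<le> N \<and> 0 \<le> py i \<and> py i + rot_h w h rot i \<le> N"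
        "\<forall>i\<in>R. \<forall>j\<in>R. i \<noteq> j \<longrightarrow> box_int (px i) (py i) (rot_w w h rot i) (rot_h w h rot i) \<inter>
          box_int (px j) (py j) (rot_w w h rot j) (rot_h w h rot j) = {}"
        unfolding feasible_packing_def by (elim exE conjE)
      let ?w = "rot_w w h rot" and ?h = "rot_h w h rot"
      have pos: "0 < ?w i" "0 < ?h i" if "i \<in> R" for i using R that unfolding rot_w_def rot_h_def by auto
      have packed: "packed ?w ?h px py R N N"
        unfolding packed_def
      proof (intro conjI ballI impI fin)
        fix i assume "i \<in> R"
        then show "0 < ?w i" "0 < ?h i" "0 \<le> px i" "px i + ?w i \<le> N" "0 \<le> py i" "py i + ?h i \<le> N"
          using pos f(1) by blast+
      next
        fix i j assume ij: "i \<in> R" "j \<in> R" "i \<noteq> j"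
        then show "sep px ?w i j \<or> sep py ?h i j"
          using f(2) pos by (intro sep_of_disjoint_boxes) blast+
      qed
      obtain i where "i \<in> R" using False by blast
      then have N: "0 < N" using f(1) pos(1)[of i] by force
      have "\<exists>S\<subseteq>R. (2 / 3 - 16 * eps) * sum p R \<le> sum p S \<and>
        rot_containable eps (\<lambda>i. ?w i / N) (\<lambda>i. ?h i / N) (box_int 0 0 1 1) S K"
        by (rule K[rule_format]) (use packed_scale[OF packed N N] R in blast)
      then obtain S where S: "S \<subseteq> R" "(2 / 3 - 16 * eps) * sum p R \<le> sum p S"
        "rot_containable eps (\<lambda>i. ?w i / N) (\<lambda>i. ?h i / N) (box_int 0 0 1 1) S K" by (elim exE conjE)
      from S(3) obtain r where r: "containable eps (rot_w (\<lambda>i. ?w i / N) (\<lambda>i. ?h i / N) r)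
        (rot_h (\<lambda>i. ?w i / N) (\<lambda>i. ?h i / N) r) (box_int 0 0 1 1) S K" unfolding rot_containable_def by blast
      \<comment> \<open>The rotation of the given packing is composed with the one made in the unit
        square, so an item turned twice is not turned at all.\<close>
      define r' where "r' i = (rot i \<noteq> r i)" for i
      have e: "rot_w (\<lambda>i. ?w i / N) (\<lambda>i. ?h i / N) r = (\<lambda>i. rot_w w h r' i / N)"
        "rot_h (\<lambda>i. ?w i / N) (\<lambda>i. ?h i / N) r = (\<lambda>i. rot_h w h r' i / N)"
        unfolding rot_w_def rot_h_def r'_def by (auto simp: fun_eq_iff)
      have "containable eps (rot_w w h r') (rot_h w h r') (box_int 0 0 (N * 1) (N * 1)) S K"
        by (rule containable_scale[OF r[unfolded e] N N])
      then have "\<exists>m\<le>K. container_packing eps N w h S m" by (intro container_packing_of_cpn) simp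
      then show ?thesis using S(1,2) by blast
    qed
  qed
qed

theorem mainTheorem11:
  shows "\<exists>c::real. c > 0 \<and> (\<exists>f::real \<Rightarrow> nat.
    \<forall>(\<epsilon>::real) (N::real) (w::nat \<Rightarrow> real) (h::nat \<Rightarrow> real) (p::nat \<Rightarrow> real) (R::nat set).
      0 < \<epsilon> \<and> \<epsilon> < 1/6 \<and> finite R \<and>
      (\<forall>i\<in>R. 0 < w i \<and> 0 < h i \<and> 0 \<le> p i) \<and>
      feasible_packing N w h R \<longrightarrow>
      (\<exists>R'\<subseteq>R. (2/3 - c * \<epsilon>) * sum p R \<le> sum p R' \<and>
         (\<exists>m. m \<le> f \<epsilon> \<and> container_packing \<epsilon> N w h R' m)))"
proof -
  define P where "P eps K \<longleftrightarrow> (\<forall>N w h p R. finite R \<and> (\<forall>i\<in>R. 0 < w i \<and> 0 < h i \<and> 0 \<le> p i) \<and> feasible_packing N w h R \<longrightarrow>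
    (\<exists>S\<subseteq>R. (2 / 3 - 16 * eps) * sum p R \<le> sum p S \<and> (\<exists>m. m \<le> K \<and> container_packing eps N w h S m)))"
    for eps :: real and K
  have "\<exists>K. P eps K" if "0 < eps" "eps \<le> 1" for eps
    using knapsack_container_packing[OF that] unfolding P_def .
  then obtain f where f: "\<And>eps. 0 < eps \<Longrightarrow> eps \<le> 1 \<Longrightarrow> P eps (f eps)" by metis
  show ?thesis
  \<comment> \<open>Of the 16, three augmentations in \<open>collapse_packing\<close> cost 5 each,
    and the items in the gap between the scales cost 1.\<close>
  proof (rule exI[of _ 16], intro conjI, simp, rule exI[of _ f], intro allI impI, elim conjE)
    fix \<epsilon> N :: real and w h p :: "nat \<Rightarrow> real" and R :: "nat set"
    assume a: "0 < \<epsilon>" "\<epsilon> < 1 / 6" and b: "finite R" "\<forall>i\<in>R. 0 < w i \<and> 0 < h i \<and> 0 \<le> p i" "feasible_packing N w h R"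
    have "\<epsilon> \<le> 1" using a(2) by simp
    with a(1) have "P \<epsilon> (f \<epsilon>)" by (rule f)
    then show "\<exists>R'\<subseteq>R. (2 / 3 - 16 * \<epsilon>) * sum p R \<le> sum p R' \<and> (\<exists>m. m \<le> f \<epsilon> \<and> container_packing \<epsilon> N w h R' m)"
      unfolding P_def by (elim allE impE) (intro conjI, (fact b)+)
  qed
qed

end
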